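(* Let $1<p<\infty$ and $1/p+1/q=1$. Assume that $a,b,c,d$ satisfy the basic factorization conditions in $H^p(\mathbb T)$ with indices $n,m\in\mathbb Z$ and factors $c_+,d_+$ (see context). Suppose that $T(a)+H(b)$ is Fredholm on $H^p(\mathbb T)$. Then $$\dim\ker(T(a)+H(b))=\begin{cases}0 & \text{if } n>0,\ m\le0,\\ -n & \text{if } n\le0,\ m\le0,\\ \dim\ker A_{n,m} & \text{if } n>0,\ m>0,\\ m-n & \text{if } n\le0,\ m>0,\end{cases}$$ $$\dim\ker(T(a)+H(b))^*=\begin{cases}0 & \text{if } m>0,\ n\le0,\\ -m & \text{if } m\le0,\ n\le0,\\ \dim\ker (A_{n,m})^T & \text{if } m>0,\ n>0,\\ n-m & \text{if } m\le0,\ n>0.\end{cases}$$ Here, in the case $n>0$, $m>0$, $A_{n,m}$ is the $n\times m$ matrix $$A_{n,m}=\left[\rho_{i-j}+\rho_{i+j}\right]_{0\le i\le n-1,\ 0\le j\le m-1},$$ where $\rho_k$ are the Fourier coefficients of $$\rho:=t^{-m-n}(1+t)(1+t^{-1})\,\tilde c_+\,\tilde d_+\,b^{-1}\in L^1(\mathbb T).$$ In particular, the Fredholm index of $T(a)+H(b)$ is equal to $m-n$.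
   Context: $\mathbb T=\{z\in\mathbb C:|z|=1\}$. For $f\in L^1(\mathbb T)$, $f_n=\frac1{2\pi}\int_0^{2\pi}f(e^{i\theta})e^{-in\theta}\,d\theta$. $H^p(\mathbb T)=\{f\in L^p(\mathbb T): f_n=0 \text{ for all } n<0\}$; for $1<p<\infty$, $P:\sum_{n\in\mathbb Z}f_nt^n\mapsto\sum_{n\ge0}f_nt^n$ is the (bounded) Riesz projection of $L^p(\mathbb T)$ onto $H^p(\mathbb T)$, and $(Jf)(t)=t^{-1}f(t^{-1})$. For $a,b\in L^\infty(\mathbb T)$, $T(a)f=P(af)$ and $H(b)f=P(b\cdot Jf)$ on $H^p(\mathbb T)$. For a function $f$ on $\mathbb T$, $\tilde f(t)=f(t^{-1})$. $A^*$ denotes the Banach space adjoint of an operator $A$, and the Fredholm index is $\dim\ker A-\dim\mathrm{coker}\,A$. $GL^\infty(\mathbb T)$ is the group of invertible elements of $L^\infty(\mathbb T)$. Basic factorization conditions in $H^p(\mathbb T)$ (with indices $n,m$): (i) $a,b\in GL^\infty(\mathbb T)$ satisfy $a\tilde a=b\tilde b$, and $c=\frac ab=\frac{\tilde b}{\tilde a}$, $d=\frac{\tilde a}{b}=\frac{\tilde b}{a}$. (ii) $c$ and $d$ admit factorizations $c(t)=c_+(t)\,t^{2n}\,c_+^{-1}(t^{-1})$, $d(t)=d_+(t)\,t^{2m}\,d_+^{-1}(t^{-1})$ with $n,m\in\mathbb Z$ and $(1+t)c_+(t)\in H^q(\mathbb T)$, $(1-t)c_+^{-1}(t)\in H^p(\mathbb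 T)$, $(1+t)d_+(t)\in H^p(\mathbb T)$, $(1-t)d_+^{-1}(t)\in H^q(\mathbb T)$, where $c_+^{-1}=1/c_+$, $d_+^{-1}=1/d_+$. *)

theory Defs
  imports
    "HOL-Probability.Probability"
    "HOL-Library.Extended_Nat"
    "HOL-Library.Function_Algebras"
    "Jordan_Normal_Form.Matrix_Kernel"
begin

subsection \<open>Dimensions with values in the extended naturals\<close>

text \<open>
  The library's dimension of an infinite-dimensional space is the junk value 0; the
  extended version below is infinite there. The scalar multiplication is passed explicitly.
\<close>

definition edim :: "('k::field \<Rightarrow> 'v::ab_group_add \<Rightarrow> 'v) \<Rightarrow> 'v set \<Rightarrow> enat" where
  "edim s V = (if \<exists>B. finite B \<and> V \<subseteq> Modules.module.span s B
     then enat (vector_space.dim s V) else \<infinity>)"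

text \<open>
  \<open>quotient_basis s V U B\<close>: the cosets of the elements of the finite set \<open>B\<close> are pairwise
  distinct and form a basis of \<open>V / U\<close>.
\<close>

definition quotient_basis ::
  "('k::field \<Rightarrow> 'v::ab_group_add \<Rightarrow> 'v) \<Rightarrow> 'v set \<Rightarrow> 'v set \<Rightarrow> 'v set \<Rightarrow> bool" where
  "quotient_basis s V U B \<longleftrightarrow> finite B \<and> B \<subseteq> V \<and>
     (\<forall>v\<in>V. \<exists>!x. (\<forall>w. w \<notin> B \<longrightarrow> x w = 0) \<and> v - (\<Sum>w\<in>B. s (x w) w) \<in> U)"

definition quotient_edim ::
  "('k::field \<Rightarrow> 'v::ab_group_add \<Rightarrow> 'v) \<Rightarrow> 'v set \<Rightarrow> 'v set \<Rightarrow> enat" where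
  "quotient_edim s V U = (if \<exists>B. quotient_basis s V U B
     then enat (THE k. \<exists>B. quotient_basis s V U B \<and> card B = k) else \<infinity>)"


subsection \<open>Measurable functions on the unit circle\<close>

text \<open>Normalised arc length, as a Borel measure on the plane concentrated on the unit circle.\<close>

definition circle_measure :: "complex measure" where
  "circle_measure = distr (uniform_measure lborel {0..2*pi}) borel cis"

lemma sets_circle_measure [simp, measurable_cong]: "sets circle_measure = sets borel"
  and space_circle_measure [simp]: "space circle_measure = UNIV"
  by (simp_all add: circle_measure_def)

lemma cis_measurable [measurable]: "cis \<in> borel_measurable borel"
  by (intro borel_measurable_continuous_onI) (auto intro!: continuous_intros)

lemma prob_space_circle_measure: "prob_space circle_measure"
proof -
  interpret u: prob_space "uniform_measure lborel {0..2*pi}"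
    by (rule prob_space_uniform_measure) auto
  show ?thesis unfolding circle_measure_def by (rule u.prob_space_distr) simp
qed

lemma AE_circle_measure_iff:
  assumes [measurable]: "Measurable.pred borel P"
  shows "(AE t in circle_measure. P t) \<longleftrightarrow> (AE \<theta> in lborel. \<theta> \<in> {0..2*pi} \<longrightarrow> P (cis \<theta>))"
proof -
  have "(AE t in circle_measure. P t) \<longleftrightarrow> (AE \<theta> in uniform_measure lborel {0..2*pi}. P (cis \<theta>))"
    unfolding circle_measure_def by (subst AE_distr_iff) auto
  also have "\<dots> \<longleftrightarrow> (AE \<theta> in lborel. \<theta> \<in> {0..2*pi} \<longrightarrow> P (cis \<theta>))"
    by (subst AE_uniform_measure) auto
  finally show ?thesis .
qed

lemma AE_circle_measure_inverse:
  assumes [measurable]: "Measurable.pred borel P" and P: "AE t in circle_measure. P t"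
  shows "AE t in circle_measure. P (inverse t)"
proof -
  have "AE \<theta> in lborel. \<theta> \<in> {0..2*pi} \<longrightarrow> P (cis \<theta>)"
    using P by (simp add: AE_circle_measure_iff)
  then have "AE \<theta> in lborel. 2*pi + (-1) * \<theta> \<in> {0..2*pi} \<longrightarrow> P (cis (2*pi + (-1) * \<theta>))"
    by (intro AE_borel_affine) auto
  moreover have "cis (2*pi + (-1) * \<theta>) = inverse (cis \<theta>)" for \<theta>
    by (simp add: complex_eq_iff cos_diff sin_diff)
  ultimately have "AE \<theta> in lborel. \<theta> \<in> {0..2*pi} \<longrightarrow> P (inverse (cis \<theta>))"
    by auto
  then show ?thesis by (simp add: AE_circle_measure_iff)
qed

text \<open>
  Elements of \<open>circle_fun\<close> are measurable complex functions on the circle up to equality almost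
  everywhere. Borel measurability is no restriction compared with Lebesgue measurability, as
  every Lebesgue measurable function agrees almost everywhere with a Borel measurable one.
\<close>

definition circle_eq :: "(complex \<Rightarrow> complex) \<Rightarrow> (complex \<Rightarrow> complex) \<Rightarrow> bool" where
  "circle_eq f g \<longleftrightarrow> f \<in> borel_measurable borel \<and> g \<in> borel_measurable borel \<and>
     (AE t in circle_measure. f t = g t)"

quotient_type circle_fun = "complex \<Rightarrow> complex" / partial: circle_eq
proof (rule part_equivpI)
  show "\<exists>f. circle_eq f f"
    by (rule exI[of _ "\<lambda>_. 0"]) (simp add: circle_eq_def)
  show "symp circle_eq"
    by (auto simp: symp_def circle_eq_def elim: eventually_mono)
  show "transp circle_eq"
    by (auto simp: transp_def circle_eq_def elim: eventually_elim2)
qed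

instantiation circle_fun :: "{comm_ring_1, inverse}"
begin

lift_definition zero_circle_fun :: circle_fun is "\<lambda>_. 0"
  by (simp add: circle_eq_def)
lift_definition one_circle_fun :: circle_fun is "\<lambda>_. 1"
  by (simp add: circle_eq_def)
lift_definition plus_circle_fun :: "circle_fun \<Rightarrow> circle_fun \<Rightarrow> circle_fun" is "\<lambda>f g t. f t + g t"
  by (auto simp: circle_eq_def elim: eventually_elim2)
lift_definition minus_circle_fun :: "circle_fun \<Rightarrow> circle_fun \<Rightarrow> circle_fun" is "\<lambda>f g t. f t - g t"
  by (auto simp: circle_eq_def elim: eventually_elim2)
lift_definition uminus_circle_fun :: "circle_fun \<Rightarrow> circle_fun" is "\<lambda>f t. - f t"
  by (auto simp: circle_eq_def elim: eventually_mono)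
lift_definition times_circle_fun :: "circle_fun \<Rightarrow> circle_fun \<Rightarrow> circle_fun" is "\<lambda>f g t. f t * g t"
  by (auto simp: circle_eq_def elim: eventually_elim2)
lift_definition inverse_circle_fun :: "circle_fun \<Rightarrow> circle_fun" is "\<lambda>f t. inverse (f t)"
  by (auto simp: circle_eq_def elim: eventually_mono)
lift_definition divide_circle_fun :: "circle_fun \<Rightarrow> circle_fun \<Rightarrow> circle_fun" is "\<lambda>f g t. f t / g t"
  by (auto simp: circle_eq_def elim: eventually_elim2)

instance
proof
  show "(0::circle_fun) \<noteq> 1"
    by transfer (simp add: circle_eq_def prob_space.AE_False prob_space_circle_measure)
qed (transfer; auto simp: circle_eq_def algebra_simps)+

end

lift_definition cscale :: "complex \<Rightarrow> circle_fun \<Rightarrow> circle_fun" is "\<lambda>z f t. z * f t"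
  by (auto simp: circle_eq_def elim: eventually_mono)

global_interpretation circle_fun: vector_space cscale
  by standard (transfer; auto simp: circle_eq_def algebra_simps)+

global_interpretation circle_functional:
  vector_space "\<lambda>z (\<phi> :: circle_fun \<Rightarrow> complex) f. z * \<phi> f"
  by standard (auto simp: fun_eq_iff algebra_simps)

text \<open>The independent variable \<open>t\<close> as a function on the circle.\<close>

lift_definition tt :: circle_fun is "\<lambda>t. t"
  by (simp add: circle_eq_def)

lift_definition tilde :: "circle_fun \<Rightarrow> circle_fun" is "\<lambda>f t. f (inverse t)"
proof -
  fix f g assume fg: "circle_eq f g"
  then have [measurable]: "f \<in> borel_measurable borel" "g \<in> borel_measurable borel"
    by (auto simp: circle_eq_def)
  have "AE t in circle_measure. f (inverse t) = g (inverse t)"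
    using fg by (intro AE_circle_measure_inverse[where P = "\<lambda>t. f t = g t"]) (auto simp: circle_eq_def)
  then show "circle_eq (\<lambda>t. f (inverse t)) (\<lambda>t. g (inverse t))"
    by (simp add: circle_eq_def)
qed


subsection \<open>Lebesgue and Hardy spaces\<close>

lift_definition fourier :: "circle_fun \<Rightarrow> int \<Rightarrow> complex"
  is "\<lambda>f k. \<integral>t. f t * t powi (- k) \<partial>circle_measure"
proof (rule ext)
  fix f g :: "complex \<Rightarrow> complex" and k :: int
  assume fg: "circle_eq f g"
  then have [measurable]: "f \<in> borel_measurable borel" "g \<in> borel_measurable borel"
    by (auto simp: circle_eq_def)
  have [measurable]: "(\<lambda>t::complex. t powi (- k)) \<in> borel_measurable borel"
    unfolding power_int_def by measurable
  show "(\<integral>t. f t * t powi (- k) \<partial>circle_measure) = (\<integral>t. g t * t powi (- k) \<partial>circle_measure)"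
    using fg by (intro integral_cong_AE) (auto simp: circle_eq_def elim: eventually_mono)
qed

lemma fourier_formula:
  assumes [measurable]: "f \<in> borel_measurable borel"
  shows "fourier (abs_circle_fun f) k =
    1 / (2*pi) * (LINT \<theta>:{0..2*pi}|lborel. f (cis \<theta>) * exp (- \<i> * k * \<theta>))"
proof -
  have [measurable]: "(\<lambda>t::complex. t powi (- k)) \<in> borel_measurable borel"
    unfolding power_int_def by measurable
  have cis: "cis \<theta> powi (- k) = exp (- \<i> * k * \<theta>)" for \<theta>
    by (simp only: cis_power_int) (simp add: cis_conv_exp mult_ac)
  have "fourier (abs_circle_fun f) k = (\<integral>t. f t * t powi (- k) \<partial>circle_measure)"
    by (rule fun_cong[OF fourier.abs_eq]) (simp add: circle_eq_def)
  also have "\<dots> = (\<integral>\<theta>. f (cis \<theta>) * cis \<theta> powi (- k) \<partial>uniform_measure lborel {0..2*pi})"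
    unfolding circle_measure_def by (subst integral_distr) auto
  also have "uniform_measure lborel {0..2*pi} =
      density lborel (\<lambda>\<theta>. ennreal (indicator {0..2*pi} \<theta> / (2*pi)))"
    unfolding uniform_measure_def
    by (intro density_cong) (auto simp: divide_ennreal split: split_indicator
         simp flip: ennreal_1)
  also have "(\<integral>\<theta>. f (cis \<theta>) * cis \<theta> powi (- k) \<partial>\<dots>) =
      (\<integral>\<theta>. (indicator {0..2*pi} \<theta> / (2*pi)) *\<^sub>R (f (cis \<theta>) * exp (- \<i> * k * \<theta>)) \<partial>lborel)"
    unfolding cis by (subst integral_density) auto
  also have "\<dots> = (\<integral>\<theta>. (1 / (2*pi)) *\<^sub>R (indicator {0..2*pi} \<theta> *\<^sub>R (f (cis \<theta>) * exp (- \<i> * k * \<theta>))) \<partial>lborel)"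
    by (simp add: field_simps)
  also have "\<dots> = 1 / (2*pi) * (LINT \<theta>:{0..2*pi}|lborel. f (cis \<theta>) * exp (- \<i> * k * \<theta>))"
    unfolding set_lebesgue_integral_def
    by (subst integral_scaleR_right) (simp add: scaleR_conv_of_real)
  finally show ?thesis .
qed

lift_definition in_Lp :: "real \<Rightarrow> circle_fun \<Rightarrow> bool"
  is "\<lambda>p f. integrable circle_measure (\<lambda>t. norm (f t) powr p)"
proof -
  fix f g :: "complex \<Rightarrow> complex" and p :: real
  assume fg: "circle_eq f g"
  then have [measurable]: "f \<in> borel_measurable borel" "g \<in> borel_measurable borel"
    by (auto simp: circle_eq_def)
  show "integrable circle_measure (\<lambda>t. norm (f t) powr p) =
        integrable circle_measure (\<lambda>t. norm (g t) powr p)"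
    using fg by (intro integrable_cong_AE) (auto simp: circle_eq_def elim: eventually_mono)
qed

lift_definition Lp_norm :: "real \<Rightarrow> circle_fun \<Rightarrow> real"
  is "\<lambda>p f. (\<integral>t. norm (f t) powr p \<partial>circle_measure) powr (1 / p)"
proof -
  fix f g :: "complex \<Rightarrow> complex" and p :: real
  assume fg: "circle_eq f g"
  then have [measurable]: "f \<in> borel_measurable borel" "g \<in> borel_measurable borel"
    by (auto simp: circle_eq_def)
  have "(\<integral>t. norm (f t) powr p \<partial>circle_measure) = (\<integral>t. norm (g t) powr p \<partial>circle_measure)"
    using fg by (intro integral_cong_AE) (auto simp: circle_eq_def elim: eventually_mono)
  then show "(\<integral>t. norm (f t) powr p \<partial>circle_measure) powr (1 / p) =
      (\<integral>t. norm (g t) powr p \<partial>circle_measure) powr (1 / p)"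
    by simp
qed

lift_definition ess_bounded :: "circle_fun \<Rightarrow> bool"
  is "\<lambda>f. \<exists>C. AE t in circle_measure. norm (f t) \<le> C"
proof -
  fix f g assume "circle_eq f g"
  then have "AE t in circle_measure. f t = g t"
    by (simp add: circle_eq_def)
  then have "(AE t in circle_measure. norm (f t) \<le> C) = (AE t in circle_measure. norm (g t) \<le> C)" for C
    by (intro eventually_subst) (auto elim: eventually_mono)
  then show "(\<exists>C. AE t in circle_measure. norm (f t) \<le> C) = (\<exists>C. AE t in circle_measure. norm (g t) \<le> C)"
    by simp
qed

definition Lp :: "real \<Rightarrow> circle_fun set" where
  "Lp p = {f. in_Lp p f}"

definition Linf :: "circle_fun set" where
  "Linf = {f. ess_bounded f}"

definition GLinf :: "circle_fun set" where
  "GLinf = {f \<in> Linf. \<exists>g \<in> Linf. f * g = 1}"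

definition Hp :: "real \<Rightarrow> circle_fun set" where
  "Hp p = {f \<in> Lp p. \<forall>k<0. fourier f k = 0}"


subsection \<open>Toeplitz and Hankel operators\<close>

definition riesz :: "real \<Rightarrow> circle_fun \<Rightarrow> circle_fun" where
  "riesz p f = (THE g. g \<in> Hp p \<and> (\<forall>k\<ge>0. fourier g k = fourier f k))"

definition flip_J :: "circle_fun \<Rightarrow> circle_fun" where
  "flip_J f = inverse tt * tilde f"

definition toeplitz :: "real \<Rightarrow> circle_fun \<Rightarrow> circle_fun \<Rightarrow> circle_fun" where
  "toeplitz p a f = riesz p (a * f)"

definition hankel :: "real \<Rightarrow> circle_fun \<Rightarrow> circle_fun \<Rightarrow> circle_fun" where
  "hankel p b f = riesz p (b * flip_J f)"

definition toeplitz_hankel :: "real \<Rightarrow> circle_fun \<Rightarrow> circle_fun \<Rightarrow> circle_fun \<Rightarrow> circle_fun" where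
  "toeplitz_hankel p a b f = toeplitz p a f + hankel p b f"


subsection \<open>Fredholm operators on Hardy spaces and their adjoints\<close>

definition bounded_op :: "real \<Rightarrow> (circle_fun \<Rightarrow> circle_fun) \<Rightarrow> bool" where
  "bounded_op p A \<longleftrightarrow> A ` Hp p \<subseteq> Hp p \<and>
     (\<forall>f\<in>Hp p. \<forall>g\<in>Hp p. A (f + g) = A f + A g) \<and>
     (\<forall>z. \<forall>f\<in>Hp p. A (cscale z f) = cscale z (A f)) \<and>
     (\<exists>C. \<forall>f\<in>Hp p. Lp_norm p (A f) \<le> C * Lp_norm p f)"

definition ker_Hp :: "real \<Rightarrow> (circle_fun \<Rightarrow> circle_fun) \<Rightarrow> circle_fun set" where
  "ker_Hp p A = {f \<in> Hp p. A f = 0}"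

definition dim_ker :: "real \<Rightarrow> (circle_fun \<Rightarrow> circle_fun) \<Rightarrow> enat" where
  "dim_ker p A = edim cscale (ker_Hp p A)"

definition dim_coker :: "real \<Rightarrow> (circle_fun \<Rightarrow> circle_fun) \<Rightarrow> enat" where
  "dim_coker p A = quotient_edim cscale (Hp p) (A ` Hp p)"

definition closed_range :: "real \<Rightarrow> (circle_fun \<Rightarrow> circle_fun) \<Rightarrow> bool" where
  "closed_range p A \<longleftrightarrow> (\<forall>g\<in>Hp p. \<forall>h. (\<forall>k::nat. h k \<in> A ` Hp p) \<and>
     (\<lambda>k. Lp_norm p (h k - g)) \<longlonglongrightarrow> 0 \<longrightarrow> g \<in> A ` Hp p)"

definition fredholm :: "real \<Rightarrow> (circle_fun \<Rightarrow> circle_fun) \<Rightarrow> bool" where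
  "fredholm p A \<longleftrightarrow> bounded_op p A \<and> closed_range p A \<and>
     dim_ker p A \<noteq> \<infinity> \<and> dim_coker p A \<noteq> \<infinity>"

text \<open>Only meaningful if both dimensions are finite.\<close>

definition fredholm_index :: "real \<Rightarrow> (circle_fun \<Rightarrow> circle_fun) \<Rightarrow> int" where
  "fredholm_index p A = int (the_enat (dim_ker p A)) - int (the_enat (dim_coker p A))"

text \<open>
  Functionals on \<open>Hp p\<close> are total functions in HOL; fixing the value 0 outside \<open>Hp p\<close> makes
  the representation of the dual space unique. The dual is not identified with \<open>Hp q\<close>.
\<close>

definition dual_Hp :: "real \<Rightarrow> (circle_fun \<Rightarrow> complex) set" where
  "dual_Hp p = {\<phi>. (\<forall>f. f \<notin> Hp p \<longrightarrow> \<phi> f = 0) \<and>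
     (\<forall>f\<in>Hp p. \<forall>g\<in>Hp p. \<phi> (f + g) = \<phi> f + \<phi> g) \<and>
     (\<forall>z. \<forall>f\<in>Hp p. \<phi> (cscale z f) = z * \<phi> f) \<and>
     (\<exists>C. \<forall>f\<in>Hp p. norm (\<phi> f) \<le> C * Lp_norm p f)}"

definition adjoint_op ::
  "real \<Rightarrow> (circle_fun \<Rightarrow> circle_fun) \<Rightarrow> (circle_fun \<Rightarrow> complex) \<Rightarrow> (circle_fun \<Rightarrow> complex)" where
  "adjoint_op p A \<phi> = (\<lambda>f. if f \<in> Hp p then \<phi> (A f) else 0)"

definition dim_ker_adjoint :: "real \<Rightarrow> (circle_fun \<Rightarrow> circle_fun) \<Rightarrow> enat" where
  "dim_ker_adjoint p A =
     edim (\<lambda>z \<phi> f. z * \<phi> f) {\<phi> \<in> dual_Hp p. adjoint_op p A \<phi> = (\<lambda>f. 0)}"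


subsection \<open>Factorization conditions\<close>

text \<open>
  Since \<open>c\<close> and \<open>d\<close> are invertible, the factorizations force \<open>cp\<close> and \<open>dp\<close> to be nonzero
  almost everywhere, so their inverses are genuine and the convention \<open>inverse 0 = 0\<close> is harmless.
\<close>

definition basic_factorization ::
  "real \<Rightarrow> real \<Rightarrow> circle_fun \<Rightarrow> circle_fun \<Rightarrow> circle_fun \<Rightarrow> circle_fun \<Rightarrow>
     int \<Rightarrow> int \<Rightarrow> circle_fun \<Rightarrow> circle_fun \<Rightarrow> bool" where
  "basic_factorization p q a b c d n m cp dp \<longleftrightarrow>
     a \<in> GLinf \<and> b \<in> GLinf \<and> a * tilde a = b * tilde b \<and>
     c = a / b \<and> c = tilde b / tilde a \<and> d = tilde a / b \<and> d = tilde b / a \<and>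
     c = cp * tt powi (2 * n) * tilde (inverse cp) \<and>
     d = dp * tt powi (2 * m) * tilde (inverse dp) \<and>
     (1 + tt) * cp \<in> Hp q \<and> (1 - tt) * inverse cp \<in> Hp p \<and>
     (1 + tt) * dp \<in> Hp p \<and> (1 - tt) * inverse dp \<in> Hp q"

definition rho :: "circle_fun \<Rightarrow> int \<Rightarrow> int \<Rightarrow> circle_fun \<Rightarrow> circle_fun \<Rightarrow> circle_fun" where
  "rho b n m cp dp =
     tt powi (- m - n) * (1 + tt) * (1 + inverse tt) * tilde cp * tilde dp * inverse b"

text \<open>The \<open>n \<times> m\<close> matrix; only used for positive \<open>n\<close> and \<open>m\<close>.\<close>

definition A_mat :: "circle_fun \<Rightarrow> int \<Rightarrow> int \<Rightarrow> circle_fun \<Rightarrow> circle_fun \<Rightarrow> complex mat" where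
  "A_mat b n m cp dp = mat (nat n) (nat m) (\<lambda>(i, j).
     fourier (rho b n m cp dp) (int i - int j) + fourier (rho b n m cp dp) (int i + int j))"

end

theory Submission
  imports Defs "HOL-Complex_Analysis.Complex_Analysis" "Jordan_Normal_Form.Gauss_Jordan_Elimination"
begin

text \<open>
  Multiplying the symbols \<open>a\<close>, \<open>b\<close> by \<open>t^(m-n)\<close>, \<open>t^(n+m)\<close> turns the factorization into one with
  both indices zero. For such symbols, \<open>T(a) + H(b)\<close> is injective: with \<open>G f = a f + b J f\<close>, the
  equation \<open>P (G f) = 0\<close> says that \<open>J (G f)\<close> is analytic, and \<open>G f\<close> satisfies a jump relation given
  by \<open>d\<close>, so multiplying by \<open>(1 - t) / d_+\<close> yields an analytic function that is odd under
  \<open>t \<mapsto> 1/t\<close>, hence zero; the factor \<open>(1 + t) c_+\<close> then gives \<open>f = 0\<close> in the same way. The same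
  two arguments kill every continuous functional that vanishes on the range, so the operator is
  bijective as soon as its range has finite codimension.

  Composing the given operator with powers of the shift on the right and of the backward shift on
  the left yields the same operator as composing the one with zero indices in this way. Each shift
  changes the index by one, so the index is \<open>m - n\<close> and it remains to find the kernel. If
  \<open>n, m > 0\<close>, the kernel consists of the \<open>f\<close> for which the zero-index operator maps \<open>t^n f\<close> to a
  polynomial of degree less than \<open>m\<close>. The preimages \<open>f_0\<close> of these polynomials are explicit: for
  \<open>x = (1 + t) c_+ f_0\<close> the function \<open>x + x~\<close> equals \<open>\<rho>\<close> times a symmetric trigonometric
  polynomial, and divisibility of \<open>f_0\<close> by \<open>t^n\<close> becomes the linear system with matrix \<open>A_{n,m}\<close>.

  The analysis behind this is the boundedness of the Riesz projection (M. Riesz), the separation of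
  points from closed subspaces of \<open>L^p\<close> by functions in \<open>L^q\<close> (nearest points), and the open mapping
  argument, which makes the coordinates modulo a range of finite codimension continuous.
\<close>

subsection \<open>Powers of absolute values\<close>

text \<open>The factors \<open>cp\<close> and \<open>dp\<close> may be unbounded, so the
  factorization does not split the operator into bounded invertible factors. They enter through
  \<open>(1 + tt) * cp\<close> and its three companions, paired with functions of the conjugate
  exponent; such a product lies in L^1 and is settled by its Fourier coefficients. The companions
  are shaped by the weight 1/t in J: since (1 - t)/t = -(1 - 1/t) and (1 + t)/t = 1 + 1/t, a
  J-symmetric relation becomes odd after multiplication by 1 - t, and an antisymmetric one after
  multiplication by 1 + t.

  At index zero this gives injectivity and density of the range. Surjectivity rests on finite
  codimension, which comes from the Fredholm hypothesis.

  The kernel of the adjoint has the dimension of the cokernel, which follows from the kernel and the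
  index; the transposed matrix appears because row rank equals column rank. If both indices are at
  most 0, the kernel is bounded above because one shift removes at most one dimension, and below by
  explicit functions built from \<open>(1 - tt) * inverse cp\<close>.\<close>

lemma powr_norm_add_le:
  fixes a b :: "'a::real_normed_vector"
  assumes "0 \<le> p"
  shows "norm (a + b) powr p \<le> 2 powr p * (norm a powr p + norm b powr p)"
proof -
  have "norm (a + b) powr p \<le> (2 * max (norm a) (norm b)) powr p"
    using assms norm_triangle_ineq[of a b] by (intro powr_mono2) auto
  also have "\<dots> = 2 powr p * max (norm a) (norm b) powr p"
    by (simp add: powr_mult)
  also have "max (norm a) (norm b) powr p \<le> norm a powr p + norm b powr p"
    by (auto simp: max_def)
  finally show ?thesis by simp
qed

lemma integrable_powr_add:
  fixes f g :: "'a \<Rightarrow> complex"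
  assumes p: "0 \<le> p" and [measurable]: "f \<in> borel_measurable M" "g \<in> borel_measurable M"
    and "integrable M (\<lambda>x. norm (f x) powr p)" "integrable M (\<lambda>x. norm (g x) powr p)"
  shows "integrable M (\<lambda>x. norm (f x + g x) powr p)"
proof (rule Bochner_Integration.integrable_bound)
  show "integrable M (\<lambda>x. 2 powr p * (norm (f x) powr p + norm (g x) powr p))"
    by (intro integrable_mult_right Bochner_Integration.integrable_add assms)
  show "AE x in M. norm (norm (f x + g x) powr p) \<le> norm (2 powr p * (norm (f x) powr p + norm (g x) powr p))"
  proof (rule AE_I2)
    fix x
    show "norm (norm (f x + g x) powr p) \<le> norm (2 powr p * (norm (f x) powr p + norm (g x) powr p))"
      using powr_norm_add_le[OF p, of "f x" "g x"] by (simp add: abs_mult abs_of_nonneg)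
  qed
qed measurable

lemma conjugate_exponent:
  fixes p q :: real
  assumes "1 < p" "1/p + 1/q = 1"
  shows "1 < q"
proof -
  have "1/q = 1 - 1/p" using assms by simp
  moreover have "1/p < 1" "0 < 1/p" using assms by auto
  ultimately have "0 < 1/q" "1/q < 1" by linarith+
  then show ?thesis by auto
qed

text \<open>Young's inequality majorises the product, which gives integrability. Dividing f and g by
  their norms A and B first turns the majorant into one with integral 1/p + 1/q = 1.\<close>

lemma integrable_mult_Holder:
  fixes f g :: "'a \<Rightarrow> complex"
  assumes p: "1 < p" and pq: "1/p + 1/q = 1"
    and [measurable]: "f \<in> borel_measurable M" "g \<in> borel_measurable M"
    and f: "integrable M (\<lambda>x. norm (f x) powr p)" and g: "integrable M (\<lambda>x. norm (g x) powr q)"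
  shows "integrable M (\<lambda>x. f x * g x)"
    and "(\<integral>x. norm (f x * g x) \<partial>M) \<le>
      (\<integral>x. norm (f x) powr p \<partial>M) powr (1/p) * (\<integral>x. norm (g x) powr q \<partial>M) powr (1/q)"
proof -
  have q: "q > 1" by (rule conjugate_exponent[OF p pq])
  have Y: "norm (f x) * norm (g x) \<le> norm (f x) powr p / p + norm (g x) powr q / q" for x
    using Youngs_inequality[OF p q pq] by simp
  show int: "integrable M (\<lambda>x. f x * g x)"
    by (rule Bochner_Integration.integrable_bound[where f="\<lambda>x. norm (f x) powr p / p + norm (g x) powr q / q"])
       (use f g Y p q in \<open>auto simp: norm_mult abs_of_nonneg\<close>)
  let ?F = "(\<integral>x. norm (f x) powr p \<partial>M)" and ?G = "(\<integral>x. norm (g x) powr q \<partial>M)"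
  have F0: "?F \<ge> 0" and G0: "?G \<ge> 0" by auto
  show "(\<integral>x. norm (f x * g x) \<partial>M) \<le> ?F powr (1/p) * ?G powr (1/q)"
  proof (cases "?F = 0 \<or> ?G = 0")
    case True
    then have "(AE x in M. f x = 0) \<or> (AE x in M. g x = 0)"
      using f g p q by (auto simp: integral_nonneg_eq_0_iff_AE)
    then have "AE x in M. norm (f x * g x) = 0" by (auto elim: eventually_mono)
    then have "(\<integral>x. norm (f x * g x) \<partial>M) = (\<integral>x. 0 \<partial>M)"
      by (intro integral_cong_AE) auto
    then show ?thesis by simp
  next
    case False
    define A B where "A = ?F powr (1/p)" and "B = ?G powr (1/q)"
    have A: "A > 0" "A powr p = ?F" and B: "B > 0" "B powr q = ?G"
      using False F0 G0 p q by (auto simp: A_def B_def powr_powr)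
    have "(\<integral>x. norm (f x * g x) \<partial>M) / (A * B) = (\<integral>x. norm (f x * g x) / (A * B) \<partial>M)" by simp
    also have "\<dots> \<le> (\<integral>x. (norm (f x) powr p / A powr p) / p + (norm (g x) powr q / B powr q) / q \<partial>M)"
    proof (rule integral_mono)
      fix x
      have "norm (f x * g x) / (A * B) = (norm (f x) / A) * (norm (g x) / B)"
        by (simp add: norm_mult)
      also have "\<dots> \<le> (norm (f x) / A) powr p / p + (norm (g x) / B) powr q / q"
        using A B by (intro Youngs_inequality[OF p q pq]) auto
      finally show "norm (f x * g x) / (A * B) \<le> (norm (f x) powr p / A powr p) / p + (norm (g x) powr q / B powr q) / q"
        using A B by (simp add: powr_divide)
    qed (use int f g in \<open>auto\<close>)
    also have "\<dots> = 1/p + 1/q"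
      using f g False by (simp add: A B)
    finally have "(\<integral>x. norm (f x * g x) \<partial>M) / (A * B) \<le> 1" using pq by simp
    then show ?thesis using A B by (simp add: A_def B_def field_simps)
  qed
qed

text \<open>Riesz-Fischer. A subsequence whose steps shrink geometrically converges almost
  everywhere, and Fatou's lemma along it bounds the distance of every late \<open>f n\<close> from
  the limit.\<close>

lemma Lp_complete_functions:
  fixes f :: "nat \<Rightarrow> 'a \<Rightarrow> complex"
  assumes p: "1 \<le> p" and [measurable]: "\<And>n. f n \<in> borel_measurable M"
    and int: "\<And>n. integrable M (\<lambda>x. norm (f n x) powr p)"
    and Cauchy: "\<And>e. e > 0 \<Longrightarrow> \<exists>N. \<forall>m\<ge>N. \<forall>n\<ge>N. (\<integral>x. norm (f m x - f n x) powr p \<partial>M) < e"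
  obtains g where "g \<in> borel_measurable M" "integrable M (\<lambda>x. norm (g x) powr p)"
    "(\<lambda>n. \<integral>x. norm (f n x - g x) powr p \<partial>M) \<longlonglongrightarrow> 0"
proof -
  have intd: "integrable M (\<lambda>x. norm (f m x - f n x) powr p)" for m n
    using integrable_powr_add[of p "f m" M "\<lambda>x. - f n x"] int p by simp
  \<comment> \<open>The first factor pays for the weight in \<open>h\<close> below: the integral of
    \<open>h k\<close> is still at most (1/2)^k, and h k x < 1 means that the k-th step at x is
    below (1/2)^k.\<close>
  define e where "e k = 2 powr (- p * real k) * (1/2) ^ k" for k :: nat
  have e: "e k > 0" for k by (simp add: e_def)
  have "\<exists>N. \<forall>k. ((\<forall>m\<ge>N k. \<forall>n\<ge>N k. (\<integral>x. norm (f m x - f n x) powr p \<partial>M) < e k) \<and> k \<le> N k) \<and> N k < N (Suc k)"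
  proof (rule dependent_nat_choice)
    show "\<exists>x. (\<forall>m\<ge>x. \<forall>n\<ge>x. (\<integral>y. norm (f m y - f n y) powr p \<partial>M) < e 0) \<and> 0 \<le> x"
      using Cauchy[OF e[of 0]] by auto
    fix x k
    obtain N where N: "\<forall>m\<ge>N. \<forall>n\<ge>N. (\<integral>y. norm (f m y - f n y) powr p \<partial>M) < e (Suc k)"
      using Cauchy[OF e[of "Suc k"]] by blast
    assume "(\<forall>m\<ge>x. \<forall>n\<ge>x. (\<integral>y. norm (f m y - f n y) powr p \<partial>M) < e k) \<and> k \<le> x"
    then show "\<exists>y. ((\<forall>m\<ge>y. \<forall>n\<ge>y. (\<integral>z. norm (f m z - f n z) powr p \<partial>M) < e (Suc k)) \<and> Suc k \<le> y) \<and> x < y"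
      using N by (intro exI[of _ "max N (Suc x)"]) auto
  qed
  then obtain r where r: "\<And>k m n. m \<ge> r k \<Longrightarrow> n \<ge> r k \<Longrightarrow> (\<integral>x. norm (f m x - f n x) powr p \<partial>M) < e k"
    and rk: "\<And>k. k \<le> r k" and rmono: "\<And>k. r k < r (Suc k)" by blast
  define h where "h k x = norm (f (r (Suc k)) x - f (r k) x) powr p * 2 powr (p * real k)" for k x
  have h0: "h k x \<ge> 0" for k x by (simp add: h_def)
  have hint: "integrable M (h k)" for k unfolding h_def using intd by auto
  have [measurable]: "h k \<in> borel_measurable M" for k unfolding h_def by measurable
  have hb: "(\<integral>x. h k x \<partial>M) \<le> (1/2)^k" for k
  proof -
    have "(\<integral>x. h k x \<partial>M) = (\<integral>x. norm (f (r (Suc k)) x - f (r k) x) powr p \<partial>M) * 2 powr (p * real k)"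
      unfolding h_def by simp
    also have "\<dots> \<le> e k * 2 powr (p * real k)"
      using r[of k "r (Suc k)" "r k"] rmono[of k] by (intro mult_right_mono) auto
    also have "\<dots> = (1/2)^k" by (simp add: e_def powr_minus field_simps)
    finally show ?thesis .
  qed
  have "AE x in M. summable (\<lambda>k. h k x)"
  proof -
    have "(\<integral>\<^sup>+x. (\<Sum>k. ennreal (h k x)) \<partial>M) = (\<Sum>k. \<integral>\<^sup>+x. ennreal (h k x) \<partial>M)"
      by (rule nn_integral_suminf) auto
    also have "\<dots> = (\<Sum>k. ennreal (\<integral>x. h k x \<partial>M))"
      using hint h0 by (intro suminf_cong nn_integral_eq_integral) auto
    also have "\<dots> \<le> (\<Sum>k. ennreal ((1/2)^k))"
      by (intro suminf_le ennreal_leI hb) auto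
    also have "\<dots> = ennreal (\<Sum>k. (1/2)^k)"
      by (intro suminf_ennreal2) (auto intro: summable_geometric)
    also have "\<dots> < \<infinity>" by simp
    finally have "AE x in M. (\<Sum>k. ennreal (h k x)) \<noteq> \<infinity>"
      by (intro nn_integral_PInf_AE) auto
    then show ?thesis
      by eventually_elim (use summable_suminf_not_top h0 in \<open>auto\<close>)
  qed
  then have conv: "AE x in M. convergent (\<lambda>k. f (r k) x)"
  proof eventually_elim
    case (elim x)
    have "(\<lambda>k. h k x) \<longlonglongrightarrow> 0" using elim by (rule summable_LIMSEQ_zero)
    then have "eventually (\<lambda>k. h k x < 1) sequentially" by (rule order_tendstoD) simp
    then have ev: "eventually (\<lambda>k. norm (f (r (Suc k)) x - f (r k) x) \<le> (1/2) ^ k) sequentially"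
    proof eventually_elim
      case (elim k)
      have "norm (f (r (Suc k)) x - f (r k) x) powr p * (2 powr k) powr p < 1"
        using elim by (simp add: h_def powr_powr mult.commute)
      then have "(norm (f (r (Suc k)) x - f (r k) x) * 2 powr k) powr p < 1 powr p"
        by (simp add: powr_mult)
      then have "norm (f (r (Suc k)) x - f (r k) x) * 2 powr k < 1"
        using p ge_one_powr_ge_zero[of "norm (f (r (Suc k)) x - f (r k) x) * 2 powr k" p] by (intro not_le_imp_less) auto
      then show ?case by (simp add: powr_realpow field_simps)
    qed
    have "summable (\<lambda>k. f (r (Suc k)) x - f (r k) x)"
      by (rule summable_comparison_test_ev[OF ev]) (auto intro: summable_geometric)
    then have "convergent (\<lambda>n. \<Sum>k<n. f (r (Suc k)) x - f (r k) x)"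
      by (simp add: summable_iff_convergent)
    then have "convergent (\<lambda>n. f (r n) x - f (r 0) x)"
      by (simp add: sum_lessThan_telescope[of "\<lambda>k. f (r k) x"])
    then have "convergent (\<lambda>n. (f (r n) x - f (r 0) x) + f (r 0) x)"
      by (intro convergent_add convergent_const)
    then show ?case by simp
  qed
  define g where "g x = lim (\<lambda>k. f (r k) x)" for x
  have [measurable]: "g \<in> borel_measurable M" unfolding g_def by measurable
  have lim: "AE x in M. (\<lambda>k. f (r k) x) \<longlonglongrightarrow> g x"
    using conv by eventually_elim (simp add: g_def convergent_LIMSEQ_iff)
  \<comment> \<open>Whether the difference from g is p-integrable is not yet known, so the estimate
    is made for the nonnegative integral; integrability is then read off from it.\<close>
  have bound: "(\<integral>\<^sup>+x. ennreal (norm (f n x - g x) powr p) \<partial>M) \<le> ennreal (e k)" if "n \<ge> r k" for n k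
  proof -
    have "(\<integral>\<^sup>+x. ennreal (norm (f n x - g x) powr p) \<partial>M) =
      (\<integral>\<^sup>+x. liminf (\<lambda>j. ennreal (norm (f n x - f (r j) x) powr p)) \<partial>M)"
    proof (rule nn_integral_cong_AE)
      show "AE x in M. ennreal (norm (f n x - g x) powr p) = liminf (\<lambda>j. ennreal (norm (f n x - f (r j) x) powr p))"
        using lim
      proof eventually_elim
        case (elim x)
        have "(\<lambda>j. ennreal (norm (f n x - f (r j) x) powr p)) \<longlonglongrightarrow> ennreal (norm (f n x - g x) powr p)"
          using elim p by (intro tendsto_ennrealI tendsto_powr2 tendsto_norm tendsto_diff tendsto_const) auto
        then show ?case by (intro lim_imp_Liminf[symmetric]) auto
      qed
    qed
    also have "\<dots> \<le> liminf (\<lambda>j. \<integral>\<^sup>+x. ennreal (norm (f n x - f (r j) x) powr p) \<partial>M)"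
      by (rule nn_integral_liminf) auto
    also have "\<dots> \<le> ennreal (e k)"
    proof (rule Liminf_le)
      show "\<forall>\<^sub>F j in sequentially. (\<integral>\<^sup>+x. ennreal (norm (f n x - f (r j) x) powr p) \<partial>M) \<le> ennreal (e k)"
        using eventually_ge_at_top[of "r k"]
      proof eventually_elim
        case (elim j)
        have "(\<integral>\<^sup>+x. ennreal (norm (f n x - f (r j) x) powr p) \<partial>M) = ennreal (\<integral>x. norm (f n x - f (r j) x) powr p \<partial>M)"
          using intd by (intro nn_integral_eq_integral) auto
        also have "\<dots> \<le> ennreal (e k)"
          using r[of k n "r j"] that elim rk[of j] by (intro ennreal_leI less_imp_le) auto
        finally show ?case .
      qed
    qed auto
    finally show ?thesis .
  qed
  have intfg: "integrable M (\<lambda>x. norm (f n x - g x) powr p)" if "n \<ge> r k" for n k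
    using bound[OF that] by (intro integrableI_bounded) (auto simp: ennreal_less_top[THEN le_less_trans[rotated]] intro: le_less_trans)
  have b2: "(\<integral>x. norm (f n x - g x) powr p \<partial>M) \<le> e k" if "n \<ge> r k" for n k
    using bound[OF that] intfg[OF that] e[of k]
    by (subst (asm) nn_integral_eq_integral) auto
  have "integrable M (\<lambda>x. norm (f (r 0) x + - (f (r 0) x - g x)) powr p)"
    using int intfg[of 0 "r 0"] p by (intro integrable_powr_add) (auto simp: norm_minus_commute)
  then have gint: "integrable M (\<lambda>x. norm (g x) powr p)" by simp
  have "e \<longlonglongrightarrow> 0"
  proof (rule tendsto_sandwich[OF _ _ tendsto_const])
    show "\<forall>\<^sub>F k in sequentially. e k \<le> (1/2)^k"
    proof (intro always_eventually allI)
      fix k :: nat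
      have "2 powr (- p * real k) \<le> 2 powr 0" using p by (intro powr_mono) auto
      then show "e k \<le> (1/2)^k"
        unfolding e_def using mult_right_mono[of "2 powr (- p * real k)" 1 "(1/2)^k"] by simp
    qed
  qed (auto intro!: LIMSEQ_power_zero always_eventually less_imp_le[OF e])
  have "(\<lambda>n. \<integral>x. norm (f n x - g x) powr p \<partial>M) \<longlonglongrightarrow> 0"
  proof (rule LIMSEQ_I)
    fix \<epsilon> :: real assume "\<epsilon> > 0"
    then have "eventually (\<lambda>k. e k < \<epsilon>) sequentially"
      using \<open>e \<longlonglongrightarrow> 0\<close> by (intro order_tendstoD)
    then obtain k where "e k < \<epsilon>" by (auto simp: eventually_sequentially)
    then show "\<exists>no. \<forall>n\<ge>no. norm ((\<integral>x. norm (f n x - g x) powr p \<partial>M) - 0) < \<epsilon>"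
      using b2[of k] by (intro exI[of _ "r k"]) (auto simp: abs_of_nonneg intro: le_less_trans)
  qed
  then show ?thesis by (intro that[OF _ gint]) auto
qed

subsection \<open>Representatives of functions on the circle\<close>

global_interpretation circle_prob: prob_space circle_measure
  by (rule prob_space_circle_measure)

abbreviation rv :: "circle_fun \<Rightarrow> complex \<Rightarrow> complex" where
  "rv \<equiv> rep_circle_fun"

lemma borel_measurable_rv [measurable]: "rv f \<in> borel_measurable borel"
  using Quotient3_rep_reflp[OF Quotient3_circle_fun, of f] by (simp add: circle_eq_def)

lemma rv_abs:
  assumes "f \<in> borel_measurable borel"
  shows "AE t in circle_measure. rv (abs_circle_fun f) t = f t"
proof -
  have "circle_eq f f" using assms by (simp add: circle_eq_def)
  then have "circle_eq (rv (abs_circle_fun f)) f"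
    by (rule rep_abs_rsp_left[OF Quotient3_circle_fun])
  then show ?thesis by (simp add: circle_eq_def)
qed

lemma circle_fun_eq_iff: "f = g \<longleftrightarrow> (AE t in circle_measure. rv f t = rv g t)"
proof -
  have "f = g \<longleftrightarrow> circle_eq (rv f) (rv g)"
    using Quotient3_rel_rep[OF Quotient3_circle_fun] by simp
  then show ?thesis by (simp add: circle_eq_def)
qed

lemma rv_add: "AE t in circle_measure. rv (f + g) t = rv f t + rv g t"
  unfolding plus_circle_fun_def map_fun_def o_def id_def by (rule rv_abs) measurable
lemma rv_diff: "AE t in circle_measure. rv (f - g) t = rv f t - rv g t"
  unfolding minus_circle_fun_def map_fun_def o_def id_def by (rule rv_abs) measurable
lemma rv_uminus: "AE t in circle_measure. rv (- f) t = - rv f t"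
  unfolding uminus_circle_fun_def map_fun_def o_def id_def by (rule rv_abs) measurable
lemma rv_mult: "AE t in circle_measure. rv (f * g) t = rv f t * rv g t"
  unfolding times_circle_fun_def map_fun_def o_def id_def by (rule rv_abs) measurable
lemma rv_inverse: "AE t in circle_measure. rv (inverse f) t = inverse (rv f t)"
  unfolding inverse_circle_fun_def map_fun_def o_def id_def by (rule rv_abs) measurable
lemma rv_divide: "AE t in circle_measure. rv (f / g) t = rv f t / rv g t"
  unfolding divide_circle_fun_def map_fun_def o_def id_def by (rule rv_abs) measurable
lemma rv_cscale: "AE t in circle_measure. rv (cscale z f) t = z * rv f t"
  unfolding cscale_def map_fun_def o_def id_def by (rule rv_abs) measurable
lemma rv_0: "AE t in circle_measure. rv 0 t = 0"
  unfolding zero_circle_fun_def map_fun_def o_def id_def by (rule rv_abs) measurable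
lemma rv_1: "AE t in circle_measure. rv 1 t = 1"
  unfolding one_circle_fun_def map_fun_def o_def id_def by (rule rv_abs) measurable
lemma rv_tt: "AE t in circle_measure. rv tt t = t"
  unfolding tt_def map_fun_def o_def id_def by (rule rv_abs) measurable
lemma rv_tilde: "AE t in circle_measure. rv (tilde f) t = rv f (inverse t)"
  unfolding tilde_def map_fun_def o_def id_def by (rule rv_abs) measurable

lemmas rv_simps = rv_add rv_diff rv_uminus rv_mult rv_inverse rv_divide rv_cscale rv_0 rv_1 rv_tt rv_tilde

lemma AE_circle_norm: "AE t in circle_measure. norm t = 1"
  by (subst AE_circle_measure_iff) auto

lemma AE_circle_nonzero: "AE t in circle_measure. t \<noteq> 0"
  using AE_circle_norm by eventually_elim auto

text \<open>Serves at the points 1 and -1, the zeros of \<open>1 - tt\<close> and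
  \<open>1 + tt\<close>, so that these factors can be cancelled.\<close>

lemma AE_circle_neq: "AE t in circle_measure. t \<noteq> z"
proof (cases "norm z = 1")
  case True
  have "finite {\<theta>\<in>{0..2*pi}. cis \<theta> = z}"
  proof (rule finite_subset)
    define \<phi> where "\<phi> = Arg z"
    have z: "z = cis \<phi>" using True by (simp add: \<phi>_def cis_Arg_unique cis_Arg) 
         (metis Arg_eq True cis_conv_exp mult_1 of_real_1 norm_zero zero_neq_one)
    have b: "-pi < \<phi>" "\<phi> \<le> pi" using Arg_bounded by (auto simp: \<phi>_def)
    show "{\<theta>\<in>{0..2*pi}. cis \<theta> = z} \<subseteq> (\<lambda>n::int. \<phi> + 2 * pi * n) ` {-2..2}"
    proof
      fix \<theta> assume \<theta>: "\<theta> \<in> {\<theta>\<in>{0..2*pi}. cis \<theta> = z}"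
      then have "cis \<theta> = cis \<phi>" using z by simp
      then have "sin \<theta> = sin \<phi> \<and> cos \<theta> = cos \<phi>" by (simp add: cis.ctr)
      then obtain n where n: "\<theta> = \<phi> + 2 * pi * of_int n" using sin_cos_eq_iff by blast
      have "2 * pi * of_int n \<le> 2 * pi * 2" "2 * pi * (-2) \<le> 2 * pi * of_int n"
        using \<theta> b n pi_gt_zero unfolding mem_Collect_eq atLeastAtMost_iff by linarith+
      then have "real_of_int n \<le> 2" "-2 \<le> real_of_int n"
        using mult_le_cancel_left_pos[of "2*pi"] pi_gt_zero by (metis mult_pos_pos zero_less_numeral)+
      then have "n \<in> {-2..2}" by simp
      then show "\<theta> \<in> (\<lambda>n::int. \<phi> + 2 * pi * n) ` {-2..2}" using n by blast
    qed
  qed auto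
  then have "AE \<theta> in lborel. \<theta> \<notin> {\<theta>\<in>{0..2*pi}. cis \<theta> = z}"
    by (intro AE_not_in) (auto simp: null_sets_def emeasure_lborel_countable countable_finite finite_imp_closed borel_closed)
  then show ?thesis by (subst AE_circle_measure_iff) auto
next
  case False
  then show ?thesis using AE_circle_norm by (auto elim: eventually_mono)
qed

text \<open>On the circle, inversion is the reflection of the angle at pi, which preserves
  length.\<close>

lemma integral_circle_inverse:
  fixes f :: "complex \<Rightarrow> 'b::{banach,second_countable_topology}"
  assumes [measurable]: "f \<in> borel_measurable borel"
  shows "(\<integral>t. f (inverse t) \<partial>circle_measure) = (\<integral>t. f t \<partial>circle_measure)"
    and "integrable circle_measure (\<lambda>t. f (inverse t)) \<longleftrightarrow> integrable circle_measure f"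
proof -
  have *: "distr circle_measure borel inverse = circle_measure"
  proof (rule measure_eqI)
    fix A assume "A \<in> sets (distr circle_measure borel inverse)"
    then have A[measurable]: "A \<in> sets borel" by simp
    have E: "emeasure circle_measure B = emeasure lborel {\<theta>\<in>{0..2*pi}. cis \<theta> \<in> B} / ennreal (2*pi)"
      if [measurable]: "B \<in> sets borel" for B
      unfolding circle_measure_def
      by (subst emeasure_distr) (auto simp: vimage_def Int_def conj_commute
            intro!: arg_cong2[where f="\<lambda>a b. emeasure lborel a / b"])
    have "emeasure (distr circle_measure borel inverse) A = emeasure circle_measure (inverse -` A)"
      by (subst emeasure_distr) auto
    also have "\<dots> = emeasure lborel {\<theta>\<in>{0..2*pi}. inverse (cis \<theta>) \<in> A} / ennreal (2*pi)"
      by (subst E) (use measurable_sets_borel[OF borel_measurable_inverse[OF measurable_ident_sets[OF refl]] A] in auto)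
    also have "emeasure lborel {\<theta>\<in>{0..2*pi}. inverse (cis \<theta>) \<in> A} =
        emeasure (distr lborel borel (\<lambda>\<theta>. 2*pi + (-1) * \<theta>)) {\<theta>\<in>{0..2*pi}. inverse (cis \<theta>) \<in> A}"
      using lborel_real_affine[of "-1" "2*pi"] by (simp add: density_1 flip: one_ennreal_def)
    also have "\<dots> = emeasure lborel ((\<lambda>\<theta>. 2*pi + (-1) * \<theta>) -` {\<theta>\<in>{0..2*pi}. inverse (cis \<theta>) \<in> A})"
      by (subst emeasure_distr) auto
    also have "(\<lambda>\<theta>. 2*pi + (-1) * \<theta>) -` {\<theta>\<in>{0..2*pi}. inverse (cis \<theta>) \<in> A} = {\<theta>\<in>{0..2*pi}. cis \<theta> \<in> A}"
    proof -
      have "inverse (cis (2*pi - \<theta>)) = cis \<theta>" for \<theta>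
        by (simp add: complex_eq_iff cos_diff sin_diff)
      then show ?thesis by (auto simp: vimage_def)
    qed
    also have "emeasure lborel {\<theta>\<in>{0..2*pi}. cis \<theta> \<in> A} / ennreal (2*pi) = emeasure circle_measure A" by (simp add: E)
    finally show "emeasure (distr circle_measure borel inverse) A = emeasure circle_measure A" .
  qed simp
  have "(\<integral>t. f t \<partial>distr circle_measure borel inverse) = (\<integral>t. f (inverse t) \<partial>circle_measure)"
    by (rule integral_distr) auto
  then show "(\<integral>t. f (inverse t) \<partial>circle_measure) = (\<integral>t. f t \<partial>circle_measure)" by (simp add: *)
  have "integrable (distr circle_measure borel inverse) f \<longleftrightarrow> integrable circle_measure (\<lambda>t. f (inverse t))"
    by (rule integrable_distr_eq) auto
  then show "integrable circle_measure (\<lambda>t. f (inverse t)) \<longleftrightarrow> integrable circle_measure f" by (simp add: *)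
qed

subsection \<open>Lebesgue spaces on the circle\<close>

lemma rv_power: "AE t in circle_measure. rv (f ^ n) t = rv f t ^ n"
proof (induction n)
  case 0
  show ?case using rv_1 by simp
next
  case (Suc n)
  show ?case using Suc rv_mult[of f "f ^ n"] by eventually_elim simp
qed

lemma rv_tt_powi: "AE t in circle_measure. rv (tt powi k) t = t powi k"
proof -
  have "AE t in circle_measure. rv (tt ^ nat k) t = t ^ nat k"
    using rv_power[of tt "nat k"] rv_tt by eventually_elim simp
  moreover have "AE t in circle_measure. rv (inverse tt ^ nat (- k)) t = inverse t ^ nat (- k)"
    using rv_power[of "inverse tt" "nat (- k)"] rv_inverse[of tt] rv_tt by eventually_elim simp
  ultimately show ?thesis by (simp add: power_int_def)
qed

lemma borel_measurable_powi [measurable]: "(\<lambda>t::complex. t powi k) \<in> borel_measurable borel"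
  unfolding power_int_def by measurable

lemma mem_Lp_iff: "f \<in> Lp p \<longleftrightarrow> integrable circle_measure (\<lambda>t. norm (rv f t) powr p)"
  by (simp add: Lp_def in_Lp.rep_eq)

lemma mem_Lp_cong:
  assumes "AE t in circle_measure. rv f t = u t" and [measurable]: "u \<in> borel_measurable borel"
  shows "f \<in> Lp p \<longleftrightarrow> integrable circle_measure (\<lambda>t. norm (u t) powr p)"
  unfolding mem_Lp_iff by (rule integrable_cong_AE) (use assms(1) in \<open>auto elim: eventually_mono\<close>)

lemma Lp_norm_cong:
  assumes "AE t in circle_measure. rv f t = u t" and [measurable]: "u \<in> borel_measurable borel"
  shows "Lp_norm p f = (\<integral>t. norm (u t) powr p \<partial>circle_measure) powr (1/p)"
  unfolding Lp_norm.rep_eq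
  by (intro arg_cong[where f="\<lambda>x. x powr (1/p)"] integral_cong_AE) (use assms(1) in \<open>auto elim: eventually_mono\<close>)

lemma fourier_cong:
  assumes "AE t in circle_measure. rv f t = u t" and [measurable]: "u \<in> borel_measurable borel"
  shows "fourier f k = (\<integral>t. u t * t powi (- k) \<partial>circle_measure)"
  unfolding fourier.rep_eq
  by (intro integral_cong_AE) (use assms(1) in \<open>auto elim: eventually_mono\<close>)

lemma mem_L1_iff: "f \<in> Lp 1 \<longleftrightarrow> integrable circle_measure (rv f)"
  by (simp add: mem_Lp_iff integrable_norm_iff)

lemma Lp_add: "f \<in> Lp p \<Longrightarrow> g \<in> Lp p \<Longrightarrow> 0 \<le> p \<Longrightarrow> f + g \<in> Lp p"
  unfolding mem_Lp_cong[OF rv_add borel_measurable_add[OF borel_measurable_rv borel_measurable_rv]]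
  unfolding mem_Lp_iff by (intro integrable_powr_add) auto

lemma Lp_cscale: "f \<in> Lp p \<Longrightarrow> cscale z f \<in> Lp p"
  by (subst mem_Lp_cong[OF rv_cscale]) (auto simp: mem_Lp_iff norm_mult powr_mult)

lemma Lp_uminus: "f \<in> Lp p \<Longrightarrow> - f \<in> Lp p"
  by (subst mem_Lp_cong[OF rv_uminus]) (auto simp: mem_Lp_iff)

lemma Lp_diff: "f \<in> Lp p \<Longrightarrow> g \<in> Lp p \<Longrightarrow> 0 \<le> p \<Longrightarrow> f - g \<in> Lp p"
  using Lp_add[of f p "- g"] Lp_uminus[of g p] by simp

lemma Lp_0: "0 \<in> Lp p"
  by (subst mem_Lp_cong[OF rv_0]) auto

lemma subspace_Lp: "0 \<le> p \<Longrightarrow> circle_fun.subspace (Lp p)"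
  by (auto simp: circle_fun.subspace_def Lp_add Lp_cscale Lp_0)

lemma Lp_sum: "0 \<le> p \<Longrightarrow> (\<And>i. i \<in> I \<Longrightarrow> f i \<in> Lp p) \<Longrightarrow> (\<Sum>i\<in>I. f i) \<in> Lp p"
  by (rule circle_fun.subspace_sum[OF subspace_Lp])

lemma Lp_bounded_mult:
  assumes f: "f \<in> Lp p" and "0 \<le> p" and C: "AE t in circle_measure. norm (rv u t) \<le> C"
  shows "u * f \<in> Lp p" and "1 \<le> p \<Longrightarrow> Lp_norm p (u * f) \<le> C * Lp_norm p f"
proof -
  have [simp]: "C \<ge> 0"
  proof -
    have "AE t in circle_measure. 0 \<le> C" using C by eventually_elim (metis norm_ge_zero order_trans)
    then show ?thesis by simp
  qed
  have b: "AE t in circle_measure. norm (rv u t * rv f t) powr p \<le> C powr p * norm (rv f t) powr p"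
    using C
  proof eventually_elim
    case (elim t)
    have "norm (rv u t * rv f t) powr p \<le> (C * norm (rv f t)) powr p"
      using elim \<open>0 \<le> p\<close> by (intro powr_mono2) (auto simp: norm_mult intro: mult_right_mono)
    then show ?case by (simp add: powr_mult)
  qed
  have i: "integrable circle_measure (\<lambda>t. norm (rv u t * rv f t) powr p)"
    by (rule Bochner_Integration.integrable_bound[where f="\<lambda>t. C powr p * norm (rv f t) powr p"])
       (use f b in \<open>auto simp: mem_Lp_iff elim: eventually_mono\<close>)
  then show "u * f \<in> Lp p"
    by (subst mem_Lp_cong[OF rv_mult]) auto
  assume p: "1 \<le> p"
  have "(\<integral>t. norm (rv u t * rv f t) powr p \<partial>circle_measure) \<le> (\<integral>t. C powr p * norm (rv f t) powr p \<partial>circle_measure)"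
    by (rule integral_mono_AE[OF i _ b]) (use f in \<open>auto simp: mem_Lp_iff\<close>)
  then have "Lp_norm p (u * f) \<le> (C powr p * (\<integral>t. norm (rv f t) powr p \<partial>circle_measure)) powr (1/p)"
    using p by (subst Lp_norm_cong[OF rv_mult]) (auto intro!: powr_mono2)
  also have "\<dots> = C * Lp_norm p f"
    using p by (simp add: Lp_norm.rep_eq powr_mult powr_powr)
  finally show "Lp_norm p (u * f) \<le> C * Lp_norm p f" .
qed

lemma Lp_norm_nonneg [simp]: "0 \<le> Lp_norm p f"
  by (simp add: Lp_norm.rep_eq)

lemma Lp_norm_powr: "0 < p \<Longrightarrow> Lp_norm p f powr p = (\<integral>t. norm (rv f t) powr p \<partial>circle_measure)"
  by (simp add: Lp_norm.rep_eq powr_powr)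

lemma Lp_norm_cscale: "0 < p \<Longrightarrow> Lp_norm p (cscale z f) = norm z * Lp_norm p f"
  by (subst Lp_norm_cong[OF rv_cscale]) (auto simp: Lp_norm.rep_eq norm_mult powr_mult powr_powr)

lemma Lp_norm_uminus: "Lp_norm p (- f) = Lp_norm p f"
  by (subst Lp_norm_cong[OF rv_uminus]) (auto simp: Lp_norm.rep_eq)

lemma Lp_norm_minus_commute: "Lp_norm p (f - g) = Lp_norm p (g - f)"
  using Lp_norm_uminus[of p "f - g"] by simp

lemma Lp_norm_0 [simp]: "0 < p \<Longrightarrow> Lp_norm p 0 = 0"
  by (subst Lp_norm_cong[OF rv_0]) auto

lemma Lp_norm_eq_0_iff:
  assumes "0 < p" "f \<in> Lp p"
  shows "Lp_norm p f = 0 \<longleftrightarrow> f = 0"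
proof
  assume "Lp_norm p f = 0"
  then have "AE t in circle_measure. norm (rv f t) powr p = 0"
    using assms by (auto simp: Lp_norm.rep_eq mem_Lp_iff integral_nonneg_eq_0_iff_AE)
  then show "f = 0"
    unfolding circle_fun_eq_iff using rv_0 by eventually_elim simp
qed (use assms in auto)

text \<open>Minkowski by convexity. With A and B the two norms, (f + g)/(A + B) is dominated by the
  convex combination of f/A and g/B with weights A/(A + B) and B/(A + B), and the p-th power of that
  combination has integral at most 1.\<close>

lemma Lp_norm_triangle:
  assumes p: "1 \<le> p" and f: "f \<in> Lp p" and g: "g \<in> Lp p"
  shows "Lp_norm p (f + g) \<le> Lp_norm p f + Lp_norm p g"
proof -
  let ?A = "Lp_norm p f" and ?B = "Lp_norm p g"
  have p0: "0 < p" using p by simp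
  consider "?A = 0" | "?B = 0" | "?A > 0" "?B > 0"
    using Lp_norm_nonneg[of p f] Lp_norm_nonneg[of p g] by argo
  then show ?thesis
  proof cases
    case 1
    then show ?thesis using Lp_norm_eq_0_iff[OF p0 f] by simp
  next
    case 2
    then show ?thesis using Lp_norm_eq_0_iff[OF p0 g] by simp
  next
    case 3
    let ?S = "?A + ?B"
    have conv: "(u * x + v * y) powr p \<le> u * x powr p + v * y powr p"
      if "0 \<le> x" "0 \<le> y" "0 < u" "0 < v" "u + v = 1" for x y u v :: real
    proof (cases "x = 0 \<or> y = 0")
      case True
      have "(s * z) powr p \<le> s * z powr p" if "0 < s" "s \<le> 1" "0 \<le> z" for s z :: real
      proof -
        have "s powr p \<le> s powr 1" using that p by (intro powr_mono') auto
        then show ?thesis using that by (simp add: powr_mult mult_right_mono)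
      qed
      then show ?thesis using True that by auto
    next
      case False
      then show ?thesis
        using convex_onD[OF powr_convex[OF p], of v x y] that by (simp add: eq_diff_eq [symmetric] diff_eq_eq)
    qed
    have pt: "norm (rv f t + rv g t) powr p / ?S powr p \<le>
       (?A/?S) * (norm (rv f t) powr p / ?A powr p) + (?B/?S) * (norm (rv g t) powr p / ?B powr p)" for t
    proof -
      have "norm (rv f t + rv g t) / ?S \<le> (norm (rv f t) + norm (rv g t)) / ?S"
        using 3 by (intro divide_right_mono norm_triangle_ineq) auto
      also have "\<dots> = (?A/?S) * (norm (rv f t) / ?A) + (?B/?S) * (norm (rv g t) / ?B)"
        using 3 by (simp add: add_divide_distrib)
      finally have "(norm (rv f t + rv g t) / ?S) powr p \<le> \<dots> powr p"
        using p 3 by (intro powr_mono2) auto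
      also have "\<dots> \<le> (?A/?S) * (norm (rv f t) / ?A) powr p + (?B/?S) * (norm (rv g t) / ?B) powr p"
        using 3 by (intro conv) (auto simp flip: add_divide_distrib)
      finally show ?thesis using 3 by (simp add: powr_divide)
    qed
    have i: "integrable circle_measure (\<lambda>t. norm (rv f t + rv g t) powr p)"
      using f g p by (intro integrable_powr_add) (auto simp: mem_Lp_iff)
    have "(\<integral>t. norm (rv f t + rv g t) powr p \<partial>circle_measure) / ?S powr p =
       (\<integral>t. norm (rv f t + rv g t) powr p / ?S powr p \<partial>circle_measure)" by simp
    also have "\<dots> \<le> (\<integral>t. (?A/?S) * (norm (rv f t) powr p / ?A powr p) + (?B/?S) * (norm (rv g t) powr p / ?B powr p) \<partial>circle_measure)"
      using i f g by (intro integral_mono pt) (auto simp: mem_Lp_iff)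
    also have "\<dots> = ?A/?S + ?B/?S"
      using f g 3 p0 by (simp add: mem_Lp_iff Lp_norm_powr[symmetric])
    also have "\<dots> = 1" using 3 by (simp flip: add_divide_distrib)
    finally have "(\<integral>t. norm (rv f t + rv g t) powr p \<partial>circle_measure) \<le> ?S powr p"
      using 3 by (simp add: field_simps)
    then have "(\<integral>t. norm (rv f t + rv g t) powr p \<partial>circle_measure) powr (1/p) \<le> (?S powr p) powr (1/p)"
      using p by (intro powr_mono2) auto
    then show ?thesis
      using p 3 by (subst Lp_norm_cong[OF rv_add]) (auto simp: powr_powr)
  qed
qed

lemma Lp_norm_triangle_diff:
  assumes "1 \<le> p" "f \<in> Lp p" "g \<in> Lp p" "h \<in> Lp p"
  shows "Lp_norm p (f - h) \<le> Lp_norm p (f - g) + Lp_norm p (g - h)"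
  using Lp_norm_triangle[of p "f - g" "g - h"] assms by (simp add: Lp_diff)

lemma Lp_norm_sum:
  assumes "1 \<le> p" "\<And>i. i \<in> I \<Longrightarrow> f i \<in> Lp p"
  shows "Lp_norm p (\<Sum>i\<in>I. f i) \<le> (\<Sum>i\<in>I. Lp_norm p (f i))"
  using assms(2)
proof (induction I rule: infinite_finite_induct)
  case (insert x I)
  have "Lp_norm p (f x + (\<Sum>i\<in>I. f i)) \<le> Lp_norm p (f x) + Lp_norm p (\<Sum>i\<in>I. f i)"
    using insert assms(1) by (intro Lp_norm_triangle Lp_sum) auto
  then show ?case using insert by auto
qed (use assms(1) in auto)

lemma Lp_mult_Holder:
  assumes "1 < p" "1/p + 1/q = 1" "f \<in> Lp p" "g \<in> Lp q"
  shows "f * g \<in> Lp 1" and "norm (fourier (f * g) 0) \<le> Lp_norm p f * Lp_norm q g"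
proof -
  have fg: "integrable circle_measure (\<lambda>t. rv f t * rv g t)"
    "(\<integral>t. norm (rv f t * rv g t) \<partial>circle_measure) \<le> Lp_norm p f * Lp_norm q g"
    using integrable_mult_Holder[OF assms(1,2), of "rv f" circle_measure "rv g"] assms(3,4)
    by (auto simp: mem_Lp_iff Lp_norm.rep_eq)
  show "f * g \<in> Lp 1"
    by (subst mem_Lp_cong[OF rv_mult]) (use fg(1) in \<open>auto\<close>)
  have "norm (fourier (f * g) 0) \<le> (\<integral>t. norm (rv f t * rv g t) \<partial>circle_measure)"
    by (subst fourier_cong[OF rv_mult]) (auto intro: order_trans[OF integral_norm_bound])
  then show "norm (fourier (f * g) 0) \<le> Lp_norm p f * Lp_norm q g"
    using fg(2) by simp
qed

lemma one_mem_Lp: "1 \<in> Lp p" and Lp_norm_one: "Lp_norm p 1 = 1"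
  using circle_prob.prob_space
  by (subst mem_Lp_cong[OF rv_1] Lp_norm_cong[OF rv_1]; auto)+

lemma Lp_subset_L1: "1 < p \<Longrightarrow> f \<in> Lp p \<Longrightarrow> f \<in> Lp 1"
  using Lp_mult_Holder(1)[of p "p/(p-1)" f 1] one_mem_Lp by (simp add: field_simps)

lemma Lp_complete:
  fixes f :: "nat \<Rightarrow> circle_fun"
  assumes p: "1 \<le> p" and f: "\<And>n. f n \<in> Lp p"
    and Cauchy: "\<And>e. e > 0 \<Longrightarrow> \<exists>N. \<forall>m\<ge>N. \<forall>n\<ge>N. Lp_norm p (f m - f n) < e"
  obtains g where "g \<in> Lp p" "(\<lambda>n. Lp_norm p (f n - g)) \<longlonglongrightarrow> 0"
proof -
  have eq: "Lp_norm p (h - k) = (\<integral>t. norm (rv h t - rv k t) powr p \<partial>circle_measure) powr (1/p)" for h k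
    by (rule Lp_norm_cong[OF rv_diff]) measurable
  have "\<exists>N. \<forall>m\<ge>N. \<forall>n\<ge>N. (\<integral>t. norm (rv (f m) t - rv (f n) t) powr p \<partial>circle_measure) < e" if "e > 0" for e
  proof -
    obtain N where "\<forall>m\<ge>N. \<forall>n\<ge>N. Lp_norm p (f m - f n) < e powr (1/p)"
      using Cauchy[of "e powr (1/p)"] \<open>e > 0\<close> by auto
    moreover have "x < e" if "x powr (1/p) < e powr (1/p)" for x
      using that p \<open>e > 0\<close> powr_mono2[of "1/p" e x] by (cases "x < e") auto
    ultimately show ?thesis unfolding eq by blast
  qed
  note C = this
  obtain g where g: "g \<in> borel_measurable circle_measure" "integrable circle_measure (\<lambda>x. norm (g x) powr p)"
    "(\<lambda>n. \<integral>x. norm (rv (f n) x - g x) powr p \<partial>circle_measure) \<longlonglongrightarrow> 0"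
    by (rule Lp_complete_functions[of p "\<lambda>n. rv (f n)" circle_measure])
       (use p f C in \<open>auto simp: mem_Lp_iff\<close>)
  have [measurable]: "g \<in> borel_measurable borel" using g(1) by simp
  have a: "AE t in circle_measure. rv (abs_circle_fun g) t = g t" by (rule rv_abs) measurable
  show ?thesis
  proof (rule that[of "abs_circle_fun g"])
    show "abs_circle_fun g \<in> Lp p" using g(2) by (subst mem_Lp_cong[OF a]) auto
    have d: "AE t in circle_measure. rv (f n - abs_circle_fun g) t = rv (f n) t - g t" for n
      using a rv_diff[of "f n" "abs_circle_fun g"] by eventually_elim simp
    have "Lp_norm p (f n - abs_circle_fun g) = (\<integral>x. norm (rv (f n) x - g x) powr p \<partial>circle_measure) powr (1/p)" for n
      by (rule Lp_norm_cong[OF d]) measurable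
    moreover have "(\<lambda>n. (\<integral>x. norm (rv (f n) x - g x) powr p \<partial>circle_measure) powr (1/p)) \<longlonglongrightarrow> 0 powr (1/p)"
      using p by (intro tendsto_powr2 g(3) tendsto_const) auto
    ultimately show "(\<lambda>n. Lp_norm p (f n - abs_circle_fun g)) \<longlonglongrightarrow> 0" by simp
  qed
qed

lemma integrable_rv_powi: "f \<in> Lp 1 \<Longrightarrow> integrable circle_measure (\<lambda>t. rv f t * t powi k)"
  unfolding mem_L1_iff
  by (rule Bochner_Integration.integrable_bound[of _ "rv f"])
     (use AE_circle_norm in \<open>auto elim!: eventually_mono simp: norm_mult norm_power_int\<close>)

lemma fourier_add: "f \<in> Lp 1 \<Longrightarrow> g \<in> Lp 1 \<Longrightarrow> fourier (f + g) k = fourier f k + fourier g k"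
  by (subst fourier_cong[OF rv_add])
     (auto simp: fourier.rep_eq distrib_right integrable_rv_powi)

lemma fourier_cscale: "fourier (cscale z f) k = z * fourier f k"
  by (subst fourier_cong[OF rv_cscale]) (auto simp: fourier.rep_eq mult.assoc)

lemma fourier_0 [simp]: "fourier 0 k = 0"
  by (subst fourier_cong[OF rv_0]) auto

lemma fourier_uminus: "fourier (- f) k = - fourier f k"
  by (subst fourier_cong[OF rv_uminus]) (auto simp: fourier.rep_eq)

lemma fourier_diff: "f \<in> Lp 1 \<Longrightarrow> g \<in> Lp 1 \<Longrightarrow> fourier (f - g) k = fourier f k - fourier g k"
  using fourier_add[of f "- g"] by (simp add: fourier_uminus Lp_uminus)

lemma fourier_sum: "(\<And>i. i \<in> I \<Longrightarrow> f i \<in> Lp 1) \<Longrightarrow> fourier (\<Sum>i\<in>I. f i) k = (\<Sum>i\<in>I. fourier (f i) k)"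
proof (induction I rule: infinite_finite_induct)
  case (insert x I)
  then have "fourier (f x + sum f I) k = fourier (f x) k + fourier (sum f I) k"
    by (intro fourier_add Lp_sum) auto
  then show ?case using insert by auto
qed auto

lemma fourier_tt_powi_mult: "fourier (tt powi j * f) k = fourier f (k - j)"
proof -
  have "AE t in circle_measure. rv (tt powi j * f) t = t powi j * rv f t"
    using rv_mult[of "tt powi j" f] rv_tt_powi[of j] by eventually_elim simp
  then have "fourier (tt powi j * f) k = (\<integral>t. t powi j * rv f t * t powi (- k) \<partial>circle_measure)"
    by (rule fourier_cong) measurable
  also have "\<dots> = (\<integral>t. rv f t * t powi (- (k - j)) \<partial>circle_measure)"
    by (rule integral_cong_AE) (use AE_circle_nonzero in \<open>auto elim!: eventually_mono simp: power_int_diff power_int_minus field_simps\<close>)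
  finally show ?thesis by (simp add: fourier.rep_eq)
qed

lemma fourier_tilde: "fourier (tilde f) k = fourier f (- k)"
proof -
  have "fourier (tilde f) k = (\<integral>t. rv f (inverse t) * t powi (- k) \<partial>circle_measure)"
    by (rule fourier_cong[OF rv_tilde]) measurable
  also have "\<dots> = (\<integral>t. rv f (inverse t) * (inverse t) powi k \<partial>circle_measure)"
    by (simp add: power_int_minus power_int_inverse)
  also have "\<dots> = (\<integral>t. rv f t * t powi k \<partial>circle_measure)"
    by (rule integral_circle_inverse(1)) measurable
  finally show ?thesis by (simp add: fourier.rep_eq)
qed

lemma Lp_tilde: "f \<in> Lp p \<Longrightarrow> tilde f \<in> Lp p"
  by (subst mem_Lp_cong[OF rv_tilde])
     (auto simp: mem_Lp_iff integral_circle_inverse(2)[of "\<lambda>t. norm (rv f t) powr p"])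

lemma Lp_norm_tilde: "Lp_norm p (tilde f) = Lp_norm p f"
  by (subst Lp_norm_cong[OF rv_tilde])
     (auto simp: Lp_norm.rep_eq integral_circle_inverse(1)[of "\<lambda>t. norm (rv f t) powr p"])

lemma norm_tt_powi: "AE t in circle_measure. norm (rv (tt powi k) t) = 1"
  using rv_tt_powi[of k] AE_circle_norm by eventually_elim (simp add: norm_power_int)

lemma Lp_tt_powi_mult: "f \<in> Lp p \<Longrightarrow> 0 \<le> p \<Longrightarrow> tt powi k * f \<in> Lp p"
  by (rule Lp_bounded_mult(1)[where C=1]) (use norm_tt_powi[of k] in \<open>auto elim!: eventually_mono\<close>)

lemma Lp_norm_tt_powi_mult: "Lp_norm p (tt powi k * f) = Lp_norm p f"
  by (subst Lp_norm_cong[OF rv_mult]; simp add: Lp_norm.rep_eq)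
     (intro arg_cong[where f="\<lambda>x. x powr (1/p)"] integral_cong_AE,
       use norm_tt_powi[of k] in \<open>auto elim!: eventually_mono simp: norm_mult\<close>)

lemma norm_fourier_le: "1 < p \<Longrightarrow> f \<in> Lp p \<Longrightarrow> norm (fourier f k) \<le> Lp_norm p f"
  using Lp_mult_Holder(2)[of p "p/(p-1)" "tt powi (- k) * f" 1] Lp_tt_powi_mult[of f p "-k"]
  by (simp add: Lp_norm_tt_powi_mult fourier_tt_powi_mult one_mem_Lp Lp_norm_one flip: add_divide_distrib)

subsection \<open>Uniform convexity and separation in Lebesgue spaces\<close>

text \<open>The mean value theorem on the two halves of the interval compares the two increments
  through the strictly increasing derivative. At the left end, which may be 0, continuity
  suffices.\<close>

lemma powr_midpoint_less:
  fixes x y p :: real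
  assumes p: "1 < p" and xy: "0 \<le> x" "0 \<le> y" "x \<noteq> y"
  shows "((x + y) / 2) powr p < (x powr p + y powr p) / 2"
proof -
  have *: "((x + y) / 2) powr p < (x powr p + y powr p) / 2" if xy: "0 \<le> x" "x < y" for x y :: real
  proof -
    let ?m = "(x + y) / 2"
    have mvt: "\<exists>\<xi>. a < \<xi> \<and> \<xi> < b \<and> b powr p - a powr p = p * \<xi> powr (p - 1) * (b - a)"
      if ab: "0 \<le> a" "a < b" for a b :: real
    proof -
      have "\<exists>\<xi>. a < \<xi> \<and> \<xi> < b \<and> b powr p - a powr p = (\<lambda>h. p * \<xi> powr (p - 1) * h) (b - a)"
      proof (rule mvt)
        show "continuous_on {a..b} (\<lambda>x. x powr p)"
          by (intro continuous_on_powr' continuous_intros) (use p ab in auto)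
        show "((\<lambda>x. x powr p) has_derivative (\<lambda>h. p * \<xi> powr (p - 1) * h)) (at \<xi>)" if "a < \<xi>" "\<xi> < b" for \<xi>
          using has_real_derivative_powr[of \<xi> p] that ab unfolding has_field_derivative_def by simp
      qed (use ab in auto)
      then show ?thesis by simp
    qed
    obtain u where u: "x < u" "u < ?m" "?m powr p - x powr p = p * u powr (p - 1) * (?m - x)"
      using mvt[of x ?m] xy by auto
    obtain v where v: "?m < v" "v < y" "y powr p - ?m powr p = p * v powr (p - 1) * (y - ?m)"
      using mvt[of ?m y] xy by auto
    have "u powr (p - 1) < v powr (p - 1)"
      using u v xy p by (intro powr_less_mono2) auto
    then have "p * u powr (p - 1) * (?m - x) < p * v powr (p - 1) * (?m - x)"
      using p xy by (intro mult_strict_right_mono mult_strict_left_mono) auto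
    also have "?m - x = y - ?m" by (simp add: field_simps)
    finally show ?thesis using u(3) v(3) by (simp add: field_simps)
  qed
  show ?thesis
    using *[of x y] *[of y x] xy by (cases "x < y") (auto simp: add.commute)
qed

lemma norm_powr_midpoint:
  fixes a b :: complex
  assumes p: "1 < p"
  shows "norm ((a + b) / 2) powr p \<le> (norm a powr p + norm b powr p) / 2"
    and "a \<noteq> b \<Longrightarrow> norm ((a + b) / 2) powr p < (norm a powr p + norm b powr p) / 2"
proof -
  have 1: "norm ((a + b) / 2) powr p \<le> ((norm a + norm b) / 2) powr p"
    using p norm_triangle_ineq[of a b] by (intro powr_mono2) (auto simp: norm_divide)
  have 2: "((norm a + norm b) / 2) powr p \<le> (norm a powr p + norm b powr p) / 2"
    using powr_midpoint_less[OF p, of "norm a" "norm b"] by (cases "norm a = norm b") auto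
  show "norm ((a + b) / 2) powr p \<le> (norm a powr p + norm b powr p) / 2"
    using 1 2 by simp
  assume "a \<noteq> b"
  show "norm ((a + b) / 2) powr p < (norm a powr p + norm b powr p) / 2"
  proof (cases "norm a = norm b")
    case False
    then show ?thesis using 1 powr_midpoint_less[OF p, of "norm a" "norm b"] by simp
  next
    case True
    \<comment> \<open>With equal moduli the strictness has to come from the triangle inequality: its
      equality case makes a and b positively proportional, hence equal.\<close>
    have "norm (a + b) < norm a + norm b"
    proof (rule ccontr)
      assume "\<not> norm (a + b) < norm a + norm b"
      then have "norm (a + b) = norm a + norm b" using norm_triangle_ineq[of a b] by simp
      then have "norm a *\<^sub>R b = norm b *\<^sub>R a" using norm_triangle_eq[of a b] by simp
      then have "a = b" using True \<open>a \<noteq> b\<close> by (cases "a = 0") auto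
      then show False using \<open>a \<noteq> b\<close> by simp
    qed
    then have "norm ((a + b) / 2) powr p < ((norm a + norm b) / 2) powr p"
      using p by (intro powr_less_mono2) (auto simp: norm_divide)
    then show ?thesis using 2 by simp
  qed
qed

text \<open>A homogeneous form of uniform convexity, obtained from strict convexity by compactness
  of the unit sphere in two complex variables.\<close>

lemma norm_diff_powr_le_convexity_defect:
  assumes p: "1 < p" and e: "0 < e"
  obtains K where "0 \<le> K" "\<And>a b :: complex. norm (a - b) powr p \<le>
    e * (norm a powr p + norm b powr p) +
    K * ((norm a powr p + norm b powr p) / 2 - norm ((a + b) / 2) powr p)"
proof -
  define D where "D = (\<lambda>z :: complex \<times> complex. (norm (fst z) powr p + norm (snd z) powr p) / 2 - norm ((fst z + snd z) / 2) powr p)"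
  \<comment> \<open>Normalised pairs that are at least e apart in p-th power. This set is compact
    and avoids the diagonal, so the midpoint defect \<open>D\<close> has a positive minimum c on it;
    homogeneity carries the bound to all pairs.\<close>
  define S where "S = {z :: complex \<times> complex. norm (fst z) powr p + norm (snd z) powr p = 1 \<and> e \<le> norm (fst z - snd z) powr p}"
  have contD: "continuous_on UNIV D"
    unfolding D_def using p by (intro continuous_intros continuous_on_powr') auto
  have "compact S"
  proof -
    have "closed S"
      unfolding S_def using p
      by (intro closed_Collect_conj closed_Collect_eq closed_Collect_le continuous_intros continuous_on_powr') auto
    moreover have "norm z \<le> 2" if "z \<in> S" for z
    proof -
      have "norm (fst z) powr p + norm (snd z) powr p = 1" using that by (simp add: S_def)
      then have "norm (fst z) powr p \<le> 1" "norm (snd z) powr p \<le> 1"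
        using powr_ge_zero[of "norm (fst z)" p] powr_ge_zero[of "norm (snd z)" p] by linarith+
      moreover have "x \<le> 1" if "x powr p \<le> 1" for x :: real
      proof (rule ccontr)
        assume "\<not> x \<le> 1"
        then have "1 powr p < x powr p" using p by (intro powr_less_mono2) auto
        then show False using that by simp
      qed
      ultimately have "norm (fst z) \<le> 1" "norm (snd z) \<le> 1" by blast+
      then show ?thesis using norm_Pair_le[of "fst z" "snd z"] by simp
    qed
    ultimately show ?thesis
      by (metis bounded_iff compact_eq_bounded_closed)
  qed
  have Dpos: "D z > 0" if "z \<in> S" for z
  proof -
    have "fst z \<noteq> snd z" using that e p by (auto simp: S_def)
    then show ?thesis using norm_powr_midpoint(2)[OF p] by (simp add: D_def)
  qed
  have "\<exists>c>0. \<forall>z\<in>S. c \<le> D z"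
  proof (cases "S = {}")
    case False
    then obtain x where "x \<in> S" "\<forall>y\<in>S. D x \<le> D y"
      using continuous_attains_inf[OF \<open>compact S\<close> False continuous_on_subset[OF contD]] by auto
    then show ?thesis using Dpos by blast
  qed (auto intro: exI[of _ 1])
  then obtain c where c: "c > 0" "\<And>z. z \<in> S \<Longrightarrow> c \<le> D z" by blast
  have D0: "D z \<ge> 0" for z using norm_powr_midpoint(1)[OF p] by (simp add: D_def)
  show ?thesis
  \<comment> \<open>Where the e-term does not suffice, the defect is at least c times the sum of the
    two powers, while \<open>norm (a - b) powr p\<close> never exceeds 2^p times that sum.\<close>
  proof (rule that[of "2 powr p / c"])
    show "0 \<le> 2 powr p / c" using c by simp
    fix a b :: complex
    let ?s = "norm a powr p + norm b powr p"
    show "norm (a - b) powr p \<le> e * ?s + 2 powr p / c * (?s / 2 - norm ((a + b) / 2) powr p)"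
    proof (cases "norm (a - b) powr p \<le> e * ?s")
      case True
      then show ?thesis using D0[of "(a, b)"] c by (simp add: D_def add_increasing2)
    next
      case False
      have s: "?s > 0"
      proof (rule ccontr)
        assume "\<not> ?s > 0"
        then have "norm a powr p = 0" "norm b powr p = 0"
          using powr_ge_zero[of "norm a" p] powr_ge_zero[of "norm b" p] by linarith+
        then show False using False by auto
      qed
      define r where "r = ?s powr (1/p)"
      have r: "r > 0" "r powr p = ?s" using s p by (auto simp: r_def powr_powr)
      have sc: "norm (z / r) powr p = norm z powr p / ?s" for z :: complex
        using r by (simp add: norm_divide powr_divide)
      have x: "(a / r + b / r) / 2 = ((a + b) / 2) / r" "a / r - b / r = (a - b) / r"
        by (simp_all add: add_divide_distrib diff_divide_distrib mult.commute)
      have "D (a / r, b / r) = D (a, b) / ?s"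
        unfolding D_def fst_conv snd_conv x sc by (simp add: add_divide_distrib diff_divide_distrib mult.commute)
      moreover have "(a / r, b / r) \<in> S"
        unfolding S_def mem_Collect_eq fst_conv snd_conv x sc using s False
        by (simp add: pos_le_divide_eq flip: add_divide_distrib)
      ultimately have "c \<le> D (a, b) / ?s" using c(2) by metis
      then have "c * ?s \<le> D (a, b)" using s by (simp add: field_simps)
      then have "2 powr p / c * (c * ?s) \<le> 2 powr p / c * D (a, b)"
        using c by (intro mult_left_mono) auto
      then have "2 powr p * ?s \<le> 2 powr p / c * D (a, b)" using c by simp
      moreover have "norm (a - b) powr p \<le> 2 powr p * ?s"
        using powr_norm_add_le[of p a "- b"] p by simp
      ultimately show ?thesis
        using e s by (simp add: D_def add_increasing)
    qed
  qed
qed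

section \<open>Extremal functions for Hoelder's inequality and variations of the norm\<close>

definition dual_power :: "real \<Rightarrow> complex \<Rightarrow> complex" where
  "dual_power p z = of_real (norm z powr (p - 2)) * cnj z"

lemma norm_dual_power: "norm (dual_power p z) = norm z powr (p - 1)"
proof (cases "z = 0")
  case False
  then have "norm z powr (p - 2) * norm z powr 1 = norm z powr (p - 1)"
    using powr_add[of "norm z" "p - 2" 1] by simp
  then show ?thesis using False by (simp add: dual_power_def norm_mult)
qed (simp add: dual_power_def)

lemma dual_power_mult_self: "dual_power p z * z = of_real (norm z powr p)"
proof (cases "z = 0")
  case False
  then have "norm z powr p = norm z powr (p - 2) * (norm z)\<^sup>2"
    using powr_add[of "norm z" "p - 2" 2] by simp
  moreover have "cnj z * z = of_real ((norm z)\<^sup>2)"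
    by (metis complex_norm_square mult.commute of_real_power)
  ultimately show ?thesis
    unfolding dual_power_def mult.assoc by (simp only: of_real_mult)
qed (simp add: dual_power_def)

text \<open>For p < 2 the power factor is unbounded near 0, but the modulus of the whole expression
  is \<open>norm z powr (p - 1)\<close>, which tends to 0.\<close>

lemma isCont_dual_power:
  assumes p: "1 < p"
  shows "isCont (dual_power p) z"
proof (cases "z = 0")
  case True
  have "((\<lambda>w::complex. norm w powr (p - 1)) \<longlongrightarrow> 0 powr (p - 1)) (at 0)"
    by (intro tendsto_powr2 tendsto_norm_zero tendsto_ident_at tendsto_const) (use p in auto)
  then have "((\<lambda>w. norm (dual_power p w)) \<longlongrightarrow> 0) (at 0)"
    unfolding norm_dual_power by simp
  then have "(dual_power p \<longlongrightarrow> 0) (at 0)"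
    by (rule tendsto_norm_zero_cancel)
  moreover have "dual_power p 0 = 0" by (simp only: dual_power_def complex_cnj_zero mult_zero_right)
  ultimately show ?thesis using True by (simp only: isCont_def)
next
  case False
  then show ?thesis
    unfolding dual_power_def by (intro continuous_intros) auto
qed

lemma borel_measurable_dual_power [measurable]: "dual_power p \<in> borel_measurable borel"
proof -
  have [measurable]: "cnj \<in> borel_measurable borel"
    by (intro borel_measurable_continuous_onI continuous_intros)
  show ?thesis unfolding dual_power_def by measurable
qed

text \<open>The convex function \<open>norm w powr p\<close> lies above its tangent plane at z.
  Young's inequality between \<open>norm w\<close> and \<open>norm z powr (p - 1)\<close> gives this
  without differentiating, so z = 0 needs no separate treatment.\<close>

lemma norm_powr_tangent:
  assumes p: "1 < p"
  shows "norm z powr p + p * Re (dual_power p z * (w - z)) \<le> norm w powr p"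
proof -
  define q where "q = p / (p - 1)"
  have q: "1 < q" "1/p + 1/q = 1" "(p - 1) * q = p" using p by (auto simp: q_def field_simps)
  define A where "A = Re (dual_power p z * w)"
  have r: "Re (dual_power p z * (w - z)) = A - norm z powr p"
    unfolding A_def by (simp only: right_diff_distrib minus_complex.sel dual_power_mult_self Re_complex_of_real)
  have "A \<le> norm w * norm z powr (p - 1)" unfolding A_def
    using complex_Re_le_cmod[of "dual_power p z * w"] by (simp add: norm_mult norm_dual_power mult.commute)
  also have "\<dots> \<le> norm w powr p / p + (norm z powr (p - 1)) powr q / q"
    by (rule Youngs_inequality[OF p q(1,2)]) auto
  also have "(norm z powr (p - 1)) powr q = norm z powr p" by (simp add: powr_powr q)
  finally have "p * A \<le> p * (norm w powr p / p + norm z powr p / q)"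
    using p by (intro mult_left_mono) auto
  also have "\<dots> = norm w powr p + (p - 1) * norm z powr p"
    using p by (simp add: q_def field_simps)
  finally show ?thesis unfolding r by (simp add: algebra_simps)
qed

definition dual_fun :: "real \<Rightarrow> circle_fun \<Rightarrow> circle_fun" where
  "dual_fun p f = abs_circle_fun (\<lambda>t. dual_power p (rv f t))"

lemma rv_dual_fun: "AE t in circle_measure. rv (dual_fun p f) t = dual_power p (rv f t)"
  unfolding dual_fun_def by (rule rv_abs) measurable

text \<open>The function that gives equality in Hoelder's inequality for f; it lies in L^q because
  (p - 1) q = p.\<close>

lemma dual_fun_Lp:
  assumes p: "1 < p" "1/p + 1/q = 1" and f: "f \<in> Lp p"
  shows "dual_fun p f \<in> Lp q" "fourier (dual_fun p f * f) 0 = of_real (Lp_norm p f powr p)"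
    "Lp_norm q (dual_fun p f) = Lp_norm p f powr (p - 1)"
proof -
  have q: "1 < q" using conjugate_exponent[OF p] .
  have pq: "(p - 1) * q = p" "1 / q = (p - 1) / p" using p q by (auto simp: field_simps)
  show "dual_fun p f \<in> Lp q"
    using f by (subst mem_Lp_cong[OF rv_dual_fun]) (auto simp: norm_dual_power powr_powr pq mem_Lp_iff)
  show "Lp_norm q (dual_fun p f) = Lp_norm p f powr (p - 1)"
    using q p by (subst Lp_norm_cong[OF rv_dual_fun]) 
       (auto simp: norm_dual_power powr_powr pq Lp_norm.rep_eq)
  have "AE t in circle_measure. rv (dual_fun p f * f) t = of_real (norm (rv f t) powr p)"
    using rv_mult[of "dual_fun p f" f] rv_dual_fun[of p f] by eventually_elim (simp add: dual_power_mult_self)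
  then have "fourier (dual_fun p f * f) 0 = (\<integral>t. of_real (norm (rv f t) powr p) * t powi (- 0) \<partial>circle_measure)"
    by (rule fourier_cong) measurable
  also have "\<dots> = of_real (Lp_norm p f powr p)"
    using p by (simp add: Lp_norm_powr integral_complex_of_real)
  finally show "fourier (dual_fun p f * f) 0 = of_real (Lp_norm p f powr p)" .
qed

lemma mult_cscale: "f * cscale z g = cscale z (f * g)"
  by transfer (auto simp: circle_eq_def mult_ac)

lemma Lp_norm_tendsto:
  assumes p: "1 \<le> p" and f: "\<And>n. f n \<in> Lp p" and g: "g \<in> Lp p"
    and lim: "(\<lambda>n. Lp_norm p (f n - g)) \<longlonglongrightarrow> 0"
  shows "(\<lambda>n. Lp_norm p (f n)) \<longlonglongrightarrow> Lp_norm p g"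
proof (rule LIMSEQ_I)
  fix e :: real assume "0 < e"
  then obtain N where N: "\<And>n. n \<ge> N \<Longrightarrow> Lp_norm p (f n - g) < e"
    using lim by (auto simp: LIMSEQ_iff)
  have "\<bar>Lp_norm p (f n) - Lp_norm p g\<bar> \<le> Lp_norm p (f n - g)" for n
    using Lp_norm_triangle[OF p, of "f n - g" g] Lp_norm_triangle[OF p, of "g - f n" "f n"]
      Lp_norm_minus_commute[of p g "f n"] f g p by (simp add: Lp_diff)
  then show "\<exists>no. \<forall>n\<ge>no. norm (Lp_norm p (f n) - Lp_norm p g) < e"
    using N by (intro exI[of _ N]) (auto intro: le_less_trans)
qed

text \<open>The first-order condition at a point of minimal norm. The tangent is taken at the
  perturbed point f + s r and evaluated at f, so the sign of the integral of \<open>G s\<close> is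
  immediate for each s > 0 without difference quotients; s tends to 0 under the majorant (|f| +
  |r|)^p.\<close>

lemma dual_power_scaled_limit:
  fixes f r :: circle_fun
  assumes p: "1 < p" and f: "f \<in> Lp p" and r: "r \<in> Lp p"
    and min: "\<And>s :: real. Lp_norm p f \<le> Lp_norm p (f + cscale (of_real s) r)"
  shows "0 \<le> Re (fourier (dual_fun p f * r) 0)"
proof -
  let ?N = "\<lambda>f. \<integral>t. norm (rv f t) powr p \<partial>circle_measure"
  define G where "G s t = Re (dual_power p (rv f t + of_real s * rv r t) * rv r t)" for s :: real and t
  have [measurable]: "G s \<in> borel_measurable borel" for s
    unfolding G_def by measurable
  define W where "W t = (norm (rv f t) + norm (rv r t)) powr p" for t
  have W: "integrable circle_measure W"
    unfolding W_def using integrable_powr_add[of p "\<lambda>t. of_real (norm (rv f t))" circle_measure "\<lambda>t. of_real (norm (rv r t))"] p f r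
    by (simp add: mem_Lp_iff flip: of_real_add)
  have bd: "norm (G s t) \<le> W t" if "0 \<le> s" "s \<le> 1" for s t
  proof -
    let ?m = "norm (rv f t) + norm (rv r t)"
    have le: "norm (rv f t + of_real s * rv r t) \<le> ?m"
      using norm_triangle_ineq[of "rv f t" "of_real s * rv r t"] that
        mult_left_le_one_le[of "norm (rv r t)" s] by (simp add: norm_mult)
    have "norm (G s t) \<le> norm (rv f t + of_real s * rv r t) powr (p - 1) * norm (rv r t)"
      unfolding G_def using abs_Re_le_cmod[of "dual_power p (rv f t + of_real s * rv r t) * rv r t"]
      by (simp add: norm_mult norm_dual_power)
    also have "\<dots> \<le> ?m powr (p - 1) * ?m"
      using le p by (intro mult_mono powr_mono2) auto
    also have "\<dots> = W t"
      unfolding W_def using powr_add[of ?m "p - 1" 1] by simp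
    finally show ?thesis .
  qed
  have iG: "integrable circle_measure (G s)" if "0 \<le> s" "s \<le> 1" for s
    by (rule Bochner_Integration.integrable_bound[OF W]) (use bd[OF that] in \<open>auto intro!: AE_I2 simp: W_def\<close>)
  have pos: "0 \<le> (\<integral>t. G s t \<partial>circle_measure)" if s: "0 < s" "s \<le> 1" for s
  proof -
    let ?h = "\<lambda>t. rv f t + of_real s * rv r t"
    have ae: "AE t in circle_measure. rv (f + cscale (of_real s) r) t = ?h t"
      using rv_add[of f "cscale (of_real s) r"] rv_cscale[of "of_real s" r] by eventually_elim simp
    have ih: "integrable circle_measure (\<lambda>t. norm (?h t) powr p)"
      using mem_Lp_cong[OF ae, of p] Lp_add[OF f Lp_cscale[OF r]] p by simp
    have "norm (?h t) powr p - p * s * G s t \<le> norm (rv f t) powr p" for t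
      using norm_powr_tangent[OF p, of "?h t" "rv f t"] by (simp add: G_def algebra_simps)
    then have "(\<integral>t. norm (?h t) powr p - p * s * G s t \<partial>circle_measure) \<le> ?N f"
      using ih iG[of s] s f by (intro integral_mono) (auto simp: mem_Lp_iff)
    then have "(\<integral>t. norm (?h t) powr p \<partial>circle_measure) - p * s * (\<integral>t. G s t \<partial>circle_measure) \<le> ?N f"
      using ih iG[of s] s by simp
    moreover have "?N f \<le> (\<integral>t. norm (?h t) powr p \<partial>circle_measure)"
    proof -
      have "Lp_norm p f powr p \<le> Lp_norm p (f + cscale (of_real s) r) powr p"
        using min[of s] p by (intro powr_mono2) auto
      then show ?thesis
        using p Lp_norm_cong[OF ae, of p] by (simp add: Lp_norm_powr powr_powr) 
    qed
    ultimately have "0 \<le> (p * s) * (\<integral>t. G s t \<partial>circle_measure)" by simp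
    then show ?thesis using p s by (intro mult_left_le_imp_le[of "p * s" 0]) auto
  qed
  have "(\<lambda>k. \<integral>t. G (1 / real (Suc k)) t \<partial>circle_measure) \<longlonglongrightarrow> (\<integral>t. G 0 t \<partial>circle_measure)"
  proof (rule integral_dominated_convergence[where w=W])
    show "AE t in circle_measure. (\<lambda>k. G (1 / real (Suc k)) t) \<longlonglongrightarrow> G 0 t"
    proof (rule AE_I2)
      fix t
      have "(\<lambda>k. 1 / real (Suc k)) \<longlonglongrightarrow> 0" by (rule lim_const_over_n[of 1, THEN LIMSEQ_Suc])
      then have "(\<lambda>k. rv f t + of_real (1 / real (Suc k)) * rv r t) \<longlonglongrightarrow> rv f t + of_real 0 * rv r t"
        by (intro tendsto_intros)
      note isCont_tendsto_compose[OF isCont_dual_power[OF p] this]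
      then show "(\<lambda>k. G (1 / real (Suc k)) t) \<longlonglongrightarrow> G 0 t"
        unfolding G_def by (intro tendsto_Re tendsto_mult tendsto_const)
    qed
    show "AE t in circle_measure. norm (G (1 / real (Suc k)) t) \<le> W t" for k
      by (intro AE_I2 bd) auto
  qed (use W in auto)
  then have "0 \<le> (\<integral>t. G 0 t \<partial>circle_measure)"
    by (rule LIMSEQ_le_const) (auto intro!: exI[of _ 0] pos)
  also have "\<dots> = Re (\<integral>t. dual_power p (rv f t) * rv r t \<partial>circle_measure)"
  proof -
    have ae: "AE t in circle_measure. rv (dual_fun p f * r) t = dual_power p (rv f t) * rv r t"
      using rv_mult[of "dual_fun p f" r] rv_dual_fun[of p f] by eventually_elim simp
    have "dual_fun p f * r \<in> Lp 1"
      using Lp_mult_Holder(1)[OF p _ r, of "p/(p-1)" "dual_fun p f"] dual_fun_Lp(1)[OF p _ f, of "p/(p-1)"] p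
      by (simp add: mult.commute flip: add_divide_distrib)
    then have "integrable circle_measure (\<lambda>t. dual_power p (rv f t) * rv r t)"
      unfolding mem_Lp_cong[OF ae] by (subst (asm) mem_Lp_cong[OF ae]) (auto simp: integrable_norm_iff)
    then show ?thesis by (simp only: G_def of_real_0 mult_zero_left add_0_right integral_Re)
  qed
  also have "(\<integral>t. dual_power p (rv f t) * rv r t \<partial>circle_measure) = fourier (dual_fun p f * r) 0"
  proof -
    have ae: "AE t in circle_measure. rv (dual_fun p f * r) t = dual_power p (rv f t) * rv r t"
      using rv_mult[of "dual_fun p f" r] rv_dual_fun[of p f] by eventually_elim simp
    show ?thesis by (subst fourier_cong[OF ae]) auto
  qed
  finally show ?thesis .
qed

lemma fourier_mult_tendsto:
  assumes pq: "1 < p" "1/p + 1/q = 1" and psi: "\<psi> \<in> Lp q" and f: "\<And>n. f n \<in> Lp p" and g: "g \<in> Lp p"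
    and lim: "(\<lambda>n. Lp_norm p (f n - g)) \<longlonglongrightarrow> 0"
  shows "(\<lambda>n. fourier (\<psi> * f n) 0) \<longlonglongrightarrow> fourier (\<psi> * g) 0"
proof -
  have L1: "h * \<psi> \<in> Lp 1" if "h \<in> Lp p" for h using Lp_mult_Holder(1)[OF pq that psi] .
  have b: "norm (fourier (\<psi> * f n) 0 - fourier (\<psi> * g) 0) \<le> Lp_norm p (f n - g) * Lp_norm q \<psi>" for n
  proof -
    have "(f n - g) * \<psi> = f n * \<psi> - g * \<psi>" by (simp add: left_diff_distrib)
    then have "fourier (\<psi> * f n) 0 - fourier (\<psi> * g) 0 = fourier ((f n - g) * \<psi>) 0"
      using fourier_diff[OF L1[OF f] L1[OF g]] by (simp add: mult.commute)
    then show ?thesis using Lp_mult_Holder(2)[OF pq _ psi, of "f n - g"] f g pq by (simp add: Lp_diff)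
  qed
  have l: "(\<lambda>n. Lp_norm p (f n - g) * Lp_norm q \<psi>) \<longlonglongrightarrow> 0"
    using tendsto_mult_right[OF lim, of "Lp_norm q \<psi>"] by simp
  have "(\<lambda>n. fourier (\<psi> * f n) 0 - fourier (\<psi> * g) 0) \<longlonglongrightarrow> 0"
    by (rule Lim_null_comparison[OF _ l]) (intro always_eventually allI b)
  then show ?thesis by (rule LIM_zero_cancel)
qed

text \<open>The separating function is the dual power of the difference between \<open>h\<close> and its
  nearest point in the closure of \<open>R\<close>.\<close>

lemma Lp_separation:
  assumes pq: "1 < p" "1/p + 1/q = 1" and R: "circle_fun.subspace R" "R \<subseteq> Lp p" and h: "h \<in> Lp p"
    and e: "0 < e" "\<And>r. r \<in> R \<Longrightarrow> e \<le> Lp_norm p (h - r)"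
  obtains \<psi> where "\<psi> \<in> Lp q" "\<And>r. r \<in> R \<Longrightarrow> fourier (\<psi> * r) 0 = 0" "fourier (\<psi> * h) 0 \<noteq> 0"
proof -
  have p: "1 \<le> p" "0 < p" "0 \<le> p" using pq by auto
  define d where "d = (INF r\<in>R. Lp_norm p (h - r))"
  have R0: "0 \<in> R" using R(1) by (rule circle_fun.subspace_0)
  have bdd: "bdd_below ((\<lambda>r. Lp_norm p (h - r)) ` R)" by (rule bdd_belowI[of _ 0]) auto
  have d_le: "d \<le> Lp_norm p (h - r)" if "r \<in> R" for r
    unfolding d_def by (rule cINF_lower[OF bdd that])
  have d_pos: "0 < d"
    using e R0 cINF_greatest[of R e "\<lambda>r. Lp_norm p (h - r)"] unfolding d_def by force
  have "\<exists>r\<in>R. Lp_norm p (h - r) powr p < d powr p + 1 / real (Suc k)" for k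
  proof -
    have "((\<lambda>x. x powr p) \<longlongrightarrow> d powr p) (at_right d)"
      using d_pos by (intro tendsto_powr tendsto_ident_at tendsto_const) auto
    then have "eventually (\<lambda>x. x powr p < d powr p + 1 / real (Suc k)) (at_right d)"
      by (rule order_tendstoD) simp
    then obtain b where b: "b > d" "\<And>x. d < x \<Longrightarrow> x < b \<Longrightarrow> x powr p < d powr p + 1 / real (Suc k)"
      unfolding eventually_at_right_field by blast
    obtain r where r: "r \<in> R" "Lp_norm p (h - r) < (d + b) / 2"
      using cINF_less_iff[OF _ bdd, of "(d + b)/2"] b R0 unfolding d_def by force
    have "Lp_norm p (h - r) powr p \<le> ((d + b) / 2) powr p"
      using r p by (intro powr_mono2) auto
    also have "\<dots> < d powr p + 1 / real (Suc k)" using b by auto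
    finally show ?thesis using r(1) by blast
  qed
  then obtain r where r: "\<And>k. r k \<in> R" "\<And>k. Lp_norm p (h - r k) powr p < d powr p + 1 / real (Suc k)"
    by metis
  define F where "F k = h - r k" for k
  have F: "F k \<in> Lp p" for k using r(1) R(2) h p by (auto simp: F_def intro!: Lp_diff)
  let ?N = "\<lambda>f. \<integral>t. norm (f t) powr p \<partial>circle_measure"
  have NF: "?N (rv (F k)) < d powr p + 1 / real (Suc k)" for k
    using r(2)[of k] p by (simp add: Lp_norm_powr F_def)
  \<comment> \<open>The midpoint of two differences from h is again a difference of h and an element
    of R, so its norm is at least the distance d. This keeps the convexity defect of a minimising
    sequence small.\<close>
  have mid: "d powr p \<le> ?N (\<lambda>t. (rv (F k) t + rv (F l) t) / 2)" for k l
  proof -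
    define s where "s = cscale (1/2) (r k + r l)"
    have "s \<in> R" unfolding s_def using r(1) R(1) by (intro circle_fun.subspace_scale circle_fun.subspace_add)
    then have le: "d powr p \<le> Lp_norm p (h - s) powr p"
      using d_le d_pos p by (intro powr_mono2) auto
    have "AE t in circle_measure. rv (h - s) t = (rv (F k) t + rv (F l) t) / 2"
      using rv_diff[of h s] rv_cscale[of "1/2" "r k + r l", folded s_def] rv_add[of "r k" "r l"]
        rv_diff[of h "r k"] rv_diff[of h "r l"]
      by eventually_elim (simp add: F_def diff_divide_distrib add_divide_distrib)
    then have "Lp_norm p (h - s) = ?N (\<lambda>t. (rv (F k) t + rv (F l) t) / 2) powr (1/p)"
      by (rule Lp_norm_cong) measurable
    then show ?thesis using le p by (simp add: powr_powr)
  qed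
  have "\<exists>N. \<forall>m\<ge>N. \<forall>n\<ge>N. Lp_norm p (F m - F n) < \<epsilon>" if \<epsilon>: "\<epsilon> > 0" for \<epsilon>
  proof -
    \<comment> \<open>Late terms have p-th powers of norms below d^p + 1, so with this value the
      first term of the convexity estimate contributes half of \<epsilon>^p; the choice of N bounds
      the second by the other half.\<close>
    define e' where "e' = \<epsilon> powr p / (4 * (d powr p + 1))"
    have e': "e' > 0" using \<epsilon> d_pos by (simp add: e'_def add_pos_pos)
    obtain K where K: "0 \<le> K" "\<And>a b :: complex. norm (a - b) powr p \<le> e' * (norm a powr p + norm b powr p) +
      K * ((norm a powr p + norm b powr p) / 2 - norm ((a + b) / 2) powr p)"
      using norm_diff_powr_le_convexity_defect[OF pq(1) e'] by blast
    obtain N :: nat where N: "real N > 2 * K / \<epsilon> powr p" using reals_Archimedean2 by blast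
    have "Lp_norm p (F m - F n) < \<epsilon>" if mn: "m \<ge> N" "n \<ge> N" for m n
    proof -
      have i1: "integrable circle_measure (\<lambda>t. norm (rv (F m) t) powr p)" "integrable circle_measure (\<lambda>t. norm (rv (F n) t) powr p)"
        using F by (auto simp: mem_Lp_iff)
      have i2: "integrable circle_measure (\<lambda>t. norm ((rv (F m) t + rv (F n) t) / 2) powr p)"
        using integrable_powr_add[of p "rv (F m)" circle_measure "rv (F n)"] i1 p by (simp add: norm_divide powr_divide)
      have i3: "integrable circle_measure (\<lambda>t. norm (rv (F m) t - rv (F n) t) powr p)"
        using integrable_powr_add[of p "rv (F m)" circle_measure "\<lambda>t. - rv (F n) t"] i1 p by simp
      have Npos: "real N > 0"
        using N K(1) divide_nonneg_nonneg[of "2 * K" "\<epsilon> powr p"] powr_ge_zero[of \<epsilon> p] by linarith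
      have small: "1 / real (Suc j) \<le> 1 / real N" "1 / real (Suc j) \<le> 1" if "j \<ge> N" for j
        using that Npos by (auto intro!: frac_le)
      have "?N (\<lambda>t. rv (F m) t - rv (F n) t) \<le> (\<integral>t. e' * (norm (rv (F m) t) powr p + norm (rv (F n) t) powr p) +
          K * ((norm (rv (F m) t) powr p + norm (rv (F n) t) powr p) / 2 - norm ((rv (F m) t + rv (F n) t) / 2) powr p) \<partial>circle_measure)"
        using i1 i2 i3 by (intro integral_mono K(2)) auto
      also have "\<dots> = e' * (?N (rv (F m)) + ?N (rv (F n))) + K * ((?N (rv (F m)) + ?N (rv (F n))) / 2 - ?N (\<lambda>t. (rv (F m) t + rv (F n) t) / 2))"
        using i1 i2 by simp
      also have "\<dots> \<le> e' * ((d powr p + 1) + (d powr p + 1)) + K * (1 / real N)"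
      proof (intro add_mono mult_left_mono)
        show "?N (rv (F m)) \<le> d powr p + 1" "?N (rv (F n)) \<le> d powr p + 1"
          using NF[of m] NF[of n] small(2)[OF mn(1)] small(2)[OF mn(2)] by linarith+
        show "(?N (rv (F m)) + ?N (rv (F n))) / 2 - ?N (\<lambda>t. (rv (F m) t + rv (F n) t) / 2) \<le> 1 / real N"
        proof -
          have "(A + B) / 2 - C \<le> M" if "A < D + x" "B < D + y" "x \<le> M" "y \<le> M" "D \<le> C" for A B C D M x y :: real
            using that by argo
          then show ?thesis using NF small(1)[OF mn(1)] small(1)[OF mn(2)] mid by blast
        qed
      qed (use e' K in auto)
      also have "e' * ((d powr p + 1) + (d powr p + 1)) = \<epsilon> powr p / 2"
      proof -
        have "d powr p + 1 > 0" by (simp add: add_nonneg_pos)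
        then show ?thesis by (simp add: e'_def field_simps)
      qed
      also have "K * (1 / real N) < \<epsilon> powr p / 2" if "\<epsilon> powr p > 0"
        using N Npos that by (simp add: field_simps)
      finally have "?N (\<lambda>t. rv (F m) t - rv (F n) t) < \<epsilon> powr p" using \<epsilon> by simp
      then have "Lp_norm p (F m - F n) < (\<epsilon> powr p) powr (1/p)"
        using p by (subst Lp_norm_cong[OF rv_diff]) (auto intro!: powr_less_mono2)
      then show ?thesis using p \<epsilon> by (simp add: powr_powr)
    qed
    then show ?thesis by blast
  qed
  note Cauchy = this
  obtain G where G: "G \<in> Lp p" "(\<lambda>n. Lp_norm p (F n - G)) \<longlonglongrightarrow> 0"
    by (rule Lp_complete[OF p(1) F Cauchy])
  have min: "d \<le> Lp_norm p (G + s)" if s: "s \<in> R" for s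
  proof -
    have sL: "s \<in> Lp p" using s R by auto
    have "(\<lambda>n. Lp_norm p (F n + s)) \<longlonglongrightarrow> Lp_norm p (G + s)"
      using F G sL p by (intro Lp_norm_tendsto) (auto intro!: Lp_add)
    moreover have "d \<le> Lp_norm p (F n + s)" for n
      using d_le[of "r n - s"] r(1) s R(1) by (simp add: F_def circle_fun.subspace_diff algebra_simps)
    ultimately show ?thesis by (intro LIMSEQ_le_const) auto
  qed
  have Gd: "Lp_norm p G = d"
  proof (rule antisym)
    have "(\<lambda>n. Lp_norm p (F n) powr p) \<longlonglongrightarrow> Lp_norm p G powr p"
      using Lp_norm_tendsto[OF p(1) F G(1) G(2)] p by (intro tendsto_powr2) auto
    moreover have "(\<lambda>k. d powr p + 1 / real (Suc k)) \<longlonglongrightarrow> d powr p + 0"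
      by (intro tendsto_add tendsto_const lim_const_over_n[of 1, THEN LIMSEQ_Suc])
    ultimately have "Lp_norm p G powr p \<le> d powr p + 0"
      using r(2) by (intro LIMSEQ_le) (auto simp: F_def intro!: less_imp_le)
    then show "Lp_norm p G \<le> d"
      using p d_pos powr_less_mono2[of p d "Lp_norm p G"] by (intro leI notI) auto
    show "d \<le> Lp_norm p G" using min[OF R0] by simp
  qed
  have orth: "fourier (dual_fun p G * s) 0 = 0" if s: "s \<in> R" for s
  proof -
    \<comment> \<open>The variation controls a real part from one side only. Applied to the
      multiples of s by 1, -1, i and -i it determines the whole coefficient.\<close>
    have nonneg: "0 \<le> Re (fourier (dual_fun p G * cscale z s) 0)" for z
    proof (rule dual_power_scaled_limit[OF pq(1) G(1)])
      show "cscale z s \<in> Lp p" using s R Lp_cscale by blast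
      fix x :: real
      show "Lp_norm p G \<le> Lp_norm p (G + cscale (of_real x) (cscale z s))"
        unfolding Gd using s R(1) by (intro min circle_fun.subspace_scale)
    qed
    have *: "0 \<le> Re (z * fourier (dual_fun p G * s) 0)" for z
      using nonneg[of z] by (simp add: fourier_cscale mult_cscale)
    show ?thesis using *[of 1] *[of "-1"] *[of \<i>] *[of "- \<i>"] by (simp add: complex_eq_iff)
  qed
  have psi: "dual_fun p G \<in> Lp q" by (rule dual_fun_Lp(1)[OF pq G(1)])
  have "(\<lambda>n. fourier (dual_fun p G * F n) 0) \<longlonglongrightarrow> fourier (dual_fun p G * G) 0"
    by (rule fourier_mult_tendsto[OF pq psi F G(1) G(2)])
  \<comment> \<open>\<open>F n\<close> differs from h by an element of R, so its pairing is the same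
    for all n and equals the limit, which is the p-th power of the distance.\<close>
  moreover have "fourier (dual_fun p G * F n) 0 = fourier (dual_fun p G * h) 0" for n
  proof -
    have L1: "dual_fun p G * k \<in> Lp 1" if "k \<in> Lp p" for k
      using Lp_mult_Holder(1)[OF pq that psi] by (simp add: mult.commute)
    have "dual_fun p G * F n = dual_fun p G * h - dual_fun p G * r n"
      by (simp add: F_def right_diff_distrib)
    moreover have "r n \<in> Lp p" using r(1) R by auto
    ultimately show ?thesis using orth[OF r(1)] fourier_diff[OF L1[OF h] L1[of "r n"]] by simp
  qed
  ultimately have "fourier (dual_fun p G * h) 0 = fourier (dual_fun p G * G) 0"
    by (simp add: LIMSEQ_const_iff)
  also have "\<dots> = of_real (d powr p)" using dual_fun_Lp(2)[OF pq G(1)] Gd by simp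
  finally show ?thesis using that[OF psi orth] d_pos by simp
qed

subsection \<open>Trigonometric polynomials and uniqueness of Fourier coefficients\<close>

text \<open>Honest functions on the plane, for arguments that evaluate at points of the circle. The
  version modulo null sets is \<open>trig_polys\<close>.\<close>

inductive trig_poly :: "(complex \<Rightarrow> complex) \<Rightarrow> bool" where
  trig_poly_mono: "trig_poly (\<lambda>t. c * t powi k)"
| trig_poly_add: "trig_poly f \<Longrightarrow> trig_poly g \<Longrightarrow> trig_poly (\<lambda>t. f t + g t)"

lemma trig_poly_const: "trig_poly (\<lambda>t. c)"
  using trig_poly_mono[of c 0] by simp

lemma trig_poly_cmult: "trig_poly f \<Longrightarrow> trig_poly (\<lambda>t. c * f t)"
proof (induction rule: trig_poly.induct)
  case (trig_poly_mono d k)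
  then show ?case using trig_poly.trig_poly_mono[of "c * d" k] by (simp add: mult.assoc)
qed (simp add: trig_poly.trig_poly_add distrib_left)

text \<open>The product is matched on the circle only, since the exponent law for
  \<open>powi\<close> can fail at 0 when the exponents have different signs.\<close>

lemma trig_poly_mult:
  assumes "trig_poly f" "trig_poly g"
  shows "\<exists>h. trig_poly h \<and> (\<forall>t. norm t = 1 \<longrightarrow> h t = f t * g t)"
  using assms(1)
proof (induction rule: trig_poly.induct)
  case (trig_poly_mono c j)
  show ?case using assms(2)
  proof (induction rule: trig_poly.induct)
    case (trig_poly_mono d k)
    have "c * t powi j * (d * t powi k) = (c * d) * t powi (j + k)" if "norm t = 1" for t :: complex
      using that by (subst power_int_add) auto
    then show ?case using trig_poly.trig_poly_mono[of "c * d" "j + k"] by metis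
  next
    case (trig_poly_add g1 g2)
    then obtain h1 h2 where "trig_poly h1" "trig_poly h2"
      "\<forall>t. norm t = 1 \<longrightarrow> h1 t = c * t powi j * g1 t" "\<forall>t. norm t = 1 \<longrightarrow> h2 t = c * t powi j * g2 t" by blast
    then show ?case
      by (intro exI[of _ "\<lambda>t. h1 t + h2 t"]) (auto intro: trig_poly.trig_poly_add simp: distrib_left)
  qed
next
  case (trig_poly_add f1 f2)
  then obtain h1 h2 where "trig_poly h1" "trig_poly h2"
    "\<forall>t. norm t = 1 \<longrightarrow> h1 t = f1 t * g t" "\<forall>t. norm t = 1 \<longrightarrow> h2 t = f2 t * g t" by blast
  then show ?case
    by (intro exI[of _ "\<lambda>t. h1 t + h2 t"]) (auto intro: trig_poly.trig_poly_add simp: distrib_right)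
qed

text \<open>On the circle Re t = (t + 1/t)/2 and Im t = (t - 1/t)/(2i), so the real polynomials of
  the Stone-Weierstrass theorem become trigonometric ones.\<close>

lemma trig_poly_real_polynomial:
  assumes "real_polynomial_function g"
  shows "\<exists>f. trig_poly f \<and> (\<forall>t. norm t = 1 \<longrightarrow> f t = of_real (g t))"
  using assms
proof (induction rule: real_polynomial_function.induct)
  case (linear h)
  interpret h: bounded_linear h by fact
  have eq: "of_real (h t) = (of_real (h 1) / 2 - \<i> * of_real (h \<i>) / 2) * t powi 1 + (of_real (h 1) / 2 + \<i> * of_real (h \<i>) / 2) * t powi (-1)"
    if "norm t = 1" for t :: complex
  proof -
    have "t = Re t *\<^sub>R 1 + Im t *\<^sub>R \<i>" by (simp add: complex_eq_iff)
    then have "h t = Re t * h 1 + Im t * h \<i>" by (metis h.add h.scaleR real_scaleR_def)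
    moreover have "t * cnj t = 1" using that complex_norm_square[of t] by simp
    then have "inverse t = cnj t" by (metis inverse_unique)
    ultimately show ?thesis by (simp add: power_int_minus complex_eq_iff algebra_simps)
  qed
  show ?case
    by (intro exI conjI allI impI, rule trig_poly.trig_poly_add[OF trig_poly.trig_poly_mono trig_poly.trig_poly_mono])
       (erule eq[symmetric])
next
  case (const c)
  show ?case by (intro exI[of _ "\<lambda>_. of_real c"]) (simp add: trig_poly_const)
next
  case (add g1 g2)
  then obtain f1 f2 where "trig_poly f1" "\<forall>t. norm t = 1 \<longrightarrow> f1 t = of_real (g1 t)"
    "trig_poly f2" "\<forall>t. norm t = 1 \<longrightarrow> f2 t = of_real (g2 t)" by blast
  then show ?case by (intro exI[of _ "\<lambda>t. f1 t + f2 t"]) (auto intro: trig_poly.trig_poly_add)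
next
  case (mult g1 g2)
  then obtain f1 f2 where "trig_poly f1" "\<forall>t. norm t = 1 \<longrightarrow> f1 t = of_real (g1 t)"
    "trig_poly f2" "\<forall>t. norm t = 1 \<longrightarrow> f2 t = of_real (g2 t)" by blast
  then show ?case using trig_poly_mult[of f1 f2] by fastforce
qed

lemma trig_poly_approx:
  fixes u :: "complex \<Rightarrow> real"
  assumes "continuous_on (sphere 0 1) u" "0 < e"
  obtains f where "trig_poly f" "\<And>t. norm t = 1 \<Longrightarrow> f t \<in> \<real>" "\<And>t. norm t = 1 \<Longrightarrow> \<bar>u t - Re (f t)\<bar> < e"
proof -
  obtain g where g: "real_polynomial_function g" "\<And>t. t \<in> sphere 0 1 \<Longrightarrow> \<bar>u t - g t\<bar> < e"
    using Stone_Weierstrass_real_polynomial_function[OF compact_sphere assms] by blast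
  obtain f where "trig_poly f" "\<forall>t. norm t = 1 \<longrightarrow> f t = of_real (g t)"
    using trig_poly_real_polynomial[OF g(1)] by blast
  then show ?thesis using that[of f] g(2) by simp
qed

lemma trig_poly_explicit:
  assumes "trig_poly f"
  obtains F c where "finite F" "f = (\<lambda>t. \<Sum>k\<in>F. c k * t powi k)"
proof -
  have "\<exists>F c. finite F \<and> f = (\<lambda>t. \<Sum>k\<in>F. c k * t powi k)"
    using assms
  proof (induction rule: trig_poly.induct)
    case (trig_poly_mono c k)
    show ?case by (intro exI[of _ "{k}"] exI[of _ "\<lambda>_. c"]) simp
  next
    case (trig_poly_add f g)
    then obtain F c G d where *: "finite F" "f = (\<lambda>t. \<Sum>k\<in>F. c k * t powi k)"
      "finite G" "g = (\<lambda>t. \<Sum>k\<in>G. d k * t powi k)" by blast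
    let ?c = "\<lambda>k. (if k \<in> F then c k else 0) + (if k \<in> G then d k else 0)"
    have "(\<Sum>k\<in>F \<union> G. ?c k * t powi k) = (\<Sum>k\<in>F. c k * t powi k) + (\<Sum>k\<in>G. d k * t powi k)" for t
    proof -
      have "(\<Sum>k\<in>F \<union> G. ?c k * t powi k) =
        (\<Sum>k\<in>F \<union> G. (if k \<in> F then c k * t powi k else 0)) + (\<Sum>k\<in>F \<union> G. (if k \<in> G then d k * t powi k else 0))"
        unfolding sum.distrib[symmetric] by (rule sum.cong) (auto simp: distrib_right)
      then show ?thesis
        using *(1,3) by (simp add: sum.If_cases Int_absorb1 flip: sum.inter_restrict) 
    qed
    then show ?case using *
      by (intro exI[of _ "F \<union> G"] exI[of _ ?c]) auto
  qed
  then show ?thesis using that by blast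
qed

lemma trig_poly_sum: "finite F \<Longrightarrow> trig_poly (\<lambda>t. \<Sum>k\<in>F. c k * t powi k)"
  by (induction F rule: finite_induct) (auto intro: trig_poly.intros trig_poly_const)

lemma borel_measurable_trig_poly: "trig_poly f \<Longrightarrow> f \<in> borel_measurable borel"
  by (induction rule: trig_poly.induct) measurable

lemma continuous_on_trig_poly: "trig_poly f \<Longrightarrow> continuous_on (sphere 0 1) f"
  by (induction rule: trig_poly.induct) (auto intro!: continuous_intros)

lemma integral_cis: 
  "(\<integral>t. t powi k \<partial>circle_measure) = (if k = 0 then 1 else 0)"
proof (cases "k = 0")
  case True
  then show ?thesis using circle_prob.prob_space by simp
next
  case False
  have "(\<integral>t. t powi k \<partial>circle_measure) = fourier (abs_circle_fun (\<lambda>_. 1)) (- k)"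
    by (subst fourier_cong[OF rv_abs]) auto
  also have "\<dots> = 1 / (2*pi) * (LINT \<theta>:{0..2*pi}|lborel. exp (\<i> * k * \<theta>))"
    by (subst fourier_formula) auto
  also have "(LINT \<theta>:{0..2*pi}|lborel. exp (\<i> * k * \<theta>)) = exp (\<i> * k * of_real (2 * pi)) / (\<i> * k) - exp (\<i> * k * of_real 0) / (\<i> * k)"
    unfolding set_lebesgue_integral_def
  proof (rule integral_FTC_atLeastAtMost)
    fix x assume "0 \<le> x" "x \<le> 2 * pi"
    have "((\<lambda>z. exp (\<i> * k * z) / (\<i> * k)) has_field_derivative exp (\<i> * k * of_real x)) (at (of_real x))"
      using False by (auto intro!: derivative_eq_intros)
    then show "((\<lambda>x. exp (\<i> * k * of_real x) / (\<i> * k)) has_vector_derivative exp (\<i> * k * of_real x)) (at x within {0..2 * pi})"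
      by (rule has_vector_derivative_real_field[THEN has_vector_derivative_at_within])
  qed (auto intro!: continuous_intros)
  also have "exp (\<i> * k * of_real (2 * pi)) = 1"
    by (auto simp: exp_eq_1 intro!: exI[of _ k])
  finally show ?thesis using False by simp
qed

text \<open>Uniform approximation extends the vanishing of the integrals against f from
  trigonometric polynomials to continuous functions. Monotone approximation reaches indicators of
  closed sets, which form an intersection-stable generator, and hence all Borel sets.\<close>

lemma fourier_uniqueness_0:
  assumes f: "f \<in> Lp 1" and 0: "\<And>k. fourier f k = 0"
  shows "f = 0"
proof -
  have int: "integrable circle_measure (rv f)" using f by (simp add: mem_L1_iff)
  have bint: "integrable circle_measure (\<lambda>t. rv f t * g t)"
    if [measurable]: "g \<in> borel_measurable borel" and "\<And>t. norm t = 1 \<Longrightarrow> norm (g t) \<le> B" for g B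
  proof (rule Bochner_Integration.integrable_bound[of _ "\<lambda>t. B *\<^sub>R rv f t"])
    show "AE t in circle_measure. norm (rv f t * g t) \<le> norm (B *\<^sub>R rv f t)"
      using AE_circle_norm
    proof eventually_elim
      case (elim t)
      have "norm (rv f t) * norm (g t) \<le> norm (rv f t) * \<bar>B\<bar>"
        using that(2)[OF elim] by (intro mult_left_mono) auto
      then show ?case by (simp add: norm_mult mult.commute)
    qed
  qed (use int in auto)
  have tp: "(\<integral>t. rv f t * g t \<partial>circle_measure) = 0" if tg: "trig_poly g" for g
  proof -
    obtain F c where g: "finite F" "g = (\<lambda>t. \<Sum>k\<in>F. c k * t powi k)" by (rule trig_poly_explicit[OF tg])
    have z: "(\<integral>t. rv f t * t powi k \<partial>circle_measure) = 0" for k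
      using 0[of "- k"] by (simp add: fourier.rep_eq)
    have "(\<integral>t. rv f t * g t \<partial>circle_measure) = (\<integral>t. (\<Sum>k\<in>F. c k * (rv f t * t powi k)) \<partial>circle_measure)"
      by (simp add: g sum_distrib_left mult_ac)
    also have "\<dots> = (\<Sum>k\<in>F. c k * (\<integral>t. rv f t * t powi k \<partial>circle_measure))"
      using f by (subst Bochner_Integration.integral_sum) (auto intro: integrable_rv_powi)
    finally show ?thesis by (simp add: z)
  qed
  have cont: "(\<integral>t. rv f t * of_real (u t) \<partial>circle_measure) = 0" if u: "continuous_on UNIV u" for u :: "complex \<Rightarrow> real"
  proof -
    have [measurable]: "u \<in> borel_measurable borel" using u by (rule borel_measurable_continuous_onI)
    have us: "continuous_on (sphere 0 1) u" using u by (rule continuous_on_subset) auto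
    have "bounded (u ` sphere 0 1)" by (intro compact_imp_bounded compact_continuous_image us compact_sphere)
    then obtain B where "\<forall>t\<in>sphere 0 1. \<bar>u t\<bar> \<le> B" by (auto simp: bounded_iff)
    then have B: "\<bar>u t\<bar> \<le> B" if "norm t = 1" for t using that by auto
    have "norm (\<integral>t. rv f t * of_real (u t) \<partial>circle_measure) \<le> e * (\<integral>t. norm (rv f t) \<partial>circle_measure)" if "e > 0" for e
    proof -
      obtain g where g: "trig_poly g" "\<And>t. norm t = 1 \<Longrightarrow> g t \<in> \<real>" "\<And>t. norm t = 1 \<Longrightarrow> \<bar>u t - Re (g t)\<bar> < e"
        using trig_poly_approx[OF us \<open>e > 0\<close>] by blast
      note [measurable] = borel_measurable_trig_poly[OF g(1)]
      have bg: "norm (of_real (u t) - g t) \<le> e" if "norm t = 1" for t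
      proof -
        have "of_real (u t) - g t = of_real (u t - Re (g t))" using g(2)[OF that] by (simp add: complex_is_Real_iff complex_eq_iff)
        then show ?thesis using g(3)[OF that] by (metis less_imp_le norm_of_real)
      qed
      have i1: "integrable circle_measure (\<lambda>t. rv f t * of_real (u t))"
        by (rule bint[where B=B]) (use B in auto)
      have i2: "integrable circle_measure (\<lambda>t. rv f t * (of_real (u t) - g t))"
        by (rule bint[where B=e]) (use bg in auto)
      have i3: "integrable circle_measure (\<lambda>t. rv f t * g t)"
        using Bochner_Integration.integrable_diff[OF i1 i2] by (simp add: algebra_simps)
      have "(\<integral>t. rv f t * of_real (u t) \<partial>circle_measure) = (\<integral>t. rv f t * of_real (u t) \<partial>circle_measure) - (\<integral>t. rv f t * g t \<partial>circle_measure)"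
        using tp[OF g(1)] by simp
      also have "\<dots> = (\<integral>t. rv f t * (of_real (u t) - g t) \<partial>circle_measure)"
        using i1 i3 by (simp add: right_diff_distrib)
      also have "norm \<dots> \<le> (\<integral>t. norm (rv f t * (of_real (u t) - g t)) \<partial>circle_measure)"
        by (rule integral_norm_bound)
      also have "\<dots> \<le> (\<integral>t. e * norm (rv f t) \<partial>circle_measure)"
      proof (rule integral_mono_AE)
        show "AE t in circle_measure. norm (rv f t * (of_real (u t) - g t)) \<le> e * norm (rv f t)"
          using AE_circle_norm
          by eventually_elim (use bg in \<open>auto simp: norm_mult mult.commute[of e] intro: mult_left_mono\<close>)
      qed (use i2 int in auto)
      finally show ?thesis by simp
    qed
    note le = this
    have "norm (\<integral>t. rv f t * of_real (u t) \<partial>circle_measure) \<le> 0"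
    proof (rule field_le_epsilon)
      fix e :: real assume e: "e > 0"
      let ?I = "\<integral>t. norm (rv f t) \<partial>circle_measure"
      have "?I \<ge> 0" by simp
      then have "e / (?I + 1) * ?I \<le> e"
        using e by (simp add: pos_divide_le_eq add_nonneg_pos)
      then show "norm (\<integral>t. rv f t * of_real (u t) \<partial>circle_measure) \<le> 0 + e"
        using le[of "e / (?I + 1)"] e \<open>?I \<ge> 0\<close> by (simp add: add_nonneg_pos)
    qed
    then show ?thesis by simp
  qed
  have closed: "(\<integral>t. rv f t * indicator C t \<partial>circle_measure) = 0" if C: "closed C" for C
  proof (cases "C = {}")
    case False
    \<comment> \<open>Continuous functions decreasing to the indicator of C: a nonempty closed set
      is the zero set of its distance function.\<close>
    define u where "u n t = max 0 (1 - real n * infdist t C)" for n t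
    have lim: "(\<lambda>n. u n t) \<longlonglongrightarrow> indicator C t" for t
    proof (cases "t \<in> C")
      case True
      then show ?thesis by (simp add: u_def)
    next
      case F: False
      then have d: "infdist t C > 0" using C False infdist_pos_not_in_closed by blast
      obtain N :: nat where N: "real N > 1 / infdist t C" using reals_Archimedean2 by blast
      have "u n t = 0" if "n \<ge> N" for n
      proof -
        have "1 \<le> real N * infdist t C" using N d by (simp add: field_simps)
        also have "\<dots> \<le> real n * infdist t C" using that d by (intro mult_right_mono) auto
        finally show ?thesis by (simp add: u_def)
      qed
      then have "eventually (\<lambda>n. u n t = 0) sequentially" by (auto simp: eventually_sequentially)
      then show ?thesis using F by (simp add: tendsto_eventually)
    qed
    have cu: "continuous_on UNIV (u n)" for n
      unfolding u_def by (intro continuous_intros)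
    have [measurable]: "u n \<in> borel_measurable borel" for n
      using cu by (rule borel_measurable_continuous_onI)
    have [measurable]: "C \<in> sets borel" using C by simp
    have "(\<lambda>n. \<integral>t. rv f t * of_real (u n t) \<partial>circle_measure) \<longlonglongrightarrow> (\<integral>t. rv f t * of_real (indicator C t) \<partial>circle_measure)"
    proof (rule integral_dominated_convergence[where w="\<lambda>t. norm (rv f t)"])
      show "AE t in circle_measure. (\<lambda>n. rv f t * of_real (u n t)) \<longlonglongrightarrow> rv f t * of_real (indicator C t)"
        by (intro AE_I2 tendsto_mult tendsto_const tendsto_of_real lim)
      have "\<bar>u n t\<bar> \<le> 1" for n t by (simp add: u_def infdist_nonneg)
      then show "AE t in circle_measure. norm (rv f t * of_real (u n t)) \<le> norm (rv f t)" for n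
        by (intro AE_I2) (auto simp: norm_mult intro!: mult_right_le_one_le)
    qed (use int in auto)
    then have "(\<integral>t. rv f t * of_real (indicator C t) \<partial>circle_measure) = 0"
      unfolding cont[OF cu] by (simp add: LIMSEQ_const_iff)
    moreover have "of_real (indicator C t) = (indicator C t :: complex)" for t by (simp add: indicator_def)
    ultimately show ?thesis by simp
  qed simp
  have iint: "integrable circle_measure (\<lambda>t. rv f t * indicator A t)" if "A \<in> sets borel" for A
    by (rule bint[where B=1]) (use that in \<open>auto simp: indicator_def\<close>)
  have all: "(\<integral>t. rv f t * indicator A t \<partial>circle_measure) = 0" if A: "A \<in> sets borel" for A
  proof -
    have "A \<in> sigma_sets UNIV (Collect closed)" using A unfolding borel_eq_closed by simp
    then show ?thesis
    proof (rule sigma_sets_induct_disjoint[rotated 2, consumes 1])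
      show "Int_stable (Collect closed)" by (auto simp: Int_stable_def)
      show "Collect closed \<subseteq> Pow UNIV" by auto
    next
      fix A :: "complex set" assume "A \<in> sigma_sets UNIV (Collect closed)" and eq: "(\<integral>t. rv f t * indicator A t \<partial>circle_measure) = 0"
      then have [measurable]: "A \<in> sets borel" unfolding borel_eq_closed by simp
      have "rv f t * indicator (UNIV - A) t = rv f t - rv f t * indicator A t" for t
        by (auto simp: indicator_def)
      then have "(\<integral>t. rv f t * indicator (UNIV - A) t \<partial>circle_measure) = (\<integral>t. rv f t \<partial>circle_measure) - 0"
        using iint[of A] int eq by simp
      then show "(\<integral>t. rv f t * indicator (UNIV - A) t \<partial>circle_measure) = 0"
        using 0[of 0] by (simp add: fourier.rep_eq)
    next
      fix A :: "nat \<Rightarrow> complex set" assume d: "disjoint_family A" and A: "range A \<subseteq> sigma_sets UNIV (Collect closed)"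
        and eq: "\<And>i. (\<integral>t. rv f t * indicator (A i) t \<partial>circle_measure) = 0"
      have [measurable]: "A i \<in> sets borel" for i using A unfolding borel_eq_closed by auto
      let ?B = "\<lambda>n. \<Union>i<n. A i"
      have z: "(\<integral>t. rv f t * indicator (?B n) t \<partial>circle_measure) = 0" for n
      proof (induction n)
        case (Suc n)
        have "A i \<inter> A n = {}" if "i < n" for i
          using disjoint_family_onD[OF d, of i n] that by auto
        then have "A n \<inter> ?B n = {}" by auto
        then have "rv f t * indicator (?B (Suc n)) t = rv f t * indicator (A n) t + rv f t * indicator (?B n) t" for t
          by (auto simp: lessThan_Suc indicator_def)
        moreover have "?B n \<in> sets borel" by measurable
        ultimately show ?case using eq[of n] Suc iint[of "A n"] iint[of "?B n"] by simp
      qed simp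
      have "(\<lambda>n. \<integral>t. rv f t * indicator (?B n) t \<partial>circle_measure) \<longlonglongrightarrow> (\<integral>t. rv f t * indicator (\<Union>i. A i) t \<partial>circle_measure)"
      proof (rule integral_dominated_convergence[where w="\<lambda>t. norm (rv f t)"])
        show "AE t in circle_measure. (\<lambda>n. rv f t * indicator (?B n) t) \<longlonglongrightarrow> rv f t * indicator (\<Union>i. A i) t"
          by (intro AE_I2 tendsto_mult tendsto_const LIMSEQ_indicator_UN)
        show "AE t in circle_measure. norm (rv f t * indicator (?B n) t) \<le> norm (rv f t)" for n
          by (intro AE_I2) (auto simp: indicator_def)
      qed (use int in auto)
      then show "(\<integral>t. rv f t * indicator (\<Union>i. A i) t \<partial>circle_measure) = 0"
        unfolding z by (simp add: LIMSEQ_const_iff)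
    qed (use closed in auto)
  qed
  have r: "Re (z * indicator A t) = Re z * indicator A t" "Im (z * indicator A t) = Im z * indicator A t"
    for z :: complex and A and t :: complex by (auto simp: indicator_def)
  have re: "(\<integral>t. Re (rv f t) * indicator A t \<partial>circle_measure) = 0" "(\<integral>t. Im (rv f t) * indicator A t \<partial>circle_measure) = 0"
    if "A \<in> sets borel" for A
    using integral_Re[OF iint[OF that]] integral_Im[OF iint[OF that]] all[OF that] unfolding r by simp_all
  \<comment> \<open>Tested on the set where h is positive. The real and imaginary parts of f and
    their negatives are all of this kind.\<close>
  have half: "AE t in circle_measure. h t \<le> 0"
    if h[measurable]: "h \<in> borel_measurable borel" and hi: "integrable circle_measure h"
      and hz: "\<And>A. A \<in> sets borel \<Longrightarrow> (\<integral>t. h t * indicator A t \<partial>circle_measure) = 0" for h :: "complex \<Rightarrow> real"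
  proof -
    have "(\<integral>t. h t * indicator {t. h t > 0} t \<partial>circle_measure) = 0"
      by (rule hz) measurable
    moreover have "integrable circle_measure (\<lambda>t. h t * indicator {t. h t > 0} t)"
      by (rule Bochner_Integration.integrable_bound[OF hi]) (auto simp: indicator_def)
    ultimately have "AE t in circle_measure. h t * indicator {t. h t > 0} t = 0"
      by (subst (asm) integral_nonneg_eq_0_iff_AE) (auto simp: indicator_def)
    then show ?thesis by eventually_elim (auto simp: indicator_def split: if_splits)
  qed
  have "AE t in circle_measure. Re (rv f t) \<le> 0" "AE t in circle_measure. Im (rv f t) \<le> 0"
    "AE t in circle_measure. - Re (rv f t) \<le> 0" "AE t in circle_measure. - Im (rv f t) \<le> 0"
    using re int by (intro half; simp)+
  then have "AE t in circle_measure. rv f t = 0"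
    by eventually_elim (simp add: complex_eq_iff)
  then show ?thesis
    unfolding circle_fun_eq_iff using rv_0 by eventually_elim simp
qed

lemma circle_fun_eq_fourier:
  assumes "f \<in> Lp 1" "g \<in> Lp 1" "\<And>k. fourier f k = fourier g k"
  shows "f = g"
  using fourier_uniqueness_0[of "f - g"] assms by (simp add: Lp_diff fourier_diff)

section \<open>Trigonometric polynomials up to equality almost everywhere\<close>

definition trig_sum :: "(int \<Rightarrow> complex) \<Rightarrow> int set \<Rightarrow> circle_fun" where
  "trig_sum c F = (\<Sum>k\<in>F. cscale (c k) (tt powi k))"

definition trig_polys :: "circle_fun set" where
  "trig_polys = {trig_sum c F |c F. finite F}"

lemma tt_powi_Lp: "0 \<le> p \<Longrightarrow> tt powi k \<in> Lp p"
  using Lp_tt_powi_mult[OF one_mem_Lp, of p k] by simp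

lemma trig_sum_Lp: "0 \<le> p \<Longrightarrow> trig_sum c F \<in> Lp p"
  unfolding trig_sum_def by (intro Lp_sum Lp_cscale tt_powi_Lp)

lemma trig_polys_Lp: "0 \<le> p \<Longrightarrow> x \<in> trig_polys \<Longrightarrow> x \<in> Lp p"
  by (auto simp: trig_polys_def trig_sum_Lp)

lemma rv_trig_sum:
  assumes "finite F"
  shows "AE t in circle_measure. rv (trig_sum c F) t = (\<Sum>k\<in>F. c k * t powi k)"
  using assms
proof (induction F rule: finite_induct)
  case empty
  show ?case using rv_0 by (simp add: trig_sum_def)
next
  case (insert j F)
  have "AE t in circle_measure. rv (cscale (c j) (tt powi j) + trig_sum c F) t = c j * t powi j + (\<Sum>k\<in>F. c k * t powi k)"
    using rv_add[of "cscale (c j) (tt powi j)" "trig_sum c F"] rv_cscale[of "c j" "tt powi j"] rv_tt_powi[of j] insert.IH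
    by eventually_elim simp
  then show ?case using insert.hyps by (simp add: trig_sum_def)
qed

lemma fourier_tt_powi: "fourier (tt powi j) k = (if k = j then 1 else 0)"
proof -
  have "fourier (tt powi j) k = fourier 1 (k - j)"
    using fourier_tt_powi_mult[of j 1 k] by simp
  also have "\<dots> = (\<integral>t. 1 * t powi (- (k - j)) \<partial>circle_measure)"
    by (rule fourier_cong[OF rv_1]) measurable
  finally show ?thesis by (auto simp: integral_cis)
qed

lemma fourier_trig_sum:
  assumes "finite F"
  shows "fourier (trig_sum c F) k = (if k \<in> F then c k else 0)"
proof -
  have "fourier (trig_sum c F) k = (\<Sum>j\<in>F. c j * (if k = j then 1 else 0))"
    unfolding trig_sum_def
    by (subst fourier_sum) (auto simp: fourier_cscale fourier_tt_powi intro!: Lp_cscale tt_powi_Lp)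
  also have "\<dots> = (\<Sum>j\<in>F. if k = j then c j else 0)" by (intro sum.cong) auto
  finally show ?thesis using assms by simp
qed

lemma trig_polys_iff: "x \<in> trig_polys \<longleftrightarrow> x \<in> Lp 1 \<and> finite {k. fourier x k \<noteq> 0}"
proof
  assume "x \<in> trig_polys"
  then obtain c F where x: "x = trig_sum c F" "finite F" by (auto simp: trig_polys_def)
  then have "{k. fourier x k \<noteq> 0} \<subseteq> F" by (auto simp: fourier_trig_sum)
  then show "x \<in> Lp 1 \<and> finite {k. fourier x k \<noteq> 0}"
    using x by (auto simp: trig_sum_Lp intro: finite_subset)
next
  assume x: "x \<in> Lp 1 \<and> finite {k. fourier x k \<noteq> 0}"
  then have "x = trig_sum (fourier x) {k. fourier x k \<noteq> 0}"
    by (intro circle_fun_eq_fourier) (auto simp: trig_sum_Lp fourier_trig_sum)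
  then show "x \<in> trig_polys" using x unfolding trig_polys_def by blast
qed

lemma subspace_trig_polys: "circle_fun.subspace trig_polys"
proof (rule circle_fun.subspaceI)
  show "0 \<in> trig_polys" by (simp add: trig_polys_iff Lp_0)
next
  fix x y assume x: "x \<in> trig_polys" and y: "y \<in> trig_polys"
  then have "{k. fourier (x + y) k \<noteq> 0} \<subseteq> {k. fourier x k \<noteq> 0} \<union> {k. fourier y k \<noteq> 0}"
    by (auto simp: trig_polys_iff fourier_add)
  then show "x + y \<in> trig_polys"
    using x y by (auto simp: trig_polys_iff Lp_add intro: finite_subset)
next
  fix z x assume x: "x \<in> trig_polys"
  have "{k. fourier (cscale z x) k \<noteq> 0} \<subseteq> {k. fourier x k \<noteq> 0}"
    by (auto simp: fourier_cscale)
  then show "cscale z x \<in> trig_polys"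
    using x by (auto simp: trig_polys_iff Lp_cscale intro: finite_subset)
qed

lemma tt_powi_trig_polys: "tt powi k \<in> trig_polys"
  by (auto simp: trig_polys_iff tt_powi_Lp fourier_tt_powi)

text \<open>A function at positive distance would be separated from the trigonometric polynomials by
  some \<psi> in L^q. Orthogonality to all powers of t kills the Fourier coefficients of \<psi>,
  hence \<psi> itself.\<close>

lemma trig_polys_dense:
  assumes p: "1 < p" and f: "f \<in> Lp p" and e: "0 < e"
  obtains x where "x \<in> trig_polys" "Lp_norm p (f - x) < e"
proof (rule ccontr)
  assume "\<not> thesis"
  then have far: "\<And>x. x \<in> trig_polys \<Longrightarrow> e \<le> Lp_norm p (f - x)" using that by force
  define q where "q = p / (p - 1)"
  have q: "1/p + 1/q = 1" "1/q + 1/p = 1" "1 < q" using p by (auto simp: q_def field_simps)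
  have sub: "trig_polys \<subseteq> Lp p" using p by (auto intro: trig_polys_Lp)
  obtain \<psi> where psi: "\<psi> \<in> Lp q" "\<And>r. r \<in> trig_polys \<Longrightarrow> fourier (\<psi> * r) 0 = 0" "fourier (\<psi> * f) 0 \<noteq> 0"
    by (rule Lp_separation[OF p q(1) subspace_trig_polys sub f e far], assumption, rule that)
  have "fourier \<psi> k = 0" for k
    using psi(2)[OF tt_powi_trig_polys, of "- k"] fourier_tt_powi_mult[of "- k" \<psi> 0] by (simp add: mult.commute)
  then have "\<psi> = 0" using Lp_subset_L1[OF q(3) psi(1)] by (rule fourier_uniqueness_0[rotated])
  then show False using psi(3) by simp
qed

lemma abs_trig_poly_mem:
  assumes "trig_poly f"
  shows "abs_circle_fun f \<in> trig_polys"
proof -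
  obtain F c where f: "finite F" "f = (\<lambda>t. \<Sum>k\<in>F. c k * t powi k)" by (rule trig_poly_explicit[OF assms])
  have "abs_circle_fun f = trig_sum c F"
    unfolding circle_fun_eq_iff
    using rv_abs[OF borel_measurable_trig_poly[OF assms]] rv_trig_sum[OF f(1), of c]
    by eventually_elim (simp add: f(2))
  then show ?thesis using f(1) by (auto simp: trig_polys_def)
qed

lemma trig_polys_obtain:
  assumes "x \<in> trig_polys"
  obtains f where "trig_poly f" "x = abs_circle_fun f" "f = (\<lambda>t. \<Sum>k | fourier x k \<noteq> 0. fourier x k * t powi k)"
proof -
  let ?f = "\<lambda>t. \<Sum>k | fourier x k \<noteq> 0. fourier x k * t powi k"
  have fin: "finite {k. fourier x k \<noteq> 0}" using assms by (simp add: trig_polys_iff)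
  have x: "x = trig_sum (fourier x) {k. fourier x k \<noteq> 0}"
    using assms fin by (intro circle_fun_eq_fourier) (auto simp: trig_sum_Lp fourier_trig_sum trig_polys_Lp)
  have tf: "trig_poly ?f" using fin by (rule trig_poly_sum)
  have "AE t in circle_measure. rv x t = ?f t"
    using rv_trig_sum[OF fin, of "fourier x"] unfolding x[symmetric] .
  then have "x = abs_circle_fun ?f"
    unfolding circle_fun_eq_iff using rv_abs[OF borel_measurable_trig_poly[OF tf]]
    by eventually_elim simp
  then show ?thesis using that[OF tf] by simp
qed

text \<open>The Riesz projection on trigonometric polynomials, where it is a finite sum independent
  of the exponent.\<close>

definition ana :: "circle_fun \<Rightarrow> circle_fun" where
  "ana x = trig_sum (fourier x) {k. 0 \<le> k \<and> fourier x k \<noteq> 0}"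

lemma finite_ana: "x \<in> trig_polys \<Longrightarrow> finite {k. 0 \<le> k \<and> fourier x k \<noteq> 0}"
  by (rule finite_subset[of _ "{k. fourier x k \<noteq> 0}"]) (auto simp: trig_polys_iff)

lemma ana_trig_polys: "x \<in> trig_polys \<Longrightarrow> ana x \<in> trig_polys"
  unfolding ana_def by (subst trig_polys_def) (use finite_ana in blast)

lemma fourier_ana: "x \<in> trig_polys \<Longrightarrow> fourier (ana x) k = (if 0 \<le> k then fourier x k else 0)"
  using finite_ana by (auto simp: ana_def fourier_trig_sum)

lemma ana_Lp: "0 \<le> p \<Longrightarrow> ana x \<in> Lp p"
  by (simp add: ana_def trig_sum_Lp)

lemma ana_add: "x \<in> trig_polys \<Longrightarrow> y \<in> trig_polys \<Longrightarrow> ana (x + y) = ana x + ana y"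
  using circle_fun.subspace_add[OF subspace_trig_polys, of x y]
  by (intro circle_fun_eq_fourier) (auto simp: ana_Lp Lp_add fourier_ana fourier_add trig_polys_Lp)

lemma ana_cscale: "x \<in> trig_polys \<Longrightarrow> ana (cscale z x) = cscale z (ana x)"
  using circle_fun.subspace_scale[OF subspace_trig_polys, of x z]
  by (intro circle_fun_eq_fourier) (auto simp: ana_Lp Lp_cscale fourier_ana fourier_cscale trig_polys_Lp)

lemma ana_diff: "x \<in> trig_polys \<Longrightarrow> y \<in> trig_polys \<Longrightarrow> ana (x - y) = ana x - ana y"
  using circle_fun.subspace_diff[OF subspace_trig_polys, of x y]
  by (intro circle_fun_eq_fourier) (auto simp: ana_Lp Lp_diff fourier_ana fourier_diff trig_polys_Lp)

subsection \<open>The theorem of M. Riesz\<close>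

text \<open>The pointwise inequality that drives the theorem for p at most 2. As p pi/2 lies in
  (pi/2, pi], the cosine of p times the argument is negative near the imaginary axis, where the
  B-term dominates. Elsewhere the cosine of the argument stays away from 0 and the A-term absorbs
  everything.\<close>

lemma Im_powr_le:
  assumes p: "1 < p" "p \<le> 2"
  obtains A B :: real where "0 \<le> A" "0 \<le> B"
    "\<And>w. 0 < Re w \<Longrightarrow> \<bar>Im w\<bar> powr p \<le> A * Re w powr p - B * Re (exp (of_real p * Ln w))"
proof -
  define \<eta> where "\<eta> = - cos (p * (pi/2))"
  have "cos (p * (pi/2)) < 0"
  proof -
    have "pi - p * (pi/2) < pi/2" "- (pi/2) < pi - p * (pi/2)" using p by (auto simp: field_simps)
    then have "cos (pi - p * (pi/2)) > 0" by (intro cos_gt_zero_pi)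
    then show ?thesis by simp
  qed
  then have eta: "\<eta> > 0" by (simp add: \<eta>_def)
  have "isCont (\<lambda>x. cos (p * x)) (pi/2)" by (intro continuous_intros)
  then obtain d where d: "d > 0" "\<And>x. \<bar>x - pi/2\<bar> < d \<Longrightarrow> \<bar>cos (p * x) - cos (p * (pi/2))\<bar> < \<eta>/2"
    unfolding continuous_at_eps_delta dist_real_def using half_gt_zero[OF eta] by metis
  define e where "e = min (d/2) (pi/4)"
  have e: "0 < e" "e < pi/2" "e < d" using d(1) pi_gt_zero by (auto simp: e_def min_def)
  define s where "s = sin e"
  have s: "s > 0" using e unfolding s_def by (intro sin_gt_zero) auto
  \<comment> \<open>In the zone near the imaginary axis cos(p \<theta>) is below -\<eta>/2, so this
    B makes the second term at least 1. In the other zone cos \<theta> is at least s, and A is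
    chosen so that the first term covers 1 + B.\<close>
  define B where "B = 2 / \<eta>"
  define A where "A = (1 + B) / s powr p"
  have B: "B > 0" using eta by (simp add: B_def)
  have A: "A > 0" using B s by (simp add: A_def)
  have trig: "\<bar>sin \<theta>\<bar> powr p \<le> A * cos \<theta> powr p - B * cos (p * \<theta>)" if \<theta>: "\<bar>\<theta>\<bar> < pi/2" for \<theta>
  proof -
    have 1: "\<bar>sin \<theta>\<bar> powr p \<le> 1"
      using p powr_mono2[of p "\<bar>sin \<theta>\<bar>" 1] by simp
    have c: "cos (p * \<bar>\<theta>\<bar>) = cos (p * \<theta>)" by (cases "\<theta> \<ge> 0") auto
    show ?thesis
    proof (cases "\<bar>\<theta>\<bar> > pi/2 - e")
      case True
      then have "\<bar>\<bar>\<theta>\<bar> - pi/2\<bar> < d" using \<theta> e by auto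
      then have "cos (p * \<theta>) < - \<eta> / 2" using d(2)[of "\<bar>\<theta>\<bar>"] unfolding c \<eta>_def by linarith
      then have "B * cos (p * \<theta>) < B * (- \<eta> / 2)" using B by (intro mult_strict_left_mono) auto
      also have "\<dots> = -1" using eta by (simp add: B_def)
      finally have "1 \<le> - (B * cos (p * \<theta>))" by simp
      moreover have "0 \<le> A * cos \<theta> powr p" using A by simp
      ultimately show ?thesis using 1 by linarith
    next
      case False
      have "s = cos (pi/2 - e)" by (simp add: s_def cos_diff)
      also have "\<dots> \<le> cos \<bar>\<theta>\<bar>" using False e \<theta> by (intro cos_monotone_0_pi_le) auto
      finally have "s powr p \<le> cos \<theta> powr p" using s p by (intro powr_mono2) auto
      then have "A * s powr p \<le> A * cos \<theta> powr p" using A by (intro mult_left_mono) auto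
      then have "1 + B \<le> A * cos \<theta> powr p" using s by (simp add: A_def)
      moreover have "B * cos (p * \<theta>) \<le> B * 1" using B by (intro mult_left_mono) auto
      ultimately show ?thesis using 1 by linarith
    qed
  qed
  show ?thesis
  proof (rule that[of A B])
    fix w :: complex assume w: "0 < Re w"
    define r where "r = norm w"
    have r: "r > 0" using w by (auto simp: r_def)
    have w0: "w \<noteq> 0" using w by auto
    have Ln: "Ln w = Complex (ln r) (Arg w)" using w0 by (simp add: complex_eq_iff r_def Arg_eq_Im_Ln)
    have th: "\<bar>Arg w\<bar> < pi/2" using w w0 Re_Ln_pos_lt_imp by (simp add: Arg_eq_Im_Ln Re_Ln_pos_lt)
    have wr: "Re w = r * cos (Arg w)" "Im w = r * sin (Arg w)"
      using w0 by (simp_all add: r_def cos_Arg sin_Arg)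
    have "exp (of_real p * Ln w) = of_real (r powr p) * cis (p * Arg w)"
      using r by (simp add: Ln exp_eq_polar powr_def complex_eq_iff)
    then have ex: "Re (exp (of_real p * Ln w)) = r powr p * cos (p * Arg w)" by simp
    have cpos: "cos (Arg w) > 0" using th by (intro cos_gt_zero_pi) auto
    have "r powr p * \<bar>sin (Arg w)\<bar> powr p \<le> r powr p * (A * cos (Arg w) powr p - B * cos (p * Arg w))"
      using trig[OF th] by (intro mult_left_mono) auto
    then show "\<bar>Im w\<bar> powr p \<le> A * Re w powr p - B * Re (exp (of_real p * Ln w))"
      unfolding ex wr using r cpos by (simp add: abs_mult powr_mult right_diff_distrib mult_ac)
  qed (use A B in auto)
qed

text \<open>Cauchy's formula at the centre. The cut-off outside the closed disc gives a Borel
  function on the whole plane, where \<open>circle_measure\<close> lives, although h is controlled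
  on the disc only.\<close>

lemma circle_mean_value:
  assumes c: "continuous_on (cball 0 1) h" and h: "h holomorphic_on ball 0 1"
  shows "integrable circle_measure (\<lambda>t. if t \<in> cball 0 1 then h t else 0)"
    and "(\<integral>t. (if t \<in> cball 0 1 then h t else 0) \<partial>circle_measure) = h 0"
proof -
  let ?H = "\<lambda>t. if t \<in> cball 0 1 then h t else 0"
  have m[measurable]: "?H \<in> borel_measurable borel"
    by (rule borel_measurable_continuous_on_if) (use c in auto)
  have "bounded (h ` cball 0 1)" by (intro compact_imp_bounded compact_continuous_image c compact_cball)
  then obtain K where K: "\<forall>t\<in>cball 0 1. norm (h t) \<le> K" by (auto simp: bounded_iff)
  have "AE t in circle_measure. norm (?H t) \<le> K"
    using AE_circle_norm by eventually_elim (use K in auto)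
  then show "integrable circle_measure ?H"
    by (rule circle_prob.integrable_const_bound) (use m in simp)
  have "((\<lambda>u. h u / (u - 0)) has_contour_integral 2 * of_real pi * \<i> * h 0) (circlepath 0 1)"
    using c h by (intro Cauchy_integral_circlepath) auto
  then have "((\<lambda>\<theta>. h (cis \<theta>) / cis \<theta> * \<i> * cis \<theta>) has_integral 2 * of_real pi * \<i> * h 0) {0..2*pi}"
    unfolding circlepath_def by (subst (asm) has_contour_integral_part_circlepath_iff) auto
  then have "((\<lambda>\<theta>. \<i> * h (cis \<theta>)) has_integral 2 * of_real pi * \<i> * h 0) {0..2*pi}"
    by (rule has_integral_eq[rotated]) (simp add: mult_ac)
  from has_integral_mult_right[OF this, of "- \<i>"]
  have hi: "((\<lambda>\<theta>. h (cis \<theta>)) has_integral 2 * of_real pi * h 0) {0..2*pi}"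
    by (simp add: mult_ac)
  have cont: "continuous_on {0..2*pi} (\<lambda>\<theta>. h (cis \<theta>))"
    by (rule continuous_on_compose2[OF c]) (auto intro!: continuous_intros)
  have si: "set_integrable lborel {0..2*pi} (\<lambda>\<theta>. h (cis \<theta>))"
    by (rule borel_integrable_compact[OF compact_Icc cont, folded set_integrable_def])
  have "(LINT \<theta>:{0..2*pi}|lborel. h (cis \<theta>)) = 2 * of_real pi * h 0"
    using set_borel_integral_eq_integral(2)[OF si] hi by (simp add: integral_unique)
  moreover have "(\<integral>t. ?H t \<partial>circle_measure) = fourier (abs_circle_fun ?H) 0"
    by (subst fourier_cong[OF rv_abs[OF m] m]) simp
  moreover have "\<dots> = 1 / (2*pi) * (LINT \<theta>:{0..2*pi}|lborel. h (cis \<theta>))"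
    by (subst fourier_formula[OF m]) simp
  ultimately show "(\<integral>t. ?H t \<partial>circle_measure) = h 0" by simp
qed

lemma Lp_norm_mono:
  assumes p: "1 \<le> p" and g: "g \<in> Lp p" and le: "AE t in circle_measure. norm (rv f t) \<le> norm (rv g t)"
  shows "f \<in> Lp p" "Lp_norm p f \<le> Lp_norm p g"
proof -
  have le': "AE t in circle_measure. norm (rv f t) powr p \<le> norm (rv g t) powr p"
    using le by eventually_elim (use p in \<open>auto intro!: powr_mono2\<close>)
  have i: "integrable circle_measure (\<lambda>t. norm (rv f t) powr p)"
    by (rule Bochner_Integration.integrable_bound[where f="\<lambda>t. norm (rv g t) powr p"])
       (use g le' in \<open>auto simp: mem_Lp_iff\<close>)
  then show "f \<in> Lp p" by (simp add: mem_Lp_iff)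
  show "Lp_norm p f \<le> Lp_norm p g"
    unfolding Lp_norm.rep_eq using p g i le'
    by (intro powr_mono2 integral_mono_AE) (auto simp: mem_Lp_iff)
qed

lemma Lp_norm_bound_const:
  assumes p: "1 \<le> p" and g: "g \<in> Lp p" and e: "0 \<le> e"
    and le: "AE t in circle_measure. norm (rv f t) \<le> norm (rv g t) + e"
  shows "Lp_norm p f \<le> Lp_norm p g + e"
proof -
  define g' where "g' = abs_circle_fun (\<lambda>t. of_real (norm (rv g t)))"
  have g': "AE t in circle_measure. rv g' t = of_real (norm (rv g t))"
    unfolding g'_def by (rule rv_abs) measurable
  have gL: "g' \<in> Lp p" and gn: "Lp_norm p g' = Lp_norm p g"
    using g by (subst mem_Lp_cong[OF g'] Lp_norm_cong[OF g']; simp add: mem_Lp_iff Lp_norm.rep_eq)+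
  have eL: "cscale (of_real e) 1 \<in> Lp p" by (intro Lp_cscale one_mem_Lp)
  have "AE t in circle_measure. norm (rv f t) \<le> norm (rv (g' + cscale (of_real e) 1) t)"
    using le g' rv_add[of g' "cscale (of_real e) 1"] rv_cscale[of "of_real e" 1] rv_1
    by eventually_elim (use e in \<open>simp flip: of_real_add\<close>)
  then have "Lp_norm p f \<le> Lp_norm p (g' + cscale (of_real e) 1)"
    using p gL eL by (intro Lp_norm_mono(2) Lp_add) auto
  also have "\<dots> \<le> Lp_norm p g' + Lp_norm p (cscale (of_real e) 1)"
    by (rule Lp_norm_triangle[OF p gL eL])
  also have "\<dots> = Lp_norm p g + e"
    using p e by (simp add: gn Lp_norm_cscale Lp_norm_one)
  finally show ?thesis .
qed

lemma fourier_real: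
  assumes "AE t in circle_measure. rv x t \<in> \<real>"
  shows "fourier x (- k) = cnj (fourier x k)"
proof -
  have "cnj (fourier x k) = (\<integral>t. cnj (rv x t * t powi (- k)) \<partial>circle_measure)"
    unfolding fourier.rep_eq
    by (rule integral_bounded_linear'[OF bounded_linear_cnj bounded_linear_cnj, symmetric]) simp
  also have "\<dots> = (\<integral>t. rv x t * t powi k \<partial>circle_measure)"
  proof (rule integral_cong_AE)
    show "AE t in circle_measure. cnj (rv x t * t powi (- k)) = rv x t * t powi k"
      using assms AE_circle_norm
    proof eventually_elim
      case (elim t)
      have "t * cnj t = 1" using elim(2) complex_norm_square[of t] by simp
      then have "cnj t = inverse t" by (metis inverse_unique)
      then show ?case using elim(1) by (simp add: Reals_cnj_iff power_int_minus power_int_inverse)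
    qed
    have "(\<lambda>t. cnj (rv x t * t powi (- k))) = (\<lambda>t. cnj (rv x t) * (cnj t) powi (- k))"
      by (simp add: fun_eq_iff)
    have c: "cnj \<in> borel_measurable borel" by (intro borel_measurable_continuous_onI continuous_intros)
    show "(\<lambda>t. cnj (rv x t * t powi (- k))) \<in> borel_measurable circle_measure"
      by (rule measurable_compose[OF _ c]) measurable
  qed measurable
  finally show ?thesis by (simp add: fourier.rep_eq)
qed

text \<open>A positive f is the boundary real part of a polynomial \<open>G\<close> that maps the
  disc into the right half-plane, so the p-th power of \<open>G\<close> is holomorphic with mean
  value G(0)^p. Integrating the pointwise inequality bounds the conjugate function Im G by f, and
  the analytic part of f is a combination of f, Im G and a constant.\<close>

lemma riesz_positive:
  assumes p: "1 < p" "p \<le> 2" and AB: "0 \<le> A" "0 \<le> B"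
    "\<And>w. 0 < Re w \<Longrightarrow> \<bar>Im w\<bar> powr p \<le> A * Re w powr p - B * Re (exp (of_real p * Ln w))"
    and f: "trig_poly f" "\<And>t. norm t = 1 \<Longrightarrow> f t \<in> \<real>" "\<And>t. norm t = 1 \<Longrightarrow> 0 < Re (f t)"
  shows "Lp_norm p (ana (abs_circle_fun f)) \<le> (2 + A powr (1/p)) * Lp_norm p (abs_circle_fun f)"
proof -
  define x where "x = abs_circle_fun f"
  have xT: "x \<in> trig_polys" unfolding x_def by (rule abs_trig_poly_mem[OF f(1)])
  have xL: "x \<in> Lp p" using xT p by (simp add: trig_polys_Lp)
  have rx: "AE t in circle_measure. rv x t = f t"
    unfolding x_def by (rule rv_abs[OF borel_measurable_trig_poly[OF f(1)]])
  have "AE t in circle_measure. rv x t \<in> \<real>"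
    using rx AE_circle_norm by eventually_elim (use f(2) in auto)
  note sym = fourier_real[OF this]
  obtain F c where F: "finite F" "f = (\<lambda>t. \<Sum>k\<in>F. c k * t powi k)" by (rule trig_poly_explicit[OF f(1)])
  have xs: "x = trig_sum c F"
    unfolding circle_fun_eq_iff using rx rv_trig_sum[OF F(1), of c] by eventually_elim (simp add: F(2))
  have fx: "fourier x k = (if k \<in> F then c k else 0)" for k
    unfolding xs by (rule fourier_trig_sum[OF F(1)])
  obtain N :: nat where N: "F \<subseteq> {- int N..int N}"
  proof -
    have "finite ((\<lambda>k. nat \<bar>k\<bar>) ` F)" using F(1) by simp
    then obtain N where N: "\<forall>j\<in>(\<lambda>k. nat \<bar>k\<bar>) ` F. j \<le> N"
      by (meson finite_nat_set_iff_bounded_le)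
    have "F \<subseteq> {- int N..int N}"
    proof
      fix k assume "k \<in> F"
      then have "nat \<bar>k\<bar> \<le> N" using N by blast
      then show "k \<in> {- int N..int N}" by auto
    qed
    then show ?thesis by (rule that)
  qed
  \<comment> \<open>\<open>Y\<close> collects the positive frequencies of f. As f is real on the
    circle, the negative ones are conjugate to them, so \<open>G\<close> has real part f
    there.\<close>
  define Y where "Y z = (\<Sum>k\<in>{1..N}. fourier x (int k) * z ^ k)" for z
  define G where "G z = fourier x 0 + 2 * Y z" for z
  have c0: "fourier x 0 \<in> \<real>" using sym[of 0] by (simp add: Reals_cnj_iff)
  have pos_part: "(\<Sum>k\<in>{1..int N}. fourier x k * t powi k) = Y t" for t
    unfolding Y_def by (rule sum.reindex_bij_witness[of _ int nat]) (auto simp: power_int_def)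
  have fG: "f t = of_real (Re (G t))" if t: "norm t = 1" for t
  proof -
    have "t * cnj t = 1" using t complex_norm_square[of t] by simp
    then have ct: "cnj t = inverse t" by (metis inverse_unique)
    have "f t = (\<Sum>k\<in>{- int N..int N}. fourier x k * t powi k)"
      unfolding F(2) by (rule sum.mono_neutral_cong_left) (use N fx in auto)
    also have "{- int N..int N} = {- int N..-1} \<union> ({0} \<union> {1..int N})" by auto
    also have "(\<Sum>k\<in>\<dots>. fourier x k * t powi k) = (\<Sum>k\<in>{- int N..-1}. fourier x k * t powi k) + (fourier x 0 + Y t)"
      by (subst sum.union_disjoint) (auto simp: pos_part)
    also have "(\<Sum>k\<in>{- int N..-1}. fourier x k * t powi k) = (\<Sum>k\<in>{1..int N}. cnj (fourier x k * t powi k))"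
      by (rule sum.reindex_bij_witness[of _ uminus uminus])
         (auto simp: sym[symmetric] ct power_int_minus power_int_inverse)
    also have "\<dots> = cnj (Y t)" unfolding pos_part[symmetric] by simp
    finally have "f t = fourier x 0 + (Y t + cnj (Y t))" by (simp add: add_ac)
    also have "\<dots> = of_real (Re (G t))"
      using c0 by (simp add: complex_add_cnj G_def complex_is_Real_iff complex_eq_iff)
    finally show ?thesis .
  qed
  have Gh: "G holomorphic_on S" for S unfolding G_def Y_def by (intro holomorphic_intros)
  have Gc: "continuous_on S G" for S using Gh by (rule holomorphic_on_imp_continuous_on)
  have "\<exists>s\<in>sphere 0 1. \<forall>t\<in>sphere 0 1. Re (G s) \<le> Re (G t)"
    by (intro continuous_attains_inf compact_sphere continuous_on_Re Gc) auto
  then obtain s where s: "norm s = 1" "\<And>t. norm t = 1 \<Longrightarrow> Re (G s) \<le> Re (G t)" by auto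
  have s0: "0 < Re (G s)" using f(3)[OF s(1)] fG[OF s(1)] by simp
  have ReG: "0 < Re (G z)" if z: "z \<in> cball 0 1" for z
  proof -
    \<comment> \<open>The minimum principle for Re G, read off from the maximum modulus principle
      for exp(-G).\<close>
    have "norm (exp (- G z)) \<le> exp (- Re (G s))"
      by (rule maximum_modulus_frontier[where S="cball 0 1"])
         (use z s in \<open>auto intro!: holomorphic_intros continuous_intros Gh Gc simp: frontier_cball\<close>)
    then show ?thesis using s0 by simp
  qed
  define h where "h z = exp (of_real p * Ln (G z))" for z
  have "h holomorphic_on cball 0 1"
    unfolding h_def using ReG by (intro holomorphic_intros Gh) (auto simp: complex_nonpos_Reals_iff not_le)
  then have hc: "continuous_on (cball 0 1) h" "h holomorphic_on ball 0 1"
    by (auto intro: holomorphic_on_imp_continuous_on holomorphic_on_subset)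
  note mv = circle_mean_value[OF hc]
  \<comment> \<open>At the centre \<open>G\<close> is a positive real number, and so is its p-th
    power. Hence the B-term may be dropped after integration.\<close>
  have "0 \<le> Re (h 0)"
  proof -
    have G0: "G 0 = of_real (Re (G 0))" using c0 by (simp add: G_def Y_def complex_is_Real_iff complex_eq_iff)
    have "0 < Re (G 0)" by (rule ReG) simp
    then have "h 0 = of_real (exp (p * ln (Re (G 0))))"
      unfolding h_def by (subst G0) (simp add: Ln_of_real flip: of_real_mult exp_of_real)
    then show ?thesis by simp
  qed
  define y where "y = abs_circle_fun (\<lambda>t. of_real (Im (G t)))"
  have [measurable]: "G \<in> borel_measurable borel" using Gc by (rule borel_measurable_continuous_onI)
  have ry: "AE t in circle_measure. rv y t = of_real (Im (G t))"
    unfolding y_def by (rule rv_abs) measurable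
  let ?H = "\<lambda>t. if t \<in> cball 0 1 then h t else 0"
  have ptw: "AE t in circle_measure. \<bar>Im (G t)\<bar> powr p \<le> A * norm (f t) powr p - B * Re (?H t)"
    using AE_circle_norm
  proof eventually_elim
    case (elim t)
    then have "0 < Re (G t)" by (intro ReG) auto
    moreover have "norm (f t) = Re (G t)" using fG[OF elim] \<open>0 < Re (G t)\<close> by simp
    ultimately show ?case using AB(3)[of "G t"] elim by (simp add: h_def)
  qed
  have [measurable]: "f \<in> borel_measurable borel" by (rule borel_measurable_trig_poly[OF f(1)])
  have fi: "integrable circle_measure (\<lambda>t. norm (f t) powr p)"
    using xL mem_Lp_cong[OF rx, of p] by simp
  have bi: "integrable circle_measure (\<lambda>t. A * norm (f t) powr p - B * Re (?H t))"
    using fi mv(1) by (intro Bochner_Integration.integrable_diff integrable_mult_right integrable_Re)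
  have yi: "integrable circle_measure (\<lambda>t. \<bar>Im (G t)\<bar> powr p)"
    by (rule Bochner_Integration.integrable_bound[OF bi]) (use ptw in \<open>auto elim!: eventually_mono\<close>)
  have "(\<integral>t. \<bar>Im (G t)\<bar> powr p \<partial>circle_measure) \<le> (\<integral>t. A * norm (f t) powr p - B * Re (?H t) \<partial>circle_measure)"
    by (rule integral_mono_AE[OF yi bi ptw])
  also have "\<dots> = A * (\<integral>t. norm (f t) powr p \<partial>circle_measure) - B * (\<integral>t. Re (?H t) \<partial>circle_measure)"
    using fi integrable_Re[OF mv(1)] by simp
  also have "(\<integral>t. Re (?H t) \<partial>circle_measure) = Re (h 0)"
    using integral_Re[OF mv(1)] mv(2) by simp
  finally have yle: "(\<integral>t. \<bar>Im (G t)\<bar> powr p \<partial>circle_measure) \<le> A * (\<integral>t. norm (f t) powr p \<partial>circle_measure)"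
    using AB(2) \<open>0 \<le> Re (h 0)\<close> by (smt (verit) mult_nonneg_nonneg)
  have p0: "0 < p" "1 \<le> p" "0 \<le> p" using p by auto
  have yL: "y \<in> Lp p" using yi mem_Lp_cong[OF ry, of p] by simp
  have yn: "Lp_norm p y \<le> A powr (1/p) * Lp_norm p x"
  proof -
    have "Lp_norm p y \<le> (A * (\<integral>t. norm (f t) powr p \<partial>circle_measure)) powr (1/p)"
      using yle p0 by (subst Lp_norm_cong[OF ry]) (auto intro!: powr_mono2)
    also have "\<dots> = A powr (1/p) * Lp_norm p x"
      using AB(1) by (subst Lp_norm_cong[OF rx]) (auto simp: powr_mult)
    finally show ?thesis .
  qed
  \<comment> \<open>On the circle x + i y is G = x_0 + 2 Y with x_0 the mean of x, while the
    analytic part of x is x_0 + Y.\<close>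
  have "ana x = cscale (1/2) (cscale (fourier x 0) 1 + (x + cscale \<i> y))"
  proof -
    have fin: "finite {k. 0 \<le> k \<and> fourier x k \<noteq> 0}" using xT by (rule finite_ana)
    have "AE t in circle_measure. rv (ana x) t = fourier x 0 + Y t"
      using rv_trig_sum[OF fin, of "fourier x"] unfolding ana_def[symmetric]
    proof eventually_elim
      case (elim t)
      have "(\<Sum>k\<in>{k. 0 \<le> k \<and> fourier x k \<noteq> 0}. fourier x k * t powi k) = (\<Sum>k\<in>{0} \<union> {1..int N}. fourier x k * t powi k)"
        by (rule sum.mono_neutral_cong_left) (use N fx in \<open>auto split: if_splits\<close>)
      also have "\<dots> = fourier x 0 + Y t" by (subst sum.union_disjoint) (auto simp: pos_part)
      finally show ?case using elim by simp
    qed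
    then show ?thesis
      unfolding circle_fun_eq_iff
      using rx ry rv_1 rv_cscale[of "1/2" "cscale (fourier x 0) 1 + (x + cscale \<i> y)"] AE_circle_norm
        rv_add[of "cscale (fourier x 0) 1" "x + cscale \<i> y"] rv_add[of x "cscale \<i> y"]
        rv_cscale[of \<i> y] rv_cscale[of "fourier x 0" 1]
    proof eventually_elim
      case (elim t)
      have "rv (cscale (1/2) (cscale (fourier x 0) 1 + (x + cscale \<i> y))) t = 1/2 * (fourier x 0 + (of_real (Re (G t)) + \<i> * of_real (Im (G t))))"
        using elim fG[OF elim(6)] by simp
      also have "of_real (Re (G t)) + \<i> * of_real (Im (G t)) = G t" by (simp add: complex_eq_iff)
      also have "1/2 * (fourier x 0 + G t) = rv (ana x) t" using elim by (simp add: G_def)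
      finally show ?case by simp
    qed
  qed
  then have "Lp_norm p (ana x) = 1/2 * Lp_norm p (cscale (fourier x 0) 1 + (x + cscale \<i> y))"
    using p0 by (simp only: Lp_norm_cscale) (simp add: norm_divide)
  also have "Lp_norm p (cscale (fourier x 0) 1 + (x + cscale \<i> y)) \<le> Lp_norm p (cscale (fourier x 0) 1) + Lp_norm p (x + cscale \<i> y)"
    using p0 xL yL by (intro Lp_norm_triangle Lp_add Lp_cscale one_mem_Lp)
  also have "Lp_norm p (x + cscale \<i> y) \<le> Lp_norm p x + Lp_norm p (cscale \<i> y)"
    using p0 xL yL by (intro Lp_norm_triangle Lp_cscale)
  finally have "Lp_norm p (ana x) \<le> 1/2 * (norm (fourier x 0) + (Lp_norm p x + Lp_norm p y))"
    using p0 by (simp add: Lp_norm_cscale Lp_norm_one)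
  also have "\<dots> \<le> 1/2 * (Lp_norm p x + (Lp_norm p x + A powr (1/p) * Lp_norm p x))"
    using norm_fourier_le[OF p(1) xL, of 0] yn by simp
  also have "\<dots> \<le> (2 + A powr (1/p)) * Lp_norm p x"
    by (simp add: algebra_simps)
  finally show ?thesis unfolding x_def .
qed

text \<open>A real f is written as g - (g - f) with g within e/3 of max(0, f) + 2e/3. Both terms are
  then positive trigonometric polynomials bounded by |f| + e, which explains the factor 2; finally e
  tends to 0.\<close>

lemma riesz_real:
  assumes p: "1 < p" and C: "0 \<le> C"
    "\<And>f. trig_poly f \<Longrightarrow> (\<And>t. norm t = 1 \<Longrightarrow> f t \<in> \<real>) \<Longrightarrow> (\<And>t. norm t = 1 \<Longrightarrow> 0 < Re (f t)) \<Longrightarrow>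
      Lp_norm p (ana (abs_circle_fun f)) \<le> C * Lp_norm p (abs_circle_fun f)"
    and f: "trig_poly f" "\<And>t. norm t = 1 \<Longrightarrow> f t \<in> \<real>"
  shows "Lp_norm p (ana (abs_circle_fun f)) \<le> 2 * C * Lp_norm p (abs_circle_fun f)"
proof -
  have rvf: "AE t in circle_measure. rv (abs_circle_fun g) t = g t" if "trig_poly g" for g
    by (rule rv_abs[OF borel_measurable_trig_poly[OF that]])
  let ?x = "abs_circle_fun f"
  have xT: "?x \<in> trig_polys" by (rule abs_trig_poly_mem[OF f(1)])
  have p1: "1 \<le> p" "0 \<le> p" using p by auto
  have xL: "?x \<in> Lp p" using xT p1 by (simp add: trig_polys_Lp)
  have le: "Lp_norm p (ana ?x) \<le> 2 * C * (Lp_norm p ?x + e)" if e: "e > 0" for e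
  proof -
    have "continuous_on (sphere 0 1) (\<lambda>t. max 0 (Re (f t)) + 2 * (e/3))"
      by (intro continuous_intros continuous_on_trig_poly[OF f(1)])
    then obtain g where g: "trig_poly g" "\<And>t. norm t = 1 \<Longrightarrow> g t \<in> \<real>"
      "\<And>t. norm t = 1 \<Longrightarrow> \<bar>max 0 (Re (f t)) + 2 * (e/3) - Re (g t)\<bar> < e/3"
      by (rule trig_poly_approx[of _ "e/3"]) (use e in auto)
    define k where "k t = g t + (-1) * f t" for t
    have k: "trig_poly k"
      unfolding k_def by (intro trig_poly_add g(1) trig_poly_cmult f(1))
    have kr: "k t \<in> \<real>" if "norm t = 1" for t using g(2)[OF that] f(2)[OF that] by (simp add: k_def)
    have gb: "0 < Re (g t)" "norm (g t) \<le> norm (f t) + e" "0 < Re (k t)" "norm (k t) \<le> norm (f t) + e" if t: "norm t = 1" for t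
    proof -
      have ff: "norm (f t) = \<bar>Re (f t)\<bar>" using f(2)[OF t] by (metis complex_is_Real_iff complex_eq_iff Re_complex_of_real Im_complex_of_real norm_of_real)
      have gg: "norm (g t) = \<bar>Re (g t)\<bar>" using g(2)[OF t] by (metis complex_is_Real_iff complex_eq_iff Re_complex_of_real Im_complex_of_real norm_of_real)
      have kk: "norm (k t) = \<bar>Re (k t)\<bar>" using kr[OF t] by (metis complex_is_Real_iff complex_eq_iff Re_complex_of_real Im_complex_of_real norm_of_real)
      have k': "Re (k t) = Re (g t) - Re (f t)" by (simp add: k_def)
      show "0 < Re (g t)" "norm (g t) \<le> norm (f t) + e" "0 < Re (k t)" "norm (k t) \<le> norm (f t) + e"
        unfolding ff gg kk k' using g(3)[OF t] e by linarith+
    qed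
    have bound: "Lp_norm p (ana (abs_circle_fun u)) \<le> C * (Lp_norm p ?x + e)"
      if u: "trig_poly u" "\<And>t. norm t = 1 \<Longrightarrow> u t \<in> \<real>" "\<And>t. norm t = 1 \<Longrightarrow> 0 < Re (u t)"
        "\<And>t. norm t = 1 \<Longrightarrow> norm (u t) \<le> norm (f t) + e" for u
    proof -
      have "AE t in circle_measure. norm (rv (abs_circle_fun u) t) \<le> norm (rv ?x t) + e"
        using rvf[OF u(1)] rvf[OF f(1)] AE_circle_norm by eventually_elim (use u(4) in auto)
      then have "Lp_norm p (abs_circle_fun u) \<le> Lp_norm p ?x + e"
        using e by (intro Lp_norm_bound_const[OF p1(1) xL]) auto
      then have "C * Lp_norm p (abs_circle_fun u) \<le> C * (Lp_norm p ?x + e)"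
        using C(1) by (intro mult_left_mono)
      then show ?thesis using C(2)[OF u(1-3)] by simp
    qed
    have b1: "Lp_norm p (ana (abs_circle_fun g)) \<le> C * (Lp_norm p ?x + e)"
      by (rule bound) (use g gb in auto)
    have b2: "Lp_norm p (ana (abs_circle_fun k)) \<le> C * (Lp_norm p ?x + e)"
      by (rule bound) (use k kr gb in auto)
    have "?x = abs_circle_fun g - abs_circle_fun k"
      unfolding circle_fun_eq_iff
      using rvf[OF f(1)] rvf[OF g(1)] rvf[OF k] rv_diff[of "abs_circle_fun g" "abs_circle_fun k"]
      by eventually_elim (simp add: k_def)
    then have "ana ?x = ana (abs_circle_fun g) - ana (abs_circle_fun k)"
      using ana_diff[OF abs_trig_poly_mem[OF g(1)] abs_trig_poly_mem[OF k]] by simp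
    then have "Lp_norm p (ana ?x) \<le> Lp_norm p (ana (abs_circle_fun g)) + Lp_norm p (ana (abs_circle_fun k))"
      using Lp_norm_triangle_diff[OF p1(1), of "ana (abs_circle_fun g)" 0 "ana (abs_circle_fun k)"] p1
      by (simp add: ana_Lp Lp_0 Lp_norm_uminus)
    then show ?thesis using b1 b2 by simp
  qed
  show ?thesis
  proof (rule field_le_epsilon)
    fix e :: real assume e: "e > 0"
    have "Lp_norm p (ana ?x) \<le> 2 * C * (Lp_norm p ?x + e / (2 * C + 1))"
      using e C(1) by (intro le) auto
    also have "2 * C * (e / (2 * C + 1)) \<le> e"
      using e C(1) by (simp add: pos_divide_le_eq)
    then have "2 * C * (Lp_norm p ?x + e / (2 * C + 1)) \<le> 2 * C * Lp_norm p ?x + e"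
      by (simp add: distrib_left)
    finally show "Lp_norm p (ana ?x) \<le> 2 * C * Lp_norm p ?x + e" .
  qed
qed

lemma trig_poly_cnj:
  assumes "trig_poly f"
  shows "\<exists>g. trig_poly g \<and> (\<forall>t. norm t = 1 \<longrightarrow> g t = cnj (f t))"
  using assms
proof (induction rule: trig_poly.induct)
  case (trig_poly_mono c k)
  have "cnj c * t powi (- k) = cnj (c * t powi k)" if "norm t = 1" for t
  proof -
    have "t * cnj t = 1" using that complex_norm_square[of t] by simp
    then have "cnj t = inverse t" by (metis inverse_unique)
    then show ?thesis by (simp add: power_int_minus power_int_inverse)
  qed
  then show ?case using trig_poly.trig_poly_mono[of "cnj c" "- k"] by blast
next
  case (trig_poly_add f g)
  then obtain f' g' where "trig_poly f'" "\<forall>t. norm t = 1 \<longrightarrow> f' t = cnj (f t)"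
    "trig_poly g'" "\<forall>t. norm t = 1 \<longrightarrow> g' t = cnj (g t)" by blast
  then show ?case by (intro exI[of _ "\<lambda>t. f' t + g' t"]) (auto intro: trig_poly.trig_poly_add)
qed

lemma ana_bounded_small:
  assumes p: "1 < p" "p \<le> 2"
  obtains C where "0 \<le> C" "\<And>x. x \<in> trig_polys \<Longrightarrow> Lp_norm p (ana x) \<le> C * Lp_norm p x"
proof -
  obtain A B where AB: "0 \<le> A" "0 \<le> B"
    "\<And>w. 0 < Re w \<Longrightarrow> \<bar>Im w\<bar> powr p \<le> A * Re w powr p - B * Re (exp (of_real p * Ln w))"
    using Im_powr_le[OF p] by blast
  define D where "D = 2 + A powr (1/p)"
  have D: "0 \<le> D" by (simp add: D_def)
  have p1: "1 \<le> p" "0 \<le> p" "0 < p" using p by auto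
  show ?thesis
  proof (rule that[of "4 * D"])
    fix x assume x: "x \<in> trig_polys"
    obtain f where f: "trig_poly f" "x = abs_circle_fun f" by (rule trig_polys_obtain[OF x])
    obtain g where g: "trig_poly g" "\<And>t. norm t = 1 \<Longrightarrow> g t = cnj (f t)" using trig_poly_cnj[OF f(1)] by blast
    \<comment> \<open>Real and imaginary part of f on the circle; g replaces the conjugate of f,
      which as a function on the plane is not of the required form.\<close>
    define u where "u t = (1/2) * f t + (1/2) * g t" for t
    define v where "v t = (-\<i>/2) * f t + (\<i>/2) * g t" for t
    have uv: "trig_poly u" "trig_poly v"
      unfolding u_def v_def by (intro trig_poly_add trig_poly_cmult f(1) g(1))+
    have val: "u t = of_real (Re (f t))" "v t = of_real (Im (f t))" if "norm t = 1" for t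
      using g(2)[OF that] by (simp_all add: u_def v_def complex_eq_iff field_simps)
    have rvf: "AE t in circle_measure. rv (abs_circle_fun g) t = g t" if "trig_poly g" for g
      by (rule rv_abs[OF borel_measurable_trig_poly[OF that]])
    have xL: "x \<in> Lp p" using x p1 by (simp add: trig_polys_Lp)
    have b: "Lp_norm p (ana (abs_circle_fun w)) \<le> 2 * D * Lp_norm p x"
      if w: "trig_poly w" "\<And>t. norm t = 1 \<Longrightarrow> w t \<in> \<real>" "\<And>t. norm t = 1 \<Longrightarrow> norm (w t) \<le> norm (f t)" for w
    proof -
      have "Lp_norm p (ana (abs_circle_fun w)) \<le> 2 * D * Lp_norm p (abs_circle_fun w)"
        unfolding D_def using p AB w
        by (intro riesz_real riesz_positive[OF p AB]) auto
      also have "Lp_norm p (abs_circle_fun w) \<le> Lp_norm p x"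
      proof (rule Lp_norm_mono(2)[OF p1(1) xL])
        show "AE t in circle_measure. norm (rv (abs_circle_fun w) t) \<le> norm (rv x t)"
          using rvf[OF w(1)] rvf[OF f(1)] AE_circle_norm unfolding f(2)
          by eventually_elim (use w(3) in auto)
      qed
      finally show ?thesis using D by (simp add: mult_left_mono)
    qed
    have "x = abs_circle_fun u + cscale \<i> (abs_circle_fun v)"
      unfolding circle_fun_eq_iff unfolding f(2)
      using rvf[OF f(1)] rvf[OF uv(1)] rvf[OF uv(2)] AE_circle_norm
        rv_add[of "abs_circle_fun u" "cscale \<i> (abs_circle_fun v)"] rv_cscale[of \<i> "abs_circle_fun v"]
      by eventually_elim (simp add: val complex_eq_iff)
    then have "ana x = ana (abs_circle_fun u) + cscale \<i> (ana (abs_circle_fun v))"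
      using abs_trig_poly_mem[OF uv(1)] abs_trig_poly_mem[OF uv(2)]
      by (simp add: ana_add ana_cscale circle_fun.subspace_scale[OF subspace_trig_polys])
    then have "Lp_norm p (ana x) \<le> Lp_norm p (ana (abs_circle_fun u)) + Lp_norm p (ana (abs_circle_fun v))"
      using Lp_norm_triangle[OF p1(1), of "ana (abs_circle_fun u)" "cscale \<i> (ana (abs_circle_fun v))"] p1
      by (simp add: ana_Lp Lp_cscale Lp_norm_cscale)
    moreover have "Lp_norm p (ana (abs_circle_fun u)) \<le> 2 * D * Lp_norm p x"
      by (rule b[OF uv(1)]) (auto simp: val abs_Re_le_cmod)
    moreover have "Lp_norm p (ana (abs_circle_fun v)) \<le> 2 * D * Lp_norm p x"
      by (rule b[OF uv(2)]) (auto simp: val abs_Im_le_cmod)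
    ultimately show "Lp_norm p (ana x) \<le> 4 * D * Lp_norm p x" by simp
  qed (use D in auto)
qed

lemma trig_polys_expand:
  assumes "x \<in> trig_polys"
  shows "x = trig_sum (fourier x) {k. fourier x k \<noteq> 0}" "finite {k. fourier x k \<noteq> 0}"
proof -
  show fin: "finite {k. fourier x k \<noteq> 0}" using assms by (simp add: trig_polys_iff)
  show "x = trig_sum (fourier x) {k. fourier x k \<noteq> 0}"
    using assms fin by (intro circle_fun_eq_fourier) (auto simp: trig_sum_Lp fourier_trig_sum trig_polys_Lp)
qed

lemma cscale_mult: "cscale z f * g = cscale z (f * g)"
  using mult_cscale[of g z f] by (simp add: mult.commute)

lemma fourier_trig_polys_mult:
  assumes x: "x \<in> trig_polys" and y: "y \<in> Lp 1"
  shows "fourier (x * y) j = (\<Sum>k | fourier x k \<noteq> 0. fourier x k * fourier y (j - k))"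
proof -
  have "x * y = (\<Sum>k | fourier x k \<noteq> 0. cscale (fourier x k) (tt powi k * y))"
    by (subst trig_polys_expand(1)[OF x]) (simp add: trig_sum_def sum_distrib_right cscale_mult)
  then show ?thesis
    using y by (simp add: fourier_sum fourier_cscale fourier_tt_powi_mult Lp_cscale Lp_tt_powi_mult)
qed

lemma tilde_trig_polys: "x \<in> trig_polys \<Longrightarrow> tilde x \<in> trig_polys"
proof -
  assume x: "x \<in> trig_polys"
  have "{k. fourier (tilde x) k \<noteq> 0} = uminus ` {k. fourier x k \<noteq> 0}"
    by (force simp: fourier_tilde)
  then show ?thesis using x by (simp add: trig_polys_iff Lp_tilde)
qed

text \<open>The pairing couples the coefficients k and -k. The transpose of \<open>ana\<close> is
  therefore \<open>ana\<close> conjugated by \<open>tilde\<close>.\<close>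

lemma fourier_ana_mult:
  assumes x: "x \<in> trig_polys" and y: "y \<in> trig_polys"
  shows "fourier (ana x * y) 0 = fourier (x * tilde (ana (tilde y))) 0"
proof -
  have L: "y \<in> Lp 1" "tilde (ana (tilde y)) \<in> Lp 1"
    using x y by (auto simp: trig_polys_Lp ana_Lp Lp_tilde)
  have "fourier (ana x * y) 0 = (\<Sum>k | fourier (ana x) k \<noteq> 0. fourier (ana x) k * fourier y (0 - k))"
    by (rule fourier_trig_polys_mult[OF ana_trig_polys[OF x] L(1)])
  also have "\<dots> = (\<Sum>k | fourier x k \<noteq> 0. fourier x k * fourier (tilde (ana (tilde y))) (0 - k))"
    by (rule sum.mono_neutral_cong_left)
       (use trig_polys_expand(2)[OF x] in \<open>auto simp: fourier_ana[OF x] fourier_tilde fourier_ana[OF tilde_trig_polys[OF y]] split: if_splits\<close>)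
  also have "\<dots> = fourier (x * tilde (ana (tilde y))) 0"
    by (rule fourier_trig_polys_mult[OF x L(2), symmetric])
  finally show ?thesis .
qed

text \<open>Exponents above 2 follow by duality from their conjugates below 2. The analytic part h
  is tested with its extremal function in L^q, replaced by a nearby trigonometric polynomial so that
  \<open>ana\<close> can be transposed onto it. The result bounds the p-th power of the norm of h by
  its (p - 1)-st power, which is then divided out.\<close>

lemma ana_bounded:
  assumes p: "1 < p"
  obtains C where "0 \<le> C" "\<And>x. x \<in> trig_polys \<Longrightarrow> Lp_norm p (ana x) \<le> C * Lp_norm p x"
proof (cases "p \<le> 2")
  case True
  then show ?thesis using ana_bounded_small[OF p True] that by blast
next
  case False
  define q where "q = p / (p - 1)"
  have pq: "1/p + 1/q = 1" "1/q + 1/p = 1" "1 < q" "q \<le> 2" using p False by (auto simp: q_def field_simps)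
  obtain C where C: "0 \<le> C" "\<And>x. x \<in> trig_polys \<Longrightarrow> Lp_norm q (ana x) \<le> C * Lp_norm q x"
    using ana_bounded_small[OF pq(3,4)] by blast
  have p1: "1 \<le> p" "0 \<le> p" "0 < p" and q1: "1 \<le> q" "0 \<le> q" using p pq by auto
  show ?thesis
  proof (rule that[OF C(1)])
    fix x assume x: "x \<in> trig_polys"
    define h where "h = ana x"
    have hL: "h \<in> Lp p" and xL: "x \<in> Lp p" using x p1 by (auto simp: h_def ana_Lp trig_polys_Lp)
    note dh = dual_fun_Lp[OF p pq(1) hL]
    let ?h = "Lp_norm p h" and ?x = "Lp_norm p x"
    have le: "?h powr p \<le> C * ?x * ?h powr (p - 1) + e * (?h + C * ?x)" if e: "e > 0" for e
    proof -
      obtain y where y: "y \<in> trig_polys" "Lp_norm q (dual_fun p h - y) < e"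
        by (rule trig_polys_dense[OF pq(3) dh(1) e])
      have yL: "y \<in> Lp q" using y q1 by (simp add: trig_polys_Lp)
      have dyL: "dual_fun p h - y \<in> Lp q" using dh(1) yL q1 by (simp add: Lp_diff)
      have "Lp_norm q y \<le> Lp_norm q (dual_fun p h) + e"
        using Lp_norm_triangle_diff[OF q1(1) yL dh(1) Lp_0] y(2) Lp_norm_minus_commute[of q y "dual_fun p h"] by simp
      then have ny: "Lp_norm q y \<le> ?h powr (p - 1) + e" using dh(3) by simp
      have hdL: "h * dual_fun p h \<in> Lp 1" "h * y \<in> Lp 1" "h * (dual_fun p h - y) \<in> Lp 1"
        using Lp_mult_Holder(1)[OF p pq(1) hL] dh(1) yL dyL by auto
      have "of_real (?h powr p) = fourier (h * dual_fun p h) 0" using dh(2) by (simp add: mult.commute)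
      also have "\<dots> = fourier (h * (dual_fun p h - y)) 0 + fourier (h * y) 0"
        using fourier_add[OF hdL(3,2), of 0] by (simp add: algebra_simps)
      finally have "?h powr p \<le> norm (fourier (h * (dual_fun p h - y)) 0) + norm (fourier (h * y) 0)"
        by (metis abs_of_nonneg norm_of_real norm_triangle_ineq powr_ge_zero)
      also have "norm (fourier (h * (dual_fun p h - y)) 0) \<le> ?h * Lp_norm q (dual_fun p h - y)"
        by (rule Lp_mult_Holder(2)[OF p pq(1) hL dyL])
      also have "\<dots> \<le> ?h * e" using y(2) by (intro mult_left_mono) auto
      also have "norm (fourier (h * y) 0) \<le> ?x * (C * (?h powr (p - 1) + e))"
      proof -
        let ?z = "ana (tilde y)"
        have "norm (fourier (h * y) 0) \<le> ?x * Lp_norm q (tilde ?z)"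
          unfolding h_def fourier_ana_mult[OF x y(1)] using q1
          by (intro Lp_mult_Holder(2)[OF p pq(1) xL] Lp_tilde ana_Lp) auto
        also have "Lp_norm q (tilde ?z) \<le> C * Lp_norm q y"
          using C(2)[OF tilde_trig_polys[OF y(1)]] by (simp add: Lp_norm_tilde)
        also have "\<dots> \<le> C * (?h powr (p - 1) + e)" using ny C(1) by (rule mult_left_mono)
        finally show ?thesis by (simp add: mult_left_mono)
      qed
      finally show ?thesis by (simp add: algebra_simps)
    qed
    have "?h powr p \<le> C * ?x * ?h powr (p - 1)"
    proof (rule field_le_epsilon)
      fix e :: real assume e: "e > 0"
      let ?K = "?h + C * ?x"
      have K: "0 \<le> ?K" using C(1) by simp
      have "?h powr p \<le> C * ?x * ?h powr (p - 1) + e / (?K + 1) * ?K"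
        using e K by (intro le) (auto intro!: divide_pos_pos)
      also have "e / (?K + 1) * ?K \<le> e" using e K by (simp add: pos_divide_le_eq add_nonneg_pos)
      finally show "?h powr p \<le> C * ?x * ?h powr (p - 1) + e" by simp
    qed
    then show "Lp_norm p (ana x) \<le> C * Lp_norm p x"
    proof (cases "?h = 0")
      case False
      then have hp: "?h > 0" using Lp_norm_nonneg[of p h] by linarith
      then have "?h powr p = ?h * ?h powr (p - 1)" using powr_add[of ?h 1 "p - 1"] by simp
      with \<open>?h powr p \<le> _\<close> have "?h * ?h powr (p - 1) \<le> C * ?x * ?h powr (p - 1)" by simp
      then show ?thesis using hp by (simp add: h_def)
    qed (use C in \<open>simp add: h_def\<close>)
  qed
qed

subsection \<open>Hardy spaces and the Riesz projection\<close>

lemma Hp_Lp: "f \<in> Hp p \<Longrightarrow> f \<in> Lp p" and fourier_Hp: "f \<in> Hp p \<Longrightarrow> k < 0 \<Longrightarrow> fourier f k = 0"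
  by (auto simp: Hp_def)

lemma fourier_tendsto:
  assumes p: "1 < p" and f: "\<And>n. f n \<in> Lp p" and g: "g \<in> Lp p"
    and lim: "(\<lambda>n. Lp_norm p (f n - g)) \<longlonglongrightarrow> 0"
  shows "(\<lambda>n. fourier (f n) k) \<longlonglongrightarrow> fourier g k"
proof -
  have b: "norm (fourier (f n) k - fourier g k) \<le> Lp_norm p (f n - g)" for n
  proof -
    have "fourier (f n) k - fourier g k = fourier (f n - g) k"
      using fourier_diff[OF Lp_subset_L1[OF p f] Lp_subset_L1[OF p g]] by simp
    then show ?thesis using norm_fourier_le[OF p Lp_diff[OF f g]] p by simp
  qed
  have "(\<lambda>n. fourier (f n) k - fourier g k) \<longlonglongrightarrow> 0"
    by (rule Lim_null_comparison[OF _ lim]) (intro always_eventually allI b)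
  then show ?thesis by (rule LIM_zero_cancel)
qed

text \<open>The definite description in \<open>riesz\<close> needs a function with the prescribed
  coefficients. It is the limit of \<open>ana\<close> along approximating trigonometric polynomials;
  coefficients and norm bound pass to the limit.\<close>

lemma riesz_exists:
  assumes p: "1 < p"
  obtains C where "0 \<le> C" "\<And>f. f \<in> Lp p \<Longrightarrow>
    \<exists>g\<in>Hp p. (\<forall>k\<ge>0. fourier g k = fourier f k) \<and> Lp_norm p g \<le> C * Lp_norm p f"
proof -
  obtain C where C: "0 \<le> C" "\<And>x. x \<in> trig_polys \<Longrightarrow> Lp_norm p (ana x) \<le> C * Lp_norm p x"
    using ana_bounded[OF p] by metis
  have p1: "1 \<le> p" "0 \<le> p" using p by auto
  show ?thesis
  proof (rule that[OF C(1)])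
    fix f assume f: "f \<in> Lp p"
    have "\<exists>x\<in>trig_polys. Lp_norm p (f - x) < 1 / real (Suc n)" for n
      by (rule trig_polys_dense[OF p f, of "1 / real (Suc n)"]) auto
    then obtain x where x: "\<And>n. x n \<in> trig_polys" "\<And>n. Lp_norm p (f - x n) < 1 / real (Suc n)" by metis
    have xL: "x n \<in> Lp p" for n using x p1 by (simp add: trig_polys_Lp)
    have aL: "ana (x n) \<in> Lp p" for n using p1 by (simp add: ana_Lp)
    have lim0: "(\<lambda>n. 1 / real (Suc n)) \<longlonglongrightarrow> 0" by (rule lim_const_over_n[of 1, THEN LIMSEQ_Suc])
    have limx: "(\<lambda>n. Lp_norm p (x n - f)) \<longlonglongrightarrow> 0"
      by (rule tendsto_sandwich[OF _ _ tendsto_const lim0])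
         (use x(2) in \<open>auto simp: Lp_norm_minus_commute[of p _ f] intro!: always_eventually less_imp_le\<close>)
    have Cauchy: "\<exists>N. \<forall>m\<ge>N. \<forall>n\<ge>N. Lp_norm p (ana (x m) - ana (x n)) < e" if e: "e > 0" for e
    proof -
      define d where "d = e / (C + 1)"
      have d: "d > 0" "(C + 1) * d = e" using e C(1) by (auto simp: d_def)
      then obtain N where N: "\<And>n. n \<ge> N \<Longrightarrow> Lp_norm p (x n - f) < d / 2"
        using LIMSEQ_D[OF limx half_gt_zero[OF d(1)]] by auto
      have "Lp_norm p (ana (x m) - ana (x n)) < e" if "m \<ge> N" "n \<ge> N" for m n
      proof -
        have "Lp_norm p (ana (x m) - ana (x n)) \<le> C * Lp_norm p (x m - x n)"
          using C(2)[of "x m - x n"] x(1) by (simp add: ana_diff circle_fun.subspace_diff[OF subspace_trig_polys])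
        also have "\<dots> \<le> (C + 1) * Lp_norm p (x m - x n)" by (intro mult_right_mono) auto
        also have "Lp_norm p (x m - x n) \<le> Lp_norm p (x m - f) + Lp_norm p (f - x n)"
          by (rule Lp_norm_triangle_diff[OF p1(1) xL f xL])
        also have "\<dots> < d"
          using N[OF that(1)] N[OF that(2)] Lp_norm_minus_commute[of p f "x n"] by linarith
        finally show ?thesis using C(1) d(2) by (simp add: mult_strict_left_mono)
      qed
      then show ?thesis by blast
    qed
    obtain g where g: "g \<in> Lp p" "(\<lambda>n. Lp_norm p (ana (x n) - g)) \<longlonglongrightarrow> 0"
      by (rule Lp_complete[OF p1(1) aL Cauchy])
    have fg: "fourier g k = (if 0 \<le> k then fourier f k else 0)" for k
    proof (rule LIMSEQ_unique)
      show "(\<lambda>n. fourier (ana (x n)) k) \<longlonglongrightarrow> fourier g k" by (rule fourier_tendsto[OF p aL g])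
      show "(\<lambda>n. fourier (ana (x n)) k) \<longlonglongrightarrow> (if 0 \<le> k then fourier f k else 0)"
        using fourier_tendsto[OF p xL f limx, of k] by (simp add: fourier_ana[OF x(1)])
    qed
    have "Lp_norm p g \<le> C * Lp_norm p f"
    proof (rule LIMSEQ_le)
      show "(\<lambda>n. Lp_norm p (ana (x n))) \<longlonglongrightarrow> Lp_norm p g" by (rule Lp_norm_tendsto[OF p1(1) aL g])
      show "(\<lambda>n. C * Lp_norm p (x n)) \<longlonglongrightarrow> C * Lp_norm p f"
        by (intro tendsto_mult_left Lp_norm_tendsto[OF p1(1) xL f limx])
    qed (use C(2)[OF x(1)] in auto)
    then show "\<exists>g\<in>Hp p. (\<forall>k\<ge>0. fourier g k = fourier f k) \<and> Lp_norm p g \<le> C * Lp_norm p f"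
      using g(1) fg by (intro bexI[of _ g]) (auto simp: Hp_def)
  qed
qed

lemma Hp_eqI:
  assumes p: "1 < p" and f: "f \<in> Hp p" and g: "g \<in> Hp p" and eq: "\<And>k. 0 \<le> k \<Longrightarrow> fourier f k = fourier g k"
  shows "f = g"
proof (rule circle_fun_eq_fourier)
  show "f \<in> Lp 1" "g \<in> Lp 1" using f g by (auto intro: Lp_subset_L1[OF p] Hp_Lp)
  show "fourier f k = fourier g k" for k
    using eq[of k] fourier_Hp[OF f, of k] fourier_Hp[OF g, of k] by (cases "0 \<le> k") auto
qed

lemma riesz_eqI:
  assumes p: "1 < p" and g: "g \<in> Hp p" "\<And>k. 0 \<le> k \<Longrightarrow> fourier g k = fourier f k"
  shows "riesz p f = g"
  unfolding riesz_def
proof (rule the_equality)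
  fix h assume "h \<in> Hp p \<and> (\<forall>k\<ge>0. fourier h k = fourier f k)"
  then show "h = g" using g by (intro Hp_eqI[OF p]) auto
qed (use g in auto)

lemma riesz_Hp:
  assumes p: "1 < p" and f: "f \<in> Lp p"
  shows "riesz p f \<in> Hp p" and fourier_riesz: "fourier (riesz p f) k = (if 0 \<le> k then fourier f k else 0)"
proof -
  obtain C where "\<And>f. f \<in> Lp p \<Longrightarrow>
    \<exists>g\<in>Hp p. (\<forall>k\<ge>0. fourier g k = fourier f k) \<and> Lp_norm p g \<le> C * Lp_norm p f"
    using riesz_exists[OF p] by metis
  then obtain g where g: "g \<in> Hp p" "\<forall>k\<ge>0. fourier g k = fourier f k" using f by blast
  then have "riesz p f = g" by (intro riesz_eqI[OF p]) auto
  then show "riesz p f \<in> Hp p" "fourier (riesz p f) k = (if 0 \<le> k then fourier f k else 0)"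
    using g fourier_Hp[OF g(1), of k] by auto
qed

lemma riesz_bounded:
  assumes p: "1 < p"
  obtains C where "0 \<le> C" "\<And>f. f \<in> Lp p \<Longrightarrow> Lp_norm p (riesz p f) \<le> C * Lp_norm p f"
proof -
  obtain C where C: "0 \<le> C" "\<And>f. f \<in> Lp p \<Longrightarrow>
    \<exists>g\<in>Hp p. (\<forall>k\<ge>0. fourier g k = fourier f k) \<and> Lp_norm p g \<le> C * Lp_norm p f"
    using riesz_exists[OF p] by metis
  show ?thesis
  proof (rule that[OF C(1)])
    fix f assume "f \<in> Lp p"
    then obtain g where g: "g \<in> Hp p" "\<forall>k\<ge>0. fourier g k = fourier f k" "Lp_norm p g \<le> C * Lp_norm p f" using C(2) by blast
    then have "riesz p f = g" by (intro riesz_eqI[OF p]) auto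
    then show "Lp_norm p (riesz p f) \<le> C * Lp_norm p f" using g by simp
  qed
qed

lemma riesz_ident: "1 < p \<Longrightarrow> f \<in> Hp p \<Longrightarrow> riesz p f = f"
  by (intro riesz_eqI) auto

lemma subspace_Hp:
  assumes p: "1 < p"
  shows "circle_fun.subspace (Hp p)"
proof (rule circle_fun.subspaceI)
  show "0 \<in> Hp p" by (simp add: Hp_def Lp_0)
  show "x + y \<in> Hp p" if "x \<in> Hp p" "y \<in> Hp p" for x y
    using that p Lp_subset_L1[OF p] by (auto simp: Hp_def Lp_add fourier_add)
  show "cscale z x \<in> Hp p" if "x \<in> Hp p" for x z
    using that by (auto simp: Hp_def Lp_cscale fourier_cscale)
qed

lemmas Hp_add = circle_fun.subspace_add[OF subspace_Hp]
lemmas Hp_diff = circle_fun.subspace_diff[OF subspace_Hp]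
lemmas Hp_cscale = circle_fun.subspace_scale[OF subspace_Hp]
lemmas Hp_0 = circle_fun.subspace_0[OF subspace_Hp]
lemmas Hp_sum = circle_fun.subspace_sum[OF subspace_Hp]

lemma riesz_add:
  assumes p: "1 < p" and f: "f \<in> Lp p" and g: "g \<in> Lp p"
  shows "riesz p (f + g) = riesz p f + riesz p g"
  using Lp_subset_L1[OF p] f g riesz_Hp(1)[OF p f] riesz_Hp(1)[OF p g]
  by (intro riesz_eqI[OF p] Hp_add) (auto simp: fourier_add fourier_riesz p Hp_Lp)

lemma riesz_cscale:
  assumes p: "1 < p" and f: "f \<in> Lp p"
  shows "riesz p (cscale z f) = cscale z (riesz p f)"
  using riesz_Hp(1)[OF p f] by (intro riesz_eqI[OF p] Hp_cscale) (auto simp: fourier_cscale fourier_riesz p f)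

lemma Hp_closed:
  assumes p: "1 < p" and f: "\<And>n. f n \<in> Hp p" and g: "g \<in> Lp p" and lim: "(\<lambda>n. Lp_norm p (f n - g)) \<longlonglongrightarrow> 0"
  shows "g \<in> Hp p"
proof -
  have "fourier g k = 0" if "k < 0" for k
    using fourier_tendsto[OF p Hp_Lp[OF f] g lim, of k] fourier_Hp[OF f that] by (simp add: LIMSEQ_const_iff)
  then show ?thesis using g by (simp add: Hp_def)
qed

text \<open>For a polynomial factor the coefficients of the product are finite sums in which every
  term vanishes. In general f is approximated by analytic polynomials, and Hoelder's inequality
  makes the error small.\<close>

lemma Hp_mult_fourier:
  assumes pq: "1 < p" "1/p + 1/q = 1" and f: "f \<in> Hp p" and g: "g \<in> Hp q"
  shows "k < 0 \<Longrightarrow> fourier (f * g) k = 0"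
proof -
  assume k: "k < 0"
  have q: "1 < q" by (rule conjugate_exponent[OF pq])
  have fL: "f \<in> Lp p" and gL: "g \<in> Lp q" using f g by (auto intro: Hp_Lp)
  obtain C where C: "0 \<le> C" "\<And>f. f \<in> Lp p \<Longrightarrow> Lp_norm p (riesz p f) \<le> C * Lp_norm p f"
    using riesz_bounded[OF pq(1)] by metis
  have le: "norm (fourier (f * g) k) \<le> e * (C * Lp_norm q g)" if e: "e > 0" for e
  proof -
    obtain x where x: "x \<in> trig_polys" "Lp_norm p (f - x) < e" by (rule trig_polys_dense[OF pq(1) fL e])
    have xL: "x \<in> Lp p" using x pq by (simp add: trig_polys_Lp)
    define y where "y = ana x"
    have yT: "y \<in> trig_polys" unfolding y_def by (rule ana_trig_polys[OF x(1)])
    have yH: "y \<in> Hp p" using pq by (auto simp: y_def Hp_def ana_Lp fourier_ana[OF x(1)])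
    \<comment> \<open>The approximant x need not be analytic. Its analytic part y remains close to f
      because f is fixed by the bounded Riesz projection.\<close>
    have "riesz p (f - x) = f - y"
      using Lp_subset_L1[OF pq(1)] fL xL Hp_Lp[OF yH]
      by (intro riesz_eqI[OF pq(1)] Hp_diff[OF pq(1) f yH]) (simp add: fourier_diff y_def fourier_ana[OF x(1)])
    then have "Lp_norm p (f - y) \<le> C * Lp_norm p (f - x)" using C(2)[OF Lp_diff[OF fL xL]] pq by simp
    also have "\<dots> \<le> C * e" using x(2) C(1) by (intro mult_left_mono) auto
    finally have n: "Lp_norm p (f - y) \<le> C * e" .
    have L1: "f * g \<in> Lp 1" "y * g \<in> Lp 1" "(f - y) * g \<in> Lp 1"
      using Lp_mult_Holder(1)[OF pq _ gL] fL Hp_Lp[OF yH] pq by (auto simp: Lp_diff)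
    have "fourier (y * g) k = 0"
      unfolding fourier_trig_polys_mult[OF yT Lp_subset_L1[OF q gL]]
      using k by (intro sum.neutral) (auto simp: y_def fourier_ana[OF x(1)] fourier_Hp[OF g] split: if_splits)
    then have "fourier (f * g) k = fourier ((f - y) * g) k"
      using fourier_add[OF L1(3,2), of k] by (simp add: algebra_simps)
    also have "\<dots> = fourier ((f - y) * (tt powi (- k) * g)) 0"
      using fourier_tt_powi_mult[of "- k" "(f - y) * g" 0] by (simp add: mult_ac)
    also have "norm \<dots> \<le> Lp_norm p (f - y) * Lp_norm q (tt powi (- k) * g)"
      using fL Hp_Lp[OF yH] gL pq q by (intro Lp_mult_Holder(2)[OF pq]) (auto intro!: Lp_diff Lp_tt_powi_mult)
    also have "\<dots> \<le> C * e * Lp_norm q g" unfolding Lp_norm_tt_powi_mult using n by (intro mult_right_mono) auto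
    finally show ?thesis by (simp add: mult_ac)
  qed
  have "norm (fourier (f * g) k) \<le> 0"
  proof (rule field_le_epsilon)
    fix e :: real assume e: "e > 0"
    let ?K = "C * Lp_norm q g"
    have K: "0 \<le> ?K" using C(1) by simp
    have "norm (fourier (f * g) k) \<le> e / (?K + 1) * ?K" using e K by (intro le) auto
    also have "\<dots> \<le> e" using e K by (simp add: pos_divide_le_eq add_nonneg_pos)
    finally show "norm (fourier (f * g) k) \<le> 0 + e" by simp
  qed
  then show "fourier (f * g) k = 0" by simp
qed

lemma Hp_tt_powi_mult: "1 < p \<Longrightarrow> f \<in> Hp p \<Longrightarrow> 0 \<le> k \<Longrightarrow> tt powi k * f \<in> Hp p"
  by (auto simp: Hp_def Lp_tt_powi_mult fourier_tt_powi_mult)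

lemma Hp_divide_tt_powi:
  assumes p: "1 < p" and f: "f \<in> Lp p" "\<And>j. j < k \<Longrightarrow> fourier f j = 0"
  shows "tt powi (- k) * f \<in> Hp p"
  using assms by (auto simp: Hp_def Lp_tt_powi_mult fourier_tt_powi_mult)

lemma Hp_mult_fourier_0:
  assumes pq: "1 < p" "1/p + 1/q = 1" and f: "f \<in> Hp p" and g: "g \<in> Hp q"
  shows "fourier (f * g) 0 = fourier f 0 * fourier g 0"
proof -
  have fL: "f \<in> Lp p" and gL: "g \<in> Lp q" using f g by (auto intro: Hp_Lp)
  have q: "1 < q" by (rule conjugate_exponent[OF pq])
  \<comment> \<open>Without its constant term f is t times a function in H^p, so this part of the
    product has mean zero.\<close>
  define h where "h = f - cscale (fourier f 0) 1"
  have hL: "h \<in> Lp p" unfolding h_def using fL pq by (auto intro!: Lp_diff Lp_cscale one_mem_Lp)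
  have one: "fourier 1 k = (if k = 0 then 1 else 0)" for k using fourier_tt_powi[of 0 k] by simp
  have "fourier h j = 0" if "j < 1" for j
    unfolding h_def using that fourier_Hp[OF f, of j]
    by (subst fourier_diff) (auto simp: fourier_cscale one intro!: Lp_subset_L1[OF pq(1) fL] Lp_cscale one_mem_Lp)
  then have k: "tt powi (-1) * h \<in> Hp p" using Hp_divide_tt_powi[OF pq(1) hL, of 1] by simp
  have "fourier (h * g) 0 = fourier ((tt powi (-1) * h) * g) (-1)"
    using fourier_tt_powi_mult[of "-1" "h * g" "-1"] by (simp add: mult_ac)
  also have "\<dots> = 0" by (rule Hp_mult_fourier[OF pq k g]) simp
  finally have h0: "fourier (h * g) 0 = 0" .
  have "f * g = cscale (fourier f 0) g + h * g"
    unfolding h_def left_diff_distrib cscale_mult by simp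
  then show ?thesis
    using h0 fourier_add[of "cscale (fourier f 0) g" "h * g" 0] Lp_mult_Holder(1)[OF pq hL gL] Lp_subset_L1[OF q gL]
    by (simp add: fourier_cscale Lp_cscale)
qed

subsection \<open>Dimensions of quotients and the algebraic index\<close>

text \<open>A relation, so that finiteness and the value are asserted together. With U = {0} it is
  the ordinary dimension, and one notion serves kernels and cokernels.\<close>

definition qdim :: "('k::field \<Rightarrow> 'v::ab_group_add \<Rightarrow> 'v) \<Rightarrow> 'v set \<Rightarrow> 'v set \<Rightarrow> nat \<Rightarrow> bool" where
  "qdim s V U k \<longleftrightarrow> (\<exists>B. quotient_basis s V U B \<and> card B = k)"

context vector_space
begin

lemma quotient_basisI:
  assumes U: "subspace U" and fin: "finite B" "B \<subseteq> V" and ex: "\<And>v. v \<in> V \<Longrightarrow> \<exists>x. v - (\<Sum>w\<in>B. scale (x w) w) \<in> U"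
    and un: "\<And>x w. (\<Sum>w\<in>B. scale (x w) w) \<in> U \<Longrightarrow> w \<in> B \<Longrightarrow> x w = 0"
  shows "quotient_basis scale V U B"
proof -
  have cut: "(\<Sum>w\<in>B. scale (if w \<in> B then x w else 0) w) = (\<Sum>w\<in>B. scale (x w) w)" for x
    by (rule sum.cong) auto
  have ex1: "\<exists>!x. (\<forall>w. w \<notin> B \<longrightarrow> x w = 0) \<and> v - (\<Sum>w\<in>B. scale (x w) w) \<in> U" if v: "v \<in> V" for v
  proof -
    obtain x where x: "v - (\<Sum>w\<in>B. scale (x w) w) \<in> U" using ex[OF v] by blast
    show ?thesis
    proof (rule ex1I[of _ "\<lambda>w. if w \<in> B then x w else 0"])
      show "(\<forall>w. w \<notin> B \<longrightarrow> (if w \<in> B then x w else 0) = 0) \<and> v - (\<Sum>w\<in>B. scale (if w \<in> B then x w else 0) w) \<in> U"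
        using x by (simp add: cut)
    next
      fix y assume y: "(\<forall>w. w \<notin> B \<longrightarrow> y w = 0) \<and> v - (\<Sum>w\<in>B. scale (y w) w) \<in> U"
      have "(v - (\<Sum>w\<in>B. scale (x w) w)) - (v - (\<Sum>w\<in>B. scale (y w) w)) \<in> U"
        using subspace_diff[OF U x] y by blast
      also have "(v - (\<Sum>w\<in>B. scale (x w) w)) - (v - (\<Sum>w\<in>B. scale (y w) w)) = (\<Sum>w\<in>B. scale (y w - x w) w)"
        by (simp add: scale_left_diff_distrib sum_subtractf)
      finally have "(\<Sum>w\<in>B. scale (y w - x w) w) \<in> U" .
      then have "y w - x w = 0" if "w \<in> B" for w using un[of "\<lambda>w. y w - x w" w] that by blast
      then show "y = (\<lambda>w. if w \<in> B then x w else 0)" using y by (auto simp: fun_eq_iff)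
    qed
  qed
  show ?thesis unfolding quotient_basis_def by (intro conjI ballI fin ex1)
qed

lemma quotient_basisD:
  assumes q: "quotient_basis scale V U B" and U: "subspace U" and V: "V \<noteq> {}"
  shows "finite B" "B \<subseteq> V" "\<And>v. v \<in> V \<Longrightarrow> \<exists>x. v - (\<Sum>w\<in>B. scale (x w) w) \<in> U"
    "\<And>x w. (\<Sum>w\<in>B. scale (x w) w) \<in> U \<Longrightarrow> w \<in> B \<Longrightarrow> x w = 0"
proof -
  show "finite B" "B \<subseteq> V" using q by (auto simp: quotient_basis_def)
  show "\<exists>x. v - (\<Sum>w\<in>B. scale (x w) w) \<in> U" if "v \<in> V" for v
    using q that unfolding quotient_basis_def by blast
  have cut: "(\<Sum>w\<in>B. scale (if w \<in> B then x w else 0) w) = (\<Sum>w\<in>B. scale (x w) w)" for x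
    by (rule sum.cong) auto
  \<comment> \<open>Uniqueness of coordinates is given for vectors of V only, so independence modulo
    U is obtained by perturbing the coordinates of one such vector. For an empty V nothing would
    follow.\<close>
  obtain v where v: "v \<in> V" using V by blast
  have "\<exists>!x. (\<forall>w. w \<notin> B \<longrightarrow> x w = 0) \<and> v - (\<Sum>w\<in>B. scale (x w) w) \<in> U"
    using q v unfolding quotient_basis_def by blast
  then obtain x0 where x0: "\<forall>w. w \<notin> B \<longrightarrow> x0 w = 0" "v - (\<Sum>w\<in>B. scale (x0 w) w) \<in> U"
    and un: "\<And>x. (\<forall>w. w \<notin> B \<longrightarrow> x w = 0) \<Longrightarrow> v - (\<Sum>w\<in>B. scale (x w) w) \<in> U \<Longrightarrow> x = x0"
    by (auto elim!: ex1E)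
  show "x w = 0" if x: "(\<Sum>w\<in>B. scale (x w) w) \<in> U" and w: "w \<in> B" for x w
  proof -
    let ?y = "\<lambda>w. x0 w + (if w \<in> B then x w else 0)"
    have "v - (\<Sum>w\<in>B. scale (?y w) w) = (v - (\<Sum>w\<in>B. scale (x0 w) w)) - (\<Sum>w\<in>B. scale (x w) w)"
      by (simp add: scale_left_distrib sum.distrib cut)
    also have "\<dots> \<in> U" by (rule subspace_diff[OF U x0(2) x])
    finally have "?y = x0" using x0 by (intro un) auto
    then have "?y w = x0 w" by (rule fun_cong)
    then show ?thesis using w by simp
  qed
qed

text \<open>Steinitz exchange modulo U: replacing each element of C by its B-combination modulo U
  preserves independence and lands in the span of B.\<close>

lemma quotient_basis_card_le:
  assumes U: "subspace U" and V: "V \<noteq> {}" and B: "quotient_basis scale V U B" and C: "quotient_basis scale V U C"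
  shows "card C \<le> card B"
proof -
  note B = quotient_basisD[OF B U V] and C = quotient_basisD[OF C U V]
  have "\<forall>c\<in>C. \<exists>x. c - (\<Sum>w\<in>B. scale (x w) w) \<in> U" using B(3) C(2) by blast
  then obtain m where m: "\<And>c. c \<in> C \<Longrightarrow> c - (\<Sum>w\<in>B. scale (m c w) w) \<in> U" by metis
  define f where "f c = (\<Sum>w\<in>B. scale (m c w) w)" for c
  have rel: "\<forall>c\<in>C. y c = 0" if "(\<Sum>c\<in>C. scale (y c) (f c)) = 0" for y
  proof -
    have "(\<Sum>c\<in>C. scale (y c) (c - f c)) \<in> U"
      using m U by (intro subspace_sum subspace_scale) (auto simp: f_def)
    also have "(\<Sum>c\<in>C. scale (y c) (c - f c)) = (\<Sum>c\<in>C. scale (y c) c)"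
      using that by (simp add: scale_right_diff_distrib sum_subtractf)
    finally show ?thesis using C(4) by blast
  qed
  have inj: "inj_on f C"
  proof (rule inj_onI, rule ccontr)
    fix c d assume cd: "c \<in> C" "d \<in> C" "f c = f d" "c \<noteq> d"
    let ?y = "\<lambda>x. if x = c then 1 else if x = d then -1 else 0"
    have "(\<Sum>x\<in>C. scale (?y x) (f x)) = (\<Sum>x\<in>{c, d}. scale (?y x) (f x))"
      using cd C(1) by (intro sum.mono_neutral_right) auto
    also have "\<dots> = 0" using cd by simp
    finally show False using rel[of ?y] cd(1) by auto
  qed
  have "independent (f ` C)"
  proof
    assume "dependent (f ` C)"
    then obtain u where u: "\<exists>v\<in>f ` C. u v \<noteq> 0" "(\<Sum>v\<in>f ` C. scale (u v) v) = 0"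
      using C(1) by (auto simp: dependent_finite)
    have "(\<Sum>c\<in>C. scale (u (f c)) (f c)) = 0" using u(2) by (simp add: sum.reindex[OF inj])
    then show False using rel[of "\<lambda>c. u (f c)"] u(1) by auto
  qed
  moreover have "f ` C \<subseteq> span B" unfolding f_def by (intro image_subsetI span_sum span_scale span_base)
  ultimately have "card (f ` C) \<le> card B" using B(1) independent_span_bound by blast
  then show ?thesis by (simp add: card_image[OF inj])
qed

lemma qdim_unique:
  assumes "subspace U" "V \<noteq> {}" "qdim scale V U k" "qdim scale V U l"
  shows "k = l"
  using assms quotient_basis_card_le[OF assms(1,2)] unfolding qdim_def by (metis antisym)

lemma quotient_edim_eq:
  assumes "subspace U" "V \<noteq> {}" "qdim scale V U k"
  shows "quotient_edim scale V U = enat k"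
proof -
  have "(THE k. \<exists>B. quotient_basis scale V U B \<and> card B = k) = k"
    using assms qdim_unique[OF assms(1,2)] unfolding qdim_def by (intro the_equality) auto
  then show ?thesis using assms(3) unfolding quotient_edim_def qdim_def by auto
qed

lemma quotient_edim_finite:
  assumes "quotient_edim scale V U \<noteq> \<infinity>"
  obtains k where "qdim scale V U k"
  using assms unfolding quotient_edim_def qdim_def by (metis (no_types, lifting))

lemma basis_qdim:
  assumes "independent B" "finite B"
  shows "qdim scale (span B) {0} (card B)"
proof -
  have "quotient_basis scale (span B) {0} B"
  proof (rule quotient_basisI)
    fix v assume "v \<in> span B"
    then show "\<exists>x. v - (\<Sum>w\<in>B. scale (x w) w) \<in> {0}" using assms by (auto simp: span_finite)
  next
    fix x w assume "(\<Sum>w\<in>B. scale (x w) w) \<in> {0}" "w \<in> B"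
    then show "x w = 0" using assms by (auto simp: dependent_finite)
  qed (use assms in \<open>auto intro: span_base\<close>)
  then show ?thesis unfolding qdim_def by blast
qed

lemma qdim_0_basis:
  assumes "subspace V" "qdim scale V {0} k"
  obtains B where "independent B" "finite B" "span B = V" "card B = k"
proof -
  obtain B where B: "quotient_basis scale V {0} B" "card B = k" using assms by (auto simp: qdim_def)
  have V: "V \<noteq> {}" using subspace_0[OF assms(1)] by auto
  note D = quotient_basisD[OF B(1) _ V]
  show ?thesis
  proof (rule that)
    show "independent B"
    proof
      assume "dependent B"
      then obtain u where u: "\<exists>v\<in>B. u v \<noteq> 0" "(\<Sum>v\<in>B. scale (u v) v) = 0"
        using D(1) by (auto simp: dependent_finite)
      then show False using D(4)[of u] by auto
    qed
    show "span B = V"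
    proof
      show "span B \<subseteq> V" using D(2) assms(1) by (intro span_minimal) auto
      show "V \<subseteq> span B"
      proof
        fix v assume "v \<in> V"
        then obtain x where "v = (\<Sum>w\<in>B. scale (x w) w)" using D(3) by fastforce
        then show "v \<in> span B" by (simp add: span_sum span_scale span_base)
      qed
    qed
  qed (use B D in auto)
qed

lemma edim_eq:
  assumes "subspace V" "qdim scale V {0} k"
  shows "edim scale V = enat k"
proof -
  obtain B where B: "independent B" "finite B" "span B = V" "card B = k" by (rule qdim_0_basis[OF assms])
  have "dim V = k" using dim_eq_card[of B V] B assms(1) span_eq_iff by metis
  moreover have "\<exists>B. finite B \<and> V \<subseteq> span B" using B by auto
  ultimately show ?thesis by (simp add: edim_def)
qed

lemma qdim_0_exists:
  assumes "subspace V" "V \<subseteq> span F" "finite F"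
  obtains k where "qdim scale V {0} k"
proof -
  obtain B where B: "B \<subseteq> V" "independent B" "V \<subseteq> span B" using maximal_independent_subset[of V] by blast
  have fin: "finite B" using independent_span_bound[OF assms(3) B(2)] B(1) assms(2) by auto
  have "span B = V" using B(1,3) span_minimal[OF B(1) assms(1)] by auto
  then show ?thesis using basis_qdim[OF B(2) fin] that by metis
qed

lemma edim_finite:
  assumes "subspace V" "edim scale V \<noteq> \<infinity>"
  obtains k where "qdim scale V {0} k"
proof -
  obtain F where "finite F" "V \<subseteq> span F" using assms(2) by (auto simp: edim_def split: if_splits)
  then show ?thesis using qdim_0_exists[OF assms(1)] that by blast
qed

lemma subspace_add_span: "subspace U \<Longrightarrow> subspace {u + scale c x |u c. u \<in> U}"
proof (rule subspaceI)
  assume U: "subspace U"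
  show "0 \<in> {u + scale c x |u c. u \<in> U}" using subspace_0[OF U] by (auto intro!: exI[of _ 0])
  fix y assume y: "y \<in> {u + scale c x |u c. u \<in> U}"
  then obtain u c where uc: "y = u + scale c x" "u \<in> U" by blast
  show "scale z y \<in> {u + scale c x |u c. u \<in> U}" for z
    using uc subspace_scale[OF U uc(2), of z] by (auto simp: scale_right_distrib intro!: exI[of _ "scale z u"] exI[of _ "z * c"])
  fix y' assume y': "y' \<in> {u + scale c x |u c. u \<in> U}"
  then obtain u' c' where uc': "y' = u' + scale c' x" "u' \<in> U" by blast
  show "y + y' \<in> {u + scale c x |u c. u \<in> U}"
    using uc uc' subspace_add[OF U uc(2) uc'(2)]
    by (auto simp: scale_left_distrib add_ac intro!: exI[of _ "u + u'"] exI[of _ "c + c'"])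
qed

text \<open>One new direction in the subspace lowers the codimension by one. Together with
  \<open>qdim_extend\<close> this is the counting step for a single shift.\<close>

lemma qdim_insert:
  assumes U: "subspace U" and V: "subspace V" and x: "x \<in> V" "x \<notin> U"
    and q: "qdim scale V {u + scale c x |u c. u \<in> U} k"
  shows "qdim scale V U (Suc k)"
proof -
  let ?U = "{u + scale c x |u c. u \<in> U}"
  have sU: "subspace ?U" by (rule subspace_add_span[OF U])
  have Vn: "V \<noteq> {}" using x by auto
  obtain B where B: "quotient_basis scale V ?U B" "card B = k" using q by (auto simp: qdim_def)
  note D = quotient_basisD[OF B(1) sU Vn]
  have xU: "x \<in> ?U" using subspace_0[OF U] by (auto intro!: exI[of _ 0] exI[of _ 1])
  have xB: "x \<notin> B"
  proof
    assume xB: "x \<in> B"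
    have "(\<Sum>w\<in>B. scale (if w = x then 1 else 0) w) = (\<Sum>w\<in>{x}. scale (if w = x then 1 else 0) w)"
      using xB D(1) by (intro sum.mono_neutral_right) auto
    then have "(\<Sum>w\<in>B. scale (if w = x then 1 else 0) w) \<in> ?U" using xU by simp
    from D(4)[OF this xB] show False by simp
  qed
  have "quotient_basis scale V U (insert x B)"
  proof (rule quotient_basisI[OF U])
    show "finite (insert x B)" "insert x B \<subseteq> V" using D x by auto
    fix v assume "v \<in> V"
    then obtain y where "v - (\<Sum>w\<in>B. scale (y w) w) \<in> ?U" using D(3) by blast
    then obtain u c where u: "v - (\<Sum>w\<in>B. scale (y w) w) = u + scale c x" "u \<in> U" by blast
    have "(\<Sum>w\<in>B. scale ((y(x := c)) w) w) = (\<Sum>w\<in>B. scale (y w) w)"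
      by (rule sum.cong) (use xB in auto)
    then have "v - (\<Sum>w\<in>insert x B. scale ((y(x := c)) w) w) = u"
      using u(1) D(1) xB by (simp add: algebra_simps)
    then show "\<exists>y. v - (\<Sum>w\<in>insert x B. scale (y w) w) \<in> U" using u(2) by metis
  next
    fix y w assume y: "(\<Sum>w\<in>insert x B. scale (y w) w) \<in> U" and w: "w \<in> insert x B"
    have e: "(\<Sum>w\<in>B. scale (y w) w) = (\<Sum>w\<in>insert x B. scale (y w) w) + scale (- y x) x"
      using D(1) xB by simp
    then have "(\<Sum>w\<in>B. scale (y w) w) \<in> ?U" using y by blast
    then have y0: "\<And>w. w \<in> B \<Longrightarrow> y w = 0" using D(4) by blast
    then have "(\<Sum>w\<in>B. scale (y w) w) = 0" by simp
    then have "scale (y x) x \<in> U" using y D(1) xB by simp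
    moreover have "y x = 0"
    proof (rule ccontr)
      assume "y x \<noteq> 0"
      then have "scale (inverse (y x)) (scale (y x) x) \<in> U" using \<open>scale (y x) x \<in> U\<close> subspace_scale[OF U] by blast
      then show False using \<open>y x \<noteq> 0\<close> x(2) by simp
    qed
    ultimately show "y w = 0" using w y0 by auto
  qed
  then show ?thesis unfolding qdim_def using B(2) D(1) xB by (intro exI[of _ "insert x B"]) auto
qed

text \<open>The vectors of F are absorbed into U one at a time: each either lies in U already or
  accounts for exactly one dimension of the quotient.\<close>

lemma qdim_exists:
  assumes U: "subspace U" and V: "subspace V" "U \<subseteq> V" and F: "finite F" "F \<subseteq> V"
    "\<And>v. v \<in> V \<Longrightarrow> \<exists>b\<in>span F. v - b \<in> U"
  obtains k where "qdim scale V U k"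
proof -
  have "\<exists>k. qdim scale V U k" using F(1) U V F(2,3)
  proof (induction F arbitrary: U rule: finite_induct)
    case empty
    have "quotient_basis scale V U {}" using empty by (intro quotient_basisI) auto
    then show ?case unfolding qdim_def by blast
  next
    case (insert x F)
    let ?U = "{u + scale c x |u c. u \<in> U}"
    have sU: "subspace ?U" by (rule subspace_add_span[OF insert.prems(1)])
    have UU: "?U \<subseteq> V"
    proof
      fix y assume "y \<in> ?U"
      then show "y \<in> V" using insert.prems by (auto intro!: subspace_add subspace_scale)
    qed
    have "\<exists>k. qdim scale V ?U k"
    proof (rule insert.IH[OF sU insert.prems(2) UU])
      fix v assume "v \<in> V"
      then obtain b where b: "b \<in> span (insert x F)" "v - b \<in> U" using insert.prems by blast
      then obtain c where c: "b - scale c x \<in> span F" by (auto simp: span_insert)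
      have "v - (b - scale c x) = (v - b) + scale c x" by simp
      then show "\<exists>b\<in>span F. v - b \<in> ?U" using b(2) c by (intro bexI[of _ "b - scale c x"]) blast
    qed (use insert.prems in auto)
    then obtain k where k: "qdim scale V ?U k" by blast
    show ?case
    proof (cases "x \<in> U")
      case True
      have "?U = U"
      proof
        show "?U \<subseteq> U" using True insert.prems(1) by (auto intro!: subspace_add subspace_scale)
        show "U \<subseteq> ?U"
        proof
          fix u assume "u \<in> U"
          then have "u + scale 0 x \<in> ?U" by blast
          then show "u \<in> ?U" by simp
        qed
      qed
      then show ?thesis using k by auto
    next
      case False
      then show ?thesis using qdim_insert[OF insert.prems(1,2) _ False k] insert.prems by auto
    qed
  qed
  then show ?thesis using that by blast
qed

lemma qdim_remove:
  assumes U: "subspace U" and V: "subspace V" "U \<subseteq> V" and x: "x \<in> V" "x \<notin> U" and q: "qdim scale V U l"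
  obtains k where "l = Suc k" "qdim scale V {u + scale c x |u c. u \<in> U} k"
proof -
  let ?U = "{u + scale c x |u c. u \<in> U}"
  have sU: "subspace ?U" by (rule subspace_add_span[OF U])
  have Vn: "V \<noteq> {}" using x by auto
  have UU: "?U \<subseteq> V"
  proof
    fix y assume "y \<in> ?U"
    then show "y \<in> V" using V x by (auto intro!: subspace_add subspace_scale)
  qed
  obtain B where B: "quotient_basis scale V U B" using q by (auto simp: qdim_def)
  note D = quotient_basisD[OF B U Vn]
  obtain k where k: "qdim scale V ?U k"
  proof (rule qdim_exists[OF sU V(1) UU D(1,2)])
    fix v assume "v \<in> V"
    then obtain y where "v - (\<Sum>w\<in>B. scale (y w) w) \<in> U" using D(3) by blast
    then have "v - (\<Sum>w\<in>B. scale (y w) w) + scale 0 x \<in> ?U" by blast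
    then show "\<exists>b\<in>span B. v - b \<in> ?U"
      by (intro bexI[of _ "\<Sum>w\<in>B. scale (y w) w"]) (auto simp: span_sum span_scale span_base)
  qed
  have "l = Suc k" by (rule qdim_unique[OF U Vn q qdim_insert[OF U V(1) x k]])
  then show ?thesis using k by (rule that)
qed

lemma qdim_extend:
  assumes V: "subspace V" and x: "x \<notin> V" and q: "qdim scale V {0} k"
  shows "qdim scale {v + scale c x |v c. v \<in> V} {0} (Suc k)"
proof -
  obtain B where B: "independent B" "finite B" "span B = V" "card B = k" by (rule qdim_0_basis[OF V q])
  have "independent (insert x B)" using B x by (simp add: independent_insertI)
  moreover have "span (insert x B) = {v + scale c x |v c. v \<in> V}"
  proof -
    have "y \<in> span (insert x B) \<longleftrightarrow> y \<in> {v + scale c x |v c. v \<in> V}" for y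
    proof
      assume "y \<in> span (insert x B)"
      then obtain c where "y - scale c x \<in> V" using B(3) by (auto simp: span_insert)
      then show "y \<in> {v + scale c x |v c. v \<in> V}" by (intro CollectI exI[of _ "y - scale c x"] exI[of _ c]) simp
    next
      assume "y \<in> {v + scale c x |v c. v \<in> V}"
      then obtain v c where "y = v + scale c x" "v \<in> span B" using B(3) by blast
      then show "y \<in> span (insert x B)" by (auto simp: span_insert intro!: exI[of _ c])
    qed
    then show ?thesis by blast
  qed
  moreover have "x \<notin> B" using x B(3) span_base by blast
  ultimately show ?thesis using basis_qdim[of "insert x B"] B by simp
qed

text \<open>The map f induces an isomorphism of V/U onto V'/U', because it is onto V' and U is the
  full preimage of U' in V. On V itself f may have a kernel.\<close>

lemma qdim_transport:
  assumes U: "subspace U" "subspace U'" "V \<noteq> {}" and V: "subspace V"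
    and f: "\<And>v w. v \<in> V \<Longrightarrow> w \<in> V \<Longrightarrow> f (v + w) = f v + f w" "\<And>c v. v \<in> V \<Longrightarrow> f (scale c v) = scale c (f v)"
    and onto: "f ` V = V'" and pre: "\<And>v. v \<in> V \<Longrightarrow> f v \<in> U' \<longleftrightarrow> v \<in> U" and q: "qdim scale V U k"
  shows "qdim scale V' U' k"
proof -
  obtain B where B: "quotient_basis scale V U B" "card B = k" using q by (auto simp: qdim_def)
  note D = quotient_basisD[OF B(1) U(1,3)]
  have f0: "f 0 = 0" using f(2)[OF subspace_0[OF V], of 0] by simp
  have fs: "f (\<Sum>w\<in>C. scale (y w) w) = (\<Sum>w\<in>C. scale (y w) (f w))" if "C \<subseteq> B" for C y
    using finite_subset[OF that D(1)] that
  proof (induction C rule: finite_induct)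
    case (insert w C)
    have "f (scale (y w) w + (\<Sum>w\<in>C. scale (y w) w)) = f (scale (y w) w) + f (\<Sum>w\<in>C. scale (y w) w)"
      using insert.prems D(2) V by (intro f(1) subspace_scale subspace_sum) auto
    then show ?case using insert f(2)[of w "y w"] D(2) by auto
  qed (simp add: f0)
  have inV: "(\<Sum>w\<in>B. scale (y w) w) \<in> V" for y
    using D(2) V by (intro subspace_sum subspace_scale) auto
  have fd: "f (v - w) = f v - f w" if "v \<in> V" "w \<in> V" for v w
    using f(1)[of "v - w" w] that V by (simp add: subspace_diff)
  have inj: "inj_on f B"
  proof (rule inj_onI, rule ccontr)
    fix c d assume cd: "c \<in> B" "d \<in> B" "f c = f d" "c \<noteq> d"
    let ?y = "\<lambda>x. if x = c then 1 else if x = d then -1 else 0"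
    have "(\<Sum>x\<in>B. scale (?y x) x) = (\<Sum>x\<in>{c, d}. scale (?y x) x)"
      using cd D(1) by (intro sum.mono_neutral_right) auto
    also have "\<dots> = c - d" using cd by simp
    finally have s: "(\<Sum>x\<in>B. scale (?y x) x) = c - d" .
    have "f (c - d) = 0" using cd D(2) by (subst fd) auto
    then have "c - d \<in> U" using pre[of "c - d"] subspace_0[OF U(2)] cd D(2) V by (auto intro: subspace_diff)
    then have "(\<Sum>x\<in>B. scale (?y x) x) \<in> U" using s by simp
    from D(4)[OF this cd(1)] show False by simp
  qed
  have "quotient_basis scale V' U' (f ` B)"
  proof (rule quotient_basisI[OF U(2)])
    show "finite (f ` B)" "f ` B \<subseteq> V'" using D onto by auto
    fix v' assume "v' \<in> V'"
    then obtain v where v: "v' = f v" "v \<in> V" using onto by blast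
    then obtain y where y: "v - (\<Sum>w\<in>B. scale (y w) w) \<in> U" using D(3) by blast
    then have "f (v - (\<Sum>w\<in>B. scale (y w) w)) \<in> U'" using pre inV v V by (auto intro: subspace_diff)
    then have "v' - (\<Sum>w\<in>B. scale (y w) (f w)) \<in> U'" using fd[OF v(2) inV] fs[of B y] v by simp
    moreover have "(\<Sum>w\<in>f ` B. scale (y (the_inv_into B f w)) w) = (\<Sum>w\<in>B. scale (y w) (f w))"
      by (simp add: sum.reindex[OF inj] the_inv_into_f_f[OF inj])
    ultimately show "\<exists>x. v' - (\<Sum>w\<in>f ` B. scale (x w) w) \<in> U'"
      by (intro exI[of _ "\<lambda>w. y (the_inv_into B f w)"]) simp
  next
    fix x w assume x: "(\<Sum>w\<in>f ` B. scale (x w) w) \<in> U'" and w: "w \<in> f ` B"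
    have "f (\<Sum>w\<in>B. scale (x (f w)) w) \<in> U'" using x fs[of B "\<lambda>w. x (f w)"] by (simp add: sum.reindex[OF inj])
    then have "(\<Sum>w\<in>B. scale (x (f w)) w) \<in> U" using pre[OF inV, of "\<lambda>w. x (f w)"] by simp
    then show "x w = 0" using D(4)[of "\<lambda>w. x (f w)"] w by auto
  qed
  then show ?thesis unfolding qdim_def using B(2) card_image[OF inj] by blast
qed

lemma qdim_mono:
  assumes "subspace V" "subspace W" "V \<subseteq> W" "qdim scale V {0} k" "qdim scale W {0} l"
  shows "k \<le> l"
proof -
  obtain B where B: "independent B" "finite B" "span B = V" "card B = k" by (rule qdim_0_basis[OF assms(1,4)])
  obtain C where C: "independent C" "finite C" "span C = W" "card C = l" by (rule qdim_0_basis[OF assms(2,5)])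
  have "B \<subseteq> span C" using span_superset[of B] B(3) C(3) assms(3) by blast
  then show ?thesis using independent_span_bound[OF C(2) B(1)] B(4) C(4) by simp
qed

lemma qdim_0_eqI:
  assumes V: "subspace V" "subspace W" "V \<subseteq> W" "qdim scale V {0} k" "qdim scale W {0} k"
  shows "V = W"
proof (rule ccontr)
  assume "V \<noteq> W"
  then obtain x where x: "x \<in> W" "x \<notin> V" using V(3) by blast
  have "{v + scale c x |v c. v \<in> V} \<subseteq> W" using V(2,3) x(1) by (auto intro!: subspace_add subspace_scale)
  from qdim_mono[OF subspace_add_span[OF V(1)] V(2) this qdim_extend[OF V(1) x(2) V(4)] V(5)] show False by simp
qed

lemma subspace_image_on:
  assumes V: "subspace V" and f: "\<And>v w. v \<in> V \<Longrightarrow> w \<in> V \<Longrightarrow> f (v + w) = f v + f w"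
    "\<And>c v. v \<in> V \<Longrightarrow> f (scale c v) = scale c (f v)"
  shows "subspace (f ` V)"
proof (rule subspaceI)
  have "f 0 = 0" using f(2)[OF subspace_0[OF V], of 0] by simp
  then show "0 \<in> f ` V" using subspace_0[OF V] by (metis imageI)
  show "x + y \<in> f ` V" if xy: "x \<in> f ` V" "y \<in> f ` V" for x y
  proof -
    obtain v w where "x = f v" "v \<in> V" "y = f w" "w \<in> V" using xy by blast
    then show ?thesis using f(1) subspace_add[OF V] by (metis imageI)
  qed
  show "scale c x \<in> f ` V" if x: "x \<in> f ` V" for c x
  proof -
    obtain v where "x = f v" "v \<in> V" using x by blast
    then show ?thesis using f(2) subspace_scale[OF V] by (metis imageI)
  qed
qed

lemma qdim_injective_image:
  assumes V: "subspace V" and f: "\<And>v w. v \<in> V \<Longrightarrow> w \<in> V \<Longrightarrow> f (v + w) = f v + f w"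
    "\<And>c v. v \<in> V \<Longrightarrow> f (scale c v) = scale c (f v)" "\<And>v. v \<in> V \<Longrightarrow> f v = 0 \<Longrightarrow> v = 0"
    and q: "qdim scale V {0} k"
  shows "qdim scale (f ` V) {0} k"
proof (rule qdim_transport[OF subspace_single_0 subspace_single_0 _ V f(1,2) refl _ q])
  show "V \<noteq> {}" using subspace_0[OF V] by blast
  have "f 0 = 0" using f(2)[OF subspace_0[OF V], of 0] by simp
  then show "f v \<in> {0} \<longleftrightarrow> v \<in> {0}" if "v \<in> V" for v using f(3)[OF that] by auto
qed

end

subsection \<open>Bounded coordinates modulo the range of a bounded operator\<close>

lemma bounded_opD:
  assumes "bounded_op p A"
  shows "f \<in> Hp p \<Longrightarrow> A f \<in> Hp p" "f \<in> Hp p \<Longrightarrow> g \<in> Hp p \<Longrightarrow> A (f + g) = A f + A g"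
    "f \<in> Hp p \<Longrightarrow> A (cscale z f) = cscale z (A f)"
  using assms unfolding bounded_op_def by blast+

text \<open>The open mapping argument: Baire category provides approximate preimages of controlled
  size, and iteration turns them into exact ones.\<close>

lemma bounded_coordinates_exist:
  assumes p: "1 < p" and A: "bounded_op p A" and B: "finite B" "B \<subseteq> Hp p"
    and cov: "\<And>v. v \<in> Hp p \<Longrightarrow> \<exists>x. v - (\<Sum>w\<in>B. cscale (x w) w) \<in> A ` Hp p"
  obtains C where "0 \<le> C" "\<And>g. g \<in> Hp p \<Longrightarrow> \<exists>x. g - (\<Sum>w\<in>B. cscale (x w) w) \<in> A ` Hp p \<and>
    (\<forall>w\<in>B. norm (x w) \<le> C * Lp_norm p g)"
proof -
  define H where "H = Hp p"
  let ?N = "Lp_norm p"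
  have p1: "1 \<le> p" "0 < p" "0 \<le> p" using p by auto
  have HL: "f \<in> Lp p" if "f \<in> H" for f using that by (simp add: H_def Hp_Lp)
  have sH: "circle_fun.subspace H" unfolding H_def by (rule subspace_Hp[OF p])
  note Hadd = circle_fun.subspace_add[OF sH] and Hdiff = circle_fun.subspace_diff[OF sH]
    and Hsc = circle_fun.subspace_scale[OF sH] and Hsum = circle_fun.subspace_sum[OF sH] and H0 = circle_fun.subspace_0[OF sH]
  have AH: "A f \<in> H" "A (cscale z f) = cscale z (A f)" if "f \<in> H" for f z
    using bounded_opD[OF A] that by (auto simp: H_def)
  have Aadd: "A (f + g) = A f + A g" if "f \<in> H" "g \<in> H" for f g
    using bounded_opD[OF A] that by (auto simp: H_def)
  have Adiff: "A (f - g) = A f - A g" if "f \<in> H" "g \<in> H" for f g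
    using Aadd[OF Hdiff[OF that] that(2)] by simp
  obtain K0 where K0: "\<And>f. f \<in> H \<Longrightarrow> ?N (A f) \<le> K0 * ?N f" using A unfolding bounded_op_def H_def by blast
  define S where "S x = (\<Sum>w\<in>B. cscale (x w) w)" for x
  have SH: "S x \<in> H" for x unfolding S_def using B by (intro Hsum Hsc) (auto simp: H_def)
  have Sdiff: "S x - S y = S (\<lambda>w. x w - y w)" for x y
    by (simp add: S_def circle_fun.scale_left_diff_distrib sum_subtractf)
  have Sadd: "S x + S y = S (\<lambda>w. x w + y w)" for x y
    by (simp add: S_def circle_fun.scale_left_distrib sum.distrib)
  have Ssc: "cscale z (S x) = S (\<lambda>w. z * x w)" for x z
    by (simp add: S_def circle_fun.scale_sum_right)
  define d where "d f g = ?N (f - g)" for f g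
  interpret m: Metric_space H d
  proof
    show "0 \<le> d x y" for x y by (simp add: d_def)
    show "d x y = d y x" for x y by (simp add: d_def Lp_norm_minus_commute)
    show "(d x y = 0) = (x = y)" if "x \<in> H" "y \<in> H" for x y
      using Lp_norm_eq_0_iff[OF p1(2) HL[OF Hdiff[OF that]]] by (simp add: d_def)
    show "d x z \<le> d x y + d y z" if "x \<in> H" "y \<in> H" "z \<in> H" for x y z
      unfolding d_def using that by (intro Lp_norm_triangle_diff[OF p1(1)] HL)
  qed
  have complete: "m.mcomplete"
    unfolding m.mcomplete_def
  proof (intro allI impI)
    fix \<sigma> :: "nat \<Rightarrow> circle_fun" assume "m.MCauchy \<sigma>"
    then have r: "range \<sigma> \<subseteq> H" and c: "\<And>e. e > 0 \<Longrightarrow> \<exists>N. \<forall>n n'. N \<le> n \<longrightarrow> N \<le> n' \<longrightarrow> d (\<sigma> n) (\<sigma> n') < e"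
      by (auto simp: m.MCauchy_def)
    have sL: "\<sigma> n \<in> Lp p" for n using r HL by auto
    have c': "\<exists>N. \<forall>m\<ge>N. \<forall>n\<ge>N. ?N (\<sigma> m - \<sigma> n) < e" if "e > 0" for e
      using c[OF that] unfolding d_def by blast
    obtain g where g: "g \<in> Lp p" "(\<lambda>n. ?N (\<sigma> n - g)) \<longlonglongrightarrow> 0" by (rule Lp_complete[OF p1(1) sL c'])
    have "g \<in> H" unfolding H_def by (rule Hp_closed[OF p _ g]) (use r H_def in auto)
    moreover have "\<forall>\<^sub>F n in sequentially. \<sigma> n \<in> H \<and> d (\<sigma> n) g < e" if "e > 0" for e
      using order_tendstoD(2)[OF g(2) that] by eventually_elim (use r in \<open>auto simp: d_def\<close>)
    ultimately have "limitin m.mtopology \<sigma> g sequentially"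
      unfolding m.limitin_metric by blast
    then show "\<exists>x. limitin m.mtopology \<sigma> x sequentially" by blast
  qed
  \<comment> \<open>Vectors with a preimage and coordinates bounded by j. They exhaust the space, so
    Baire's theorem gives one whose closure has interior.\<close>
  define E where "E j = {v. \<exists>f x. f \<in> H \<and> ?N f \<le> real j \<and> (\<forall>w\<in>B. norm (x w) \<le> real j) \<and> v = A f + S x}" for j :: nat
  have EH: "E j \<subseteq> H" for j unfolding E_def using AH(1) SH Hadd by auto
  have un: "(\<Union>j. E j) = H"
  proof
    show "H \<subseteq> (\<Union>j. E j)"
    proof
      fix v assume "v \<in> H"
      then obtain x f where "v - S x = A f" "f \<in> H" using cov unfolding S_def H_def by blast
      then have v: "v = A f + S x" by (simp add: algebra_simps)
      obtain j :: nat where j: "Max (insert (?N f) ((\<lambda>w. norm (x w)) ` B)) \<le> real j" using real_arch_simple by blast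
      then have "?N f \<le> real j" "\<forall>w\<in>B. norm (x w) \<le> real j" using B(1) by auto
      then show "v \<in> (\<Union>j. E j)" unfolding E_def using v \<open>f \<in> H\<close> by blast
    qed
  qed (use EH in auto)
  have "\<exists>j. m.mtopology interior_of (m.mtopology closure_of (E j)) \<noteq> {}"
  proof (rule ccontr)
    assume "\<not> ?thesis"
    then have "m.mtopology interior_of (\<Union> (range (\<lambda>j. m.mtopology closure_of (E j)))) = {}"
      by (intro m.metric_Baire_category_alt complete) auto
    moreover have "(\<Union>j. m.mtopology closure_of (E j)) = H"
    proof
      show "(\<Union>j. m.mtopology closure_of (E j)) \<subseteq> H"
        using closure_of_subset_topspace[of m.mtopology] by auto
      show "H \<subseteq> (\<Union>j. m.mtopology closure_of (E j))"
      proof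
        fix v assume "v \<in> H"
        then obtain i where "v \<in> E i" using un by blast
        moreover have "E i \<subseteq> m.mtopology closure_of (E i)" using EH by (intro closure_of_subset) simp
        ultimately show "v \<in> (\<Union>j. m.mtopology closure_of (E j))" by blast
      qed
    qed
    ultimately have "m.mtopology interior_of topspace m.mtopology = {}" by simp
    then have "H = {}" using interior_of_topspace[of m.mtopology] by simp
    then show False using H0 by auto
  qed
  then obtain j v0 where v0: "v0 \<in> m.mtopology interior_of (m.mtopology closure_of (E j))" by blast
  then obtain e where e: "e > 0" "m.mball v0 e \<subseteq> m.mtopology interior_of (m.mtopology closure_of (E j))" "v0 \<in> H"
    using openin_interior_of[of m.mtopology "m.mtopology closure_of (E j)"] unfolding m.openin_mtopology by blast
  have ball: "v \<in> m.mtopology closure_of (E j)" if "v \<in> H" "d v0 v < e" for v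
  proof -
    have "v \<in> m.mball v0 e" using that e(3) by simp
    then show ?thesis using e(2) interior_of_subset[of m.mtopology "m.mtopology closure_of (E j)"] by blast
  qed
  \<comment> \<open>Subtracting approximations of the centre and of the centre plus g moves the ball
    to the origin; the bounds j add up to 2 j.\<close>
  have app: "\<exists>f x. f \<in> H \<and> ?N f \<le> 2 * real j \<and> (\<forall>w\<in>B. norm (x w) \<le> 2 * real j) \<and> ?N (g - (A f + S x)) < \<eta>"
    if g: "g \<in> H" "?N g < e" and \<eta>: "\<eta> > 0" for g \<eta>
  proof -
    have "v0 + g \<in> m.mtopology closure_of (E j)" "v0 \<in> m.mtopology closure_of (E j)"
      using g e(1,3) Lp_norm_uminus[of p g] p1 by (auto intro!: ball Hadd simp: d_def)
    then obtain e1 e2 where e12: "e1 \<in> E j" "d (v0 + g) e1 < \<eta>/2" "e2 \<in> E j" "d v0 e2 < \<eta>/2"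
      using half_gt_zero[OF \<eta>] unfolding m.metric_closure_of m.in_mball by blast
    then obtain f1 x1 f2 x2 where f: "f1 \<in> H" "?N f1 \<le> real j" "\<forall>w\<in>B. norm (x1 w) \<le> real j" "e1 = A f1 + S x1"
      "f2 \<in> H" "?N f2 \<le> real j" "\<forall>w\<in>B. norm (x2 w) \<le> real j" "e2 = A f2 + S x2" unfolding E_def by blast
    have "?N (f1 - f2) \<le> 2 * real j"
      using Lp_norm_triangle_diff[OF p1(1) HL[OF f(1)] Lp_0 HL[OF f(5)]] f by (simp add: Lp_norm_uminus)
    moreover have "\<forall>w\<in>B. norm (x1 w - x2 w) \<le> 2 * real j"
    proof
      fix w assume "w \<in> B"
      then have "norm (x1 w) \<le> real j" "norm (x2 w) \<le> real j" using f by auto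
      then show "norm (x1 w - x2 w) \<le> 2 * real j" using norm_triangle_ineq4[of "x1 w" "x2 w"] by linarith
    qed
    moreover have "?N (g - (A (f1 - f2) + S (\<lambda>w. x1 w - x2 w))) < \<eta>"
    proof -
      have eq: "g - (A (f1 - f2) + S (\<lambda>w. x1 w - x2 w)) = ((v0 + g) - e1) + (e2 - v0)"
        using f Adiff[of f1 f2] Sdiff[of x1 x2] by (simp add: algebra_simps)
      have "?N (((v0 + g) - e1) + (e2 - v0)) \<le> ?N ((v0 + g) - e1) + ?N (e2 - v0)"
        using e12 EH[of j] e g by (intro Lp_norm_triangle[OF p1(1)] HL Hdiff Hadd) auto
      also have "\<dots> < \<eta>" using e12 Lp_norm_minus_commute[of p e2 v0] by (simp add: d_def)
      finally show ?thesis unfolding eq .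
    qed
    ultimately show ?thesis using Hdiff[OF f(1,5)]
      by (intro exI[of _ "f1 - f2"] exI[of _ "\<lambda>w. x1 w - x2 w"] conjI)
  qed
  \<comment> \<open>Scaling g to norm e/2 multiplies the bound 2 j by 2/e times the norm of g when
    scaled back.\<close>
  define C where "C = 4 * real j / e"
  have C0: "0 \<le> C" using e by (simp add: C_def)
  have step: "\<exists>f x. f \<in> H \<and> ?N f \<le> C * ?N g \<and> (\<forall>w\<in>B. norm (x w) \<le> C * ?N g) \<and> ?N (g - (A f + S x)) \<le> ?N g / 2"
    if g: "g \<in> H" for g
  proof (cases "?N g = 0")
    case True
    then have "g = 0" using Lp_norm_eq_0_iff[OF p1(2) HL[OF g]] by simp
    moreover have "A 0 = 0" using AH(2)[OF H0, of 0] by simp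
    ultimately show ?thesis using H0 p1 by (intro exI[of _ 0] exI[of _ "\<lambda>_. 0"]) (simp add: S_def)
  next
    case False
    then have Ng: "?N g > 0" using Lp_norm_nonneg[of p g] by linarith
    define s where "s = e / (2 * ?N g)"
    have s: "s > 0" using e Ng by (simp add: s_def)
    have "s * ?N g = e / 2" using Ng by (simp add: s_def)
    then have "?N (cscale (of_real s) g) = e / 2" using s p1 by (simp add: Lp_norm_cscale)
    then obtain f x where f: "f \<in> H" "?N f \<le> 2 * real j" "\<forall>w\<in>B. norm (x w) \<le> 2 * real j"
      "?N (cscale (of_real s) g - (A f + S x)) < e / 4"
      using app[OF Hsc[OF g], of "of_real s" "e/4"] e by auto
    let ?z = "of_real (1 / s) :: complex"
    have sc: "1 / s * (2 * real j) = C * ?N g" using Ng e by (simp add: s_def C_def field_simps)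
    show ?thesis
    proof (intro exI conjI)
      show "cscale ?z f \<in> H" using f by (intro Hsc)
      have "1 / s * ?N f \<le> 1 / s * (2 * real j)" using f s by (intro mult_left_mono) auto
      then show "?N (cscale ?z f) \<le> C * ?N g" using p1 s sc by (simp add: Lp_norm_cscale norm_divide)
      show "\<forall>w\<in>B. norm (?z * x w) \<le> C * ?N g"
      proof
        fix w assume "w \<in> B"
        then have "1 / s * norm (x w) \<le> 1 / s * (2 * real j)" using f s by (intro mult_left_mono) auto
        then show "norm (?z * x w) \<le> C * ?N g" using s sc by (simp add: norm_mult norm_divide)
      qed
      have "g - (A (cscale ?z f) + S (\<lambda>w. ?z * x w)) = cscale ?z (cscale (of_real s) g - (A f + S x))"
        using s AH(2)[OF f(1)] by (simp add: circle_fun.scale_right_diff_distrib circle_fun.scale_right_distrib Ssc)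
      then have "?N (g - (A (cscale ?z f) + S (\<lambda>w. ?z * x w))) = 1 / s * ?N (cscale (of_real s) g - (A f + S x))"
        using s p1 by (simp only: Lp_norm_cscale) (simp add: norm_divide)
      also have "\<dots> \<le> 1 / s * (e / 4)" using f(4) s by (intro mult_left_mono) auto
      also have "\<dots> = ?N g / 2" using e Ng by (simp add: s_def field_simps)
      finally show "?N (g - (A (cscale ?z f) + S (\<lambda>w. ?z * x w))) \<le> ?N g / 2" .
    qed
  qed
  then obtain \<phi> \<xi> where st: "\<And>g. g \<in> H \<Longrightarrow> \<phi> g \<in> H" "\<And>g. g \<in> H \<Longrightarrow> ?N (\<phi> g) \<le> C * ?N g"
    "\<And>g w. g \<in> H \<Longrightarrow> w \<in> B \<Longrightarrow> norm (\<xi> g w) \<le> C * ?N g" "\<And>g. g \<in> H \<Longrightarrow> ?N (g - (A (\<phi> g) + S (\<xi> g))) \<le> ?N g / 2"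
    by metis
  show ?thesis
  proof (rule that[of "2 * C"])
    fix g assume "g \<in> Hp p"
    then have g: "g \<in> H" by (simp add: H_def)
    \<comment> \<open>The residuals of successive approximate solutions. Their norms halve at each
      step, so the corrections sum to an exact preimage and exact coordinates with bound 2
      C.\<close>
    define gs where "gs n = ((\<lambda>g. g - (A (\<phi> g) + S (\<xi> g))) ^^ n) g" for n
    have gs0: "gs 0 = g" and gsS: "gs (Suc n) = gs n - (A (\<phi> (gs n)) + S (\<xi> (gs n)))" for n
      by (simp_all add: gs_def)
    have gsH: "gs n \<in> H" for n
      by (induction n) (auto simp: gs0 gsS g intro!: Hdiff Hadd AH st(1) SH)
    have gsN: "?N (gs n) \<le> (1/2)^n * ?N g" for n
    proof (induction n)
      case (Suc n)
      then show ?case using st(4)[OF gsH[of n]] by (simp add: gsS[of n])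
    qed (simp add: gs0)
    define Fs where "Fs n = (\<Sum>i<n. \<phi> (gs i))" for n
    define Xs where "Xs n w = (\<Sum>i<n. \<xi> (gs i) w)" for n w
    have FsH: "Fs n \<in> H" for n unfolding Fs_def by (intro Hsum st(1) gsH)
    have tele: "g - gs n = A (Fs n) + S (Xs n)" for n
    proof (induction n)
      case 0
      have "A 0 = 0" using AH(2)[OF H0, of 0] by simp
      then show ?case by (simp add: gs0 Fs_def Xs_def S_def)
    next
      case (Suc n)
      have "A (Fs (Suc n)) = A (Fs n) + A (\<phi> (gs n))"
        using Aadd[OF FsH[of n] st(1)[OF gsH[of n]]] by (simp add: Fs_def)
      moreover have "S (Xs (Suc n)) = S (Xs n) + S (\<xi> (gs n))"
      proof -
        have "Xs (Suc n) = (\<lambda>w. Xs n w + \<xi> (gs n) w)" by (simp add: Xs_def fun_eq_iff)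
        then show ?thesis by (simp add: Sadd)
      qed
      ultimately show ?case using Suc.IH by (simp add: gsS algebra_simps)
    qed
    have geo: "summable (\<lambda>i. C * ((1/2)^i * ?N g))" "(\<Sum>i. C * ((1/2)^i * ?N g)) = 2 * C * ?N g"
    proof -
      have s: "summable (\<lambda>i. (1/2::real)^i)" by (rule summable_geometric) simp
      show "summable (\<lambda>i. C * ((1/2)^i * ?N g))" by (intro summable_mult summable_mult2 s)
      have "(\<lambda>i. (1/2::real)^i) sums 2" using geometric_sums[of "1/2::real"] by simp
      then have "(\<lambda>i. C * ((1/2)^i * ?N g)) sums (C * (2 * ?N g))" by (intro sums_mult sums_mult2)
      then show "(\<Sum>i. C * ((1/2)^i * ?N g)) = 2 * C * ?N g" by (simp add: sums_iff mult_ac)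
    qed
    have phib: "?N (\<phi> (gs i)) \<le> C * ((1/2)^i * ?N g)" for i
      using order_trans[OF st(2)[OF gsH] mult_left_mono[OF gsN C0]] .
    have xib: "norm (\<xi> (gs i) w) \<le> C * ((1/2)^i * ?N g)" if "w \<in> B" for i w
      using order_trans[OF st(3)[OF gsH that] mult_left_mono[OF gsN C0]] .
    have Cauchy: "\<exists>N. \<forall>m\<ge>N. \<forall>n\<ge>N. ?N (Fs m - Fs n) < \<epsilon>" if \<epsilon>: "\<epsilon> > 0" for \<epsilon>
    proof -
      obtain N where N: "\<And>m n. m \<ge> N \<Longrightarrow> norm (sum (\<lambda>i. C * ((1/2)^i * ?N g)) {m..<n}) < \<epsilon>"
        using geo(1) \<epsilon> unfolding summable_Cauchy by metis
      have le: "?N (Fs n - Fs m) < \<epsilon>" if "N \<le> m" "m \<le> n" for m n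
      proof -
        have "Fs n - Fs m = (\<Sum>i\<in>{m..<n}. \<phi> (gs i))"
          unfolding Fs_def using that(2) by (metis sum_diff_nat_ivl atLeast0LessThan le0)
        then have "?N (Fs n - Fs m) \<le> (\<Sum>i\<in>{m..<n}. ?N (\<phi> (gs i)))"
          by (simp only:) (intro Lp_norm_sum p1 HL st(1) gsH)
        also have "\<dots> \<le> (\<Sum>i\<in>{m..<n}. C * ((1/2)^i * ?N g))" by (intro sum_mono phib)
        also have "\<dots> < \<epsilon>" using N[OF that(1), of n] by (simp add: abs_less_iff)
        finally show ?thesis .
      qed
      show ?thesis
      proof (intro exI allI impI)
        fix m n assume "N \<le> m" "N \<le> n"
        then show "?N (Fs m - Fs n) < \<epsilon>"
          using le[of m n] le[of n m] Lp_norm_minus_commute[of p "Fs m" "Fs n"] by (cases "m \<le> n") auto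
      qed
    qed
    obtain F where F: "F \<in> Lp p" "(\<lambda>n. ?N (Fs n - F)) \<longlonglongrightarrow> 0"
      by (rule Lp_complete[OF p1(1) HL[OF FsH] Cauchy])
    have FH: "F \<in> H" unfolding H_def by (rule Hp_closed[OF p _ F]) (use FsH H_def in auto)
    define X where "X w = (\<Sum>i. \<xi> (gs i) w)" for w
    have sx: "summable (\<lambda>i. norm (\<xi> (gs i) w))" if "w \<in> B" for w
      by (rule summable_comparison_test'[OF geo(1)]) (use xib[OF that] in auto)
    have Xlim: "(\<lambda>n. Xs n w) \<longlonglongrightarrow> X w" if "w \<in> B" for w
      unfolding Xs_def X_def by (rule summable_LIMSEQ[OF summable_norm_cancel[OF sx[OF that]]])
    have Xb: "norm (X w) \<le> 2 * C * ?N g" if "w \<in> B" for w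
    proof -
      have "norm (X w) \<le> (\<Sum>i. norm (\<xi> (gs i) w))" unfolding X_def by (rule summable_norm[OF sx[OF that]])
      also have "\<dots> \<le> (\<Sum>i. C * ((1/2)^i * ?N g))" by (rule suminf_le[OF xib[OF that] sx[OF that] geo(1)])
      finally show ?thesis using geo(2) by simp
    qed
    \<comment> \<open>The residual of the limits. It is bounded by the n-th residual and the
      distances of the partial sums from their limits, all of which tend to 0.\<close>
    define D where "D = g - (A F + S X)"
    have DH: "D \<in> H" unfolding D_def by (intro Hdiff Hadd g AH FH SH)
    have "?N D \<le> (1/2)^n * ?N g + (K0 * ?N (Fs n - F) + (\<Sum>w\<in>B. norm (Xs n w - X w) * ?N w))" for n
    proof -
      have Dn: "D = gs n + (A (Fs n - F) + S (\<lambda>w. Xs n w - X w))"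
        using tele[of n] Adiff[OF FsH FH, of n] Sdiff[of "Xs n" X] by (simp add: D_def algebra_simps)
      have "?N D \<le> ?N (gs n) + (?N (A (Fs n - F)) + ?N (S (\<lambda>w. Xs n w - X w)))"
        unfolding Dn using Lp_norm_triangle[OF p1(1) HL[OF gsH[of n]] HL[OF Hadd[OF AH(1)[OF Hdiff[OF FsH[of n] FH]] SH]]]
          Lp_norm_triangle[OF p1(1) HL[OF AH(1)[OF Hdiff[OF FsH[of n] FH]]] HL[OF SH]]
        by (rule order_trans[OF _ add_left_mono])
      also have "?N (S (\<lambda>w. Xs n w - X w)) \<le> (\<Sum>w\<in>B. ?N (cscale (Xs n w - X w) w))"
        unfolding S_def using B p1 by (intro Lp_norm_sum Lp_cscale) (auto intro: Hp_Lp)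
      also have "\<dots> = (\<Sum>w\<in>B. norm (Xs n w - X w) * ?N w)" using p1 by (simp add: Lp_norm_cscale)
      also have "?N (A (Fs n - F)) \<le> K0 * ?N (Fs n - F)" by (rule K0[OF Hdiff[OF FsH FH]])
      finally show ?thesis using gsN[of n] by simp
    qed
    moreover have "(\<lambda>n. (1/2)^n * ?N g + (K0 * ?N (Fs n - F) + (\<Sum>w\<in>B. norm (Xs n w - X w) * ?N w))) \<longlonglongrightarrow> 0 * ?N g + (K0 * 0 + (\<Sum>w\<in>B. 0 * ?N w))"
      by (intro tendsto_add tendsto_mult tendsto_const F(2) LIMSEQ_power_zero tendsto_sum tendsto_norm_zero LIM_zero Xlim) auto
    ultimately have "?N D \<le> 0 * ?N g + (K0 * 0 + (\<Sum>w\<in>B. 0 * ?N w))"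
      by (intro LIMSEQ_le_const) auto
    then have "?N D = 0" using Lp_norm_nonneg[of p D] by simp
    then have "D = 0" using Lp_norm_eq_0_iff[OF p1(2) HL[OF DH]] by simp
    then have "g - S X = A F" by (simp add: D_def algebra_simps)
    then show "\<exists>x. g - (\<Sum>w\<in>B. cscale (x w) w) \<in> A ` Hp p \<and> (\<forall>w\<in>B. norm (x w) \<le> 2 * C * ?N g)"
      using FH Xb unfolding S_def H_def by blast
  qed (use C0 in simp)
qed

text \<open>\<open>bounded_op\<close> without the norm estimate: the counting of dimensions under
  shifts is purely algebraic.\<close>

definition lin_op :: "real \<Rightarrow> (circle_fun \<Rightarrow> circle_fun) \<Rightarrow> bool" where
  "lin_op p A \<longleftrightarrow> A ` Hp p \<subseteq> Hp p \<and> (\<forall>f\<in>Hp p. \<forall>g\<in>Hp p. A (f + g) = A f + A g) \<and>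
     (\<forall>z. \<forall>f\<in>Hp p. A (cscale z f) = cscale z (A f))"

definition has_dims :: "real \<Rightarrow> (circle_fun \<Rightarrow> circle_fun) \<Rightarrow> nat \<Rightarrow> nat \<Rightarrow> bool" where
  "has_dims p A k l \<longleftrightarrow> qdim cscale (ker_Hp p A) {0} k \<and> qdim cscale (Hp p) (A ` Hp p) l"

lemma lin_opD:
  assumes "lin_op p A"
  shows "f \<in> Hp p \<Longrightarrow> A f \<in> Hp p" "f \<in> Hp p \<Longrightarrow> g \<in> Hp p \<Longrightarrow> A (f + g) = A f + A g"
    "f \<in> Hp p \<Longrightarrow> A (cscale z f) = cscale z (A f)"
  using assms unfolding lin_op_def by blast+

lemma bounded_op_lin_op: "bounded_op p A \<Longrightarrow> lin_op p A"
  by (simp add: bounded_op_def lin_op_def)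

lemma lin_op_0: "1 < p \<Longrightarrow> lin_op p A \<Longrightarrow> A 0 = 0"
  using lin_opD(3)[of p A 0 0] Hp_0 by simp

lemma lin_op_diff: "1 < p \<Longrightarrow> lin_op p A \<Longrightarrow> f \<in> Hp p \<Longrightarrow> g \<in> Hp p \<Longrightarrow> A (f - g) = A f - A g"
  using lin_opD(2)[of p A "f - g" g] Hp_diff[of p f g] by simp

lemma subspace_ker_Hp: "1 < p \<Longrightarrow> lin_op p A \<Longrightarrow> circle_fun.subspace (ker_Hp p A)"
  by (rule circle_fun.subspaceI) (auto simp: ker_Hp_def lin_op_0 lin_opD Hp_0 Hp_add Hp_cscale)

lemma subspace_range_Hp:
  assumes p: "1 < p" and A: "lin_op p A"
  shows "circle_fun.subspace (A ` Hp p)"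
  using lin_opD[OF A] by (intro circle_fun.subspace_image_on[OF subspace_Hp[OF p]])

text \<open>Coordinates modulo the range are unique, hence linear in f. By the same uniqueness they
  agree with the controlled coordinates of the open mapping argument, hence they are
  continuous.\<close>

lemma quotient_coordinates:
  assumes p: "1 < p" and A: "bounded_op p A" and q: "quotient_basis cscale (Hp p) (A ` Hp p) B"
  obtains \<Phi> where "\<And>w. w \<in> B \<Longrightarrow> \<Phi> w \<in> dual_Hp p" "\<And>w f. w \<in> B \<Longrightarrow> f \<in> Hp p \<Longrightarrow> \<Phi> w (A f) = 0"
    "\<And>w v. w \<in> B \<Longrightarrow> v \<in> B \<Longrightarrow> \<Phi> w v = (if v = w then 1 else 0)"
    "\<And>f. f \<in> Hp p \<Longrightarrow> f - (\<Sum>w\<in>B. cscale (\<Phi> w f) w) \<in> A ` Hp p"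
proof -
  let ?H = "Hp p"
  note sH = subspace_Hp[OF p]
  note AH = bounded_opD[OF A]
  have sR: "circle_fun.subspace (A ` ?H)" by (rule subspace_range_Hp[OF p bounded_op_lin_op[OF A]])
  have Hne: "?H \<noteq> {}" using Hp_0[OF p] by auto
  note D = circle_fun.quotient_basisD[OF q sR Hne]
  have "\<forall>v\<in>?H. \<exists>x. v - (\<Sum>w\<in>B. cscale (x w) w) \<in> A ` ?H" using D(3) by blast
  then obtain X where X: "\<And>v. v \<in> ?H \<Longrightarrow> v - (\<Sum>w\<in>B. cscale (X v w) w) \<in> A ` ?H" by metis
  have un: "X v w = x w" if v: "v \<in> ?H" and x: "v - (\<Sum>w\<in>B. cscale (x w) w) \<in> A ` ?H" and w: "w \<in> B" for v x w
  proof -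
    have "(v - (\<Sum>w\<in>B. cscale (x w) w)) - (v - (\<Sum>w\<in>B. cscale (X v w) w)) \<in> A ` ?H"
      by (rule circle_fun.subspace_diff[OF sR x X[OF v]])
    also have "(v - (\<Sum>w\<in>B. cscale (x w) w)) - (v - (\<Sum>w\<in>B. cscale (X v w) w)) = (\<Sum>w\<in>B. cscale (X v w - x w) w)"
      by (simp add: circle_fun.scale_left_diff_distrib sum_subtractf)
    finally have "X v w - x w = 0" using w by (rule D(4))
    then show ?thesis by simp
  qed
  obtain C where C: "\<And>g. g \<in> ?H \<Longrightarrow> \<exists>x. g - (\<Sum>w\<in>B. cscale (x w) w) \<in> A ` ?H \<and> (\<forall>w\<in>B. norm (x w) \<le> C * Lp_norm p g)"
    using bounded_coordinates_exist[OF p A D(1,2,3)] by metis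
  define \<Phi> where "\<Phi> w f = (if f \<in> ?H then X f w else 0)" for w f
  show ?thesis
  proof (rule that[of \<Phi>])
    fix w assume w: "w \<in> B"
    show "\<Phi> w \<in> dual_Hp p"
      unfolding dual_Hp_def
    proof (intro CollectI conjI allI ballI impI)
      show "\<Phi> w f = 0" if "f \<notin> ?H" for f using that by (simp add: \<Phi>_def)
      show "\<Phi> w (f + g) = \<Phi> w f + \<Phi> w g" if fg: "f \<in> ?H" "g \<in> ?H" for f g
      proof -
        have "(f - (\<Sum>w\<in>B. cscale (X f w) w)) + (g - (\<Sum>w\<in>B. cscale (X g w) w)) \<in> A ` ?H"
          by (intro circle_fun.subspace_add[OF sR] X fg)
        also have "(f - (\<Sum>w\<in>B. cscale (X f w) w)) + (g - (\<Sum>w\<in>B. cscale (X g w) w)) = (f + g) - (\<Sum>w\<in>B. cscale (X f w + X g w) w)"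
          by (simp add: circle_fun.scale_left_distrib sum.distrib)
        finally show ?thesis using un[OF Hp_add[OF p fg] _ w, of "\<lambda>w. X f w + X g w"] Hp_add[OF p fg] fg by (simp add: \<Phi>_def)
      qed
      show "\<Phi> w (cscale z f) = z * \<Phi> w f" if f: "f \<in> ?H" for z f
      proof -
        have "cscale z (f - (\<Sum>w\<in>B. cscale (X f w) w)) \<in> A ` ?H"
          by (intro circle_fun.subspace_scale[OF sR] X f)
        also have "cscale z (f - (\<Sum>w\<in>B. cscale (X f w) w)) = cscale z f - (\<Sum>w\<in>B. cscale (z * X f w) w)"
          by (simp add: circle_fun.scale_right_diff_distrib circle_fun.scale_sum_right)
        finally show ?thesis using un[OF Hp_cscale[OF p f] _ w, of z "\<lambda>w. z * X f w"] Hp_cscale[OF p f] f by (simp add: \<Phi>_def)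
      qed
      show "\<exists>C. \<forall>f\<in>?H. norm (\<Phi> w f) \<le> C * Lp_norm p f"
      proof (intro exI ballI)
        fix f assume f: "f \<in> ?H"
        obtain x where x: "f - (\<Sum>w\<in>B. cscale (x w) w) \<in> A ` ?H" "\<forall>w\<in>B. norm (x w) \<le> C * Lp_norm p f" using C[OF f] by blast
        then show "norm (\<Phi> w f) \<le> C * Lp_norm p f" using un[OF f x(1) w] w f by (simp add: \<Phi>_def)
      qed
    qed
    show "\<Phi> w (A f) = 0" if f: "f \<in> ?H" for f
      using un[OF AH(1)[OF f] _ w, of "\<lambda>_. 0"] AH(1)[OF f] f by (simp add: \<Phi>_def)
    show "\<Phi> w v = (if v = w then 1 else 0)" if v: "v \<in> B" for v
    proof -
      have "(\<Sum>u\<in>B. cscale (if v = u then 1 else 0) u) = (\<Sum>u\<in>{v}. cscale (if v = u then 1 else 0) u)"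
        using v D(1) by (intro sum.mono_neutral_right) auto
      then have "v - (\<Sum>u\<in>B. cscale (if v = u then 1 else 0) u) \<in> A ` ?H"
        using circle_fun.subspace_0[OF sR] by simp
      then show ?thesis using un[of v "\<lambda>u. if v = u then 1 else 0" w] v D(2) w by (auto simp: \<Phi>_def)
    qed
  next
    show "f - (\<Sum>w\<in>B. cscale (\<Phi> w f) w) \<in> A ` ?H" if "f \<in> ?H" for f
      using X[OF that] that by (simp add: \<Phi>_def)
  qed
qed

lemma dual_Hp_sum:
  assumes p: "1 < p" and phi: "\<phi> \<in> dual_Hp p" and B: "finite B" "B \<subseteq> Hp p"
  shows "\<phi> (\<Sum>w\<in>B. cscale (x w) w) = (\<Sum>w\<in>B. x w * \<phi> w)"
  using B
proof (induction B rule: finite_induct)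
  case empty
  have "\<phi> (cscale 0 0) = 0 * \<phi> 0" using phi Hp_0[OF p] unfolding dual_Hp_def by blast
  then show ?case by simp
next
  case (insert v B)
  have "cscale (x v) v \<in> Hp p" "(\<Sum>w\<in>B. cscale (x w) w) \<in> Hp p"
    using insert.prems by (auto intro!: Hp_cscale[OF p] Hp_sum[OF p])
  then have "\<phi> (cscale (x v) v + (\<Sum>w\<in>B. cscale (x w) w)) = \<phi> (cscale (x v) v) + \<phi> (\<Sum>w\<in>B. cscale (x w) w)"
    using phi unfolding dual_Hp_def by blast
  moreover have "\<phi> (cscale (x v) v) = x v * \<phi> v" using phi insert.prems unfolding dual_Hp_def by blast
  ultimately show ?case using insert by simp
qed

text \<open>A functional that vanishes on the range is determined by its values on a basis of the
  quotient, so the coordinate functionals form a basis of the kernel of the adjoint. Their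
  continuity is what places them in the dual space.\<close>

lemma dim_ker_adjoint_eq:
  assumes p: "1 < p" and A: "bounded_op p A" and q: "qdim cscale (Hp p) (A ` Hp p) l"
  shows "dim_ker_adjoint p A = enat l"
proof -
  obtain B where B: "quotient_basis cscale (Hp p) (A ` Hp p) B" "card B = l" using q by (auto simp: qdim_def)
  have fin: "finite B" "B \<subseteq> Hp p" using B(1) by (auto simp: quotient_basis_def)
  obtain \<Phi> where \<Phi>: "\<And>w. w \<in> B \<Longrightarrow> \<Phi> w \<in> dual_Hp p" "\<And>w f. w \<in> B \<Longrightarrow> f \<in> Hp p \<Longrightarrow> \<Phi> w (A f) = 0"
    "\<And>w v. w \<in> B \<Longrightarrow> v \<in> B \<Longrightarrow> \<Phi> w v = (if v = w then 1 else 0)"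
    "\<And>f. f \<in> Hp p \<Longrightarrow> f - (\<Sum>w\<in>B. cscale (\<Phi> w f) w) \<in> A ` Hp p"
    by (rule quotient_coordinates[OF p A B(1)]) (rule that)
  let ?s = "\<lambda>z (\<phi> :: circle_fun \<Rightarrow> complex) f. z * \<phi> f"
  define D where "D = {\<phi> \<in> dual_Hp p. adjoint_op p A \<phi> = (\<lambda>f. 0)}"
  have Dz: "\<phi> (A f) = 0" if "\<phi> \<in> D" "f \<in> Hp p" for \<phi> f
  proof -
    have "adjoint_op p A \<phi> f = 0" using that(1) by (simp add: D_def)
    then show ?thesis using that(2) by (simp add: adjoint_op_def)
  qed
  have DI: "\<phi> \<in> D" if "\<phi> \<in> dual_Hp p" "\<And>f. f \<in> Hp p \<Longrightarrow> \<phi> (A f) = 0" for \<phi>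
    using that by (auto simp: D_def adjoint_op_def)
  have sD: "circle_functional.subspace D"
  proof (rule circle_functional.subspaceI)
    show "0 \<in> D" by (rule DI) (auto simp: dual_Hp_def intro: exI[of _ 0])
    show "x + y \<in> D" if xy: "x \<in> D" "y \<in> D" for x y
    proof (rule DI)
      obtain C C' where "\<forall>f\<in>Hp p. norm (x f) \<le> C * Lp_norm p f" "\<forall>f\<in>Hp p. norm (y f) \<le> C' * Lp_norm p f"
        using xy by (auto simp: D_def dual_Hp_def)
      then have "\<forall>f\<in>Hp p. norm (x f + y f) \<le> (C + C') * Lp_norm p f"
        by (auto simp: distrib_right intro!: order_trans[OF norm_triangle_ineq add_mono])
      then show "x + y \<in> dual_Hp p" using xy by (auto simp: D_def dual_Hp_def distrib_left)
    qed (simp add: Dz[OF xy(1)] Dz[OF xy(2)])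
    show "(\<lambda>f. z * x f) \<in> D" if x: "x \<in> D" for z x
    proof (rule DI)
      obtain C where C: "\<forall>f\<in>Hp p. norm (x f) \<le> C * Lp_norm p f"
        using x by (auto simp: D_def dual_Hp_def)
      have "\<forall>f\<in>Hp p. norm (z * x f) \<le> (norm z * C) * Lp_norm p f"
        using C by (auto simp: norm_mult mult.assoc intro!: mult_left_mono)
      then show "(\<lambda>f. z * x f) \<in> dual_Hp p" using x by (auto simp: D_def dual_Hp_def distrib_left)
    qed (simp add: Dz[OF x])
  qed
  have inj: "inj_on \<Phi> B"
  proof (rule inj_onI)
    fix v w assume vw: "v \<in> B" "w \<in> B" "\<Phi> v = \<Phi> w"
    then have "\<Phi> w v = 1" using \<Phi>(3)[of v v] by simp
    then show "v = w" using \<Phi>(3)[of w v] vw by (auto split: if_splits)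
  qed
  have ev: "(\<Sum>\<psi>\<in>\<Phi> ` B. ?s (x \<psi>) \<psi>) f = (\<Sum>w\<in>B. x (\<Phi> w) * \<Phi> w f)" for x f
  proof -
    have "(\<Sum>\<psi>\<in>\<Phi> ` B. ?s (x \<psi>) \<psi>) = (\<Sum>w\<in>B. ?s (x (\<Phi> w)) (\<Phi> w))" by (simp add: sum.reindex[OF inj])
    moreover have "(\<Sum>w\<in>C. ?s (x (\<Phi> w)) (\<Phi> w)) f = (\<Sum>w\<in>C. x (\<Phi> w) * \<Phi> w f)" if "finite C" for C
      using that by (induction C rule: finite_induct) (auto simp: zero_fun_def)
    ultimately show ?thesis using fin(1) by simp
  qed
  have "quotient_basis ?s D {0} (\<Phi> ` B)"
  proof (rule circle_functional.quotient_basisI)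
    show "\<Phi> ` B \<subseteq> D" using \<Phi>(1,2) DI by blast
    fix \<phi> assume phi: "\<phi> \<in> D"
    let ?x = "\<lambda>\<psi>. \<phi> (the_inv_into B \<Phi> \<psi>)"
    have "\<phi> f = (\<Sum>w\<in>B. \<phi> w * \<Phi> w f)" for f
    proof (cases "f \<in> Hp p")
      case True
      let ?s = "\<Sum>w\<in>B. cscale (\<Phi> w f) w"
      obtain g where g: "f - ?s = A g" "g \<in> Hp p" using \<Phi>(4)[OF True] by blast
      have dphi: "\<phi> \<in> dual_Hp p" using phi by (simp add: D_def)
      have "?s \<in> Hp p" using fin by (auto intro!: Hp_cscale[OF p] Hp_sum[OF p])
      moreover have "f = A g + ?s" using g(1) by (simp add: algebra_simps)
      moreover have "\<forall>f\<in>Hp p. \<forall>g\<in>Hp p. \<phi> (f + g) = \<phi> f + \<phi> g" using dphi by (simp add: dual_Hp_def)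
      ultimately have "\<phi> f = \<phi> (A g) + \<phi> ?s" using bounded_opD(1)[OF A g(2)] by metis
      then show ?thesis using Dz[OF phi g(2)] dual_Hp_sum[OF p dphi fin, of "\<lambda>w. \<Phi> w f"] by (simp add: mult.commute)
    next
      case False
      then show ?thesis using phi \<Phi>(1) by (simp add: D_def dual_Hp_def)
    qed
    note exp = this
    have "\<phi> = (\<Sum>\<psi>\<in>\<Phi> ` B. ?s (?x \<psi>) \<psi>)"
    proof (rule ext)
      fix f
      have "(\<Sum>\<psi>\<in>\<Phi> ` B. ?s (?x \<psi>) \<psi>) f = (\<Sum>w\<in>B. ?x (\<Phi> w) * \<Phi> w f)" by (rule ev)
      also have "\<dots> = (\<Sum>w\<in>B. \<phi> w * \<Phi> w f)"
        by (rule sum.cong[OF refl]) (simp add: the_inv_into_f_f[OF inj])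
      finally show "\<phi> f = (\<Sum>\<psi>\<in>\<Phi> ` B. ?s (?x \<psi>) \<psi>) f" using exp[of f] by simp
    qed
    then show "\<exists>x. \<phi> - (\<Sum>\<psi>\<in>\<Phi> ` B. ?s (x \<psi>) \<psi>) \<in> {0}" by (intro exI[of _ ?x]) simp
  next
    fix x \<psi> assume z: "(\<Sum>\<psi>\<in>\<Phi> ` B. ?s (x \<psi>) \<psi>) \<in> {0}" and "\<psi> \<in> \<Phi> ` B"
    then obtain v where v: "\<psi> = \<Phi> v" "v \<in> B" by blast
    have "0 = (\<Sum>w\<in>B. x (\<Phi> w) * \<Phi> w v)" using z ev[of x v] by simp
    also have "\<dots> = (\<Sum>w\<in>B. if w = v then x (\<Phi> v) else 0)"
      by (rule sum.cong) (use \<Phi>(3) v in auto)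
    also have "\<dots> = x \<psi>" using v fin by simp
    finally show "x \<psi> = 0" by simp
  qed (use fin in auto)
  then have "qdim ?s D {0} l" unfolding qdim_def using card_image[OF inj] B(2) by blast
  from circle_functional.edim_eq[OF sD this] show ?thesis by (simp add: dim_ker_adjoint_def D_def)
qed

subsection \<open>Index of compositions with shifts\<close>

lemma has_dims_unique:
  assumes p: "1 < p" and A: "lin_op p A" and "has_dims p A k l" "has_dims p A k' l'"
  shows "k = k'" "l = l'"
proof -
  have ne: "ker_Hp p A \<noteq> {}" using circle_fun.subspace_0[OF subspace_ker_Hp[OF p A]] by auto
  have ne': "Hp p \<noteq> {}" using Hp_0[OF p] by auto
  show "k = k'" using assms(3,4) circle_fun.qdim_unique[OF circle_fun.subspace_single_0 ne] by (auto simp: has_dims_def)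
  show "l = l'" using assms(3,4) circle_fun.qdim_unique[OF subspace_range_Hp[OF p A] ne'] by (auto simp: has_dims_def)
qed

lemma dims_cong:
  assumes "\<And>f. f \<in> Hp p \<Longrightarrow> A f = B f"
  shows "ker_Hp p A = ker_Hp p B" "A ` Hp p = B ` Hp p" "has_dims p A k l \<longleftrightarrow> has_dims p B k l"
proof -
  show 1: "ker_Hp p A = ker_Hp p B" using assms by (auto simp: ker_Hp_def)
  show 2: "A ` Hp p = B ` Hp p" using assms by (rule image_cong[OF refl])
  show "has_dims p A k l \<longleftrightarrow> has_dims p B k l" unfolding has_dims_def 1 2 ..
qed

lemma tt_powi_add: "tt powi j * tt powi k = tt powi (j + k)"
  by (rule circle_fun_eq_fourier)
     (auto simp: tt_powi_Lp Lp_tt_powi_mult fourier_tt_powi_mult fourier_tt_powi)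

lemma tt_powi_cancel: "tt powi j * (tt powi k * f) = tt powi (j + k) * f"
  by (simp add: tt_powi_add flip: mult.assoc)

lemma one_Hp: "1 < p \<Longrightarrow> 1 \<in> Hp p"
  using fourier_tt_powi[of 0] by (simp add: Hp_def one_mem_Lp)

lemma fourier_one: "fourier 1 k = (if k = 0 then 1 else 0)"
  using fourier_tt_powi[of 0 k] by simp

lemma fourier_tt_mult: "fourier (tt * f) k = fourier f (k - 1)"
  and fourier_inverse_tt_mult: "fourier (inverse tt * f) k = fourier f (k + 1)"
  using fourier_tt_powi_mult[of 1 f k] fourier_tt_powi_mult[of "-1" f k] by simp_all

lemma Lp_tt_mult: "f \<in> Lp p \<Longrightarrow> 0 \<le> p \<Longrightarrow> tt * f \<in> Lp p"
  and Lp_inverse_tt_mult: "f \<in> Lp p \<Longrightarrow> 0 \<le> p \<Longrightarrow> inverse tt * f \<in> Lp p"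
  using Lp_tt_powi_mult[of f p 1] Lp_tt_powi_mult[of f p "-1"] by simp_all

lemma inverse_tt_cancel: "inverse tt * (tt * f) = f" "tt * (inverse tt * f) = f"
  using tt_powi_cancel[of "-1" 1 f] tt_powi_cancel[of 1 "-1" f] by simp_all

abbreviation shift :: "circle_fun \<Rightarrow> circle_fun" where "shift f \<equiv> tt * f"

definition backshift :: "real \<Rightarrow> circle_fun \<Rightarrow> circle_fun" where
  "backshift p f = riesz p (inverse tt * f)"

lemma shift_Hp: "1 < p \<Longrightarrow> f \<in> Hp p \<Longrightarrow> shift f \<in> Hp p"
  using Hp_tt_powi_mult[of p f 1] by simp

lemma fourier_backshift:
  "1 < p \<Longrightarrow> f \<in> Lp p \<Longrightarrow> fourier (backshift p f) k = (if 0 \<le> k then fourier f (k + 1) else 0)"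
  by (simp add: backshift_def fourier_riesz Lp_inverse_tt_mult fourier_inverse_tt_mult)

lemma backshift_Hp: "1 < p \<Longrightarrow> f \<in> Lp p \<Longrightarrow> backshift p f \<in> Hp p"
  by (simp add: backshift_def riesz_Hp Lp_inverse_tt_mult)

lemma backshift_shift: "1 < p \<Longrightarrow> f \<in> Hp p \<Longrightarrow> backshift p (shift f) = f"
  unfolding backshift_def inverse_tt_cancel by (simp add: riesz_ident)

lemma shift_backshift:
  assumes p: "1 < p" and f: "f \<in> Hp p"
  shows "shift (backshift p f) = f - cscale (fourier f 0) 1"
proof (rule Hp_eqI[OF p])
  have fL: "f \<in> Lp p" using f by (rule Hp_Lp)
  show "shift (backshift p f) \<in> Hp p" by (intro shift_Hp p backshift_Hp fL)
  show "f - cscale (fourier f 0) 1 \<in> Hp p" by (intro Hp_diff[OF p] f Hp_cscale[OF p] one_Hp p)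
  fix k :: int assume "0 \<le> k"
  then show "fourier (shift (backshift p f)) k = fourier (f - cscale (fourier f 0) 1) k"
    using Lp_subset_L1[OF p fL] fourier_backshift[OF p fL, of "k - 1"]
    by (subst fourier_diff) (auto simp: fourier_tt_mult fourier_cscale fourier_one Lp_cscale one_mem_Lp)
qed

lemma lin_op_backshift: "1 < p \<Longrightarrow> lin_op p (backshift p)"
  unfolding lin_op_def
  by (auto simp: backshift_Hp Hp_Lp) 
     (simp_all add: backshift_def distrib_left riesz_add riesz_cscale Lp_inverse_tt_mult Hp_Lp mult_cscale)

lemma lin_op_shift: "1 < p \<Longrightarrow> lin_op p shift"
  unfolding lin_op_def by (auto simp: shift_Hp distrib_left mult_cscale)

lemma lin_op_comp: "lin_op p A \<Longrightarrow> lin_op p B \<Longrightarrow> lin_op p (\<lambda>f. A (B f))"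
  unfolding lin_op_def by (auto simp: image_subset_iff)

text \<open>The shift identifies H^p with the hyperplane of functions with zero constant
  coefficient. If the kernel of A leaves this hyperplane, it loses one dimension and the range is
  unchanged; otherwise the kernel keeps its dimension and the range loses the direction
  \<open>A 1\<close>.\<close>

lemma has_dims_shift:
  assumes p: "1 < p" and A: "lin_op p A" and d: "has_dims p A k l"
  obtains k' l' where "has_dims p (\<lambda>f. A (shift f)) k' l'" "k' + l + 1 = k + l'" "k \<le> k' + 1"
proof -
  let ?K = "ker_Hp p A" and ?KS = "ker_Hp p (\<lambda>f. A (shift f))"
  let ?K' = "{f \<in> ker_Hp p A. fourier f 0 = 0}"
  have AS: "lin_op p (\<lambda>f. A (shift f))" by (rule lin_op_comp[OF A lin_op_shift[OF p]])
  have sK: "circle_fun.subspace ?K" by (rule subspace_ker_Hp[OF p A])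
  have KH: "f \<in> Hp p" if "f \<in> ?K" for f using that by (simp add: ker_Hp_def)
  have H1: "f \<in> Lp 1" if "f \<in> Hp p" for f using that by (intro Lp_subset_L1[OF p] Hp_Lp)
  have sK': "circle_fun.subspace ?K'"
    using circle_fun.subspace_0[OF sK] circle_fun.subspace_add[OF sK] circle_fun.subspace_scale[OF sK]
    by (intro circle_fun.subspaceI) (auto simp: fourier_add fourier_cscale H1 KH)
  have qK: "qdim cscale ?K {0} k" and qR: "qdim cscale (Hp p) (A ` Hp p) l" using d by (auto simp: has_dims_def)
  obtain F where F: "finite F" "circle_fun.span F = ?K" using circle_fun.qdim_0_basis[OF sK qK] by metis
  have sb: "shift (backshift p f) = f" if "f \<in> Hp p" "fourier f 0 = 0" for f
    using shift_backshift[OF p that(1)] that(2) by simp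
  have tr: "qdim cscale ?KS {0} j" if "qdim cscale ?K' {0} j" for j
  proof (rule circle_fun.qdim_transport[OF circle_fun.subspace_single_0 circle_fun.subspace_single_0 _ sK' _ _ _ _ that, where f="backshift p"])
    show "?K' \<noteq> {}" using circle_fun.subspace_0[OF sK'] by blast
    show "backshift p (v + w) = backshift p v + backshift p w" if "v \<in> ?K'" "w \<in> ?K'" for v w
      using that KH lin_opD(2)[OF lin_op_backshift[OF p]] by auto
    show "backshift p (cscale c v) = cscale c (backshift p v)" if "v \<in> ?K'" for c v
      using that KH lin_opD(3)[OF lin_op_backshift[OF p]] by auto
    show "backshift p ` ?K' = ?KS"
    proof
      show "backshift p ` ?K' \<subseteq> ?KS"
        using sb by (auto simp: ker_Hp_def backshift_Hp p Hp_Lp)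
      show "?KS \<subseteq> backshift p ` ?K'"
      proof
        fix g assume g: "g \<in> ?KS"
        then have gH: "g \<in> Hp p" by (simp add: ker_Hp_def)
        have "shift g \<in> ?K'" using g shift_Hp[OF p gH] fourier_Hp[OF gH, of "-1"] by (simp add: ker_Hp_def fourier_tt_mult)
        then show "g \<in> backshift p ` ?K'" using backshift_shift[OF p gH] by (metis (no_types, lifting) imageI)
      qed
    qed
    show "backshift p v \<in> {0} \<longleftrightarrow> v \<in> {0}" if v: "v \<in> ?K'" for v
    proof -
      have "v = shift (backshift p v)" using sb v KH by auto
      then show ?thesis using lin_op_0[OF p lin_op_backshift[OF p]] by auto
    qed
  qed
  show ?thesis
  proof (cases "\<exists>f0\<in>?K. fourier f0 0 \<noteq> 0")
    case True
    then obtain f0 where f0: "f0 \<in> ?K" "fourier f0 0 \<noteq> 0" by blast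
    obtain j where j: "qdim cscale ?K' {0} j"
      by (rule circle_fun.qdim_0_exists[OF sK' _ F(1)]) (use F(2) in auto)
    have red: "f - cscale (fourier f 0 / fourier f0 0) f0 \<in> Hp p"
      "fourier (f - cscale (fourier f 0 / fourier f0 0) f0) 0 = 0" if "f \<in> Hp p" for f
    proof -
      show "f - cscale (fourier f 0 / fourier f0 0) f0 \<in> Hp p" using that f0 KH by (intro Hp_diff[OF p] Hp_cscale[OF p]) auto
      show "fourier (f - cscale (fourier f 0 / fourier f0 0) f0) 0 = 0"
        using that f0 H1 KH by (subst fourier_diff) (auto simp: fourier_cscale Lp_cscale)
    qed
    have "{v + cscale c f0 |v c. v \<in> ?K'} = ?K"
    proof
      show "{v + cscale c f0 |v c. v \<in> ?K'} \<subseteq> ?K"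
        using f0 circle_fun.subspace_add[OF sK] circle_fun.subspace_scale[OF sK] by auto
      show "?K \<subseteq> {v + cscale c f0 |v c. v \<in> ?K'}"
      proof
        fix f assume f: "f \<in> ?K"
        let ?c = "fourier f 0 / fourier f0 0"
        have "f - cscale ?c f0 \<in> ?K'"
          using red[OF KH[OF f]] circle_fun.subspace_diff[OF sK f circle_fun.subspace_scale[OF sK f0(1)]] by simp
        then have "(f - cscale ?c f0) + cscale ?c f0 \<in> {v + cscale c f0 |v c. v \<in> ?K'}" by blast
        then show "f \<in> {v + cscale c f0 |v c. v \<in> ?K'}" by simp
      qed
    qed
    then have "qdim cscale ?K {0} (Suc j)" using circle_fun.qdim_extend[OF sK' _ j, of f0] f0 by simp
    then have k: "k = Suc j"
      using qK circle_fun.qdim_unique[OF circle_fun.subspace_single_0, of ?K] f0(1) by blast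
    have "(\<lambda>f. A (shift f)) ` Hp p = A ` Hp p"
    proof
      show "(\<lambda>f. A (shift f)) ` Hp p \<subseteq> A ` Hp p" using shift_Hp[OF p] by auto
      show "A ` Hp p \<subseteq> (\<lambda>f. A (shift f)) ` Hp p"
      proof
        fix y assume "y \<in> A ` Hp p"
        then obtain f where f: "f \<in> Hp p" "y = A f" by blast
        let ?g = "f - cscale (fourier f 0 / fourier f0 0) f0"
        have "A ?g = A f - A (cscale (fourier f 0 / fourier f0 0) f0)"
          by (rule lin_op_diff[OF p A f(1) Hp_cscale[OF p KH[OF f0(1)]]])
        also have "A (cscale (fourier f 0 / fourier f0 0) f0) = 0"
          using lin_opD(3)[OF A KH[OF f0(1)]] f0(1) by (simp add: ker_Hp_def)
        finally have "y = A (shift (backshift p ?g))" using sb[OF red[OF f(1)]] f(2) by simp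
        then show "y \<in> (\<lambda>f. A (shift f)) ` Hp p" using backshift_Hp[OF p Hp_Lp[OF red(1)[OF f(1)]]] by blast
      qed
    qed
    then have "has_dims p (\<lambda>f. A (shift f)) j l" using tr[OF j] qR by (simp add: has_dims_def)
    then show ?thesis using k by (intro that[of j l]) auto
  next
    case False
    then have "?K' = ?K" by auto
    then have qKS: "qdim cscale ?KS {0} k" using tr qK by metis
    let ?R = "(\<lambda>f. A (shift f)) ` Hp p"
    have sR: "circle_fun.subspace ?R" by (rule subspace_range_Hp[OF p AS])
    have A1: "A 1 \<in> Hp p" by (rule lin_opD(1)[OF A one_Hp[OF p]])
    have A1R: "A 1 \<notin> ?R"
    proof
      assume "A 1 \<in> ?R"
      then obtain g where g: "g \<in> Hp p" "A 1 = A (shift g)" by blast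
      have "A (1 - shift g) = 0" using lin_op_diff[OF p A one_Hp[OF p] shift_Hp[OF p g(1)]] g(2) by simp
      then have "1 - shift g \<in> ?K" using Hp_diff[OF p one_Hp[OF p] shift_Hp[OF p g(1)]] by (simp add: ker_Hp_def)
      then have "fourier (1 - shift g) 0 = 0" using False by blast
      moreover have "fourier (1 - shift g) 0 = 1"
        using g(1) fourier_Hp[OF g(1), of "-1"] H1 shift_Hp[OF p g(1)]
        by (subst fourier_diff) (auto simp: fourier_one one_mem_Lp fourier_tt_mult)
      ultimately show False by simp
    qed
    have "{u + cscale c (A 1) |u c. u \<in> ?R} = A ` Hp p"
    proof
      show "{u + cscale c (A 1) |u c. u \<in> ?R} \<subseteq> A ` Hp p"
      proof
        fix y assume "y \<in> {u + cscale c (A 1) |u c. u \<in> ?R}"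
        then obtain g c where g: "g \<in> Hp p" "y = A (shift g) + cscale c (A 1)" by blast
        have "A (shift g) \<in> A ` Hp p" "A 1 \<in> A ` Hp p" using shift_Hp[OF p g(1)] one_Hp[OF p] by auto
        then show "y \<in> A ` Hp p"
          unfolding g(2) by (intro circle_fun.subspace_add[OF subspace_range_Hp[OF p A]] circle_fun.subspace_scale[OF subspace_range_Hp[OF p A]])
      qed
      show "A ` Hp p \<subseteq> {u + cscale c (A 1) |u c. u \<in> ?R}"
      proof
        fix y assume "y \<in> A ` Hp p"
        then obtain f where f: "f \<in> Hp p" "y = A f" by blast
        have "f = shift (backshift p f) + cscale (fourier f 0) 1" using shift_backshift[OF p f(1)] by simp
        then have "y = A (shift (backshift p f)) + cscale (fourier f 0) (A 1)"
          using f lin_opD(2,3)[OF A] shift_Hp[OF p] backshift_Hp[OF p Hp_Lp] Hp_cscale[OF p] one_Hp[OF p] by metis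
        then show "y \<in> {u + cscale c (A 1) |u c. u \<in> ?R}" using backshift_Hp[OF p Hp_Lp[OF f(1)]] by blast
      qed
    qed
    then have "qdim cscale (Hp p) ?R (Suc l)"
      using circle_fun.qdim_insert[OF sR subspace_Hp[OF p] A1 A1R] qR by simp
    then have "has_dims p (\<lambda>f. A (shift f)) k (Suc l)" using qKS by (simp add: has_dims_def)
    then show ?thesis by (intro that[of k "Suc l"]) auto
  qed
qed

text \<open>The backward shift is onto and kills exactly the constants. If 1 lies in the range of A,
  its preimage enlarges the kernel; otherwise the constants fill one missing direction and the
  codimension drops.\<close>

lemma has_dims_backshift:
  assumes p: "1 < p" and A: "lin_op p A" and d: "has_dims p A k l"
  obtains k' l' where "has_dims p (\<lambda>f. backshift p (A f)) k' l'" "k + 1 + l' = k' + l"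
proof -
  let ?K = "ker_Hp p A" and ?KS = "ker_Hp p (\<lambda>f. backshift p (A f))"
  let ?R = "A ` Hp p" and ?RS = "(\<lambda>f. backshift p (A f)) ` Hp p"
  note bs = lin_op_backshift[OF p]
  have BA: "lin_op p (\<lambda>f. backshift p (A f))" by (rule lin_op_comp[OF bs A])
  have sK: "circle_fun.subspace ?K" by (rule subspace_ker_Hp[OF p A])
  have sR: "circle_fun.subspace ?R" by (rule subspace_range_Hp[OF p A])
  have sRS: "circle_fun.subspace ?RS" by (rule subspace_range_Hp[OF p BA])
  have RH: "?R \<subseteq> Hp p" using lin_opD(1)[OF A] by auto
  have qK: "qdim cscale ?K {0} k" and qR: "qdim cscale (Hp p) ?R l" using d by (auto simp: has_dims_def)
  have b0: "backshift p v = 0 \<longleftrightarrow> v = cscale (fourier v 0) 1" if "v \<in> Hp p" for v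
    using shift_backshift[OF p that] lin_op_0[OF p bs] backshift_shift[OF p backshift_Hp[OF p Hp_Lp[OF that]]]
    by (auto simp: algebra_simps)
  have bc: "backshift p (cscale c 1) = 0" for c
    using b0[OF Hp_cscale[OF p one_Hp[OF p]], of c] by (simp add: fourier_cscale fourier_one)
  \<comment> \<open>In both cases the codimension is carried along the surjective backward shift;
    \<open>U\<close> stands for the range enlarged by the constants, which is the full preimage of
    the new range.\<close>
  have tr: "qdim cscale (Hp p) ?RS j" if U: "circle_fun.subspace U" "?R \<subseteq> U" "U \<subseteq> {u + cscale c 1 |u c. u \<in> ?R}" "1 \<in> U"
    and q: "qdim cscale (Hp p) U j" for U j
  proof (rule circle_fun.qdim_transport[OF U(1) sRS _ subspace_Hp[OF p] _ _ _ _ q, where f="backshift p"])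
    show "Hp p \<noteq> {}" using Hp_0[OF p] by auto
    show "backshift p (v + w) = backshift p v + backshift p w" if "v \<in> Hp p" "w \<in> Hp p" for v w
      using that lin_opD(2)[OF bs] by auto
    show "backshift p (cscale c v) = cscale c (backshift p v)" if "v \<in> Hp p" for c v
      using that lin_opD(3)[OF bs] by auto
    show "backshift p ` Hp p = Hp p"
      using lin_opD(1)[OF bs] backshift_shift[OF p] shift_Hp[OF p] by (metis (no_types, lifting) image_iff subsetI subset_antisym image_subsetI)
    show "backshift p v \<in> ?RS \<longleftrightarrow> v \<in> U" if v: "v \<in> Hp p" for v
    proof
      assume "backshift p v \<in> ?RS"
      then obtain f where f: "f \<in> Hp p" "backshift p v = backshift p (A f)" by blast
      let ?w = "v - A f"
      have AfH: "A f \<in> Hp p" by (rule lin_opD(1)[OF A f(1)])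
      have "backshift p ?w = 0" using lin_op_diff[OF p bs v AfH] f(2) by simp
      then have "?w = cscale (fourier ?w 0) 1" using b0[OF Hp_diff[OF p v AfH]] by blast
      then have "v = A f + cscale (fourier ?w 0) 1" by (metis add.commute diff_add_cancel)
      moreover have "A f \<in> U" using U(2) f(1) by blast
      ultimately show "v \<in> U" using circle_fun.subspace_add[OF U(1) _ circle_fun.subspace_scale[OF U(1,4)]] by metis
    next
      assume "v \<in> U"
      then obtain f c where f: "v = A f + cscale c 1" "f \<in> Hp p" using U(3) by blast
      have "backshift p v = backshift p (A f)"
        unfolding f(1) using lin_opD(2)[OF bs lin_opD(1)[OF A f(2)] Hp_cscale[OF p one_Hp[OF p]], of c] by (simp add: bc)
      then show "backshift p v \<in> ?RS" using f(2) by blast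
    qed
  qed
  show ?thesis
  proof (cases "1 \<in> ?R")
    case True
    then obtain f0 where f0: "f0 \<in> Hp p" "A f0 = 1" by (metis imageE)
    have f0K: "f0 \<notin> ?K" using f0 by (simp add: ker_Hp_def)
    have "{v + cscale c f0 |v c. v \<in> ?K} = ?KS"
    proof
      show "{v + cscale c f0 |v c. v \<in> ?K} \<subseteq> ?KS"
      proof
        fix f assume "f \<in> {v + cscale c f0 |v c. v \<in> ?K}"
        then obtain v c where v: "f = v + cscale c f0" "v \<in> ?K" by blast
        then have vH: "v \<in> Hp p" "A v = 0" by (auto simp: ker_Hp_def)
        have "A f = cscale c 1" unfolding v(1)
          using lin_opD(2)[OF A vH(1) Hp_cscale[OF p f0(1)], of c] lin_opD(3)[OF A f0(1), of c] vH(2) f0(2) by simp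
        moreover have "f \<in> Hp p" unfolding v(1) by (intro Hp_add[OF p] vH Hp_cscale[OF p] f0)
        ultimately show "f \<in> ?KS" by (simp add: ker_Hp_def bc)
      qed
      show "?KS \<subseteq> {v + cscale c f0 |v c. v \<in> ?K}"
      proof
        fix f assume "f \<in> ?KS"
        then have f: "f \<in> Hp p" "backshift p (A f) = 0" by (auto simp: ker_Hp_def)
        let ?c = "fourier (A f) 0"
        have Af: "A f = cscale ?c 1" using b0[OF lin_opD(1)[OF A f(1)]] f(2) by blast
        have "A (f - cscale ?c f0) = 0"
          using lin_op_diff[OF p A f(1) Hp_cscale[OF p f0(1)], of ?c] lin_opD(3)[OF A f0(1), of ?c] Af f0(2) by simp
        then have "f - cscale ?c f0 \<in> ?K" using Hp_diff[OF p f(1) Hp_cscale[OF p f0(1)]] by (simp add: ker_Hp_def)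
        then have "(f - cscale ?c f0) + cscale ?c f0 \<in> {v + cscale c f0 |v c. v \<in> ?K}" by blast
        then show "f \<in> {v + cscale c f0 |v c. v \<in> ?K}" by simp
      qed
    qed
    then have "qdim cscale ?KS {0} (Suc k)" using circle_fun.qdim_extend[OF sK f0K qK] by simp
    moreover have "qdim cscale (Hp p) ?RS l"
    proof (rule tr[OF sR _ _ True qR])
      show "?R \<subseteq> {u + cscale c 1 |u c. u \<in> ?R}"
      proof
        fix u assume "u \<in> ?R"
        then have "u + cscale 0 1 \<in> {u + cscale c 1 |u c. u \<in> ?R}" by blast
        then show "u \<in> {u + cscale c 1 |u c. u \<in> ?R}" by simp
      qed
    qed simp
    ultimately show ?thesis by (intro that[of "Suc k" l]) (auto simp: has_dims_def)
  next
    case False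
    let ?U = "{u + cscale c 1 |u c. u \<in> ?R}"
    have "?KS = ?K"
    proof
      show "?KS \<subseteq> ?K"
      proof
        fix f assume "f \<in> ?KS"
        then have f: "f \<in> Hp p" "backshift p (A f) = 0" by (auto simp: ker_Hp_def)
        have Af: "A f = cscale (fourier (A f) 0) 1" using b0[OF lin_opD(1)[OF A f(1)]] f(2) by blast
        have "fourier (A f) 0 = 0"
        proof (rule ccontr)
          assume n: "fourier (A f) 0 \<noteq> 0"
          have "cscale (inverse (fourier (A f) 0)) (A f) \<in> ?R"
            using f(1) by (intro circle_fun.subspace_scale[OF sR]) auto
          then have "cscale (inverse (fourier (A f) 0)) (cscale (fourier (A f) 0) 1) \<in> ?R" using Af by simp
          then show False using False n by simp
        qed
        then have "A f = 0" using Af by simp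
        then show "f \<in> ?K" using f(1) by (simp add: ker_Hp_def)
      qed
      show "?K \<subseteq> ?KS" using lin_op_0[OF p bs] by (auto simp: ker_Hp_def)
    qed
    obtain j where j: "l = Suc j" "qdim cscale (Hp p) ?U j"
      by (rule circle_fun.qdim_remove[OF sR subspace_Hp[OF p] RH one_Hp[OF p] False qR])
    have "qdim cscale (Hp p) ?RS j"
    proof (rule tr[OF circle_fun.subspace_add_span[OF sR] _ subset_refl _ j(2)])
      show "?R \<subseteq> ?U"
      proof
        fix u assume "u \<in> ?R"
        then have "u + cscale 0 1 \<in> ?U" by blast
        then show "u \<in> ?U" by simp
      qed
      have "0 + cscale 1 1 \<in> ?U" using circle_fun.subspace_0[OF sR] by blast
      then show "1 \<in> ?U" by simp
    qed
    then show ?thesis using j(1) qK \<open>?KS = ?K\<close> by (intro that[of k j]) (auto simp: has_dims_def)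
  qed
qed

lemma lin_op_powi_mult: "1 < p \<Longrightarrow> 0 \<le> j \<Longrightarrow> lin_op p (\<lambda>f. tt powi j * f)"
  by (auto simp: lin_op_def Hp_tt_powi_mult distrib_left mult_cscale)

lemma has_dims_shift_powi:
  assumes p: "1 < p" and A: "lin_op p A" and d: "has_dims p A k l"
  obtains k' l' where "has_dims p (\<lambda>f. A (tt powi int j * f)) k' l'" "k' + l + j = k + l'" "k \<le> k' + j"
proof -
  have "lin_op p (\<lambda>f. A (tt powi int j * f)) \<and>
    (\<exists>k' l'. has_dims p (\<lambda>f. A (tt powi int j * f)) k' l' \<and> k' + l + j = k + l' \<and> k \<le> k' + j)"
  proof (induction j)
    case 0
    then show ?case using A d by auto
  next
    case (Suc j)
    let ?A = "\<lambda>f. A (tt powi int j * f)"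
    have e: "?A (tt * f) = A (tt powi int (Suc j) * f)" for f
      using tt_powi_cancel[of "int j" 1 f] by (simp add: add.commute del: power_int_of_nat)
    have lin: "lin_op p ?A" using Suc by blast
    obtain k' l' where kl: "has_dims p ?A k' l'" "k' + l + j = k + l'" "k \<le> k' + j" using Suc by blast
    obtain k2 l2 where kl2: "has_dims p (\<lambda>f. ?A (tt * f)) k2 l2" "k2 + l' + 1 = k' + l2" "k' \<le> k2 + 1"
      by (rule has_dims_shift[OF p lin kl(1)])
    have "lin_op p (\<lambda>f. ?A (tt * f))" by (rule lin_op_comp[OF lin lin_op_shift[OF p]])
    then show ?case using kl kl2 unfolding e by (intro conjI exI[of _ k2] exI[of _ l2]) auto
  qed
  then show ?thesis using that by blast
qed

text \<open>A negative power of t moves coefficients downwards, so whatever the inner projection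
  removes would be removed by the outer one as well.\<close>

lemma riesz_inverse_powi_riesz:
  assumes p: "1 < p" and g: "g \<in> Lp p" and j: "0 \<le> j"
  shows "riesz p (tt powi (- j) * riesz p g) = riesz p (tt powi (- j) * g)"
proof -
  have L: "tt powi (- j) * g \<in> Lp p" using g p by (simp add: Lp_tt_powi_mult)
  show ?thesis
    by (rule riesz_eqI[OF p riesz_Hp(1)[OF p L]])
       (use j in \<open>simp add: fourier_riesz[OF p L] fourier_tt_powi_mult fourier_riesz[OF p g]\<close>)
qed

lemma lin_op_inverse_powi:
  assumes p: "1 < p"
  shows "lin_op p (\<lambda>f. riesz p (tt powi j * f))"
  unfolding lin_op_def using p
  by (auto simp: image_subset_iff riesz_Hp Lp_tt_powi_mult Hp_Lp distrib_left riesz_add mult_cscale riesz_cscale)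

lemma has_dims_backshift_powi:
  assumes p: "1 < p" and A: "lin_op p A" and d: "has_dims p A k l"
  obtains k' l' where "has_dims p (\<lambda>f. riesz p (tt powi (- int j) * A f)) k' l'" "k + j + l' = k' + l"
proof -
  have "\<exists>k' l'. has_dims p (\<lambda>f. riesz p (tt powi (- int j) * A f)) k' l' \<and> k + j + l' = k' + l"
  proof (induction j)
    case 0
    have "riesz p (A f) = A f" if "f \<in> Hp p" for f using lin_opD(1)[OF A that] by (rule riesz_ident[OF p])
    then have "has_dims p (\<lambda>f. riesz p (tt powi (- int 0) * A f)) k l"
      using d by (subst dims_cong(3)[where B=A]) auto
    then show ?case by auto
  next
    case (Suc j)
    let ?A = "\<lambda>f. riesz p (tt powi (- int j) * A f)"
    have e: "backshift p (?A f) = riesz p (tt powi (- int (Suc j)) * A f)" if f: "f \<in> Hp p" for f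
    proof -
      have L: "tt powi (- int j) * A f \<in> Lp p"
        using lin_opD(1)[OF A f] p by (simp add: Lp_tt_powi_mult Hp_Lp)
      have "tt powi (- 1) * (tt powi (- int j) * A f) = tt powi (- int (Suc j)) * A f"
        unfolding tt_powi_cancel by simp
      then show ?thesis using riesz_inverse_powi_riesz[OF p L, of 1] by (simp add: backshift_def)
    qed
    have lin: "lin_op p ?A" by (rule lin_op_comp[OF lin_op_inverse_powi[OF p] A])
    obtain k' l' where kl: "has_dims p ?A k' l'" "k + j + l' = k' + l" using Suc by blast
    obtain k2 l2 where kl2: "has_dims p (\<lambda>f. backshift p (?A f)) k2 l2" "k' + 1 + l2 = k2 + l'"
      by (rule has_dims_backshift[OF p lin kl(1)])
    have "has_dims p (\<lambda>f. riesz p (tt powi (- int (Suc j)) * A f)) k2 l2"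
      using kl2(1) dims_cong(3)[where A="\<lambda>f. backshift p (?A f)", OF e] by blast
    then show ?case using kl kl2 by (intro exI[of _ k2] exI[of _ l2]) auto
  qed
  then show ?thesis using that by blast
qed

subsection \<open>Toeplitz plus Hankel operators\<close>

lemma tilde_mult: "tilde (f * g) = tilde f * tilde g"
  and tilde_add: "tilde (f + g) = tilde f + tilde g"
  and tilde_diff: "tilde (f - g) = tilde f - tilde g"
  and tilde_inverse: "tilde (inverse f) = inverse (tilde f)"
  and tilde_1: "tilde 1 = 1"
  and tilde_0: "tilde 0 = 0"
  and tilde_cscale: "tilde (cscale z f) = cscale z (tilde f)"
  by (transfer; simp add: circle_eq_def)+

lemma tilde_tilde: "tilde (tilde f) = f"
  by transfer (simp add: circle_eq_def)

lemma tilde_tt_powi: "tilde (tt powi k) = tt powi (- k)"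
  by (rule circle_fun_eq_fourier) (auto simp: Lp_tilde tt_powi_Lp fourier_tilde fourier_tt_powi)

lemma tilde_tt: "tilde tt = inverse tt"
  using tilde_tt_powi[of 1] by simp

lemma divide_circle_fun: "f / g = f * inverse (g :: circle_fun)"
  by transfer (simp add: circle_eq_def divide_inverse)

text \<open>Pointwise inversion sends 0 to 0 and is therefore a genuine inverse only once some
  reciprocal has been exhibited.\<close>

lemma inverse_unique_circle_fun:
  assumes "f * g = (1 :: circle_fun)"
  shows "inverse f = g" "f * inverse f = 1"
proof -
  show *: "inverse f = g"
    unfolding circle_fun_eq_iff
    using assms[unfolded circle_fun_eq_iff] rv_mult[of f g] rv_1 rv_inverse[of f]
    by eventually_elim (metis inverse_unique)
  show "f * inverse f = 1" using assms * by simp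
qed

lemma tt_inverse: "tt * inverse tt = 1" "inverse tt * tt = 1"
  using inverse_tt_cancel[of 1] by (simp_all add: mult.commute)

lemma one_minus_tt_cancel:
  assumes "(1 - tt) * f = 0"
  shows "f = 0"
  unfolding circle_fun_eq_iff
  using assms[unfolded circle_fun_eq_iff] rv_mult[of "1 - tt" f] rv_diff[of 1 tt] rv_1 rv_tt rv_0 AE_circle_neq[of 1]
  by eventually_elim auto

lemma one_plus_tt_cancel:
  assumes "(1 + tt) * f = 0"
  shows "f = 0"
  unfolding circle_fun_eq_iff
  using assms[unfolded circle_fun_eq_iff] rv_mult[of "1 + tt" f] rv_add[of 1 tt] rv_1 rv_tt rv_0 AE_circle_neq[of "-1"]
  by eventually_elim (auto simp: add_eq_0_iff)

lemma flip_J_add: "flip_J (f + g) = flip_J f + flip_J g"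
  and flip_J_cscale: "flip_J (cscale z f) = cscale z (flip_J f)"
  and flip_J_0: "flip_J 0 = 0"
  by (simp_all add: flip_J_def tilde_add tilde_cscale tilde_0 distrib_left mult_cscale)

lemma tilde_flip_J: "tilde (flip_J f) = tt * f"
  by (simp add: flip_J_def tilde_mult tilde_inverse tilde_tt tilde_tilde inverse_unique_circle_fun(1)[OF tt_inverse(2)])

lemma flip_J_flip_J: "flip_J (flip_J f) = f"
  unfolding flip_J_def[of "flip_J f"] tilde_flip_J by (rule inverse_tt_cancel)

lemma flip_J_mult: "flip_J (f * g) = tilde f * flip_J g"
  by (simp add: flip_J_def tilde_mult mult_ac)

lemma fourier_flip_J: "fourier (flip_J f) k = fourier f (- k - 1)"
  by (simp add: flip_J_def fourier_inverse_tt_mult fourier_tilde)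

lemma Lp_flip_J: "0 \<le> p \<Longrightarrow> f \<in> Lp p \<Longrightarrow> flip_J f \<in> Lp p"
  by (simp add: flip_J_def Lp_inverse_tt_mult Lp_tilde)

lemma Lp_norm_flip_J: "Lp_norm p (flip_J f) = Lp_norm p f"
  using Lp_norm_tt_powi_mult[of p "-1" "tilde f"] by (simp add: flip_J_def Lp_norm_tilde)

lemma Linf_mult_Lp:
  assumes "u \<in> Linf" "0 \<le> p"
  shows "f \<in> Lp p \<Longrightarrow> u * f \<in> Lp p"
  using assms Lp_bounded_mult(1) by (auto simp: Linf_def ess_bounded.rep_eq)

lemma Linf_mult_bounded:
  assumes "u \<in> Linf" "1 \<le> p"
  obtains C where "0 \<le> C" "\<And>f. f \<in> Lp p \<Longrightarrow> Lp_norm p (u * f) \<le> C * Lp_norm p f"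
proof -
  obtain C where C: "AE t in circle_measure. norm (rv u t) \<le> C"
    using assms by (auto simp: Linf_def ess_bounded.rep_eq)
  have "AE t in circle_measure. 0 \<le> C" using C by eventually_elim (metis norm_ge_zero order_trans)
  then have "0 \<le> C" by simp
  then show ?thesis using Lp_bounded_mult(2)[OF _ _ C] assms(2) by (intro that[of C]) auto
qed

lemma Linf_mult: "u \<in> Linf \<Longrightarrow> v \<in> Linf \<Longrightarrow> u * v \<in> Linf"
proof -
  assume "u \<in> Linf" "v \<in> Linf"
  then obtain C D where C: "AE t in circle_measure. norm (rv u t) \<le> C" and D: "AE t in circle_measure. norm (rv v t) \<le> D"
    by (auto simp: Linf_def ess_bounded.rep_eq)
  have "AE t in circle_measure. norm (rv (u * v) t) \<le> C * D"
    using C D rv_mult[of u v]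
    by eventually_elim (auto simp: norm_mult intro!: mult_mono order_trans[OF norm_ge_zero])
  then show ?thesis by (auto simp: Linf_def ess_bounded.rep_eq)
qed

lemma Linf_tt_powi: "tt powi k \<in> Linf"
proof -
  have "AE t in circle_measure. norm (rv (tt powi k) t) \<le> 1" using norm_tt_powi[of k] by eventually_elim simp
  then show ?thesis by (auto simp: Linf_def ess_bounded.rep_eq)
qed

lemma Linf_tilde: "u \<in> Linf \<Longrightarrow> tilde u \<in> Linf"
proof -
  assume "u \<in> Linf"
  then obtain C where C: "AE t in circle_measure. norm (rv u t) \<le> C" by (auto simp: Linf_def ess_bounded.rep_eq)
  have "AE t in circle_measure. norm (rv u (inverse t)) \<le> C"
    by (rule AE_circle_measure_inverse[OF _ C]) measurable
  then have "AE t in circle_measure. norm (rv (tilde u) t) \<le> C" using rv_tilde[of u] by eventually_elim simp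
  then show ?thesis by (auto simp: Linf_def ess_bounded.rep_eq)
qed

lemma toeplitz_hankel_eq:
  assumes p: "1 < p" and ab: "a \<in> Linf" "b \<in> Linf" and f: "f \<in> Lp p"
  shows "toeplitz_hankel p a b f = riesz p (a * f + b * flip_J f)"
  using assms by (simp add: toeplitz_hankel_def toeplitz_def hankel_def riesz_add Linf_mult_Lp Lp_flip_J)

lemma symbol_Lp:
  assumes p: "1 < p" and ab: "a \<in> Linf" "b \<in> Linf" and f: "f \<in> Lp p"
  shows "a * f + b * flip_J f \<in> Lp p"
  using assms by (auto intro!: Lp_add Linf_mult_Lp Lp_flip_J)

lemma bounded_op_toeplitz_hankel:
  assumes p: "1 < p" and ab: "a \<in> Linf" "b \<in> Linf"
  shows "bounded_op p (toeplitz_hankel p a b)"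
proof -
  note eq = toeplitz_hankel_eq[OF p ab Hp_Lp] and sL = symbol_Lp[OF p ab Hp_Lp]
  have p1: "1 \<le> p" using p by simp
  obtain A where A: "0 \<le> A" "\<And>f. f \<in> Lp p \<Longrightarrow> Lp_norm p (a * f) \<le> A * Lp_norm p f" using Linf_mult_bounded[OF ab(1) p1] by metis
  obtain B where B: "0 \<le> B" "\<And>f. f \<in> Lp p \<Longrightarrow> Lp_norm p (b * f) \<le> B * Lp_norm p f" using Linf_mult_bounded[OF ab(2) p1] by metis
  obtain C where C: "0 \<le> C" "\<And>f. f \<in> Lp p \<Longrightarrow> Lp_norm p (riesz p f) \<le> C * Lp_norm p f" using riesz_bounded[OF p] by metis
  show ?thesis
    unfolding bounded_op_def
  proof (intro conjI ballI allI)
    show "toeplitz_hankel p a b ` Hp p \<subseteq> Hp p" using eq sL riesz_Hp[OF p] by auto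
    show "toeplitz_hankel p a b (f + g) = toeplitz_hankel p a b f + toeplitz_hankel p a b g" if fg: "f \<in> Hp p" "g \<in> Hp p" for f g
    proof -
      have "a * (f + g) + b * flip_J (f + g) = (a * f + b * flip_J f) + (a * g + b * flip_J g)"
        by (simp add: flip_J_add distrib_left)
      then show ?thesis using fg by (simp add: eq Hp_add[OF p] riesz_add[OF p] sL)
    qed
    show "toeplitz_hankel p a b (cscale z f) = cscale z (toeplitz_hankel p a b f)" if f: "f \<in> Hp p" for z f
    proof -
      have "a * cscale z f + b * flip_J (cscale z f) = cscale z (a * f + b * flip_J f)"
        by (simp add: flip_J_cscale mult_cscale circle_fun.scale_right_distrib)
      then show ?thesis using f by (simp add: eq Hp_cscale[OF p] riesz_cscale[OF p] sL)
    qed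
    show "\<exists>C. \<forall>f\<in>Hp p. Lp_norm p (toeplitz_hankel p a b f) \<le> C * Lp_norm p f"
    proof (intro exI ballI)
      fix f assume f: "f \<in> Hp p"
      have fL: "f \<in> Lp p" "flip_J f \<in> Lp p" using f p by (auto simp: Hp_Lp Lp_flip_J)
      have "Lp_norm p (toeplitz_hankel p a b f) \<le> C * Lp_norm p (a * f + b * flip_J f)"
        unfolding eq[OF f] by (rule C(2)[OF sL[OF f]])
      also have "Lp_norm p (a * f + b * flip_J f) \<le> Lp_norm p (a * f) + Lp_norm p (b * flip_J f)"
        using fL ab p by (intro Lp_norm_triangle Linf_mult_Lp) auto
      also have "\<dots> \<le> A * Lp_norm p f + B * Lp_norm p f"
        using A(2)[OF fL(1)] B(2)[OF fL(2)] by (simp add: Lp_norm_flip_J)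
      finally show "Lp_norm p (toeplitz_hankel p a b f) \<le> (C * (A + B)) * Lp_norm p f"
        using C(1) by (simp add: mult_left_mono distrib_right mult.assoc)
    qed
  qed
qed

text \<open>Since J inverts t, shifts on the right act on the two symbols with opposite exponents,
  while backward shifts on the left act on both with the same one. This allows the powers in c and d
  to be changed independently.\<close>

lemma toeplitz_hankel_shifts:
  assumes p: "1 < p" and ab: "a \<in> Linf" "b \<in> Linf" and f: "f \<in> Hp p" and ij: "0 \<le> i" "0 \<le> j"
  shows "riesz p (tt powi (- j) * toeplitz_hankel p a b (tt powi i * f)) =
    toeplitz_hankel p (a * tt powi (i - j)) (b * tt powi (- i - j)) f"
proof -
  have fi: "tt powi i * f \<in> Lp p" using f p by (simp add: Lp_tt_powi_mult Hp_Lp)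
  have J: "flip_J (tt powi i * f) = tt powi (- i) * flip_J f" by (simp add: flip_J_mult tilde_tt_powi)
  have "tt powi (- j) * (a * (tt powi i * f) + b * flip_J (tt powi i * f)) =
      a * (tt powi (- j) * (tt powi i * f)) + b * (tt powi (- j) * (tt powi (- i) * flip_J f))"
    unfolding J by (simp add: distrib_left mult_ac)
  also have "\<dots> = (a * tt powi (i - j)) * f + (b * tt powi (- i - j)) * flip_J f"
    unfolding tt_powi_cancel by (simp add: mult.assoc add.commute)
  finally show ?thesis
    unfolding toeplitz_hankel_eq[OF p ab fi] riesz_inverse_powi_riesz[OF p symbol_Lp[OF p ab fi] ij(2)]
    by (simp add: toeplitz_hankel_eq p ab Linf_mult Linf_tt_powi Hp_Lp f)
qed

section \<open>Injectivity and dense range at index zero\<close>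

lemma odd_analytic_eq_0:
  assumes "y \<in> Lp 1" "tilde y = - y" "\<And>k. k < 0 \<Longrightarrow> fourier y k = 0"
  shows "y = 0"
proof (rule fourier_uniqueness_0[OF assms(1)])
  have odd: "fourier y (- k) = - fourier y k" for k
    using fourier_tilde[of y k] assms(2) by (simp add: fourier_uminus)
  show "fourier y k = 0" for k
    using assms(3)[of k] assms(3)[of "- k"] odd[of k] odd[of 0] by (cases k "0::int" rule: linorder_cases) auto
qed

text \<open>The next two lemmas are the uniqueness halves of the two scalar Riemann-Hilbert problems
  into which the kernel equation splits.\<close>

lemma jump_minus_eq_0:
  assumes pq: "1 < p" "1/p + 1/q = 1" and e: "e * e' = 1" "(1 - tt) * e' \<in> Hp p" and g: "g \<in> Hp q"
    and rel: "tilde e * g = e * flip_J g"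
  shows "g = 0"
proof -
  define y where "y = ((1 - tt) * e') * g"
  have te: "tilde e * tilde e' = 1" using e(1) tilde_1 by (simp flip: tilde_mult)
  have "e' * g = (tilde e * tilde e') * (e' * g)" using te by simp
  also have "\<dots> = tilde e' * e' * (tilde e * g)" by (simp only: mult_ac)
  also have "\<dots> = (e * e') * (tilde e' * flip_J g)" unfolding rel by (simp only: mult_ac)
  finally have eg: "e' * g = tilde e' * flip_J g" using e(1) by simp
  have "y = (1 - tt) * (tilde e' * flip_J g)" unfolding y_def mult.assoc eg ..
  also have "\<dots> = ((1 - tt) * inverse tt) * (tilde e' * tilde g)" by (simp only: flip_J_def mult_ac)
  also have "(1 - tt) * inverse tt = - (1 - inverse tt)" by (simp add: left_diff_distrib tt_inverse)
  also have "- (1 - inverse tt) * (tilde e' * tilde g) = - tilde y"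
    by (simp add: y_def tilde_mult tilde_diff tilde_1 tilde_tt mult.assoc left_diff_distrib)
  finally have odd: "tilde y = - y" by (metis minus_minus)
  have "y = 0"
  proof (rule odd_analytic_eq_0[OF _ odd])
    show "y \<in> Lp 1" unfolding y_def by (rule Lp_mult_Holder(1)[OF pq Hp_Lp[OF e(2)] Hp_Lp[OF g]])
    show "fourier y k = 0" if "k < 0" for k unfolding y_def by (rule Hp_mult_fourier[OF pq e(2) g that])
  qed
  then have "(1 - tt) * (e' * g) = 0" by (simp add: y_def mult.assoc)
  then have "e' * g = 0" by (rule one_minus_tt_cancel)
  then have "e * (e' * g) = 0" by simp
  then show ?thesis using e(1) by (simp flip: mult.assoc)
qed

lemma jump_plus_eq_0:
  assumes pq: "1 < p" "1/p + 1/q = 1" and e: "e * e' = 1" "(1 + tt) * e \<in> Hp p" and g: "g \<in> Hp q"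
    and rel: "e * g + tilde e * flip_J g = 0"
  shows "g = 0"
proof -
  define x where "x = ((1 + tt) * e) * g"
  have eg: "e * g = - (tilde e * flip_J g)" using rel by (simp add: add_eq_0_iff2)
  have "x = - ((1 + tt) * (tilde e * flip_J g))" unfolding x_def mult.assoc eg by simp
  also have "(1 + tt) * (tilde e * flip_J g) = ((1 + tt) * inverse tt) * (tilde e * tilde g)" by (simp only: flip_J_def mult_ac)
  also have "(1 + tt) * inverse tt = 1 + inverse tt" by (simp add: distrib_right tt_inverse add.commute)
  also have "(1 + inverse tt) * (tilde e * tilde g) = tilde x"
    by (simp add: x_def tilde_mult tilde_add tilde_1 tilde_tt mult.assoc)
  finally have odd: "tilde x = - x" by (metis minus_minus)
  have "x = 0"
  proof (rule odd_analytic_eq_0[OF _ odd])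
    show "x \<in> Lp 1" unfolding x_def by (rule Lp_mult_Holder(1)[OF pq Hp_Lp[OF e(2)] Hp_Lp[OF g]])
    show "fourier x k = 0" if "k < 0" for k unfolding x_def by (rule Hp_mult_fourier[OF pq e(2) g that])
  qed
  then have "(1 + tt) * (e * g) = 0" by (simp add: x_def mult.assoc)
  then have "e * g = 0" by (rule one_plus_tt_cancel)
  then have "e' * (e * g) = 0" by simp
  then show ?thesis using e(1) by (simp add: mult.commute[of e'] flip: mult.assoc)
qed

text \<open>The two factorizations with exponent 0, a/b = cp / tilde cp and tilde a / b = dp / tilde
  dp, cleared of denominators. Reciprocals are carried as separate parameters so that cancellation
  is plain ring algebra.\<close>

locale zero_index_factorization =
  fixes p q :: real and a b a' b' cp cp' dp dp' :: circle_fun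
  assumes pq: "1 < p" "1/p + 1/q = 1"
    and ab: "a \<in> Linf" "b \<in> Linf" "a * a' = 1" "b * b' = 1" "b' \<in> Linf"
    and c_rel: "a * tilde cp = b * cp" and d_rel: "tilde a * tilde dp = b * dp"
    and cp': "cp * cp' = 1" and dp': "dp * dp' = 1"
    and cp_Hq: "(1 + tt) * cp \<in> Hp q" and cp'_Hp: "(1 - tt) * cp' \<in> Hp p"
    and dp_Hp: "(1 + tt) * dp \<in> Hp p" and dp'_Hq: "(1 - tt) * dp' \<in> Hp q"
begin

lemma q: "1 < q" and qp: "1/q + 1/p = 1"
  using conjugate_exponent[OF pq] pq(2) by auto

abbreviation "M \<equiv> toeplitz_hankel p a b"
abbreviation "G f \<equiv> a * f + b * flip_J f"

lemma c_rel': "tilde a * cp = tilde b * tilde cp"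
  using arg_cong[OF c_rel, of tilde] by (simp add: tilde_mult tilde_tilde)

lemma d_rel': "a * dp = tilde b * tilde dp"
  using arg_cong[OF d_rel, of tilde] by (simp add: tilde_mult tilde_tilde)

lemma M_eq: "f \<in> Hp p \<Longrightarrow> M f = riesz p (G f)"
  by (rule toeplitz_hankel_eq[OF pq(1) ab(1,2) Hp_Lp])

lemma G_Lp: "f \<in> Hp p \<Longrightarrow> G f \<in> Lp p"
  by (rule symbol_Lp[OF pq(1) ab(1,2) Hp_Lp])

text \<open>J exchanges the two terms of \<open>G f\<close> at the price of reflecting the symbols;
  the relation for d and its reflection undo this.\<close>

lemma G_jump: "dp * G f = tilde dp * flip_J (G f)"
proof -
  have "tilde dp * flip_J (G f) = (tilde a * tilde dp) * flip_J f + (tilde b * tilde dp) * f"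
    by (simp add: flip_J_add flip_J_mult flip_J_flip_J distrib_left mult_ac)
  also have "\<dots> = (b * dp) * flip_J f + (a * dp) * f" unfolding d_rel d_rel' ..
  also have "\<dots> = dp * G f" by (simp add: distrib_left mult_ac)
  finally show ?thesis ..
qed

text \<open>If all nonnegative coefficients of g vanish, then J g is analytic, and the uniqueness
  result applies to it with the exponents p and q interchanged.\<close>

lemma jump_unique:
  assumes G: "g \<in> Lp p" "dp * g = tilde dp * flip_J g" "\<And>k. 0 \<le> k \<Longrightarrow> fourier g k = 0"
  shows "g = 0"
proof -
  have "flip_J g = 0"
  proof (rule jump_minus_eq_0[OF q qp dp' dp'_Hq])
    show "flip_J g \<in> Hp p" using G(1,3) pq by (simp add: Hp_def Lp_flip_J fourier_flip_J)
    show "tilde dp * flip_J g = dp * flip_J (flip_J g)" using G(2) by (simp add: flip_J_flip_J)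
  qed
  then show ?thesis using flip_J_flip_J[of g] by (simp add: flip_J_0)
qed

text \<open>Multiplication by \<open>tilde cp\<close> and the relation for c expose b as a common
  factor of both terms; what remains is an antisymmetric relation for f.\<close>

lemma G_injective:
  assumes f: "f \<in> Hp p" and "G f = 0"
  shows "f = 0"
proof (rule jump_plus_eq_0[OF q qp cp' cp_Hq f])
  have "b * (cp * f + tilde cp * flip_J f) = (a * tilde cp) * f + b * tilde cp * flip_J f"
    unfolding c_rel by (simp add: distrib_left mult_ac)
  also have "\<dots> = tilde cp * G f" by (simp add: distrib_left mult_ac)
  finally have "b' * (b * (cp * f + tilde cp * flip_J f)) = 0" using assms(2) by simp
  then show "cp * f + tilde cp * flip_J f = 0" using ab(4) by (simp add: mult.commute[of b'] flip: mult.assoc)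
qed

lemma M_injective:
  assumes f: "f \<in> Hp p" and "M f = 0"
  shows "f = 0"
proof (rule G_injective[OF f jump_unique[OF G_Lp[OF f] G_jump]])
  fix k :: int assume "0 \<le> k"
  then show "fourier (G f) k = 0"
    using fourier_riesz[OF pq(1) G_Lp[OF f], of k] M_eq[OF f] assms(2) by simp
qed

text \<open>The transposed operator has the same structure with the roles of c and d interchanged.
  Only the analytic part \<Psi> of the reflected \<psi> matters; annihilation of the range makes
  \<theta> analytic, the relation for c forces \<theta> = 0, and then the relation for d forces
  \<Psi> = 0.\<close>

lemma annihilator_trivial:
  assumes psi: "\<psi> \<in> Lp q" and ann: "\<And>f. f \<in> Hp p \<Longrightarrow> fourier (\<psi> * M f) 0 = 0" and h: "h \<in> Hp p"
  shows "fourier (\<psi> * h) 0 = 0"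
proof -
  define \<Psi> where "\<Psi> = riesz q (tilde \<psi>)"
  have tL: "tilde \<psi> \<in> Lp q" by (rule Lp_tilde[OF psi])
  have PH: "\<Psi> \<in> Hp q" unfolding \<Psi>_def by (rule riesz_Hp[OF q tL])
  have PL: "\<Psi> \<in> Lp q" "tilde \<Psi> \<in> Lp q" using Hp_Lp[OF PH] Lp_tilde by auto
  have L1: "u * v \<in> Lp 1" if "u \<in> Lp q" "v \<in> Lp p" for u v by (rule Lp_mult_Holder(1)[OF q qp that])
  \<comment> \<open>The two functions paired with h agree in all coefficients of index at most 0,
    and the remaining difference has zero pairing with an analytic h.\<close>
  have pair: "fourier (\<psi> * h) 0 = fourier (tilde \<Psi> * h) 0" if h: "h \<in> Hp p" for h
  proof -
    define \<zeta> where "\<zeta> = tt powi (- 1) * (\<psi> - tilde \<Psi>)"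
    have dL: "\<psi> - tilde \<Psi> \<in> Lp q" using psi PL q by (simp add: Lp_diff)
    have zH: "\<zeta> \<in> Hp q" unfolding \<zeta>_def
    proof (rule Hp_divide_tt_powi[OF q dL])
      fix j :: int assume "j < 1"
      then show "fourier (\<psi> - tilde \<Psi>) j = 0"
        using Lp_subset_L1[OF q] psi PL fourier_riesz[OF q tL, of "- j"]
        by (subst fourier_diff) (auto simp: fourier_tilde \<Psi>_def)
    qed
    have "fourier ((\<psi> - tilde \<Psi>) * h) 0 = fourier (tt * (\<zeta> * h)) 0"
      unfolding \<zeta>_def mult.assoc[symmetric] by (simp add: tt_inverse)
    also have "\<dots> = 0" using Hp_mult_fourier[OF q qp zH h, of "-1"] by (simp add: fourier_tt_mult)
    finally show ?thesis
      using fourier_diff[OF L1[OF psi Hp_Lp[OF h]] L1[OF PL(2) Hp_Lp[OF h]], of 0] by (simp add: left_diff_distrib)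
  qed
  \<comment> \<open>\<open>M f\<close> may be replaced by \<open>G f\<close>: their difference has
    negative frequencies only, and the reflected \<Psi> has no positive ones, so the product has
    mean zero.\<close>
  have PG: "fourier (tilde \<Psi> * G f) 0 = 0" if f: "f \<in> Hp p" for f
  proof -
    have MH: "M f \<in> Hp p" unfolding M_eq[OF f] by (rule riesz_Hp[OF pq(1) G_Lp[OF f]])
    define w where "w = flip_J (G f - M f)"
    have dL: "G f - M f \<in> Lp p" using G_Lp[OF f] Hp_Lp[OF MH] pq by (simp add: Lp_diff)
    have wH: "w \<in> Hp p"
      using dL pq Lp_subset_L1[OF pq(1)] G_Lp[OF f] Hp_Lp[OF MH] fourier_riesz[OF pq(1) G_Lp[OF f]]
      by (auto simp: w_def Hp_def Lp_flip_J fourier_flip_J fourier_diff M_eq[OF f])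
    have "fourier (tilde \<Psi> * (G f - M f)) 0 = fourier (tilde (tilde \<Psi> * flip_J w)) 0"
      by (simp add: w_def flip_J_flip_J fourier_tilde)
    also have "tilde (tilde \<Psi> * flip_J w) = tt * (\<Psi> * w)"
      by (simp add: tilde_mult tilde_tilde tilde_flip_J mult_ac)
    also have "fourier (tt * (\<Psi> * w)) 0 = 0"
      using Hp_mult_fourier[OF q qp PH wH, of "-1"] by (simp add: fourier_tt_mult)
    finally have "fourier (tilde \<Psi> * G f) 0 = fourier (tilde \<Psi> * M f) 0"
      using fourier_diff[OF L1[OF PL(2) G_Lp[OF f]] L1[OF PL(2) Hp_Lp[OF MH]], of 0] by (simp add: right_diff_distrib)
    then show ?thesis using pair[OF MH] ann[OF f] by simp
  qed
  define \<theta> where "\<theta> = a * flip_J \<Psi> + tilde b * \<Psi>"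
  have thL: "\<theta> \<in> Lp q" unfolding \<theta>_def
    by (intro Lp_add Linf_mult_Lp ab Linf_tilde Lp_flip_J PL) (use q in simp_all)
  \<comment> \<open>The test functions are the powers of t. Reflecting the Hankel term leaves its
    coefficient at 0 unchanged and lets both terms combine to a power of t times \<theta>.\<close>
  have th: "fourier \<theta> (- 1 - k) = 0" if k: "0 \<le> k" for k
  proof -
    have f: "tt powi k \<in> Hp p" using k pq by (auto simp: Hp_def tt_powi_Lp fourier_tt_powi)
    have aL: "a * (tilde \<Psi> * tt powi k) \<in> Lp 1" "tilde b * (tt * (\<Psi> * tt powi k)) \<in> Lp 1"
      using Linf_mult_Lp[OF ab(1) _ L1[OF PL(2) Hp_Lp[OF f]]]
        Linf_mult_Lp[OF Linf_tilde[OF ab(2)] _ Lp_tt_mult[OF L1[OF PL(1) Hp_Lp[OF f]]]] by simp_all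
    have "b * (tilde \<Psi> * flip_J (tt powi k)) = tilde (tilde b * (tt * (\<Psi> * tt powi k)))"
      by (simp add: tilde_mult tilde_tilde flip_J_def tilde_tt mult_ac)
    then have split: "tilde \<Psi> * G (tt powi k) = a * (tilde \<Psi> * tt powi k) + tilde (tilde b * (tt * (\<Psi> * tt powi k)))"
      by (simp add: distrib_left mult_ac)
    have "0 = fourier (a * (tilde \<Psi> * tt powi k)) 0 + fourier (tilde b * (tt * (\<Psi> * tt powi k))) 0"
      using PG[OF f] unfolding split fourier_add[OF aL(1) Lp_tilde[OF aL(2)]] by (simp add: fourier_tilde)
    also have "\<dots> = fourier (a * (tilde \<Psi> * tt powi k) + tilde b * (tt * (\<Psi> * tt powi k))) 0"
      by (simp add: fourier_add[OF aL])
    also have "a * (tilde \<Psi> * tt powi k) + tilde b * (tt * (\<Psi> * tt powi k)) = tt * (tt powi k * \<theta>)"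
    proof -
      have "tilde \<Psi> = tt * flip_J \<Psi>" by (simp add: flip_J_def inverse_tt_cancel)
      then show ?thesis by (simp add: \<theta>_def distrib_left mult_ac)
    qed
    finally show ?thesis by (simp add: fourier_tt_mult fourier_tt_powi_mult)
  qed
  have thH: "\<theta> \<in> Hp q"
    using thL th[of "- 1 - k" for k] by (auto simp: Hp_def)
  have "\<theta> = 0"
  proof (rule jump_minus_eq_0[OF pq cp' cp'_Hp thH])
    have J: "flip_J \<theta> = tilde a * \<Psi> + b * flip_J \<Psi>"
      by (simp add: \<theta>_def flip_J_add flip_J_mult flip_J_flip_J tilde_tilde)
    have "cp * flip_J \<theta> = (tilde a * cp) * \<Psi> + (b * cp) * flip_J \<Psi>"
      unfolding J by (simp add: distrib_left mult_ac)
    also have "\<dots> = tilde cp * \<theta>" unfolding c_rel' c_rel[symmetric] by (simp add: \<theta>_def distrib_left mult_ac)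
    finally show "tilde cp * \<theta> = cp * flip_J \<theta>" ..
  qed
  have "\<Psi> = 0"
  proof (rule jump_plus_eq_0[OF pq dp' dp_Hp PH])
    have "a * (dp * \<Psi> + tilde dp * flip_J \<Psi>) = (a * dp) * \<Psi> + tilde dp * (a * flip_J \<Psi>)"
      by (simp add: distrib_left mult_ac)
    also have "\<dots> = tilde dp * \<theta>" unfolding d_rel' by (simp add: \<theta>_def distrib_left mult_ac)
    finally have "a' * (a * (dp * \<Psi> + tilde dp * flip_J \<Psi>)) = 0" using \<open>\<theta> = 0\<close> by simp
    then show "dp * \<Psi> + tilde dp * flip_J \<Psi> = 0" using ab(3) by (simp add: mult.commute[of a'] flip: mult.assoc)
  qed
  then show ?thesis using pair[OF h] by (simp add: tilde_0)
qed

text \<open>If the range were proper, a coordinate functional modulo the range would be nonzero and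
  continuous. Its null space is then at positive distance from a basis vector w, and the separation
  in L^p supplies a \<psi> in L^q to which the triviality of annihilators applies. No representation
  of the dual of H^p enters.\<close>

lemma M_surjective:
  assumes q: "qdim cscale (Hp p) (M ` Hp p) l"
  shows "M ` Hp p = Hp p"
proof (rule ccontr)
  assume ne: "M ` Hp p \<noteq> Hp p"
  have bM: "bounded_op p M" by (rule bounded_op_toeplitz_hankel[OF pq(1) ab(1,2)])
  note lM = bounded_op_lin_op[OF bM]
  obtain B where B: "quotient_basis cscale (Hp p) (M ` Hp p) B" using q by (auto simp: qdim_def)
  obtain \<Phi> where \<Phi>: "\<And>w. w \<in> B \<Longrightarrow> \<Phi> w \<in> dual_Hp p" "\<And>w f. w \<in> B \<Longrightarrow> f \<in> Hp p \<Longrightarrow> \<Phi> w (M f) = 0"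
    "\<And>w v. w \<in> B \<Longrightarrow> v \<in> B \<Longrightarrow> \<Phi> w v = (if v = w then 1 else 0)"
    "\<And>f. f \<in> Hp p \<Longrightarrow> f - (\<Sum>w\<in>B. cscale (\<Phi> w f) w) \<in> M ` Hp p"
    by (rule quotient_coordinates[OF pq(1) bM B]) (rule that)
  have "B \<noteq> {}" using \<Phi>(4) ne lin_opD(1)[OF lM] by auto
  then obtain w where w: "w \<in> B" by blast
  have wH: "w \<in> Hp p" using B w by (auto simp: quotient_basis_def)
  let ?\<phi> = "\<Phi> w"
  have lin: "\<forall>f\<in>Hp p. \<forall>g\<in>Hp p. ?\<phi> (f + g) = ?\<phi> f + ?\<phi> g" "\<forall>z. \<forall>f\<in>Hp p. ?\<phi> (cscale z f) = z * ?\<phi> f"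
    using \<Phi>(1)[OF w] by (auto simp: dual_Hp_def)
  obtain C where C: "\<forall>f\<in>Hp p. norm (?\<phi> f) \<le> C * Lp_norm p f" using \<Phi>(1)[OF w] by (auto simp: dual_Hp_def)
  define R where "R = {f \<in> Hp p. ?\<phi> f = 0}"
  have phi0: "?\<phi> 0 = 0" using lin(2) Hp_0[OF pq(1)] by (metis circle_fun.scale_zero_left mult_zero_left)
  have sR: "circle_fun.subspace R"
    using lin phi0 by (intro circle_fun.subspaceI) (auto simp: R_def Hp_0 Hp_add Hp_cscale pq)
  have RL: "R \<subseteq> Lp p" by (auto simp: R_def Hp_Lp)
  \<comment> \<open>The functional takes the value 1 at w - r for every r in its null space, so its
    bound C limits how close r can come to w. The summand 1 covers C = 0.\<close>
  have lower: "1 / (\<bar>C\<bar> + 1) \<le> Lp_norm p (w - r)" if r: "r \<in> R" for r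
  proof -
    have rH: "r \<in> Hp p" using r by (simp add: R_def)
    have dH: "w - r \<in> Hp p" by (rule Hp_diff[OF pq(1) wH rH])
    have "?\<phi> w = ?\<phi> (w - r) + ?\<phi> r" using lin(1) dH rH by (metis diff_add_cancel)
    then have "?\<phi> (w - r) = 1" using r \<Phi>(3)[OF w w] by (simp add: R_def)
    then have "1 \<le> C * Lp_norm p (w - r)" using C dH by force
    also have "\<dots> \<le> (\<bar>C\<bar> + 1) * Lp_norm p (w - r)" by (intro mult_right_mono) auto
    finally show ?thesis by (simp add: pos_divide_le_eq mult.commute add_nonneg_pos)
  qed
  have pos: "0 < 1 / (\<bar>C\<bar> + 1)" by (simp add: add_nonneg_pos)
  obtain \<psi> where psi: "\<psi> \<in> Lp q" "\<And>r. r \<in> R \<Longrightarrow> fourier (\<psi> * r) 0 = 0" "fourier (\<psi> * w) 0 \<noteq> 0"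
    by (rule Lp_separation[OF pq sR RL Hp_Lp[OF wH] pos lower], assumption, rule that)
  have "M f \<in> R" if "f \<in> Hp p" for f using that \<Phi>(2)[OF w] lin_opD(1)[OF lM] by (simp add: R_def)
  then have "fourier (\<psi> * w) 0 = 0" by (intro annihilator_trivial[OF psi(1) _ wH] psi(2))
  then show False using psi(3) by simp
qed

end

subsection \<open>Analytic polynomials and kernels of matrices\<close>

lemma independent_tt_powi:
  assumes "finite I"
  shows "inj_on (\<lambda>i. tt powi i) I" "circle_fun.independent ((\<lambda>i. tt powi i) ` I)"
proof -
  show inj: "inj_on (\<lambda>i. tt powi i) I"
  proof (rule inj_onI)
    fix i j :: int assume "tt powi i = tt powi j"
    then have "fourier (tt powi i) i = fourier (tt powi j) i" by simp
    then show "i = j" by (simp add: fourier_tt_powi split: if_splits)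
  qed
  show "circle_fun.independent ((\<lambda>i. tt powi i) ` I)"
  proof
    assume "circle_fun.dependent ((\<lambda>i. tt powi i) ` I)"
    then obtain u where u: "\<exists>v\<in>(\<lambda>i. tt powi i) ` I. u v \<noteq> 0" "(\<Sum>v\<in>(\<lambda>i. tt powi i) ` I. cscale (u v) v) = 0"
      using assms by (auto simp: circle_fun.dependent_finite)
    have "trig_sum (\<lambda>i. u (tt powi i)) I = 0" using u(2) by (simp add: sum.reindex[OF inj] trig_sum_def)
    then have "(if j \<in> I then u (tt powi j) else 0) = 0" for j
      using fourier_trig_sum[OF assms, of "\<lambda>i. u (tt powi i)" j] by simp
    moreover obtain j where "j \<in> I" "u (tt powi j) \<noteq> 0" using u(1) by blast
    ultimately show False by metis
  qed
qed

text \<open>Places coefficient vectors in the space of circle functions, so that matrix kernels and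
  operator kernels are measured by the same \<open>qdim\<close>.\<close>

definition vec_poly :: "complex vec \<Rightarrow> circle_fun" where
  "vec_poly v = (\<Sum>i<dim_vec v. cscale (v $ i) (tt powi int i))"

lemma vec_poly_trig_sum: "vec_poly v = trig_sum (\<lambda>k. v $ nat k) (int ` {..<dim_vec v})"
  unfolding vec_poly_def trig_sum_def by (subst sum.reindex) auto

lemma fourier_vec_poly: "fourier (vec_poly v) k = (if 0 \<le> k \<and> k < int (dim_vec v) then v $ nat k else 0)"
proof -
  have "k \<in> int ` {..<dim_vec v} \<longleftrightarrow> 0 \<le> k \<and> k < int (dim_vec v)"
    by (auto simp: image_iff intro!: bexI[of _ "nat k"])
  then show ?thesis unfolding vec_poly_trig_sum by (subst fourier_trig_sum) auto
qed

lemma vec_poly_Lp: "0 \<le> p \<Longrightarrow> vec_poly v \<in> Lp p"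
  by (simp add: vec_poly_trig_sum trig_sum_Lp)

lemma vec_poly_add: "v \<in> carrier_vec n \<Longrightarrow> w \<in> carrier_vec n \<Longrightarrow> vec_poly (v + w) = vec_poly v + vec_poly w"
  by (rule circle_fun_eq_fourier) (auto simp: vec_poly_Lp Lp_add fourier_add fourier_vec_poly nat_less_iff)

lemma vec_poly_smult: "vec_poly (z \<cdot>\<^sub>v v) = cscale z (vec_poly v)"
  by (rule circle_fun_eq_fourier) (auto simp: vec_poly_Lp Lp_cscale fourier_cscale fourier_vec_poly nat_less_iff)

lemma vec_poly_inj:
  assumes "v \<in> carrier_vec n" "w \<in> carrier_vec n" "vec_poly v = vec_poly w"
  shows "v = w"
proof (rule eq_vecI)
  fix i assume "i < dim_vec w"
  then show "v $ i = w $ i" using arg_cong[OF assms(3), of "\<lambda>f. fourier f (int i)"] assms(1,2) by (simp add: fourier_vec_poly)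
qed (use assms in auto)

lemma subspace_mat_kernel_poly:
  assumes A: "A \<in> carrier_mat nr nc"
  shows "circle_fun.subspace (vec_poly ` mat_kernel A)"
proof (rule circle_fun.subspaceI)
  have "0\<^sub>v nc \<in> mat_kernel A" using A by (intro mat_kernelI[OF A]) auto
  moreover have "vec_poly (0\<^sub>v nc) = 0" by (simp add: vec_poly_def)
  ultimately show "0 \<in> vec_poly ` mat_kernel A" by (metis imageI)
  show "x + y \<in> vec_poly ` mat_kernel A" if xy: "x \<in> vec_poly ` mat_kernel A" "y \<in> vec_poly ` mat_kernel A" for x y
  proof -
    obtain v w where vw: "x = vec_poly v" "v \<in> mat_kernel A" "y = vec_poly w" "w \<in> mat_kernel A" using xy by blast
    note v = mat_kernelD[OF A vw(2)] and w = mat_kernelD[OF A vw(4)]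
    have "v + w \<in> mat_kernel A"
      using v w A by (intro mat_kernelI[OF A]) (auto simp: mult_add_distrib_mat_vec[OF A])
    then show ?thesis using vec_poly_add[OF v(1) w(1)] vw by (metis imageI)
  qed
  show "cscale z x \<in> vec_poly ` mat_kernel A" if x: "x \<in> vec_poly ` mat_kernel A" for z x
  proof -
    obtain v where v: "x = vec_poly v" "v \<in> mat_kernel A" using x by blast
    then show ?thesis using mat_kernel_smult[OF A v(2), of z] vec_poly_smult[of z v] by (metis imageI)
  qed
qed

lemma qdim_mat_kernel:
  assumes A: "A \<in> carrier_mat nr nc"
  shows "qdim cscale (vec_poly ` mat_kernel A) {0} (kernel_dim A)"
proof -
  interpret K: kernel nr nc A by unfold_locales (rule A)
  obtain B where fin: "finite B" and B: "K.basis B" using kernel_basis_exists[OF A] by blast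
  have BK: "B \<subseteq> mat_kernel A" and ind: "K.lin_indpt B" and gen: "K.span B = mat_kernel A"
    using B unfolding K.Ker.basis_def by auto
  have card: "kernel_dim A = card B" using K.Ker.dim_basis[OF fin B] by simp
  have Bc: "v \<in> carrier_vec nc" if "v \<in> B" for v using that BK mat_kernel_carrier[OF A] by auto
  have Bd: "dim_vec v = nc" if "v \<in> B" for v using carrier_vecD[OF Bc[OF that]] .
  have inj: "inj_on vec_poly B" using vec_poly_inj Bc by (intro inj_onI) blast
  have four: "fourier (\<Sum>v\<in>B. cscale (a v) (vec_poly v)) k = (\<Sum>v\<in>B. a v * fourier (vec_poly v) k)" for a k
    by (subst fourier_sum) (auto simp: fourier_cscale Lp_cscale vec_poly_Lp)
  have lc: "vec_poly (K.lincomb a B) = (\<Sum>v\<in>B. cscale (a v) (vec_poly v))" for a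
  proof (rule circle_fun_eq_fourier)
    have carr: "K.lincomb a B \<in> carrier_vec nc"
      using K.Ker.lincomb_closed[of B a] BK mat_kernel_carrier[OF A] by auto
    show "fourier (vec_poly (K.lincomb a B)) k = fourier (\<Sum>v\<in>B. cscale (a v) (vec_poly v)) k" for k
    proof (cases "0 \<le> k \<and> k < int nc")
      case True
      then have "nat k < nc" by auto
      then show ?thesis using True carr Bd K.lincomb_index[OF _ BK, of "nat k" a]
        by (auto simp: four fourier_vec_poly intro!: sum.cong)
    next
      case False
      then show ?thesis using carr Bd by (auto simp: four fourier_vec_poly intro!: sum.neutral)
    qed
  qed (auto simp: vec_poly_Lp intro!: Lp_sum Lp_cscale)
  have "quotient_basis cscale (vec_poly ` mat_kernel A) {0} (vec_poly ` B)"
  proof (rule circle_fun.quotient_basisI)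
    fix x assume "x \<in> vec_poly ` mat_kernel A"
    then obtain v where v: "x = vec_poly v" "v \<in> K.span B" using gen by blast
    obtain a where "v = K.lincomb a B" using K.Ker.finite_in_span[OF fin _ v(2)] BK by auto
    then have "x = (\<Sum>v\<in>B. cscale (a v) (vec_poly v))" using v lc by simp
    also have "\<dots> = (\<Sum>w\<in>vec_poly ` B. cscale (a (the_inv_into B vec_poly w)) w)"
      by (simp add: sum.reindex[OF inj] the_inv_into_f_f[OF inj])
    finally show "\<exists>y. x - (\<Sum>w\<in>vec_poly ` B. cscale (y w) w) \<in> {0}"
      by (intro exI[of _ "\<lambda>w. a (the_inv_into B vec_poly w)"]) simp
  next
    fix y w assume y: "(\<Sum>w\<in>vec_poly ` B. cscale (y w) w) \<in> {0}" and w: "w \<in> vec_poly ` B"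
    let ?a = "\<lambda>v. y (vec_poly v)"
    have "vec_poly (K.lincomb ?a B) = vec_poly (0\<^sub>v nc)"
      using y by (simp add: lc sum.reindex[OF inj] vec_poly_def[of "0\<^sub>v nc"])
    moreover have "K.lincomb ?a B \<in> carrier_vec nc"
      using K.Ker.lincomb_closed[of B ?a] BK mat_kernel_carrier[OF A] by auto
    ultimately have z: "K.lincomb ?a B = 0\<^sub>v nc" using vec_poly_inj by blast
    have "?a v = 0" if "v \<in> B" for v
    proof (rule ccontr)
      assume "?a v \<noteq> 0"
      then have "K.lin_dep B" unfolding K.Ker.lin_dep_def using fin z that
        by (intro exI[of _ B] exI[of _ ?a] exI[of _ v]) auto
      then show False using ind by simp
    qed
    then show "y w = 0" using w by auto
  qed (use fin BK in auto)
  then show ?thesis unfolding qdim_def card using card_image[OF inj] by blast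
qed

text \<open>Row rank equals column rank, by Gauss-Jordan elimination: the number of pivots gives the
  kernel of A, and the transposed echelon form has the vectors that vanish at the pivot rows as its
  kernel. Elimination multiplies the transpose by an invertible matrix on the right, which keeps the
  kernel dimension.\<close>

lemma kernel_dim_transpose:
  assumes A: "(A :: complex mat) \<in> carrier_mat n m"
  shows "kernel_dim (transpose_mat A) + m = kernel_dim A + n"
proof -
  define C where "C = gauss_jordan_single A"
  note gj = gauss_jordan_single[OF A C_def[symmetric]]
  obtain P Q where PQ: "C = P * A" "P \<in> carrier_mat n n" "Q \<in> carrier_mat n n" "P * Q = 1\<^sub>m n" "Q * P = 1\<^sub>m n"
    using gj(4) by blast
  have C: "C \<in> carrier_mat n m" by (rule gj(2))
  obtain f where f: "pivot_fun C f m" using gj(3) C unfolding row_echelon_form_def by auto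
  have dC: "dim_row C = n" using C by simp
  note piv = pivot_funD[OF dC f]
  note pp = pivot_positions[OF C f]
  define I where "I = {i. i < n \<and> f i \<noteq> m}"
  have finI: "finite I" by (simp add: I_def)
  have len: "length (pivot_positions C) = card I"
  proof -
    have "length (pivot_positions C) = card (fst ` set (pivot_positions C))"
      using distinct_card[OF pp(2)] by simp
    also have "fst ` set (pivot_positions C) = I" unfolding pp(1) I_def by force
    finally show ?thesis .
  qed
  have le: "card I \<le> m"
  proof -
    have "snd ` set (pivot_positions C) \<subseteq> {..<m}" unfolding pp(1) using piv(1) by fastforce
    then have "card (snd ` set (pivot_positions C)) \<le> m" using card_mono[of "{..<m}"] by fastforce
    then show ?thesis using distinct_card[OF pp(3)] len by simp
  qed
  have dimA: "kernel_dim A = m - card I"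
    unfolding kernel_dim_code using len A by (simp add: C_def)
  have At: "transpose_mat A \<in> carrier_mat m n" and Ct: "transpose_mat C \<in> carrier_mat m n" using A C by auto
  have "kernel_dim (transpose_mat C) = kernel_dim (transpose_mat A)"
  proof -
    have e: "transpose_mat C = transpose_mat A * transpose_mat P"
      unfolding PQ(1) by (rule transpose_mult[OF PQ(2) A])
    have i: "transpose_mat P * transpose_mat Q = 1\<^sub>m n"
      using transpose_mult[OF PQ(3,2)] PQ(5) by simp
    have "kernel.dim n (transpose_mat A * transpose_mat P) = kernel.dim n (transpose_mat A)"
      by (rule mat_kernel_dim_mult_eq_right[OF At _ _ i]) (use PQ in auto)
    then show ?thesis unfolding kernel_dim_def e[symmetric] using A C by simp
  qed
  moreover have "kernel_dim (transpose_mat C) = n - card I"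
  proof -
    let ?J = "{..<n} - I"
    let ?T = "(\<lambda>i. tt powi i) ` (int ` ?J)"
    \<comment> \<open>The column of a pivot has its only nonzero entry in the pivot row, which
      isolates one coordinate of v. Rows without pivot are zero and impose nothing.\<close>
    have ker: "v \<in> mat_kernel (transpose_mat C) \<longleftrightarrow> v \<in> carrier_vec n \<and> (\<forall>i\<in>I. v $ i = 0)" for v
    proof
      assume v: "v \<in> mat_kernel (transpose_mat C)"
      note vD = mat_kernelD[OF Ct v]
      have "v $ i = 0" if i: "i \<in> I" for i
      proof -
        have fi: "f i < m" "i < n" using i piv(1)[of i] by (auto simp: I_def)
        have "0 = (transpose_mat C *\<^sub>v v) $ f i" using vD(2) fi by simp
        also have "\<dots> = (\<Sum>i'<n. C $$ (i', f i) * v $ i')"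
          using fi C vD(1) by (simp add: scalar_prod_def atLeast0LessThan)
        also have "\<dots> = (\<Sum>i'\<in>{i}. C $$ (i', f i) * v $ i')"
          using fi piv(5)[OF fi(2,1)] by (intro sum.mono_neutral_right) auto
        finally show ?thesis using piv(4)[OF fi(2,1)] by simp
      qed
      then show "v \<in> carrier_vec n \<and> (\<forall>i\<in>I. v $ i = 0)" using vD by blast
    next
      assume v: "v \<in> carrier_vec n \<and> (\<forall>i\<in>I. v $ i = 0)"
      show "v \<in> mat_kernel (transpose_mat C)"
      proof (rule mat_kernelI[OF Ct])
        show "transpose_mat C *\<^sub>v v = 0\<^sub>v m"
        proof (rule eq_vecI)
          fix j assume j: "j < dim_vec (0\<^sub>v m)"
          have "dim_vec v = n" using v by auto
          then have "(transpose_mat C *\<^sub>v v) $ j = (\<Sum>i<n. C $$ (i, j) * v $ i)"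
            using j C by (auto simp: scalar_prod_def atLeast0LessThan intro!: sum.cong)
          also have "\<dots> = 0"
          proof (rule sum.neutral, rule ballI)
            fix i assume i: "i \<in> {..<n}"
            show "C $$ (i, j) * v $ i = 0"
            proof (cases "i \<in> I")
              case False
              then have "f i = m" using i by (simp add: I_def)
              then show ?thesis using piv(2)[of i j] i j by simp
            qed (use v in auto)
          qed
          finally show "(transpose_mat C *\<^sub>v v) $ j = 0\<^sub>v m $ j" using j by simp
        qed (use C in auto)
      qed (use v in auto)
    qed
    have sp: "circle_fun.span ?T = vec_poly ` mat_kernel (transpose_mat C)"
    proof
      show "circle_fun.span ?T \<subseteq> vec_poly ` mat_kernel (transpose_mat C)"
      proof (rule circle_fun.span_minimal[OF _ subspace_mat_kernel_poly[OF Ct]])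
        show "?T \<subseteq> vec_poly ` mat_kernel (transpose_mat C)"
        proof
          fix x assume "x \<in> ?T"
          then obtain i where i: "i < n" "i \<notin> I" "x = tt powi int i" by auto
          have "x = vec_poly (unit_vec n i)"
            using i by (intro circle_fun_eq_fourier) (auto simp: tt_powi_Lp vec_poly_Lp fourier_tt_powi fourier_vec_poly nat_less_iff simp del: power_int_of_nat)
          moreover have "unit_vec n i \<in> mat_kernel (transpose_mat C)" using i by (auto simp: ker I_def)
          ultimately show "x \<in> vec_poly ` mat_kernel (transpose_mat C)" by blast
        qed
      qed
      show "vec_poly ` mat_kernel (transpose_mat C) \<subseteq> circle_fun.span ?T"
      proof
        fix x assume "x \<in> vec_poly ` mat_kernel (transpose_mat C)"
        then obtain v :: "complex vec" where v: "x = vec_poly v" "v \<in> carrier_vec n" "\<forall>i\<in>I. vec_index v i = 0" using ker by blast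
        have "x = (\<Sum>i\<in>?J. cscale (vec_index v i) (tt powi int i))"
          unfolding v(1) vec_poly_def using v(2,3) by (intro sum.mono_neutral_right) auto
        also have "\<dots> \<in> circle_fun.span ?T"
          by (intro circle_fun.span_sum circle_fun.span_scale circle_fun.span_base imageI) auto
        finally show "x \<in> circle_fun.span ?T" .
      qed
    qed
    have fJ: "finite (int ` ?J)" by simp
    have "qdim cscale (circle_fun.span ?T) {0} (card ?T)"
      by (rule circle_fun.basis_qdim) (use independent_tt_powi[OF fJ] in auto)
    then have "kernel_dim (transpose_mat C) = card ?T"
      unfolding sp using circle_fun.qdim_unique[OF circle_fun.subspace_single_0 _ qdim_mat_kernel[OF Ct]]
        circle_fun.subspace_0[OF subspace_mat_kernel_poly[OF Ct]] by blast
    also have "\<dots> = card ?J" by (simp add: card_image[OF independent_tt_powi(1)[OF fJ]] card_image)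
    also have "\<dots> = n - card I" by (subst card_Diff_subset) (auto simp: I_def)
    finally show ?thesis .
  qed
  moreover have "card I \<le> n" using card_mono[of "{..<n}" I] by (auto simp: I_def)
  ultimately show ?thesis using dimA le by simp
qed

text \<open>For \<open>N \<le> 0\<close> this is the zero space, in accordance with the dimension
  \<open>nat N\<close>.\<close>

definition polys :: "int \<Rightarrow> circle_fun set" where
  "polys N = {f \<in> Lp 1. \<forall>k. k < 0 \<or> N \<le> k \<longrightarrow> fourier f k = 0}"

lemma polys_span: "polys N = circle_fun.span ((\<lambda>i. tt powi i) ` {0..<N})"
proof
  show "polys N \<subseteq> circle_fun.span ((\<lambda>i. tt powi i) ` {0..<N})"
  proof
    fix f assume f: "f \<in> polys N"
    have "f = trig_sum (fourier f) {0..<N}"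
      using f by (intro circle_fun_eq_fourier) (auto simp: polys_def trig_sum_Lp fourier_trig_sum)
    moreover have "trig_sum (fourier f) {0..<N} \<in> circle_fun.span ((\<lambda>i. tt powi i) ` {0..<N})"
      unfolding trig_sum_def by (intro circle_fun.span_sum circle_fun.span_scale circle_fun.span_base imageI)
    ultimately show "f \<in> circle_fun.span ((\<lambda>i. tt powi i) ` {0..<N})" by metis
  qed
  have "circle_fun.subspace (polys N)"
    by (rule circle_fun.subspaceI) (auto simp: polys_def Lp_0 Lp_add Lp_cscale fourier_add fourier_cscale)
  then show "circle_fun.span ((\<lambda>i. tt powi i) ` {0..<N}) \<subseteq> polys N"
    by (intro circle_fun.span_minimal) (auto simp: polys_def tt_powi_Lp fourier_tt_powi)
qed

lemma subspace_polys: "circle_fun.subspace (polys N)"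
  unfolding polys_span by simp

lemma qdim_polys: "qdim cscale (polys N) {0} (nat N)"
  using circle_fun.basis_qdim[OF independent_tt_powi(2), of "{0..<N}"] card_image[OF independent_tt_powi(1), of "{0..<N}"]
  by (simp add: polys_span)

lemma polys_Lp: "f \<in> polys N \<Longrightarrow> 0 \<le> p \<Longrightarrow> f \<in> Lp p"
proof -
  assume f: "f \<in> polys N" and p: "0 \<le> p"
  have "f = trig_sum (fourier f) {0..<N}"
    using f by (intro circle_fun_eq_fourier) (auto simp: polys_def trig_sum_Lp fourier_trig_sum)
  then show "f \<in> Lp p" using p by (metis trig_sum_Lp)
qed

lemma polys_Hp: "1 < p \<Longrightarrow> polys N \<subseteq> Hp p"
  by (auto simp: Hp_def polys_Lp) (simp add: polys_def)

lemma riesz_inverse_powi_eq_0_iff: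
  assumes p: "1 < p" and h: "h \<in> Hp p" and j: "0 \<le> j"
  shows "riesz p (tt powi (- j) * h) = 0 \<longleftrightarrow> h \<in> polys j"
proof -
  have L: "tt powi (- j) * h \<in> Lp p" using h p by (simp add: Lp_tt_powi_mult Hp_Lp)
  have "riesz p (tt powi (- j) * h) = 0 \<longleftrightarrow> (\<forall>k\<ge>0. fourier h (k + j) = 0)"
  proof
    assume "riesz p (tt powi (- j) * h) = 0"
    then show "\<forall>k\<ge>0. fourier h (k + j) = 0"
      using fourier_riesz[OF p L] by (metis diff_minus_eq_add fourier_0 fourier_tt_powi_mult)
  next
    assume "\<forall>k\<ge>0. fourier h (k + j) = 0"
    then show "riesz p (tt powi (- j) * h) = 0"
      by (intro riesz_eqI[OF p] Hp_0 p) (auto simp: fourier_tt_powi_mult)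
  qed
  also have "\<dots> \<longleftrightarrow> h \<in> polys j"
  proof
    assume z: "\<forall>k\<ge>0. fourier h (k + j) = 0"
    have "fourier h k = 0" if "k < 0 \<or> j \<le> k" for k
      using that z[rule_format, of "k - j"] fourier_Hp[OF h] by auto
    then show "h \<in> polys j" using Lp_subset_L1[OF p Hp_Lp[OF h]] by (simp add: polys_def)
  qed (use j in \<open>auto simp: polys_def\<close>)
  finally show ?thesis .
qed

text \<open>As h has a nonzero constant coefficient, the first nonzero coefficient of h f sits at
  the same index as that of f. The induction divides f by t once at each step. In the application h
  is \<open>(1 + tt) * cp\<close>.\<close>

lemma low_coefficients_mult:
  assumes pq: "1 < p" "1/p + 1/q = 1" and h: "h \<in> Hp q" "fourier h 0 \<noteq> 0" and f: "f \<in> Hp p" and n: "0 \<le> n"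
  shows "(\<forall>k. k < n \<longrightarrow> fourier (h * f) k = 0) \<longleftrightarrow> (\<exists>g\<in>Hp p. f = tt powi n * g)"
proof -
  have qq: "1 < q" "1/q + 1/p = 1" using conjugate_exponent[OF pq] pq(2) by auto
  have low: "fourier (h * (tt powi j * g)) k = 0" if "g \<in> Hp p" "k < j" for g j k
  proof -
    have "h * (tt powi j * g) = tt powi j * (h * g)" by (simp add: mult_ac)
    then have "fourier (h * (tt powi j * g)) k = fourier (h * g) (k - j)" by (simp only: fourier_tt_powi_mult)
    then show ?thesis using Hp_mult_fourier[OF qq h(1) that(1), of "k - j"] that(2) by simp
  qed
  have "\<exists>g\<in>Hp p. f = tt powi int i * g" if "\<forall>k. k < int i \<longrightarrow> fourier (h * f) k = 0" for i
    using that
  proof (induction i)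
    case 0
    then show ?case using f by auto
  next
    case (Suc i)
    then obtain g where g: "g \<in> Hp p" "f = tt powi int i * g" by force
    have "h * f = tt powi int i * (h * g)" unfolding g(2) by (simp add: mult_ac)
    then have "fourier (h * f) (int i) = fourier (h * g) 0" by (simp add: fourier_tt_powi_mult del: power_int_of_nat)
    then have "fourier g 0 = 0" using Suc.prems Hp_mult_fourier_0[OF qq h(1) g(1)] h(2) by simp
    then have "g = tt * backshift p g" using shift_backshift[OF pq(1) g(1)] by simp
    then have "f = tt powi int i * (tt powi 1 * backshift p g)" using g(2) by simp
    also have "\<dots> = tt powi int (Suc i) * backshift p g" unfolding tt_powi_cancel by (simp add: add.commute del: power_int_of_nat)
    finally show ?case using backshift_Hp[OF pq(1) Hp_Lp[OF g(1)]] by blast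
  qed
  from this[of "nat n"] show ?thesis using low n by (auto simp del: power_int_of_nat)
qed

lemma fourier_sym:
  assumes "u \<in> Lp 1"
  shows "fourier (u + tilde u) k = fourier u k + fourier u (- k)"
  using assms by (simp add: fourier_add Lp_tilde fourier_tilde)

text \<open>For k > 0 the coefficient of the symmetrised polynomial is that of u, and at 0 it is
  doubled; either way it determines u.\<close>

lemma sym_eq_0:
  assumes u: "u \<in> polys N" and z: "u + tilde u = 0"
  shows "u = 0"
proof (rule fourier_uniqueness_0)
  show "u \<in> Lp 1" using u by (simp add: polys_def)
  have "fourier u k + fourier u (- k) = 0" for k
    using fourier_sym[of u k] z u by (simp add: polys_def)
  from this[of k for k] this[of 0] show "fourier u k = 0" for k
    using u by (cases k "0::int" rule: linorder_cases) (auto simp: polys_def, (metis add_cancel_left_right add.right_neutral neg_less_0_iff_less)?)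
qed

lemma polys_mult_Lp:
  assumes u: "u \<in> polys N" and h: "h \<in> Lp s" and s: "0 \<le> s"
  shows "h * u \<in> Lp s" "h * tilde u \<in> Lp s"
proof -
  have *: "h * u \<in> Lp s" if h: "h \<in> Lp s" for h
  proof -
    have "circle_fun.subspace {u. h * u \<in> Lp s}"
      by (rule circle_fun.subspaceI) (auto simp: Lp_0 distrib_left Lp_add s mult_cscale Lp_cscale)
    then have "circle_fun.span ((\<lambda>i. tt powi i) ` {0..<N}) \<subseteq> {u. h * u \<in> Lp s}"
      by (intro circle_fun.span_minimal) (auto simp: mult.commute[of h] Lp_tt_powi_mult h s)
    then show ?thesis using u polys_span by blast
  qed
  show "h * u \<in> Lp s" by (rule *[OF h])
  have "tilde (tilde h * u) \<in> Lp s" by (intro Lp_tilde * h)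
  then show "h * tilde u \<in> Lp s" by (simp add: tilde_mult tilde_tilde)
qed

lemma sym_shift_Hp:
  assumes u: "u \<in> polys N" and s: "1 < s"
  shows "tt powi (N - 1) * (u + tilde u) \<in> Hp s"
proof -
  have uL: "u \<in> Lp 1" using u by (simp add: polys_def)
  have "u + tilde u \<in> Lp s" using polys_Lp[OF u, of s] s by (intro Lp_add Lp_tilde) auto
  moreover have "fourier u j = 0" if "j < 0 \<or> N \<le> j" for j using u that by (auto simp: polys_def)
  then have "fourier u (k - (N - 1)) = 0 \<and> fourier u (- (k - (N - 1))) = 0" if "k < 0" for k
    using that by (smt (verit))
  ultimately show ?thesis using s by (auto simp: Hp_def Lp_tt_powi_mult fourier_tt_powi_mult fourier_sym[OF uL])
qed

lemma polys_vec_poly: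
  assumes "u \<in> polys N"
  obtains y where "y \<in> carrier_vec (nat N)" "u = vec_poly y"
proof (rule that)
  show "vec (nat N) (\<lambda>i. fourier u (int i)) \<in> carrier_vec (nat N)" by simp
  show "u = vec_poly (vec (nat N) (\<lambda>i. fourier u (int i)))"
    using assms by (intro circle_fun_eq_fourier) (auto simp: vec_poly_Lp fourier_vec_poly polys_def)
qed

lemma vec_poly_polys: "y \<in> carrier_vec (nat N) \<Longrightarrow> vec_poly y \<in> polys N"
  by (auto simp: polys_def vec_poly_Lp fourier_vec_poly)

lemma fourier_vec_poly_mult:
  assumes "f \<in> Lp 1"
  shows "fourier (f * vec_poly y) k = (\<Sum>i<dim_vec y. y $ i * fourier f (k - int i))"
    and "fourier (f * tilde (vec_poly y)) k = (\<Sum>i<dim_vec y. y $ i * fourier f (k + int i))"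
proof -
  have *: "fourier (f * vec_poly y) k = (\<Sum>i<dim_vec y. y $ i * fourier f (k - int i))" if f: "f \<in> Lp 1" for f k
    using f unfolding vec_poly_def sum_distrib_left mult_cscale mult.commute[of f]
    by (subst fourier_sum) (auto simp: Lp_cscale Lp_tt_powi_mult fourier_cscale fourier_tt_powi_mult simp del: power_int_of_nat)
  show "fourier (f * vec_poly y) k = (\<Sum>i<dim_vec y. y $ i * fourier f (k - int i))" by (rule *[OF assms])
  have "fourier (f * tilde (vec_poly y)) k = fourier (tilde f * vec_poly y) (- k)"
    using fourier_tilde[of "tilde f * vec_poly y" k] by (simp add: tilde_mult tilde_tilde)
  also have "\<dots> = (\<Sum>i<dim_vec y. y $ i * fourier f (k + int i))"
    by (subst *[OF Lp_tilde[OF assms]]) (simp add: fourier_tilde add.commute)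
  finally show "fourier (f * tilde (vec_poly y)) k = (\<Sum>i<dim_vec y. y $ i * fourier f (k + int i))" .
qed

subsection \<open>Operators with general indices\<close>

locale fredholm_factorization =
  fixes p q :: real and n m :: int and a b c d cp dp :: circle_fun
  assumes pq: "1 < p" "1 / p + 1 / q = 1"
    and bf: "basic_factorization p q a b c d n m cp dp"
    and fred: "fredholm p (toeplitz_hankel p a b)"
begin

lemma qq: "1 < q" "1 / q + 1 / p = 1"
  using conjugate_exponent[OF pq] pq(2) by auto

lemma ab_inverse:
  "a \<in> Linf" "b \<in> Linf" "a * inverse a = 1" "b * inverse b = 1" "inverse b \<in> Linf"
proof -
  obtain a' b' where ab': "a \<in> Linf" "b \<in> Linf" "a * a' = 1" "b * b' = 1" "b' \<in> Linf"
    using bf unfolding basic_factorization_def GLinf_def by blast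
  then show "a \<in> Linf" "b \<in> Linf" "a * inverse a = 1" "b * inverse b = 1" "inverse b \<in> Linf"
    using inverse_unique_circle_fun[of a a'] inverse_unique_circle_fun[of b b'] by auto
qed

text \<open>The factorization writes the invertible quotient a/b as a multiple of \<open>cp\<close>,
  which exhibits a reciprocal of \<open>cp\<close>.\<close>

lemma cp_inverse: "cp * inverse cp = 1"
proof -
  have "a * inverse b = cp * tt powi (2 * n) * tilde (inverse cp)"
    using bf unfolding basic_factorization_def divide_circle_fun by metis
  then have "cp * (tt powi (2 * n) * tilde (inverse cp) * (b * inverse a)) = (a * inverse b) * (b * inverse a)"
    by (simp add: mult_ac)
  also have "\<dots> = (a * inverse a) * (b * inverse b)" by (simp only: mult_ac)
  finally show ?thesis using ab_inverse by (intro inverse_unique_circle_fun(2)) simp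
qed

lemma tilde_a_inverse: "tilde a * tilde (inverse a) = 1"
  unfolding tilde_mult[symmetric] ab_inverse(3) by (rule tilde_1)

lemma dp_inverse: "dp * inverse dp = 1"
proof -
  have "tilde a * inverse b = dp * tt powi (2 * m) * tilde (inverse dp)"
    using bf unfolding basic_factorization_def divide_circle_fun by metis
  then have "dp * (tt powi (2 * m) * tilde (inverse dp) * (b * tilde (inverse a))) = (tilde a * inverse b) * (b * tilde (inverse a))"
    by (simp add: mult_ac)
  also have "\<dots> = (tilde a * tilde (inverse a)) * (b * inverse b)" by (simp only: mult_ac)
  finally show ?thesis using ab_inverse tilde_a_inverse by (intro inverse_unique_circle_fun(2)) simp
qed

lemma tilde_cp_inverse: "tilde cp * tilde (inverse cp) = 1" and tilde_dp_inverse: "tilde dp * tilde (inverse dp) = 1"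
  unfolding tilde_mult[symmetric] cp_inverse dp_inverse by (rule tilde_1)+

lemma c_factor: "a * tilde cp = b * cp * tt powi (2 * n)"
proof -
  have "a * inverse b = cp * tt powi (2 * n) * tilde (inverse cp)"
    using bf unfolding basic_factorization_def divide_circle_fun by metis
  then have "(a * inverse b) * (b * tilde cp) = (cp * tt powi (2 * n) * tilde (inverse cp)) * (b * tilde cp)" by simp
  moreover have "(a * inverse b) * (b * tilde cp) = (b * inverse b) * (a * tilde cp)" by (simp only: mult_ac)
  moreover have "(cp * tt powi (2 * n) * tilde (inverse cp)) * (b * tilde cp) =
      (tilde cp * tilde (inverse cp)) * (b * cp * tt powi (2 * n))" by (simp only: mult_ac)
  ultimately show ?thesis unfolding tilde_cp_inverse ab_inverse by simp
qed

lemma d_factor: "tilde a * tilde dp = b * dp * tt powi (2 * m)"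
proof -
  have "tilde a * inverse b = dp * tt powi (2 * m) * tilde (inverse dp)"
    using bf unfolding basic_factorization_def divide_circle_fun by metis
  then have "(tilde a * inverse b) * (b * tilde dp) = (dp * tt powi (2 * m) * tilde (inverse dp)) * (b * tilde dp)" by simp
  moreover have "(tilde a * inverse b) * (b * tilde dp) = (b * inverse b) * (tilde a * tilde dp)" by (simp only: mult_ac)
  moreover have "(dp * tt powi (2 * m) * tilde (inverse dp)) * (b * tilde dp) =
      (tilde dp * tilde (inverse dp)) * (b * dp * tt powi (2 * m))" by (simp only: mult_ac)
  ultimately show ?thesis unfolding tilde_dp_inverse ab_inverse by simp
qed

lemma factor_Hp: "(1 + tt) * cp \<in> Hp q" "(1 - tt) * inverse cp \<in> Hp p"
    "(1 + tt) * dp \<in> Hp p" "(1 - tt) * inverse dp \<in> Hp q"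
  using bf unfolding basic_factorization_def by blast+

section \<open>Passing between the given operator and the one with zero indices\<close>

abbreviation "A \<equiv> toeplitz_hankel p a b"
abbreviation "a0 \<equiv> a * tt powi (m - n)"
abbreviation "b0 \<equiv> b * tt powi (n + m)"

text \<open>The exponents solve two equations: the quotient of the new symbols carries t^(m-n) /
  t^(n+m) = t^(-2n), and with the first symbol reflected it carries t^(n-m) / t^(n+m) = t^(-2m).
  Both powers in the factorization cancel.\<close>

sublocale Z: zero_index_factorization p q a0 b0 "inverse a * tt powi (n - m)" "inverse b * tt powi (- n - m)"
  cp "inverse cp" dp "inverse dp"
proof
  show "a0 \<in> Linf" "b0 \<in> Linf" "inverse b * tt powi (- n - m) \<in> Linf"
    using ab_inverse by (simp_all add: Linf_mult Linf_tt_powi)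
  have "a0 * (inverse a * tt powi (n - m)) = (a * inverse a) * (tt powi (m - n) * tt powi (n - m))" by (simp only: mult_ac)
  then show "a0 * (inverse a * tt powi (n - m)) = 1" unfolding tt_powi_add ab_inverse by simp
  have "b0 * (inverse b * tt powi (- n - m)) = (b * inverse b) * (tt powi (n + m) * tt powi (- n - m))" by (simp only: mult_ac)
  then show "b0 * (inverse b * tt powi (- n - m)) = 1" unfolding tt_powi_add ab_inverse by simp
  have "a0 * tilde cp = (a * tilde cp) * tt powi (m - n)" by (simp only: mult_ac)
  also have "\<dots> = b * cp * (tt powi (2 * n) * tt powi (m - n))" unfolding c_factor by (simp only: mult_ac)
  also have "tt powi (2 * n) * tt powi (m - n) = tt powi (n + m)" unfolding tt_powi_add by (simp add: algebra_simps)
  finally show "a0 * tilde cp = b0 * cp" by (simp only: mult_ac)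
  have "tilde a0 * tilde dp = (tilde a * tilde dp) * tt powi (n - m)"
    unfolding tilde_mult tilde_tt_powi by (simp add: mult_ac)
  also have "\<dots> = b * dp * (tt powi (2 * m) * tt powi (n - m))" unfolding d_factor by (simp only: mult_ac)
  also have "tt powi (2 * m) * tt powi (n - m) = tt powi (n + m)" unfolding tt_powi_add by (simp add: algebra_simps)
  finally show "tilde a0 * tilde dp = b0 * dp" by (simp only: mult_ac)
qed (use pq cp_inverse dp_inverse factor_Hp in auto)

lemma bounded_op_A: "bounded_op p A" and lin_op_A: "lin_op p A"
  using bounded_op_toeplitz_hankel[OF pq(1) ab_inverse(1,2)] by (auto intro: bounded_op_lin_op)

lemma lin_op_M: "lin_op p Z.M"
  using bounded_op_toeplitz_hankel[OF pq(1) Z.ab(1,2)] by (rule bounded_op_lin_op)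

text \<open>Shifts are compositions with nonnegative powers of t, so each index is split into
  positive and negative part, one for each side of the comparison.\<close>

abbreviation "n1 \<equiv> max 0 n"
abbreviation "n2 \<equiv> max 0 (- n)"
abbreviation "m1 \<equiv> max 0 m"
abbreviation "m2 \<equiv> max 0 (- m)"

text \<open>Both sides are the Toeplitz plus Hankel operator with symbols \<open>a t^(n2-m2)\<close> and \<open>b t^(-n2-m2)\<close>.\<close>

lemma shifted_operators:
  assumes f: "f \<in> Hp p"
  shows "riesz p (tt powi (- m2) * A (tt powi n2 * f)) = riesz p (tt powi (- m1) * Z.M (tt powi n1 * f))"
proof -
  have "a0 * tt powi (n1 - m1) = a * tt powi (n2 - m2)"
    unfolding mult.assoc tt_powi_add by (intro arg_cong[where f="\<lambda>k. a * tt powi k"]) auto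
  moreover have "b0 * tt powi (- n1 - m1) = b * tt powi (- n2 - m2)"
    unfolding mult.assoc tt_powi_add by (intro arg_cong[where f="\<lambda>k. b * tt powi k"]) auto
  ultimately show ?thesis
    by (simp add: toeplitz_hankel_shifts[OF pq(1) ab_inverse(1,2) f] toeplitz_hankel_shifts[OF pq(1) Z.ab(1,2) f])
qed

lemma has_dims_A:
  obtains k l where "has_dims p A k l"
proof -
  obtain k where "qdim cscale (ker_Hp p A) {0} k"
    using fred circle_fun.edim_finite[OF subspace_ker_Hp[OF pq(1) lin_op_A]] unfolding fredholm_def dim_ker_def by metis
  moreover obtain l where "qdim cscale (Hp p) (A ` Hp p) l"
    using fred circle_fun.quotient_edim_finite[of "Hp p" "A ` Hp p"] unfolding fredholm_def dim_coker_def by metis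
  ultimately show ?thesis using that by (simp add: has_dims_def)
qed

abbreviation "L f \<equiv> riesz p (tt powi (- m2) * A (tt powi n2 * f))"

lemma lin_op_L: "lin_op p L"
  by (rule lin_op_comp[OF lin_op_comp[OF lin_op_inverse_powi lin_op_A] lin_op_powi_mult]) (use pq in auto)

lemma has_dims_L:
  assumes "has_dims p A k l"
  obtains k' l' where "has_dims p L k' l'" "int k' - int l' = int k - int l + m2 - n2"
proof -
  obtain k1 l1 where 1: "has_dims p (\<lambda>f. A (tt powi int (nat n2) * f)) k1 l1" "k1 + l + nat n2 = k + l1"
    by (rule has_dims_shift_powi[OF pq(1) lin_op_A assms])
  have "lin_op p (\<lambda>f. tt powi n2 * f)" by (rule lin_op_powi_mult[OF pq(1)]) simp
  from lin_op_comp[OF lin_op_A this] have lin: "lin_op p (\<lambda>f. A (tt powi int (nat n2) * f))" by simp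
  obtain k2 l2 where 2: "has_dims p (\<lambda>f. riesz p (tt powi (- int (nat m2)) * A (tt powi int (nat n2) * f))) k2 l2"
    "k1 + nat m2 + l2 = k2 + l1"
    by (rule has_dims_backshift_powi[OF pq(1) lin 1(1)])
  show ?thesis
  proof (rule that)
    show "has_dims p L k2 l2" using 2(1) by simp
    have "int k1 + int l + n2 = int k + int l1" "int k1 + m2 + int l2 = int k2 + int l1"
      using arg_cong[OF 1(2), of int] arg_cong[OF 2(2), of int] by simp_all
    then show "int k2 - int l2 = int k - int l + m2 - n2" by linarith
  qed
qed

text \<open>Finite codimension passes from \<open>A\<close> to \<open>L\<close> by counting shifts.
  It passes from \<open>L\<close> back to \<open>Z.M\<close> because \<open>L\<close> is also
  \<open>Z.M\<close> between shifts, and the backward shifts on its left lose only polynomials of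
  bounded degree.\<close>

lemma M_onto: "Z.M ` Hp p = Hp p"
proof -
  obtain k l where "has_dims p A k l" by (rule has_dims_A)
  then obtain k' l' where kl: "has_dims p L k' l'" by (rule has_dims_L)
  obtain B where B: "quotient_basis cscale (Hp p) (L ` Hp p) B" using kl by (auto simp: has_dims_def qdim_def)
  have "Hp p \<noteq> {}" using Hp_0[OF pq(1)] by auto
  note D = circle_fun.quotient_basisD[OF B subspace_range_Hp[OF pq(1) lin_op_L] this]
  \<comment> \<open>A complement for \<open>L\<close> lifted by t^m1, together with the polynomials
    of degree below m1 that the backward shifts annihilate.\<close>
  define F where "F = (\<lambda>w. tt powi m1 * w) ` B \<union> (\<lambda>i. tt powi i) ` {0..<m1}"
  have sp: "polys m1 \<subseteq> circle_fun.span F"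
    unfolding polys_span F_def by (intro circle_fun.span_mono) auto
  obtain l0 where "qdim cscale (Hp p) (Z.M ` Hp p) l0"
  proof (rule circle_fun.qdim_exists[OF subspace_range_Hp[OF pq(1) lin_op_M] subspace_Hp[OF pq(1)]])
    show "Z.M ` Hp p \<subseteq> Hp p" using lin_opD(1)[OF lin_op_M] by auto
    show "finite F" using D(1) by (simp add: F_def)
    show "F \<subseteq> Hp p" using D(2) polys_Hp[OF pq(1), of m1] pq
      by (auto simp: F_def Hp_tt_powi_mult) (auto simp: Hp_def tt_powi_Lp fourier_tt_powi)
    fix h assume h: "h \<in> Hp p"
    have hL: "tt powi (- m1) * h \<in> Lp p" using h pq by (simp add: Lp_tt_powi_mult Hp_Lp)
    obtain y where "riesz p (tt powi (- m1) * h) - (\<Sum>w\<in>B. cscale (y w) w) \<in> L ` Hp p"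
      using D(3)[OF riesz_Hp(1)[OF pq(1) hL]] by blast
    then obtain f where f: "f \<in> Hp p" "riesz p (tt powi (- m1) * h) - (\<Sum>w\<in>B. cscale (y w) w) = L f" by blast
    define w where "w = (\<Sum>w\<in>B. cscale (y w) w)"
    have wH: "w \<in> Hp p" unfolding w_def by (intro Hp_sum[OF pq(1)] Hp_cscale[OF pq(1)]) (use D(2) in auto)
    have gH: "tt powi n1 * f \<in> Hp p" using f(1) pq by (simp add: Hp_tt_powi_mult)
    define g where "g = Z.M (tt powi n1 * f)"
    have MH: "g \<in> Hp p" unfolding g_def by (rule lin_opD(1)[OF lin_op_M gH])
    have TwH: "tt powi m1 * w \<in> Hp p" using wH pq by (simp add: Hp_tt_powi_mult)
    note R = lin_op_diff[OF pq(1) lin_op_inverse_powi[OF pq(1), of "- m1"]]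
    have "riesz p (tt powi (- m1) * (h - g - tt powi m1 * w)) =
        riesz p (tt powi (- m1) * h) - riesz p (tt powi (- m1) * g) - riesz p (tt powi (- m1) * (tt powi m1 * w))"
      by (simp add: R Hp_diff[OF pq(1)] h MH TwH)
    also have "\<dots> = 0"
      using f(2) shifted_operators[OF f(1)] riesz_ident[OF pq(1) wH] unfolding tt_powi_cancel w_def[symmetric] g_def[symmetric]
      by (simp add: diff_eq_eq)
    finally have "h - g - tt powi m1 * w \<in> polys m1"
      using riesz_inverse_powi_eq_0_iff[OF pq(1), of "h - g - tt powi m1 * w" m1] h MH TwH by (simp add: Hp_diff[OF pq(1)])
    then have "h - g - tt powi m1 * w \<in> circle_fun.span F" using sp by blast
    moreover have "tt powi m1 * w \<in> circle_fun.span F"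
    proof -
      have "tt powi m1 * w = (\<Sum>w\<in>B. cscale (y w) (tt powi m1 * w))"
        by (simp only: w_def sum_distrib_left mult_cscale)
      also have "\<dots> \<in> circle_fun.span F"
        by (intro circle_fun.span_sum circle_fun.span_scale circle_fun.span_base) (simp add: F_def)
      finally show ?thesis .
    qed
    ultimately have "(h - g - tt powi m1 * w) + tt powi m1 * w \<in> circle_fun.span F" by (rule circle_fun.span_add)
    moreover have "h - ((h - g - tt powi m1 * w) + tt powi m1 * w) \<in> Z.M ` Hp p" using gH by (simp add: g_def)
    ultimately show "\<exists>b\<in>circle_fun.span F. h - b \<in> Z.M ` Hp p" by blast
  qed
  then show ?thesis by (rule Z.M_surjective)
qed

text \<open>The index of \<open>L\<close> is computed twice. From \<open>A\<close> it is k - l + m2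
  - n2; from the bijective \<open>Z.M\<close> it is m1 - n1. Positive and negative parts recombine
  to m - n.\<close>

lemma index:
  assumes "has_dims p A k l"
  shows "int k - int l = m - n"
proof -
  obtain k' l' where kl: "has_dims p L k' l'" "int k' - int l' = int k - int l + m2 - n2"
    using assms by (rule has_dims_L)
  have k0: "ker_Hp p Z.M = {0}"
    using Z.M_injective lin_op_0[OF pq(1) lin_op_M] Hp_0[OF pq(1)] by (auto simp: ker_Hp_def)
  have "qdim cscale (ker_Hp p Z.M) {0} 0"
    using circle_fun.basis_qdim[of "{}"] unfolding k0 by (simp add: circle_fun.independent_empty)
  moreover have "qdim cscale (Hp p) (Z.M ` Hp p) 0"
    unfolding qdim_def M_onto by (intro exI[of _ "{}"] conjI circle_fun.quotient_basisI subspace_Hp pq) auto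
  ultimately have d0: "has_dims p Z.M 0 0" by (simp add: has_dims_def)
  obtain k1 l1 where 1: "has_dims p (\<lambda>f. Z.M (tt powi int (nat n1) * f)) k1 l1" "k1 + 0 + nat n1 = 0 + l1"
    by (rule has_dims_shift_powi[OF pq(1) lin_op_M d0])
  have "lin_op p (\<lambda>f. tt powi n1 * f)" by (rule lin_op_powi_mult[OF pq(1)]) simp
  from lin_op_comp[OF lin_op_M this] have lin: "lin_op p (\<lambda>f. Z.M (tt powi int (nat n1) * f))" by simp
  obtain k2 l2 where 2: "has_dims p (\<lambda>f. riesz p (tt powi (- int (nat m1)) * Z.M (tt powi int (nat n1) * f))) k2 l2"
    "k1 + nat m1 + l2 = k2 + l1"
    by (rule has_dims_backshift_powi[OF pq(1) lin 1(1)])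
  have "has_dims p L k2 l2"
    using 2(1) dims_cong(3)[where A=L and B="\<lambda>f. riesz p (tt powi (- m1) * Z.M (tt powi n1 * f))", OF shifted_operators] by simp
  then have "k' = k2" "l' = l2" using has_dims_unique[OF pq(1) lin_op_L kl(1)] by blast+
  moreover have "int k1 + n1 = int l1" "int k1 + m1 + int l2 = int k2 + int l1"
    using arg_cong[OF 1(2), of int] arg_cong[OF 2(2), of int] by simp_all
  ultimately show ?thesis using kl(2) by linarith
qed

section \<open>Indices of which at least one is not positive\<close>

lemma kernel_trivial:
  assumes "n \<ge> 0" "m \<le> 0" "has_dims p A k l"
  shows "k = 0"
proof -
  have "ker_Hp p A = {0}"
  proof -
    have "f = 0" if f: "f \<in> Hp p" "A f = 0" for f
    proof -
      have fH: "tt powi n1 * f \<in> Hp p" using f(1) pq by (simp add: Hp_tt_powi_mult)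
      \<comment> \<open>In this case \<open>A\<close> followed by backward shifts equals
        \<open>Z.M\<close> preceded by shifts, and the latter composition is injective.\<close>
      have e: "n2 = 0" "m1 = 0" using assms by auto
      have "riesz p (Z.M (tt powi n1 * f)) = 0"
        using shifted_operators[OF f(1)] f(2) riesz_ident[OF pq(1) Hp_0[OF pq(1)]] by (simp add: e)
      then have "Z.M (tt powi n1 * f) = 0" using riesz_ident[OF pq(1) lin_opD(1)[OF lin_op_M fH]] by simp
      then have "tt powi n1 * f = 0" by (rule Z.M_injective[OF fH])
      then have "tt powi (- n1) * (tt powi n1 * f) = 0" by simp
      then show ?thesis unfolding tt_powi_cancel by simp
    qed
    then show ?thesis using lin_op_0[OF pq(1) lin_op_A] Hp_0[OF pq(1)] by (auto simp: ker_Hp_def)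
  qed
  then have "qdim cscale (ker_Hp p A) {0} 0" using circle_fun.basis_qdim[of "{}"] by (simp add: circle_fun.independent_empty)
  then show ?thesis
    using assms(3) circle_fun.qdim_unique[OF circle_fun.subspace_single_0, of "ker_Hp p A"] subspace_ker_Hp[OF pq(1) lin_op_A]
      circle_fun.subspace_0 unfolding has_dims_def by blast
qed

text \<open>Here \<open>A\<close> preceded by shifts equals \<open>Z.M\<close> followed by backward
  shifts, and both factors of the latter are onto.\<close>

lemma cokernel_trivial:
  assumes "n \<le> 0" "m \<ge> 0" "has_dims p A k l"
  shows "l = 0"
proof -
  have "A ` Hp p = Hp p"
  proof
    show "A ` Hp p \<subseteq> Hp p" using lin_opD(1)[OF lin_op_A] by auto
    show "Hp p \<subseteq> A ` Hp p"
    proof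
      fix h assume h: "h \<in> Hp p"
      have "tt powi m1 * h \<in> Z.M ` Hp p" unfolding M_onto using h pq by (simp add: Hp_tt_powi_mult)
      then obtain f where f: "f \<in> Hp p" "Z.M f = tt powi m1 * h" by force
      have fH: "tt powi n2 * f \<in> Hp p" using f(1) pq by (simp add: Hp_tt_powi_mult)
      have e: "tt powi (- m1) * (tt powi m1 * h) = h" "n1 = 0" "m2 = 0" using assms by (auto simp: tt_powi_cancel)
      have "riesz p (A (tt powi n2 * f)) = h"
        using shifted_operators[OF f(1)] f(2) riesz_ident[OF pq(1) h] by (simp add: e)
      then have "A (tt powi n2 * f) = h" using riesz_ident[OF pq(1) lin_opD(1)[OF lin_op_A fH]] by simp
      then show "h \<in> A ` Hp p" using fH by blast
    qed
  qed
  then have "qdim cscale (Hp p) (A ` Hp p) 0"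
    unfolding qdim_def by (intro exI[of _ "{}"] conjI circle_fun.quotient_basisI subspace_Hp pq) (auto simp: subspace_Hp pq)
  then show ?thesis
    using assms(3) circle_fun.qdim_unique[OF subspace_range_Hp[OF pq(1) lin_op_A], of "Hp p"] Hp_0[OF pq(1)]
    unfolding has_dims_def by blast
qed

text \<open>After -n shifts on the right the operator is injective, and each shift lowers the kernel
  dimension by at most one; this is the upper bound. The lower bound comes from explicit elements of
  the kernel.\<close>

lemma kernel_negative_indices:
  assumes nm: "n \<le> 0" "m \<le> 0" and d: "has_dims p A k l"
  shows "k = nat (- n)"
proof (rule antisym)
  obtain k1 l1 where 1: "has_dims p (\<lambda>f. A (tt powi int (nat n2) * f)) k1 l1" "k \<le> k1 + nat n2"
    by (rule has_dims_shift_powi[OF pq(1) lin_op_A d])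
  let ?B = "\<lambda>f. A (tt powi n2 * f)"
  have lin: "lin_op p ?B"
    by (rule lin_op_comp[OF lin_op_A lin_op_powi_mult[OF pq(1)]]) simp
  have "f = 0" if f: "f \<in> Hp p" "?B f = 0" for f
  proof -
    have e: "n1 = 0" "m1 = 0" using nm by auto
    have "riesz p (Z.M f) = 0"
      using shifted_operators[OF f(1)] f(2) riesz_ident[OF pq(1) Hp_0[OF pq(1)]] by (simp add: e)
    then have "Z.M f = 0" using riesz_ident[OF pq(1) lin_opD(1)[OF lin_op_M f(1)]] by simp
    then show ?thesis by (rule Z.M_injective[OF f(1)])
  qed
  then have K0: "ker_Hp p ?B = {0}" using lin_op_0[OF pq(1) lin] Hp_0[OF pq(1)] by (auto simp: ker_Hp_def)
  have "qdim cscale (ker_Hp p ?B) {0} 0"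
    unfolding K0 using circle_fun.basis_qdim[of "{}"] by (simp add: circle_fun.independent_empty)
  then have "k1 = 0"
    using 1(1) circle_fun.qdim_unique[OF circle_fun.subspace_single_0, of "ker_Hp p ?B"] K0 unfolding has_dims_def by auto
  then show "k \<le> nat (- n)" using 1(2) nm by simp
next
  let ?h = "(1 - tt) * inverse cp"
  \<comment> \<open>With f = v / c_+ the equation a f + b J f = 0 becomes t^(2n) v + J v = 0, which
    (1 - t) t^(-n-1) times any symmetric function solves. Analyticity is ensured if the symmetric
    factor has frequencies of modulus at most -n - 1, which leaves -n parameters.\<close>
  define \<Phi> where "\<Phi> u = ?h * (tt powi (- n - 1) * (u + tilde u))" for u
  let ?V = "polys (- n)"
  have inj: "u = 0" if u: "u \<in> ?V" "\<Phi> u = 0" for u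
  proof -
    have "inverse cp * (tt powi (- n - 1) * (u + tilde u)) = 0"
      using u(2) unfolding \<Phi>_def mult.assoc by (rule one_minus_tt_cancel)
    then have "tt powi (n + 1) * (cp * (inverse cp * (tt powi (- n - 1) * (u + tilde u)))) = 0" by simp
    moreover have "tt powi (n + 1) * (cp * (inverse cp * (tt powi (- n - 1) * (u + tilde u)))) =
      (cp * inverse cp) * (tt powi (n + 1) * (tt powi (- n - 1) * (u + tilde u)))" by (simp only: mult_ac)
    ultimately have "u + tilde u = 0" unfolding cp_inverse tt_powi_cancel by simp
    then show ?thesis by (rule sym_eq_0[OF u(1)])
  qed
  have ker: "\<Phi> u \<in> ker_Hp p A" if u: "u \<in> ?V" for u
  proof -
    let ?e = "u + tilde u"
    have "?h * (u + tilde u) \<in> Lp p"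
      unfolding distrib_left using pq by (intro Lp_add polys_mult_Lp[OF u Hp_Lp[OF factor_Hp(2)]]) auto
    then have "tt powi (- n - 1) * (?h * ?e) \<in> Lp p" using pq by (simp add: Lp_tt_powi_mult)
    then have L: "\<Phi> u \<in> Lp p" unfolding \<Phi>_def by (simp only: mult_ac)
    have H: "\<Phi> u \<in> Hp p"
      using L Hp_mult_fourier[OF pq factor_Hp(2) sym_shift_Hp[OF u qq(1)]] by (auto simp: Hp_def \<Phi>_def)
    have te: "tilde ?e = ?e" by (simp add: tilde_add tilde_tilde add.commute)
    have "flip_J (\<Phi> u) = (inverse tt * (1 - inverse tt)) * (tilde (inverse cp) * (tt powi (n + 1) * ?e))"
      unfolding flip_J_def \<Phi>_def tilde_mult tilde_diff tilde_1 tilde_tt tilde_tt_powi te by (simp add: mult_ac add.commute)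
    also have "inverse tt * (1 - inverse tt) = - (tt powi (- 2) * (1 - tt))"
      using tt_powi_add[of "-1" "-1"] tt_powi_add[of "-2" 1] by (simp add: right_diff_distrib)
    finally have J: "b * flip_J (\<Phi> u) = - ((tt powi (- 2) * tt powi (n + 1)) * (b * (1 - tt) * tilde (inverse cp) * ?e))"
      by (simp add: mult_ac)
    have "a = (tilde cp * tilde (inverse cp)) * a" unfolding tilde_cp_inverse by simp
    also have "\<dots> = (a * tilde cp) * tilde (inverse cp)" by (simp only: mult_ac)
    finally have "a * \<Phi> u = (b * cp * tt powi (2 * n)) * tilde (inverse cp) * (?h * (tt powi (- n - 1) * ?e))"
      unfolding c_factor \<Phi>_def by simp
    also have "\<dots> = (cp * inverse cp) * ((tt powi (2 * n) * tt powi (- n - 1)) * (b * (1 - tt) * tilde (inverse cp) * ?e))"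
      by (simp only: mult_ac)
    finally have "a * \<Phi> u + b * flip_J (\<Phi> u) = 0" unfolding J cp_inverse tt_powi_add by simp
    then have "A (\<Phi> u) = 0" using toeplitz_hankel_eq[OF pq(1) ab_inverse(1,2) L] riesz_ident[OF pq(1) Hp_0[OF pq(1)]] by simp
    then show ?thesis using H by (simp add: ker_Hp_def)
  qed
  have lin: "\<Phi> (u + v) = \<Phi> u + \<Phi> v" "\<Phi> (cscale z u) = cscale z (\<Phi> u)" for u v z
  proof -
    show "\<Phi> (u + v) = \<Phi> u + \<Phi> v" by (simp add: \<Phi>_def tilde_add distrib_left add_ac)
    show "\<Phi> (cscale z u) = cscale z (\<Phi> u)" by (simp add: \<Phi>_def tilde_cscale mult_cscale flip: circle_fun.scale_right_distrib)
  qed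
  have "qdim cscale (\<Phi> ` ?V) {0} (nat (- n))"
    by (rule circle_fun.qdim_injective_image[OF subspace_polys lin inj qdim_polys])
  moreover have "circle_fun.subspace (\<Phi> ` ?V)" by (rule circle_fun.subspace_image_on[OF subspace_polys lin])
  ultimately show "nat (- n) \<le> k"
    using d circle_fun.qdim_mono[OF _ subspace_ker_Hp[OF pq(1) lin_op_A], of "\<Phi> ` ?V"] ker unfolding has_dims_def by blast
qed

section \<open>Both indices positive: the matrix of the divisibility conditions\<close>

lemma rho_eq: "rho b n m cp dp =
    (inverse b * tt powi (- n - m)) * (tilde ((1 + tt) * cp) * (tt * tilde ((1 + tt) * dp)))"
proof -
  \<comment> \<open>Writing 1 + t as t (1 + 1/t) gives both reflected factors, one in L^q and one in
    L^p; the rest is bounded, so \<rho> is integrable.\<close>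
  have e: "tt * (1 + inverse tt) = 1 + tt" by (simp add: distrib_left tt_inverse)
  have mn: "- m - n = - n - m" by simp
  have "rho b n m cp dp = (inverse b * tt powi (- n - m)) * (((1 + inverse tt) * tilde cp) * ((1 + tt) * tilde dp))"
    unfolding rho_def mn by (simp only: mult_ac)
  also have "\<dots> = (inverse b * tt powi (- n - m)) * (((1 + inverse tt) * tilde cp) * (tt * ((1 + inverse tt) * tilde dp)))"
    unfolding e[symmetric] by (simp only: mult_ac)
  finally show ?thesis by (simp add: tilde_mult tilde_add tilde_1 tilde_tt)
qed

lemma rho_L1: "rho b n m cp dp \<in> Lp 1"
proof -
  have "tilde ((1 + tt) * cp) \<in> Lp q" "tt * tilde ((1 + tt) * dp) \<in> Lp p"
    using factor_Hp[THEN Hp_Lp] pq by (simp_all add: Lp_tilde Lp_tt_mult)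
  then show ?thesis unfolding rho_eq
    using Z.ab(5) by (intro Linf_mult_Lp[OF _ _ Lp_mult_Holder(1)[OF qq]]) auto
qed

text \<open>Multiplying the antianalytic function \<open>tilde ((1 + tt) * dp)\<close> by a symmetric trigonometric
  polynomial gives solutions of the jump relation that characterises the values \<open>Z.G f\<close>.\<close>

definition "source u = tilde ((1 + tt) * dp) * (u + tilde u)"

lemma source_Lp: "u \<in> polys N \<Longrightarrow> source u \<in> Lp p"
  unfolding source_def distrib_left using factor_Hp pq
  by (intro Lp_add polys_mult_Lp[of _ N] Lp_tilde Hp_Lp) auto

lemma source_jump: "dp * source u = tilde dp * flip_J (source u)"
proof -
  have e: "inverse tt * (1 + tt) = 1 + inverse tt" by (simp add: distrib_left tt_inverse)
  have "flip_J (source u) = (inverse tt * (1 + tt)) * dp * (u + tilde u)"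
    by (simp add: source_def flip_J_def tilde_mult tilde_add tilde_1 tilde_tilde mult.assoc add.commute)
  then show ?thesis unfolding e source_def tilde_mult tilde_add tilde_1 tilde_tt by (simp only: mult_ac)
qed

lemma source_eq_0:
  assumes u: "u \<in> polys N" and z: "source u = 0"
  shows "u = 0"
proof (rule sym_eq_0[OF u])
  have "tilde (source u) = (1 + tt) * (dp * (u + tilde u))"
    by (simp add: source_def tilde_mult tilde_add tilde_tilde mult.assoc add.commute)
  then have "(1 + tt) * (dp * (u + tilde u)) = 0" using z by (simp add: tilde_0)
  then have "dp * (u + tilde u) = 0" by (rule one_plus_tt_cancel)
  then have "inverse dp * (dp * (u + tilde u)) = 0" by simp
  then show "u + tilde u = 0" using dp_inverse by (simp add: mult.commute[of _ dp] flip: mult.assoc)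
qed

lemma riesz_source_linear:
  assumes "u \<in> polys N" "v \<in> polys N"
  shows "riesz p (source (u + v)) = riesz p (source u) + riesz p (source v)"
    and "riesz p (source (cscale z u)) = cscale z (riesz p (source u))"
proof -
  have "source (u + v) = source u + source v" by (simp add: source_def tilde_add distrib_left add_ac)
  then show "riesz p (source (u + v)) = riesz p (source u) + riesz p (source v)"
    using assms by (simp add: riesz_add pq source_Lp)
  have "source (cscale z u) = cscale z (source u)"
    by (simp add: source_def tilde_cscale mult_cscale flip: circle_fun.scale_right_distrib)
  then show "riesz p (source (cscale z u)) = cscale z (riesz p (source u))"
    using assms by (simp add: riesz_cscale pq source_Lp)
qed

lemma riesz_source_injective:
  assumes u: "u \<in> polys N" "riesz p (source u) = 0"
  shows "u = 0"
proof (rule source_eq_0[OF u(1)], rule Z.jump_unique[OF source_Lp[OF u(1)] source_jump])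
  show "fourier (source u) k = 0" if "0 \<le> k" for k
    using fourier_riesz[OF pq(1) source_Lp[OF u(1)], of k] u(2) that by simp
qed

text \<open>The analytic part of \<open>source u\<close> is again a polynomial of degree below m.
  The map is injective by uniqueness for the jump relation, so equality of dimensions makes it onto:
  every admissible right-hand side has a known value of \<open>Z.G\<close>.\<close>

lemma riesz_source_onto: "(\<lambda>u. riesz p (source u)) ` polys m = polys m"
proof -
  let ?R = "\<lambda>u. riesz p (source u)"
  note lin = riesz_source_linear[of _ m] and inj = riesz_source_injective[of _ m]
  have sub: "?R u \<in> polys m" if u: "u \<in> polys m" for u
  proof -
    have RH: "?R u \<in> Hp p" by (rule riesz_Hp(1)[OF pq(1) source_Lp[OF u]])
    have "fourier (?R u) k = 0" if k: "k < 0 \<or> m \<le> k" for k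
    proof -
      \<comment> \<open>The symmetric factor reaches down to frequency -(m - 1) and the other factor
        is analytic. Reflected back, \<open>source u\<close> has no frequency above m - 1.\<close>
      have "tilde (source u) = ((1 + tt) * dp) * (u + tilde u)"
        by (simp add: source_def tilde_mult tilde_add tilde_tilde add.commute)
      also have "\<dots> = tt powi (- (m - 1)) * (((1 + tt) * dp) * (tt powi (m - 1) * (u + tilde u)))"
        using tt_powi_cancel[of "- (m - 1)" "m - 1" "((1 + tt) * dp) * (u + tilde u)"] by (simp add: mult_ac)
      finally have "fourier (source u) k = fourier (((1 + tt) * dp) * (tt powi (m - 1) * (u + tilde u))) (m - 1 - k)"
        using fourier_tilde[of "source u" "- k"] by (simp only: minus_minus fourier_tt_powi_mult) (simp add: algebra_simps)
      also have "\<dots> = 0" if "m \<le> k"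
        using that by (intro Hp_mult_fourier[OF pq factor_Hp(3) sym_shift_Hp[OF u qq(1)]]) auto
      finally show ?thesis using k fourier_riesz[OF pq(1) source_Lp[OF u], of k] by auto
    qed
    then show ?thesis using Lp_subset_L1[OF pq(1) Hp_Lp[OF RH]] by (simp add: polys_def)
  qed
  have "qdim cscale (?R ` polys m) {0} (nat m)"
    by (rule circle_fun.qdim_injective_image[OF subspace_polys lin(1) lin(2) inj qdim_polys])
  moreover have "circle_fun.subspace (?R ` polys m)"
    by (rule circle_fun.subspace_image_on[OF subspace_polys lin(1) lin(2)])
  ultimately show ?thesis using circle_fun.qdim_0_eqI[OF _ subspace_polys _ _ qdim_polys] sub by blast
qed

lemma fourier_rho_sym:
  assumes y: "y \<in> carrier_vec (nat m)" and i: "i < nat n"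
  shows "fourier (rho b n m cp dp * (vec_poly y + tilde (vec_poly y))) (int i) = (A_mat b n m cp dp *\<^sub>v y) $ i"
proof -
  let ?r = "fourier (rho b n m cp dp)" and ?u = "vec_poly y"
  have "rho b n m cp dp * ?u \<in> Lp 1" "rho b n m cp dp * tilde ?u \<in> Lp 1"
    using polys_mult_Lp[OF vec_poly_polys[OF y] rho_L1] by simp_all
  then have "fourier (rho b n m cp dp * (?u + tilde ?u)) (int i) =
      (\<Sum>j<dim_vec y. y $ j * ?r (int i - int j)) + (\<Sum>j<dim_vec y. y $ j * ?r (int i + int j))"
    unfolding distrib_left by (simp add: fourier_add fourier_vec_poly_mult rho_L1)
  also have "\<dots> = (\<Sum>j<nat m. (?r (int i - int j) + ?r (int i + int j)) * y $ j)"
    unfolding carrier_vecD[OF y] sum.distrib[symmetric] by (intro sum.cong refl) (simp only: distrib_left mult.commute)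
  also have "\<dots> = (A_mat b n m cp dp *\<^sub>v y) $ i"
    using y i by (auto simp: A_mat_def scalar_prod_def atLeast0LessThan intro!: sum.cong)
  finally show ?thesis .
qed

text \<open>(1 + t) c_+ times (1 - t) / c_+ is 1 - t^2, and the constant coefficients of the two
  factors multiply to 1.\<close>

lemma cp_leading: "fourier ((1 + tt) * cp) 0 \<noteq> 0"
proof
  assume z: "fourier ((1 + tt) * cp) 0 = 0"
  have "((1 + tt) * cp) * ((1 - tt) * inverse cp) = (cp * inverse cp) * ((1 + tt) * (1 - tt))" by (simp only: mult_ac)
  also have "\<dots> = 1 - tt * tt" unfolding cp_inverse by (simp add: algebra_simps)
  finally have "fourier (1 - tt * tt) 0 = 0"
    using Hp_mult_fourier_0[OF qq factor_Hp(1,2)] z by simp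
  then show False
    using one_mem_Lp[of 1] tt_powi_Lp[of 1 1] by (simp add: fourier_diff Lp_tt_mult fourier_one fourier_tt_mult fourier_tt_powi[of 1, simplified])
qed

text \<open>The right-hand side determines all of \<open>Z.G f\<close> by uniqueness for the jump
  relation, so \<open>Z.G f\<close> is the source. The relation for c then combines its two terms to
  x + tilde x with analytic x = (1 + t) c_+ f. Divisibility of f by t^n is the vanishing of the
  first n coefficients of x, and these are read off from \<rho> times a symmetric
  polynomial.\<close>

lemma solution_divisible_iff:
  assumes f: "f \<in> Hp p" and y: "y \<in> carrier_vec (nat m)" and eq: "Z.M f = riesz p (source (vec_poly y))" and n: "0 \<le> n"
  shows "(\<exists>g\<in>Hp p. f = tt powi n * g) \<longleftrightarrow> A_mat b n m cp dp *\<^sub>v y = 0\<^sub>v (nat n)"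
proof -
  let ?u = "vec_poly y"
  note u = vec_poly_polys[OF y]
  have "Z.G f - source ?u = 0"
  proof (rule Z.jump_unique)
    show "Z.G f - source ?u \<in> Lp p" by (intro Lp_diff Z.G_Lp f source_Lp[OF u]) (use pq in auto)
    have "flip_J (g - h) = flip_J g - flip_J h" for g h by (simp add: flip_J_def tilde_diff right_diff_distrib)
    then show "dp * (Z.G f - source ?u) = tilde dp * flip_J (Z.G f - source ?u)"
      by (simp only: right_diff_distrib Z.G_jump source_jump)
    fix k :: int assume "0 \<le> k"
    then show "fourier (Z.G f - source ?u) k = 0"
      using fourier_riesz[OF pq(1) Z.G_Lp[OF f], of k] fourier_riesz[OF pq(1) source_Lp[OF u], of k] Z.M_eq[OF f] eq
      by (subst fourier_diff) (auto intro!: Lp_subset_L1[OF pq(1)] Z.G_Lp f source_Lp[OF u])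
  qed
  then have G: "a0 * f + b0 * flip_J f = source ?u" by simp
  define b' where "b' = inverse b * tt powi (- n - m)"
  have b': "b0 * b' = 1" using Z.ab(4) by (simp add: b'_def)
  define x where "x = ((1 + tt) * cp) * f"
  have e: "(1 + tt) * inverse tt = 1 + inverse tt" by (simp add: distrib_right tt_inverse add.commute)
  have tx: "tilde x = (1 + tt) * tilde cp * flip_J f"
    unfolding x_def tilde_mult tilde_add tilde_1 tilde_tt flip_J_def e[symmetric] by (simp only: mult_ac)
  have "x = (b0 * b') * ((1 + tt) * cp * f)" unfolding b' x_def by simp
  also have "\<dots> = ((1 + tt) * b') * (b0 * cp) * f" by (simp only: mult_ac)
  also have "\<dots> = ((1 + tt) * b' * tilde cp) * (a0 * f)" unfolding Z.c_rel[symmetric] by (simp only: mult_ac)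
  finally have x: "x = ((1 + tt) * b' * tilde cp) * (a0 * f)" .
  have "tilde x = (b0 * b') * ((1 + tt) * tilde cp * flip_J f)" unfolding b' tx by simp
  also have "\<dots> = ((1 + tt) * b' * tilde cp) * (b0 * flip_J f)" by (simp only: mult_ac)
  finally have "x + tilde x = ((1 + tt) * b' * tilde cp) * source ?u" unfolding x G[symmetric] by (simp add: distrib_left)
  also have "\<dots> = rho b n m cp dp * (?u + tilde ?u)"
  proof -
    have e2: "(1 + tt) = tt * (1 + inverse tt)" by (simp add: distrib_left tt_inverse)
    have "(1 + tt) * b' * tilde cp * source ?u = b' * ((1 + inverse tt) * tilde cp * (tt * (1 + inverse tt) * tilde dp)) * (?u + tilde ?u)"
      unfolding source_def tilde_mult tilde_add tilde_1 tilde_tt by (subst e2) (simp only: mult_ac)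
    then show ?thesis unfolding rho_eq b'_def tilde_mult tilde_add tilde_1 tilde_tt by (simp only: mult_ac)
  qed
  finally have xs: "x + tilde x = rho b n m cp dp * (?u + tilde ?u)" .
  have xL: "x \<in> Lp 1" unfolding x_def by (rule Lp_mult_Holder(1)[OF qq Hp_Lp Hp_Lp]) (intro factor_Hp f)+
  have x0: "fourier x k = 0" if "k < 0" for k
    unfolding x_def by (rule Hp_mult_fourier[OF qq factor_Hp(1) f that])
  \<comment> \<open>For i > 0 the reflected part of the analytic x contributes nothing. At i = 0 the
    coefficient is counted twice, which does not affect its vanishing.\<close>
  have xc: "fourier x (int i) = 0 \<longleftrightarrow> (A_mat b n m cp dp *\<^sub>v y) $ i = 0" if "i < nat n" for i
  proof -
    have "fourier x (int i) + fourier x (- int i) = (A_mat b n m cp dp *\<^sub>v y) $ i"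
      using arg_cong[OF xs, of "\<lambda>f. fourier f (int i)"] fourier_sym[OF xL] fourier_rho_sym[OF y that] by simp
    then show ?thesis using x0[of "- int i"] by (cases "i = 0") auto
  qed
  have "(\<exists>g\<in>Hp p. f = tt powi n * g) \<longleftrightarrow> (\<forall>k<n. fourier x k = 0)"
    unfolding x_def by (rule low_coefficients_mult[OF pq factor_Hp(1) cp_leading f n, symmetric])
  also have "\<dots> \<longleftrightarrow> (\<forall>i<nat n. fourier x (int i) = 0)"
  proof
    assume h: "\<forall>i<nat n. fourier x (int i) = 0"
    show "\<forall>k<n. fourier x k = 0"
    proof (intro allI impI)
      fix k assume "k < n"
      then show "fourier x k = 0" using x0[of k] h[rule_format, of "nat k"] by (cases "k < 0") auto
    qed
  qed auto
  also have "\<dots> \<longleftrightarrow> A_mat b n m cp dp *\<^sub>v y = 0\<^sub>v (nat n)"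
    by (auto simp: xc vec_eq_iff A_mat_def)
  finally show ?thesis .
qed

text \<open>The kernel of \<open>A\<close> is mapped by f -> Z.M(t^n f), the kernel of the matrix by
  y -> riesz p (source u) with u the polynomial of y. Both maps are injective and have the same
  image inside the polynomials of degree below m, so the dimensions agree.\<close>

lemma kernel_positive_indices:
  assumes nm: "0 < n" "0 < m" and d: "has_dims p A k l"
  shows "k = kernel_dim (A_mat b n m cp dp)"
proof -
  let ?C = "A_mat b n m cp dp" and ?R = "\<lambda>u. riesz p (source u)"
  have C: "?C \<in> carrier_mat (nat n) (nat m)" by (simp add: A_mat_def)
  let ?K = "vec_poly ` mat_kernel ?C"
  have KD: "y \<in> carrier_vec (nat m)" "?C *\<^sub>v y = 0\<^sub>v (nat n)" if "y \<in> mat_kernel ?C" for y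
    using mat_kernelD[OF C that] by auto
  have Kp: "?K \<subseteq> polys m" using KD vec_poly_polys by blast
  have "qdim cscale (?R ` ?K) {0} (kernel_dim ?C)"
  proof (rule circle_fun.qdim_injective_image[OF subspace_mat_kernel_poly[OF C] _ _ _ qdim_mat_kernel[OF C]])
    show "?R (u + v) = ?R u + ?R v" if "u \<in> ?K" "v \<in> ?K" for u v
      using that Kp by (intro riesz_source_linear(1)[of _ m]) auto
    show "?R (cscale z u) = cscale z (?R u)" if "u \<in> ?K" for z u
      using that Kp by (intro riesz_source_linear(2)[of _ m u]) auto
    show "u = 0" if "u \<in> ?K" "?R u = 0" for u
      using that Kp riesz_source_injective[of u m] by blast
  qed
  moreover have "qdim cscale ((\<lambda>f. Z.M (tt powi n * f)) ` ker_Hp p A) {0} k"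
  proof (rule circle_fun.qdim_injective_image[OF subspace_ker_Hp[OF pq(1) lin_op_A]])
    have "lin_op p (\<lambda>f. Z.M (tt powi n * f))"
      by (rule lin_op_comp[OF lin_op_M lin_op_powi_mult[OF pq(1)]]) (use nm in simp)
    note l = lin_opD[OF this]
    show "Z.M (tt powi n * (f + g)) = Z.M (tt powi n * f) + Z.M (tt powi n * g)"
      if "f \<in> ker_Hp p A" "g \<in> ker_Hp p A" for f g using l(2) that by (simp add: ker_Hp_def)
    show "Z.M (tt powi n * cscale z f) = cscale z (Z.M (tt powi n * f))" if "f \<in> ker_Hp p A" for f z
      using l(3) that by (simp add: ker_Hp_def)
    show "f = 0" if "f \<in> ker_Hp p A" "Z.M (tt powi n * f) = 0" for f
    proof -
      have "tt powi n * f \<in> Hp p" using that(1) nm pq by (simp add: ker_Hp_def Hp_tt_powi_mult)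
      then have "tt powi n * f = 0" using that(2) by (rule Z.M_injective)
      then have "tt powi (- n) * (tt powi n * f) = 0" by simp
      then show ?thesis unfolding tt_powi_cancel by simp
    qed
    show "qdim cscale (ker_Hp p A) {0} k" using d by (simp add: has_dims_def)
  qed
  moreover have "(\<lambda>f. Z.M (tt powi n * f)) ` ker_Hp p A = ?R ` ?K"
  proof -
    have e: "n1 = n" "n2 = 0" "m1 = m" "m2 = 0" using nm by auto
    have A: "A f = 0 \<longleftrightarrow> Z.M (tt powi n * f) \<in> polys m" if f: "f \<in> Hp p" for f
    proof -
      have fH: "tt powi n * f \<in> Hp p" using f pq nm by (simp add: Hp_tt_powi_mult)
      have "A f = riesz p (tt powi (- m) * Z.M (tt powi n * f))"
        using shifted_operators[OF f] riesz_ident[OF pq(1) lin_opD(1)[OF lin_op_A f]] by (simp add: e)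
      then show ?thesis using riesz_inverse_powi_eq_0_iff[OF pq(1) lin_opD(1)[OF lin_op_M fH], of m] nm by simp
    qed
    show ?thesis
    proof
      show "(\<lambda>f. Z.M (tt powi n * f)) ` ker_Hp p A \<subseteq> ?R ` ?K"
      proof
        fix h assume "h \<in> (\<lambda>f. Z.M (tt powi n * f)) ` ker_Hp p A"
        then obtain f where f: "f \<in> Hp p" "A f = 0" "h = Z.M (tt powi n * f)" by (auto simp: ker_Hp_def)
        have fH: "tt powi n * f \<in> Hp p" using f pq nm by (simp add: Hp_tt_powi_mult)
        have "h \<in> ?R ` polys m" unfolding riesz_source_onto using f A by blast
        then obtain u where u: "u \<in> polys m" "h = ?R u" by blast
        obtain y where y: "y \<in> carrier_vec (nat m)" "u = vec_poly y" using u(1) by (rule polys_vec_poly)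
        have "?C *\<^sub>v y = 0\<^sub>v (nat n)"
          using solution_divisible_iff[OF fH y(1)] f u y nm by auto
        then have "y \<in> mat_kernel ?C" using y(1) by (intro mat_kernelI[OF C])
        then show "h \<in> ?R ` ?K" using u y by blast
      qed
      show "?R ` ?K \<subseteq> (\<lambda>f. Z.M (tt powi n * f)) ` ker_Hp p A"
      proof
        fix h assume "h \<in> ?R ` ?K"
        then obtain y where y: "y \<in> mat_kernel ?C" "h = ?R (vec_poly y)" by blast
        have "h \<in> ?R ` polys m" using y Kp by blast
        then have hp: "h \<in> polys m" by (simp only: riesz_source_onto)
        then have "h \<in> Z.M ` Hp p" unfolding M_onto using polys_Hp[OF pq(1)] by blast
        then obtain f where f: "f \<in> Hp p" "Z.M f = h" by blast
        obtain g where g: "g \<in> Hp p" "f = tt powi n * g"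
          using solution_divisible_iff[OF f(1) KD(1)[OF y(1)]] KD(2)[OF y(1)] f(2) y(2) nm by auto
        then have "g \<in> ker_Hp p A" using A[OF g(1)] f(2) hp by (simp add: ker_Hp_def)
        then show "h \<in> (\<lambda>f. Z.M (tt powi n * f)) ` ker_Hp p A" using f(2) g(2) by blast
      qed
    qed
  qed
  ultimately have q: "qdim cscale (?R ` ?K) {0} (kernel_dim ?C)" "qdim cscale (?R ` ?K) {0} k" by simp_all
  have "?R ` ?K \<noteq> {}" using circle_fun.subspace_0[OF subspace_mat_kernel_poly[OF C]] by blast
  from circle_fun.qdim_unique[OF circle_fun.subspace_single_0 this q(2,1)] show ?thesis .
qed

end

theorem theorem4p2:
  fixes p q :: real and n m :: int and a b c d cp dp :: circle_fun
  assumes "1 < p" and "1 / p + 1 / q = 1"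
    and "basic_factorization p q a b c d n m cp dp"
    and "fredholm p (toeplitz_hankel p a b)"
  shows "rho b n m cp dp \<in> Lp 1 \<and>
    dim_ker p (toeplitz_hankel p a b) =
      (if n > 0 \<and> m \<le> 0 then 0
       else if n \<le> 0 \<and> m \<le> 0 then enat (nat (- n))
       else if n > 0 \<and> m > 0 then enat (kernel_dim (A_mat b n m cp dp))
       else enat (nat (m - n))) \<and>
    dim_ker_adjoint p (toeplitz_hankel p a b) =
      (if m > 0 \<and> n \<le> 0 then 0
       else if m \<le> 0 \<and> n \<le> 0 then enat (nat (- m))
       else if m > 0 \<and> n > 0 then enat (kernel_dim (transpose_mat (A_mat b n m cp dp)))
       else enat (nat (n - m))) \<and>
    fredholm_index p (toeplitz_hankel p a b) = m - n"
proof -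
  interpret fredholm_factorization p q n m a b c d cp dp
    using assms by unfold_locales
  obtain k l where d: "has_dims p A k l" by (rule has_dims_A)
  have q: "qdim cscale (ker_Hp p A) {0} k" "qdim cscale (Hp p) (A ` Hp p) l" using d by (auto simp: has_dims_def)
  have ker: "dim_ker p A = enat k"
    unfolding dim_ker_def by (rule circle_fun.edim_eq[OF subspace_ker_Hp[OF pq(1) lin_op_A] q(1)])
  have adj: "dim_ker_adjoint p A = enat l" by (rule dim_ker_adjoint_eq[OF pq(1) bounded_op_A q(2)])
  have "Hp p \<noteq> {}" using Hp_0[OF pq(1)] by auto
  then have coker: "dim_coker p A = enat l"
    unfolding dim_coker_def by (rule circle_fun.quotient_edim_eq[OF subspace_range_Hp[OF pq(1) lin_op_A] _ q(2)])
  note i = index[OF d]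
  have k: "k = (if n > 0 \<and> m \<le> 0 then 0 else if n \<le> 0 \<and> m \<le> 0 then nat (- n)
      else if n > 0 \<and> m > 0 then kernel_dim (A_mat b n m cp dp) else nat (m - n))"
  proof -
    consider "n > 0" "m \<le> 0" | "n \<le> 0" "m \<le> 0" | "n > 0" "m > 0" | "n \<le> 0" "m > 0" by linarith
    then show ?thesis
    proof cases
      case 1
      then show ?thesis using kernel_trivial[OF _ _ d] by simp
    next
      case 2
      then show ?thesis using kernel_negative_indices[OF _ _ d] by simp
    next
      case 3
      then show ?thesis using kernel_positive_indices[OF _ _ d] by simp
    next
      \<comment> \<open>The range is everything in this case, so the kernel dimension is the index
        itself.\<close>
      case 4
      then show ?thesis using cokernel_trivial[OF _ _ d] i by simp
    qed
  qed
  have "A_mat b n m cp dp \<in> carrier_mat (nat n) (nat m)" by (simp add: A_mat_def)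
  note tr = kernel_dim_transpose[OF this]
  \<comment> \<open>The codimension is k minus the index. With both indices positive, the dimension
    formula for the matrix and its transpose turns this into the kernel dimension of the
    transpose.\<close>
  have l: "l = (if m > 0 \<and> n \<le> 0 then 0 else if m \<le> 0 \<and> n \<le> 0 then nat (- m)
      else if m > 0 \<and> n > 0 then kernel_dim (transpose_mat (A_mat b n m cp dp)) else nat (n - m))"
    using k i arg_cong[OF tr, of int] by (auto split: if_splits)
  have "fredholm_index p A = m - n" using i by (simp add: fredholm_index_def ker coker)
  then show ?thesis unfolding ker adj using rho_L1 by (subst k, subst l) (simp add: zero_enat_def)
qed

end
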